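(* Let $(\phi,\psi)$ be the solution of problem (P) described in the context, with initial data $(\phi_0,\phi_1)\in H^1_0(0,L)\times L^2(0,L)$ and $(\psi_0,\psi_1)\in H^1_*(0,L)\times L^2_*(0,L)$. Assume that hypotheses (A1) and (A2) of the context hold and that the wave speeds are equal: $\frac{\kappa}{\rho_1}=\frac{b}{\rho_2}$. Then there exist constants $q_0\in(0,1)$ and $c,d,c_1,c_2>0$ (entering the definitions of $q$, $G_5$ and of the class $S$ in the context) such that for every $\chi\in S$ there exists a strictly positive constant $C$ such that, for all $t\ge 0$, $$E(t)\le \frac{C\,G_5(t)}{\chi(t)\,q(t)}.$$
   Context: Problem (P). Let $L,\rho_1,\rho_2,b,\kappa>0$. The unknowns $\phi,\psi$ satisfy, in $(0,L)\times(0,\infty)$, $$\rho_1\phi_{tt}-\kappa(\phi_x+\psi)_x+\kappa\int_0^\infty g(s)(\phi_x+\psi)_x(t-s)\,ds=0,$$ $$\rho_2\psi_{tt}-b\psi_{xx}+\kappa(\phi_x+\psi)-\kappa\int_0^\infty g(s)(\phi_x+\psi)(t-s)\,ds=0,$$ with $\phi(0,t)=\phi(L,t)=\psi_x(0,t)=\psi_x(L,t)=0$ for $t\ge0$, prescribed past histories $\phi(x,-t)=\phi_0(x,t)$, $\psi(x,-t)=\psi_0(x,t)$ for $t\ge 0$, and $\phi_t(x,0)=\phi_1(x)$, $\psi_t(x,0)=\psi_1(x)$. "Solution" means weak solution in the class $(\phi,\psi)\in C(\mathbb{R}^+;H^1_0\times H^1_* )\cap C^1(\mathbb{R}^+;L^2\times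 L^2_* )$. Membership of $\phi_0,\psi_0$ in spaces of functions of $x$ is understood for each value of the history variable, and the initial energy $E(0)$ (defined below) is finite. Spaces. $L^2=L^2(0,L)$ with norm $\|\cdot\|_2$; $L^2_*=\{u\in L^2:\int_0^L u\,dx=0\}$; $H^1_*=\{u\in H^1(0,L):\int_0^L u\,dx=0\}$. (A1) $g:[0,\infty)\to(0,\infty)$ is a non-increasing differentiable function with $g(0)>0$, $\ell:=1-\int_0^\infty g(s)\,ds>0$, and $\int_0^\infty g(s)\,ds>\max\left\{\frac{31}{32},\frac{64\rho_1L^2}{64\rho_1L^2+\rho_2}\right\}$. (A2) There exist a positive non-increasing differentiable function $\xi:[0,\infty)\to(0,\infty)$ and a $C^1$ function $H:[0,\infty)\to[0,\infty)$ which is either linear or a strictly increasing and strictly convex $C^2$ function on $(0,r]$ for some $r>0$, with $H(0)=H'(0)=0$, $\lim_{s\to+\infty}H'(s)=+\infty$, and with $s\mapsto sH'(s)$ and $s\mapsto s(H')^{-1}(s)$ convex on $(0,r]$, such that $g'(t)\le-\xi(t)H(g(t))$ for all $t\ge0$. Convention: $H$ is identified with an extension of $H|_{(0,r]}$ that is strictly increasing, strictly convex and $C^2$ on $(0,\infty)$; for example, for $t>r$, $H(t)=\frac{H''(r)}{2}t^2+(H'(r)-H''(r)r)t+\left(H(r)+\frac{H''(r)}{2}r^2-H'(r)r\right)$. Energy. Put $p(x,t):=\int_0^x(\phi_x+\psi)(y,t)\,dy$, so that $p_x=\phi_x+\psi$ (for all $t\in\mathbb{R}$, using the histories when $t<0$),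 $\gamma:=1-\int_0^\infty g(s)\,ds$, $(g\circ u)(t):=\int_0^\infty g(s)\|u(t)-u(t-s)\|_2^2\,ds$, and $$E(t):=\frac{\rho_1}{2}\|\phi_t(t)\|_2^2+\frac{\rho_2}{2}\|\psi_t(t)\|_2^2+\frac b2\|\psi_x(t)\|_2^2+\frac{\kappa}{2}\gamma\|p_x(t)\|_2^2+\frac\kappa2(g\circ p_x)(t).$$ Auxiliary functions. $h_0(t):=\int_0^{\infty}g(t+s)\left(1+\|p_x(\cdot,-s)\|_2^2\right)ds$, $f(t):=1+\int_0^t h_0(s)\,ds$, $q(t):=\frac{q_0}{f(t)}$. Also $$G_1(t):=\int_t^1\frac{ds}{sH'(s)},\quad G_2(t):=tH'(t),\quad G_3(t):=t(H')^{-1}(t),\quad G_4:=G_3^*,\quad G_5(t):=G_1^{-1}\left(c_1\int_0^t\xi(s)\,ds\right),$$ where $G_3^*$ is the convex conjugate of $G_3$ in the sense of Young and $G_1$ is viewed as a decreasing bijection from $(0,1]$ onto $[0,\infty)$. Class $S$. For given $c,d,c_1,c_2>0$, $S$ is the set of functions $\chi:[0,\infty)\to(0,\infty)$ with $\chi\in C^1([0,\infty))$, $\chi\le1$, $\chi'\le0$, and, for all $t\ge 0$, $$c_2\,G_4\left[\frac cd\,q(t)h_0(t)\right]\le c_1\left(G_2\left(\frac{G_5(t)}{\chi(t)}\right)-\frac{G_2(G_5(t))}{\chi(t)}\right).$$ *)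

theory Defs
  imports "HOL-Analysis.Analysis"
begin

text \<open>
  Elements of \<open>L\<^sup>2(0,L)\<close> are represented by functions on \<open>real\<close>, of which only the
  values almost everywhere on \<open>(0,L)\<close> matter. A function of time and space is written
  time first: \<open>u t x\<close> stands for \<open>u(x,t)\<close>.
\<close>

section \<open>Function spaces on \<open>(0,L)\<close>\<close>

definition L2 :: "real \<Rightarrow> (real \<Rightarrow> real) \<Rightarrow> bool" where
  "L2 L u \<longleftrightarrow> set_borel_measurable lebesgue {0<..<L} u
     \<and> set_integrable lebesgue {0<..<L} (\<lambda>x. (u x)\<^sup>2)"

definition l2_inner :: "real \<Rightarrow> (real \<Rightarrow> real) \<Rightarrow> (real \<Rightarrow> real) \<Rightarrow> real" where
  "l2_inner L u v = (LINT x:{0<..<L}|lebesgue. u x * v x)"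

definition l2_norm :: "real \<Rightarrow> (real \<Rightarrow> real) \<Rightarrow> real" where
  "l2_norm L u = sqrt (LINT x:{0<..<L}|lebesgue. (u x)\<^sup>2)"

definition L2_star :: "real \<Rightarrow> (real \<Rightarrow> real) \<Rightarrow> bool" where
  "L2_star L u \<longleftrightarrow> L2 L u \<and> (LINT x:{0<..<L}|lebesgue. u x) = 0"

definition test_function :: "real \<Rightarrow> (real \<Rightarrow> real) \<Rightarrow> bool" where
  "test_function L \<eta> \<longleftrightarrow> (\<forall>k. (deriv ^^ k) \<eta> differentiable_on UNIV)
     \<and> (\<exists>\<alpha> \<beta>. 0 < \<alpha> \<and> \<beta> < L \<and> (\<forall>x. x \<notin> {\<alpha>..\<beta>} \<longrightarrow> \<eta> x = 0))"

definition is_weak_deriv :: "real \<Rightarrow> (real \<Rightarrow> real) \<Rightarrow> (real \<Rightarrow> real) \<Rightarrow> bool" where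
  "is_weak_deriv L u v \<longleftrightarrow> L2 L v
     \<and> (\<forall>\<eta>. test_function L \<eta> \<longrightarrow> l2_inner L u (deriv \<eta>) = - l2_inner L v \<eta>)"

text \<open>The weak derivative is unique up to null sets; \<open>wderiv\<close> picks a representative.\<close>

definition wderiv :: "real \<Rightarrow> (real \<Rightarrow> real) \<Rightarrow> real \<Rightarrow> real" where
  "wderiv L u = (SOME v. is_weak_deriv L u v)"

definition H1 :: "real \<Rightarrow> (real \<Rightarrow> real) \<Rightarrow> bool" where
  "H1 L u \<longleftrightarrow> L2 L u \<and> (\<exists>v. is_weak_deriv L u v)"

text \<open>\<open>H\<^sup>1\<^sub>0\<close> is the closure of the test functions in \<open>H\<^sup>1\<close>; it carries the boundary
  condition \<open>u(0) = u(L) = 0\<close>.\<close>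

definition H1_0 :: "real \<Rightarrow> (real \<Rightarrow> real) \<Rightarrow> bool" where
  "H1_0 L u \<longleftrightarrow> H1 L u \<and> (\<exists>\<eta>. (\<forall>n. test_function L (\<eta> n))
     \<and> (\<lambda>n. l2_norm L (\<lambda>x. \<eta> n x - u x)) \<longlonglongrightarrow> 0
     \<and> (\<lambda>n. l2_norm L (\<lambda>x. deriv (\<eta> n) x - wderiv L u x)) \<longlonglongrightarrow> 0)"

definition H1_star :: "real \<Rightarrow> (real \<Rightarrow> real) \<Rightarrow> bool" where
  "H1_star L u \<longleftrightarrow> H1 L u \<and> (LINT x:{0<..<L}|lebesgue. u x) = 0"


section \<open>Continuity and differentiability in time, \<open>t \<ge> 0\<close>\<close>

definition cont_L2 :: "real \<Rightarrow> (real \<Rightarrow> real \<Rightarrow> real) \<Rightarrow> bool" where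
  "cont_L2 L u \<longleftrightarrow> (\<forall>t\<ge>0. L2 L (u t)
     \<and> ((\<lambda>s. l2_norm L (\<lambda>x. u s x - u t x)) \<longlongrightarrow> 0) (at t within {0..}))"

definition cont_H1 :: "real \<Rightarrow> (real \<Rightarrow> real \<Rightarrow> real) \<Rightarrow> bool" where
  "cont_H1 L u \<longleftrightarrow> (\<forall>t\<ge>0. H1 L (u t)) \<and> cont_L2 L u \<and> cont_L2 L (\<lambda>t. wderiv L (u t))"

definition is_tderiv_L2 ::
    "real \<Rightarrow> (real \<Rightarrow> real \<Rightarrow> real) \<Rightarrow> real \<Rightarrow> (real \<Rightarrow> real) \<Rightarrow> bool" where
  "is_tderiv_L2 L u t v \<longleftrightarrow> L2 L v
     \<and> ((\<lambda>s. l2_norm L (\<lambda>x. (u s x - u t x) / (s - t) - v x)) \<longlongrightarrow> 0) (at t within {0..})"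

definition tderiv :: "real \<Rightarrow> (real \<Rightarrow> real \<Rightarrow> real) \<Rightarrow> real \<Rightarrow> real \<Rightarrow> real" where
  "tderiv L u t = (SOME v. is_tderiv_L2 L u t v)"

definition C1_L2 :: "real \<Rightarrow> (real \<Rightarrow> real \<Rightarrow> real) \<Rightarrow> bool" where
  "C1_L2 L u \<longleftrightarrow> cont_L2 L u \<and> (\<forall>t\<ge>0. \<exists>v. is_tderiv_L2 L u t v) \<and> cont_L2 L (tderiv L u)"


section \<open>The problem\<close>

text \<open>\<open>px L \<phi> \<psi> t\<close> is \<open>p\<^sub>x(\<cdot>,t) = \<phi>\<^sub>x + \<psi>\<close>, the derivative of
  \<open>p(x,t) = \<integral>\<^sub>0\<^sup>x (\<phi>\<^sub>x + \<psi>)(y,t) dy\<close>. It is used for all real times, the functions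
  \<open>\<phi>, \<psi>\<close> being equal to the prescribed histories for negative times.\<close>

definition px ::
    "real \<Rightarrow> (real \<Rightarrow> real \<Rightarrow> real) \<Rightarrow> (real \<Rightarrow> real \<Rightarrow> real) \<Rightarrow> real \<Rightarrow> real \<Rightarrow> real" where
  "px L \<phi> \<psi> t x = wderiv L (\<phi> t) x + \<psi> t x"

definition ae_eq :: "real \<Rightarrow> (real \<Rightarrow> real) \<Rightarrow> (real \<Rightarrow> real) \<Rightarrow> bool" where
  "ae_eq L u v \<longleftrightarrow> (AE x in lebesgue. x \<in> {0<..<L} \<longrightarrow> u x = v x)"

text \<open>Measurability of the past history as a function of time with values in \<open>L\<^sup>2\<close>. It is
  stated weakly, which by separability of \<open>L\<^sup>2\<close> is the same as strong measurability. Without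
  it the integrals over the history would have no meaning.\<close>

definition measurable_history ::
    "real \<Rightarrow> (real \<Rightarrow> real \<Rightarrow> real) \<Rightarrow> (real \<Rightarrow> real \<Rightarrow> real) \<Rightarrow> bool" where
  "measurable_history L \<phi>0 \<psi>0 \<longleftrightarrow>
     (\<forall>v. L2 L v \<longrightarrow> set_borel_measurable lebesgue {0..} (\<lambda>s. l2_inner L (px L \<phi>0 \<psi>0 s) v))"

text \<open>The equations are tested with \<open>u \<in> H\<^sup>1\<^sub>0\<close> and \<open>v \<in> H\<^sup>1\<^sub>*\<close> respectively. The Neumann
  condition on \<open>\<psi>\<close> is the natural boundary condition of the second one.\<close>

definition weak_solution ::
    "real \<Rightarrow> real \<Rightarrow> real \<Rightarrow> real \<Rightarrow> real \<Rightarrow> (real \<Rightarrow> real) \<Rightarrow>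
     (real \<Rightarrow> real \<Rightarrow> real) \<Rightarrow> (real \<Rightarrow> real) \<Rightarrow> (real \<Rightarrow> real \<Rightarrow> real) \<Rightarrow> (real \<Rightarrow> real) \<Rightarrow>
     (real \<Rightarrow> real \<Rightarrow> real) \<Rightarrow> (real \<Rightarrow> real \<Rightarrow> real) \<Rightarrow> bool" where
  "weak_solution L \<rho>1 \<rho>2 b \<kappa> g \<phi>0 \<phi>1 \<psi>0 \<psi>1 \<phi> \<psi> \<longleftrightarrow>
     cont_H1 L \<phi> \<and> (\<forall>t\<ge>0. H1_0 L (\<phi> t)) \<and> C1_L2 L \<phi> \<and>
     cont_H1 L \<psi> \<and> (\<forall>t\<ge>0. H1_star L (\<psi> t)) \<and> C1_L2 L \<psi> \<and> (\<forall>t\<ge>0. L2_star L (tderiv L \<psi> t)) \<and>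
     (\<forall>s\<ge>0. ae_eq L (\<phi> (- s)) (\<phi>0 s) \<and> ae_eq L (\<psi> (- s)) (\<psi>0 s)) \<and>
     ae_eq L (tderiv L \<phi> 0) \<phi>1 \<and> ae_eq L (tderiv L \<psi> 0) \<psi>1 \<and>
     (\<forall>u. H1_0 L u \<longrightarrow> (\<forall>t\<ge>0.
        ((\<lambda>\<tau>. \<rho>1 * l2_inner L (tderiv L \<phi> \<tau>) u) has_real_derivative
           (- \<kappa> * l2_inner L (px L \<phi> \<psi> t) (wderiv L u)
            + \<kappa> * (LINT s:{0..}|lebesgue. g s * l2_inner L (px L \<phi> \<psi> (t - s)) (wderiv L u))))
         (at t within {0..}))) \<and>
     (\<forall>v. H1_star L v \<longrightarrow> (\<forall>t\<ge>0.
        ((\<lambda>\<tau>. \<rho>2 * l2_inner L (tderiv L \<psi> \<tau>) v) has_real_derivative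
           (- b * l2_inner L (wderiv L (\<psi> t)) (wderiv L v)
            - \<kappa> * l2_inner L (px L \<phi> \<psi> t) v
            + \<kappa> * (LINT s:{0..}|lebesgue. g s * l2_inner L (px L \<phi> \<psi> (t - s)) v)))
         (at t within {0..})))"

definition g_circ :: "real \<Rightarrow> (real \<Rightarrow> real) \<Rightarrow> (real \<Rightarrow> real \<Rightarrow> real) \<Rightarrow> real \<Rightarrow> real" where
  "g_circ L g u t = (LINT s:{0..}|lebesgue. g s * (l2_norm L (\<lambda>x. u t x - u (t - s) x))\<^sup>2)"

definition energy ::
    "real \<Rightarrow> real \<Rightarrow> real \<Rightarrow> real \<Rightarrow> real \<Rightarrow> (real \<Rightarrow> real) \<Rightarrow>
     (real \<Rightarrow> real \<Rightarrow> real) \<Rightarrow> (real \<Rightarrow> real \<Rightarrow> real) \<Rightarrow> real \<Rightarrow> real" where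
  "energy L \<rho>1 \<rho>2 b \<kappa> g \<phi> \<psi> t =
     \<rho>1 / 2 * (l2_norm L (tderiv L \<phi> t))\<^sup>2
     + \<rho>2 / 2 * (l2_norm L (tderiv L \<psi> t))\<^sup>2
     + b / 2 * (l2_norm L (wderiv L (\<psi> t)))\<^sup>2
     + \<kappa> / 2 * (1 - (LINT s:{0..}|lebesgue. g s)) * (l2_norm L (px L \<phi> \<psi> t))\<^sup>2
     + \<kappa> / 2 * g_circ L g (px L \<phi> \<psi>) t"

text \<open>The last term is the only one of \<open>E(0)\<close> that can be infinite; since a divergent Bochner
  integral has value \<open>0\<close>, finiteness has to be required separately.\<close>

definition finite_initial_energy ::
    "real \<Rightarrow> (real \<Rightarrow> real) \<Rightarrow> (real \<Rightarrow> real \<Rightarrow> real) \<Rightarrow> (real \<Rightarrow> real \<Rightarrow> real) \<Rightarrow> bool" where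
  "finite_initial_energy L g \<phi> \<psi> \<longleftrightarrow> set_integrable lebesgue {0..}
     (\<lambda>s. g s * (l2_norm L (\<lambda>x. px L \<phi> \<psi> 0 x - px L \<phi> \<psi> (0 - s) x))\<^sup>2)"


section \<open>Hypotheses on the relaxation function\<close>

definition hyp_A1 :: "real \<Rightarrow> real \<Rightarrow> real \<Rightarrow> (real \<Rightarrow> real) \<Rightarrow> bool" where
  "hyp_A1 L \<rho>1 \<rho>2 g \<longleftrightarrow>
     (\<forall>t\<ge>0. g t > 0) \<and> antimono_on {0..} g \<and> g differentiable_on {0..} \<and>
     set_integrable lebesgue {0..} g \<and> 1 - (LINT s:{0..}|lebesgue. g s) > 0 \<and>
     (LINT s:{0..}|lebesgue. g s) > max (31 / 32) (64 * \<rho>1 * L\<^sup>2 / (64 * \<rho>1 * L\<^sup>2 + \<rho>2))"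

definition strictly_convex_on :: "real set \<Rightarrow> (real \<Rightarrow> real) \<Rightarrow> bool" where
  "strictly_convex_on S f \<longleftrightarrow> convex S \<and>
     (\<forall>x\<in>S. \<forall>y\<in>S. \<forall>u>0. \<forall>v>0. x \<noteq> y \<and> u + v = 1 \<longrightarrow> f (u * x + v * y) < u * f x + v * f y)"

text \<open>\<open>H'\<close> is the derivative of \<open>H\<close>. In the nonlinear case \<open>H\<close> is already identified with
  its strictly increasing and strictly convex \<open>C\<^sup>2\<close> extension to \<open>(0,\<infinity>)\<close>, so that only the
  last two conditions still refer to \<open>(0,r]\<close>.\<close>

definition hyp_H_nonlinear :: "(real \<Rightarrow> real) \<Rightarrow> (real \<Rightarrow> real) \<Rightarrow> bool" where
  "hyp_H_nonlinear H H' \<longleftrightarrow>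
     H 0 = 0 \<and> H' 0 = 0 \<and>
     strict_mono_on {0<..} H \<and> strictly_convex_on {0<..} H \<and>
     (\<exists>H''. (\<forall>s>0. (H' has_real_derivative H'' s) (at s)) \<and> continuous_on {0<..} H'') \<and>
     filterlim H' at_top at_top \<and>
     (\<exists>r>0. convex_on {0<..r} (\<lambda>s. s * H' s)
        \<and> convex_on {0<..r} (\<lambda>s. s * inv_into {0..} H' s))"

definition hyp_A2 ::
    "(real \<Rightarrow> real) \<Rightarrow> (real \<Rightarrow> real) \<Rightarrow> (real \<Rightarrow> real) \<Rightarrow> (real \<Rightarrow> real) \<Rightarrow> bool" where
  "hyp_A2 g \<xi> H H' \<longleftrightarrow>
     (\<forall>t\<ge>0. \<xi> t > 0) \<and> antimono_on {0..} \<xi> \<and> \<xi> differentiable_on {0..} \<and>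
     (\<forall>s\<ge>0. H s \<ge> 0 \<and> (H has_real_derivative H' s) (at s within {0..})) \<and>
     continuous_on {0..} H' \<and>
     ((\<exists>a>0. \<forall>s\<ge>0. H s = a * s) \<or> hyp_H_nonlinear H H') \<and>
     (\<forall>t\<ge>0. \<exists>D. (g has_real_derivative D) (at t within {0..}) \<and> D \<le> - \<xi> t * H (g t))"


section \<open>Auxiliary functions and the class \<open>S\<close>\<close>

text \<open>Here \<open>P\<close> stands for \<open>p\<^sub>x\<close>.\<close>

definition h0 :: "real \<Rightarrow> (real \<Rightarrow> real) \<Rightarrow> (real \<Rightarrow> real \<Rightarrow> real) \<Rightarrow> real \<Rightarrow> real" where
  "h0 L g P t = (LINT s:{0..}|lebesgue. g (t + s) * (1 + (l2_norm L (P (- s)))\<^sup>2))"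

definition f_hist :: "real \<Rightarrow> (real \<Rightarrow> real) \<Rightarrow> (real \<Rightarrow> real \<Rightarrow> real) \<Rightarrow> real \<Rightarrow> real" where
  "f_hist L g P t = 1 + (LINT s:{0..t}|lebesgue. h0 L g P s)"

definition q_fun :: "real \<Rightarrow> (real \<Rightarrow> real) \<Rightarrow> (real \<Rightarrow> real \<Rightarrow> real) \<Rightarrow> real \<Rightarrow> real \<Rightarrow> real" where
  "q_fun L g P q0 t = q0 / f_hist L g P t"

definition G1 :: "(real \<Rightarrow> real) \<Rightarrow> real \<Rightarrow> real" where
  "G1 H' t = (LINT s:{t..1}|lebesgue. 1 / (s * H' s))"

definition G2 :: "(real \<Rightarrow> real) \<Rightarrow> real \<Rightarrow> real" where
  "G2 H' t = t * H' t"

text \<open>For linear \<open>H\<close> the derivative has no inverse function; \<open>G3\<close>, \<open>G4\<close> then depend on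
  unspecified values of \<open>inv_into\<close>. For nonlinear \<open>H\<close> the derivative is a bijection of
  \<open>[0,\<infinity>)\<close>, so that \<open>inv_into\<close> is its inverse and \<open>G4\<close> is finite.\<close>

definition G3 :: "(real \<Rightarrow> real) \<Rightarrow> real \<Rightarrow> real" where
  "G3 H' t = t * inv_into {0..} H' t"

definition young_conjugate :: "(real \<Rightarrow> real) \<Rightarrow> real \<Rightarrow> ereal" where
  "young_conjugate G s = (SUP t\<in>{0..}. ereal (s * t - G t))"

definition G4 :: "(real \<Rightarrow> real) \<Rightarrow> real \<Rightarrow> ereal" where
  "G4 H' = young_conjugate (G3 H')"

definition G5 :: "(real \<Rightarrow> real) \<Rightarrow> (real \<Rightarrow> real) \<Rightarrow> real \<Rightarrow> real \<Rightarrow> real" where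
  "G5 H' \<xi> c1 t = inv_into {0<..1} (G1 H') (c1 * (LINT s:{0..t}|lebesgue. \<xi> s))"

definition class_S ::
    "real \<Rightarrow> (real \<Rightarrow> real) \<Rightarrow> (real \<Rightarrow> real) \<Rightarrow> (real \<Rightarrow> real) \<Rightarrow> (real \<Rightarrow> real \<Rightarrow> real) \<Rightarrow>
     real \<Rightarrow> real \<Rightarrow> real \<Rightarrow> real \<Rightarrow> real \<Rightarrow> (real \<Rightarrow> real) set" where
  "class_S L g \<xi> H' P q0 c d c1 c2 = {chi.
     (\<forall>t\<ge>0. 0 < chi t \<and> chi t \<le> 1) \<and>
     (\<exists>chi'. (\<forall>t\<ge>0. (chi has_real_derivative chi' t) (at t within {0..}) \<and> chi' t \<le> 0)
        \<and> continuous_on {0..} chi') \<and>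
     (\<forall>t\<ge>0. ereal c2 * G4 H' (c / d * q_fun L g P q0 t * h0 L g P t)
        \<le> ereal (c1 * (G2 H' (G5 H' \<xi> c1 t / chi t) - G2 H' (G5 H' \<xi> c1 t) / chi t)))}"

end

theory Submission
  imports Defs "HOL-Computational_Algebra.Polynomial"
begin

text \<open>
  Expansion into the bases \<open>sin (n \<pi> x / L)\<close> and \<open>cos (n \<pi> x / L)\<close> decouples the problem into
  ordinary differential equations with memory, one for each \<open>n\<close>. For a single mode the energy and
  the multiplier functionals are absolutely continuous in time, and since the wave speeds are equal
  they combine into a functional \<open>Ly\<close>, equivalent to the modal energy \<open>E\<close>, with
  \<open>Ly' \<le> - m0 E - M (\<integral>\<^sub>0\<^sup>\<infinity> g \<cdot> P\<^sup>2 - \<integral>\<^sub>0\<^sup>\<infinity> g(s) P(t - s)\<^sup>2 ds)\<close> and constants that do not depend on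
  the mode. Integrating in time and summing over the modes gives
  \<open>\<integral>\<^sub>0\<^sup>t E \<le> C f(t)\<close> for the total energy \<open>E\<close>.

  The memory term is split at the initial time. The part before it is of order \<open>h\<^sub>0\<close>. In the
  other part, \<open>m = - g' \<ge> \<xi> H(g)\<close> and the tangent line inequality
  \<open>H'(u) g \<le> H(g) + u H'(u)\<close> at \<open>u = \<epsilon> q E\<close> play the role of Jensen's inequality, the error
  being absorbed because \<open>q \<integral>\<^sub>0\<^sup>t E\<close> is bounded. For the functional \<open>X\<close>, comparable with \<open>q E\<close>,
  that arises from the weight \<open>q \<xi> H'(\<epsilon> q E)\<close>, this yields
  \<open>X' \<le> - \<xi> q H'(\<epsilon> q E) (c E - C h\<^sub>0)\<close>. By Young's inequality for \<open>G\<^sub>3\<close> and the definition of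
  the class \<open>S\<close>, a multiple of \<open>G\<^sub>5 / \<chi>\<close> is a supersolution of this differential inequality.
  For linear \<open>H\<close> no decay has to be proved, as the class \<open>S\<close> is empty for large \<open>c\<close>.
\<close>

section \<open>Absolutely continuous functions given by a density\<close>

text \<open>The derivative of the memory is an integral of \<open>- g'\<close> against a history
  that is only measurable and square integrable with weight \<open>g\<close>, so it converges for
  almost every time only. Hence the functionals are handled as absolutely continuous functions with
  integrable densities, and the differential inequalities hold almost everywhere. For one mode the
  multipliers are products of scalar functions, so that the low regularity of weak solutions does no
  harm; the constants see the mode only through \<open>1 / \<mu> \<le> L / pi\<close>.

  The difference \<open>\<integral> g * P\<^sup>2 - \<integral> g(s) * P(t - s)\<^sup>2 ds\<close>
  has no sign. Integrated in time it is bounded below by the contribution of the history; at a fixed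
  time it is traded against half of the decay and a multiple of the memory term. The integral bound
  for the energy has to precede the decay estimate, because the error of the tangent line inequality
  contains the unweighted integral of \<open>P\<^sup>2\<close> over \<open>[0,t]\<close>. The
  constants may depend on the initial energy, since they are chosen after the solution.\<close>

lemma local_to_global_le:
  fixes \<Phi> N :: "real \<Rightarrow> real"
  assumes "a \<le> b"
    and loc: "\<And>e. e > 0 \<Longrightarrow> \<exists>d>0. \<forall>s t. a \<le> s \<and> s \<le> t \<and> t \<le> b \<and> t - s < d
                 \<longrightarrow> \<Phi> t - \<Phi> s \<le> e * (N t - N s)"
  shows "\<Phi> b \<le> \<Phi> a"
proof -
  \<comment> \<open>The increments telescope over a partition into pieces shorter than
    \<open>d\<close>. As \<open>N b - N a\<close> is fixed, \<open>e\<close> can tend to 0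
    afterwards.\<close>
  have key: "\<Phi> b - \<Phi> a \<le> e * (N b - N a)" if e0: "e > 0" for e
  proof -
    obtain d where d: "d > 0" and d': "\<forall>s t. a \<le> s \<and> s \<le> t \<and> t \<le> b \<and> t - s < d
                 \<longrightarrow> \<Phi> t - \<Phi> s \<le> e * (N t - N s)"
      using loc[OF e0] by (elim exE conjE) (rule that)
    have dd: "\<Phi> t - \<Phi> s \<le> e * (N t - N s)" if "a \<le> s" "s \<le> t" "t \<le> b" "t - s < d" for s t
      using d' that by simp
    obtain n0 where n0: "(b - a) / d < real n0" using reals_Archimedean2 by blast
    define n where "n = Suc n0"
    have n: "n > 0" "(b - a) / d < real n" using n0 by (auto simp: n_def)
    define p where "p i = a + real i * (b - a) / real n" for i
    have small: "(b - a) / real n < d"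
      using n d by (simp add: field_simps)
    have step: "p (Suc i) - p i = (b - a) / real n" for i
      by (simp add: p_def add_divide_distrib diff_divide_distrib algebra_simps)
    have range: "a \<le> p i" "p i \<le> b" if "i \<le> n" for i
    proof -
      show "a \<le> p i" using \<open>a \<le> b\<close> by (simp add: p_def)
      have "real i * (b - a) / real n \<le> real n * (b - a) / real n"
        using that \<open>a \<le> b\<close> by (intro divide_right_mono mult_right_mono) auto
      then show "p i \<le> b" using n by (simp add: p_def)
    qed
    have "i \<le> n \<Longrightarrow> \<Phi> (p i) - \<Phi> a \<le> e * (N (p i) - N a)" for i
    proof (induction i)
      case 0 then show ?case by (simp add: p_def)
    next
      case (Suc i)
      have "(b - a) / real n \<ge> 0" using \<open>a \<le> b\<close> by simp
      then have le: "p i \<le> p (Suc i)" using step[of i] by linarith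
      have "\<Phi> (p (Suc i)) - \<Phi> (p i) \<le> e * (N (p (Suc i)) - N (p i))"
        using range[of i] range[of "Suc i"] Suc.prems le small step[of i] by (intro dd) auto
      moreover have "\<Phi> (p i) - \<Phi> a \<le> e * (N (p i) - N a)" using Suc by simp
      ultimately show ?case by (simp add: right_diff_distrib)
    qed
    from this[of n] show ?thesis using n by (simp add: p_def)
  qed
  show ?thesis
  proof (rule ccontr)
    assume "\<not> ?thesis"
    then have pos: "\<Phi> b - \<Phi> a > 0" by simp
    define M where "M = \<bar>N b - N a\<bar> + 1"
    have M: "M > 0" "N b - N a < M" by (auto simp: M_def)
    define e where "e = (\<Phi> b - \<Phi> a) / (2 * M)"
    have e: "e > 0" using pos M by (simp add: e_def)
    have "\<Phi> b - \<Phi> a \<le> e * (N b - N a)" using key[OF e] .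
    also have "\<dots> \<le> e * M" using M e by (intro mult_left_mono) auto
    also have "\<dots> = (\<Phi> b - \<Phi> a) / 2" using M by (simp add: e_def)
    finally show False using pos by simp
  qed
qed

text \<open>Local absolute continuity in integral form, with \<open>du\<close> as derivative.
  Nothing is said about differentiability at a point, so sums and products can be treated without
  Lebesgue's differentiation theorem.\<close>

definition has_density :: "(real \<Rightarrow> real) \<Rightarrow> (real \<Rightarrow> real) \<Rightarrow> bool" where
  "has_density u du \<longleftrightarrow> (\<forall>s t. 0 \<le> s \<longrightarrow> s \<le> t \<longrightarrow>
     du absolutely_integrable_on {s..t} \<and> (du has_integral (u t - u s)) {s..t})"

lemma has_densityI:
  assumes "\<And>T. T \<ge> 0 \<Longrightarrow> du absolutely_integrable_on {0..T}"
    and "\<And>T. T \<ge> 0 \<Longrightarrow> integral {0..T} du = u T - u 0"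
  shows "has_density u du"
  unfolding has_density_def
proof (intro allI impI conjI)
  fix s t :: real assume st: "0 \<le> s" "s \<le> t"
  show abs: "du absolutely_integrable_on {s..t}"
    by (rule absolutely_integrable_on_subinterval[OF assms(1)[of t]]) (use st in auto)
  have i: "du integrable_on {0..t}"
    using assms(1)[of t] st set_lebesgue_integral_eq_integral(1) by auto
  have "integral {0..s} du + integral {s..t} du = integral {0..t} du"
    by (rule Henstock_Kurzweil_Integration.integral_combine) (use st i in auto)
  then have "integral {s..t} du = u t - u s" using assms(2)[of s] assms(2)[of t] st by auto
  moreover have "du integrable_on {s..t}" using abs set_lebesgue_integral_eq_integral(1) by auto
  ultimately show "(du has_integral (u t - u s)) {s..t}" by (metis integrable_integral)
qed

lemma has_densityD:
  assumes "has_density u du" "0 \<le> s" "s \<le> t"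
  shows "du absolutely_integrable_on {s..t}" "(du has_integral (u t - u s)) {s..t}"
    "du integrable_on {s..t}" "integral {s..t} du = u t - u s"
  using assms unfolding has_density_def by (auto dest: integral_unique has_integral_integrable)

lemma has_density_continuous:
  assumes "has_density u du" shows "continuous_on {0..T} u"
proof (cases "T \<ge> 0")
  case True
  have "continuous_on {0..T} (\<lambda>t. u 0 + integral {0..t} du)"
    using has_densityD(3)[OF assms order_refl True]
    by (intro continuous_intros indefinite_integral_continuous_1)
  moreover have "u 0 + integral {0..t} du = u t" if "t \<in> {0..T}" for t
    using has_densityD(4)[OF assms order_refl, of t] that by auto
  ultimately show ?thesis by (metis (mono_tags, lifting) continuous_on_cong)
qed auto

lemma continuous_on_halfline:
  fixes u :: "real \<Rightarrow> real"
  assumes "\<And>T. continuous_on {0..T} u" shows "continuous_on {0..} u"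
proof -
  have "continuous (at x within {0..}) u" if "x \<ge> 0" for x
  proof -
    have "continuous (at x within {0..x+1}) u"
      using assms[of "x+1"] that by (simp add: continuous_on_eq_continuous_within)
    moreover have "at x within {0..x+1} = at x within {0..}"
      by (rule at_within_nhd[of _ "{..<x+1}"]) (use that in auto)
    ultimately show ?thesis by simp
  qed
  then show ?thesis by (simp add: continuous_on_eq_continuous_within)
qed

lemma has_density_continuous':
  assumes "has_density u du" shows "continuous_on {0..} u"
  using assms by (intro continuous_on_halfline has_density_continuous)

lemma has_density_add:
  assumes "has_density u du" "has_density v dv"
  shows "has_density (\<lambda>t. u t + v t) (\<lambda>t. du t + dv t)"
  unfolding has_density_def
proof (intro allI impI conjI)
  fix s t :: real assume st: "0 \<le> s" "s \<le> t"
  show "(\<lambda>t. du t + dv t) absolutely_integrable_on {s..t}"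
    using has_densityD(1)[OF assms(1) st] has_densityD(1)[OF assms(2) st] by (rule set_integral_add)
  show "((\<lambda>t. du t + dv t) has_integral (u t + v t - (u s + v s))) {s..t}"
    using has_integral_add[OF has_densityD(2)[OF assms(1) st] has_densityD(2)[OF assms(2) st]]
    by (simp add: algebra_simps)
qed

lemma has_density_cmult:
  assumes "has_density u du"
  shows "has_density (\<lambda>t. c * u t) (\<lambda>t. c * du t)"
  unfolding has_density_def
proof (intro allI impI conjI)
  fix s t :: real assume st: "0 \<le> s" "s \<le> t"
  show "(\<lambda>t. c * du t) absolutely_integrable_on {s..t}"
    using has_densityD(1)[OF assms(1) st] by (rule set_integrable_mult_right)
  show "((\<lambda>t. c * du t) has_integral (c * u t - c * u s)) {s..t}"
    using has_integral_mult_right[OF has_densityD(2)[OF assms(1) st], of c]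
    by (simp add: algebra_simps)
qed

lemma has_density_diff:
  assumes "has_density u du" "has_density v dv"
  shows "has_density (\<lambda>t. u t - v t) (\<lambda>t. du t - dv t)"
  using has_density_add[OF assms(1) has_density_cmult[OF assms(2), of "-1"]] by simp

lemma has_density_cong:
  assumes "has_density u du" "\<And>t. t \<ge> 0 \<Longrightarrow> u t = v t" "\<And>t. t \<ge> 0 \<Longrightarrow> du t = dv t"
  shows "has_density v dv"
proof (rule has_densityI)
  fix T :: real assume T: "T \<ge> 0"
  show "dv absolutely_integrable_on {0..T}"
    using has_densityD(1)[OF assms(1) order_refl T] assms(3)
    by (subst absolutely_integrable_spike_eq[where S="{}" and g=du]) auto
  show "integral {0..T} dv = v T - v 0"
    using has_densityD(4)[OF assms(1) order_refl T] assms(2)[of T] assms(2)[of 0] T assms(3)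
    by (metis (no_types, lifting) integral_cong atLeastAtMost_iff order_refl)
qed

lemma has_density_C1:
  assumes der: "\<And>t. t \<ge> 0 \<Longrightarrow> (u has_real_derivative du t) (at t within {0..})"
    and cont: "continuous_on {0..} du"
  shows "has_density u du"
proof (rule has_densityI)
  fix T :: real assume T: "T \<ge> 0"
  have c: "continuous_on {0..T} du" using cont by (rule continuous_on_subset) auto
  show "du absolutely_integrable_on {0..T}"
    by (rule absolutely_integrable_continuous_real[OF c])
  have "(du has_integral (u T - u 0)) {0..T}"
    using T by (intro fundamental_theorem_of_calculus)
      (auto intro!: has_vector_derivative_within_subset[OF der[THEN has_real_derivative_iff_has_vector_derivative[THEN iffD1]]])
  then show "integral {0..T} du = u T - u 0" by (rule integral_unique)
qed

lemma abs_integrable_mult_continuous: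
  fixes w du :: "real \<Rightarrow> real"
  assumes "continuous_on {s..t} w" "du absolutely_integrable_on {s..t}"
  shows "(\<lambda>x. w x * du x) absolutely_integrable_on {s..t}"
proof (rule absolutely_integrable_bounded_measurable_product_real)
  show "w \<in> borel_measurable (lebesgue_on {s..t})"
    by (intro continuous_imp_measurable_on_sets_lebesgue assms) auto
  show "bounded (w ` {s..t})"
    by (intro compact_imp_bounded compact_continuous_image assms) auto
qed (use assms in auto)

lemma unif_cont_modulus:
  fixes w :: "real \<Rightarrow> real"
  assumes "continuous_on {a..b} w" "e > 0"
  obtains d where "d > 0" "\<And>s t. s \<in> {a..b} \<Longrightarrow> t \<in> {a..b} \<Longrightarrow> \<bar>t - s\<bar> < d \<Longrightarrow> \<bar>w t - w s\<bar> \<le> e"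
proof -
  have "uniformly_continuous_on {a..b} w"
    using assms by (intro compact_uniformly_continuous) auto
  then obtain d where "d > 0" "\<And>s t. s \<in> {a..b} \<Longrightarrow> t \<in> {a..b} \<Longrightarrow> dist t s < d \<Longrightarrow> dist (w t) (w s) < e"
    using assms(2) unfolding uniformly_continuous_on_def by metis
  then show ?thesis by (intro that[of d]) (auto simp: dist_real_def less_imp_le)
qed

lemma integral_weighted_diff_le:
  fixes du w :: "real \<Rightarrow> real"
  assumes "du absolutely_integrable_on {s..t}" "continuous_on {s..t} w"
    and "\<And>x. x \<in> {s..t} \<Longrightarrow> \<bar>w x\<bar> \<le> e"
  shows "\<bar>integral {s..t} (\<lambda>x. w x * du x)\<bar> \<le> e * integral {s..t} (\<lambda>x. \<bar>du x\<bar>)"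
proof -
  have i1: "(\<lambda>x. w x * du x) integrable_on {s..t}"
    using abs_integrable_mult_continuous[OF assms(2,1)] set_lebesgue_integral_eq_integral(1) by auto
  have i2: "(\<lambda>x. \<bar>du x\<bar>) integrable_on {s..t}"
    using assms(1) by (simp add: absolutely_integrable_on_def)
  have "norm (integral {s..t} (\<lambda>x. w x * du x)) \<le> integral {s..t} (\<lambda>x. e * \<bar>du x\<bar>)"
  proof (rule integral_norm_bound_integral[OF i1])
    show "(\<lambda>x. e * \<bar>du x\<bar>) integrable_on {s..t}" using i2 by (rule integrable_on_mult_right)
    fix x assume "x \<in> {s..t}"
    then show "norm (w x * du x) \<le> e * \<bar>du x\<bar>"
      using assms(3)[of x] by (auto simp: abs_mult intro: mult_right_mono)
  qed
  then show ?thesis by simp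
qed

lemma indefinite_integral_split:
  fixes f :: "real \<Rightarrow> real"
  assumes "a \<le> s" "s \<le> t" "t \<le> b" "f integrable_on {a..b}"
  shows "integral {a..t} f - integral {a..s} f = integral {s..t} f"
proof -
  have "f integrable_on {a..t}" by (rule integrable_on_subinterval[OF assms(4)]) (use assms in auto)
  from Henstock_Kurzweil_Integration.integral_combine[OF assms(1,2) this] show ?thesis by simp
qed

text \<open>On a short interval the defect of the product rule is the integral of
  \<open>(v t - v x) * du x + (u s - u x) * dv x\<close>. Uniform continuity bounds the two factors
  by \<open>e\<close>, and \<open>local_to_global_le\<close> applies with the total variation of
  \<open>u\<close> and \<open>v\<close> as \<open>N\<close>.\<close>

lemma has_density_mult:
  assumes u: "has_density u du" and v: "has_density v dv"
  shows "has_density (\<lambda>t. u t * v t) (\<lambda>t. u t * dv t + v t * du t)"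
proof -
  let ?d = "\<lambda>t. u t * dv t + v t * du t"
  have cu: "continuous_on {s..t} u" if "0 \<le> s" for s t
    by (rule continuous_on_subset[OF has_density_continuous'[OF u]]) (use that in auto)
  have cv: "continuous_on {s..t} v" if "0 \<le> s" for s t
    by (rule continuous_on_subset[OF has_density_continuous'[OF v]]) (use that in auto)
  have ab: "(\<lambda>t. u t * dv t) absolutely_integrable_on {s..t}" "(\<lambda>t. v t * du t) absolutely_integrable_on {s..t}"
    if "0 \<le> s" "s \<le> t" for s t
    using cu[of s t] cv[of s t] has_densityD(1)[OF u that] has_densityD(1)[OF v that] that
    by (auto intro: abs_integrable_mult_continuous)
  have abd: "?d absolutely_integrable_on {s..t}" if "0 \<le> s" "s \<le> t" for s t
    using ab[OF that] by (rule set_integral_add)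
  have abi: "f integrable_on S" if "f absolutely_integrable_on S" for f :: "real \<Rightarrow> real" and S
    using that set_lebesgue_integral_eq_integral(1) by auto
  \<comment> \<open>The signs \<open>1\<close> and \<open>-1\<close> for \<open>\<sigma>\<close>
    give the two inequalities that make up the equality.\<close>
  have main: "\<sigma> * (u T * v T - integral {0..T} ?d) \<le> \<sigma> * (u 0 * v 0)" if T: "T \<ge> 0" and \<sigma>: "\<bar>\<sigma>\<bar> = 1" for T \<sigma> :: real
  proof -
    define N where "N t = integral {0..t} (\<lambda>x. \<bar>du x\<bar>) + integral {0..t} (\<lambda>x. \<bar>dv x\<bar>)" for t
    have "\<sigma> * (u T * v T - integral {0..T} ?d) \<le> \<sigma> * (u 0 * v 0 - integral {0..0} ?d)"
    proof (rule local_to_global_le[where N=N and \<Phi>="\<lambda>T. \<sigma> * (u T * v T - integral {0..T} ?d)", OF T])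
      fix e :: real assume e: "e > 0"
      obtain d1 where d1: "d1 > 0" "\<And>s t. s \<in> {0..T} \<Longrightarrow> t \<in> {0..T} \<Longrightarrow> \<bar>t - s\<bar> < d1 \<Longrightarrow> \<bar>u t - u s\<bar> \<le> e"
        using unif_cont_modulus[OF cu[of 0 T] e] by auto
      obtain d2 where d2: "d2 > 0" "\<And>s t. s \<in> {0..T} \<Longrightarrow> t \<in> {0..T} \<Longrightarrow> \<bar>t - s\<bar> < d2 \<Longrightarrow> \<bar>v t - v s\<bar> \<le> e"
        using unif_cont_modulus[OF cv[of 0 T] e] by auto
      show "\<exists>d>0. \<forall>s t. 0 \<le> s \<and> s \<le> t \<and> t \<le> T \<and> t - s < d \<longrightarrow>
          \<sigma> * (u t * v t - integral {0..t} ?d) - \<sigma> * (u s * v s - integral {0..s} ?d) \<le> e * (N t - N s)"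
      proof (intro exI[of _ "min d1 d2"] conjI allI impI; (elim conjE)?)
        show "min d1 d2 > 0" using d1 d2 by auto
        fix s t assume st: "0 \<le> s" "s \<le> t" "t \<le> T" "t - s < min d1 d2"
        note D = has_densityD[OF u st(1,2)] has_densityD[OF v st(1,2)]
        have sp: "integral {0..t} f - integral {0..s} f = integral {s..t} f"
          if "f absolutely_integrable_on {0..T}" for f :: "real \<Rightarrow> real"
          by (rule indefinite_integral_split[OF st(1-3) abi[OF that]])
        have N: "N t - N s = integral {s..t} (\<lambda>x. \<bar>du x\<bar>) + integral {s..t} (\<lambda>x. \<bar>dv x\<bar>)"
          using sp[OF set_integrable_abs[OF has_densityD(1)[OF u order_refl T]]]
            sp[OF set_integrable_abs[OF has_densityD(1)[OF v order_refl T]]] by (simp add: N_def)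
        have I1: "integral {s..t} (\<lambda>x. (v t - v x) * du x) = v t * (u t - u s) - integral {s..t} (\<lambda>x. v x * du x)"
        proof -
          have "integral {s..t} (\<lambda>x. v t * du x - v x * du x) = integral {s..t} (\<lambda>x. v t * du x) - integral {s..t} (\<lambda>x. v x * du x)"
            by (rule integral_diff) (use D(3) abi[OF ab(2)[OF st(1,2)]] in \<open>auto intro: integrable_on_mult_right\<close>)
          then show ?thesis using D(4) by (simp add: algebra_simps)
        qed
        have I2: "integral {s..t} (\<lambda>x. (u s - u x) * dv x) = u s * (v t - v s) - integral {s..t} (\<lambda>x. u x * dv x)"
        proof -
          have "integral {s..t} (\<lambda>x. u s * dv x - u x * dv x) = integral {s..t} (\<lambda>x. u s * dv x) - integral {s..t} (\<lambda>x. u x * dv x)"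
            by (rule integral_diff) (use D(7) abi[OF ab(1)[OF st(1,2)]] in \<open>auto intro: integrable_on_mult_right\<close>)
          then show ?thesis using D(8) by (simp add: algebra_simps)
        qed
        have I3: "integral {s..t} ?d = integral {s..t} (\<lambda>x. u x * dv x) + integral {s..t} (\<lambda>x. v x * du x)"
          by (rule integral_add) (use abi ab[OF st(1,2)] in auto)
        have "(u t * v t - integral {0..t} ?d) - (u s * v s - integral {0..s} ?d) =
           integral {s..t} (\<lambda>x. (v t - v x) * du x) + integral {s..t} (\<lambda>x. (u s - u x) * dv x)"
          using sp[OF abd[OF order_refl T]] I1 I2 I3 by (simp add: algebra_simps)
        also have "\<bar>\<dots>\<bar> \<le> e * integral {s..t} (\<lambda>x. \<bar>du x\<bar>) + e * integral {s..t} (\<lambda>x. \<bar>dv x\<bar>)"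
        proof -
          have "\<bar>integral {s..t} (\<lambda>x. (v t - v x) * du x)\<bar> \<le> e * integral {s..t} (\<lambda>x. \<bar>du x\<bar>)"
            by (rule integral_weighted_diff_le[OF D(1)])
               (use st cv[of s t] d2(2) in \<open>auto intro!: continuous_intros\<close>)
          moreover have "\<bar>integral {s..t} (\<lambda>x. (u s - u x) * dv x)\<bar> \<le> e * integral {s..t} (\<lambda>x. \<bar>dv x\<bar>)"
            by (rule integral_weighted_diff_le[OF D(5)])
               (use st cu[of s t] d1(2) in \<open>auto intro!: continuous_intros\<close>)
          ultimately show ?thesis by linarith
        qed
        finally have "\<bar>\<sigma>\<bar> * \<bar>(u t * v t - integral {0..t} ?d) - (u s * v s - integral {0..s} ?d)\<bar> \<le> e * (N t - N s)"
          using N \<sigma> by (simp add: algebra_simps)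
        then show "\<sigma> * (u t * v t - integral {0..t} ?d) - \<sigma> * (u s * v s - integral {0..s} ?d) \<le> e * (N t - N s)"
          by (metis (no_types) abs_le_D1 abs_mult right_diff_distrib)
      qed
    qed
    then show ?thesis by simp
  qed
  show ?thesis
  proof (rule has_densityI)
    fix T :: real assume T: "T \<ge> 0"
    show "?d absolutely_integrable_on {0..T}" by (rule abd[OF order_refl T])
    show "integral {0..T} ?d = u T * v T - u 0 * v 0"
      using main[OF T, of 1] main[OF T, of "-1"] by simp
  qed
qed

text \<open>The weight is continuous and nonincreasing but comes without a density, so there is no
  product rule for it. Of the two terms of the defect, \<open>(w t - w s) * u s\<close> is
  nonpositive and the other one is small by uniform continuity of \<open>w\<close>.\<close>

lemma antimono_weight_density_le:
  assumes u: "has_density u du" and pos: "\<And>t. t \<ge> 0 \<Longrightarrow> u t \<ge> 0"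
    and w: "continuous_on {0..} w" and dec: "\<And>s t. 0 \<le> s \<Longrightarrow> s \<le> t \<Longrightarrow> w t \<le> w s"
    and ab: "0 \<le> a" "a \<le> b"
  shows "w b * u b - w a * u a \<le> integral {a..b} (\<lambda>x. w x * du x)"
proof -
  let ?d = "\<lambda>x. w x * du x"
  have cw: "continuous_on {s..t} w" if "0 \<le> s" for s t
    by (rule continuous_on_subset[OF w]) (use that in auto)
  have ai: "?d absolutely_integrable_on {s..t}" if "0 \<le> s" "s \<le> t" for s t
    using abs_integrable_mult_continuous[OF cw has_densityD(1)[OF u that]] that by auto
  have abi: "f integrable_on S" if "f absolutely_integrable_on S" for f :: "real \<Rightarrow> real" and S
    using that set_lebesgue_integral_eq_integral(1) by auto
  define N where "N t = integral {a..t} (\<lambda>x. \<bar>du x\<bar>)" for t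
  have "w b * u b - integral {a..b} ?d \<le> w a * u a - integral {a..a} ?d"
  proof (rule local_to_global_le[where N=N and \<Phi>="\<lambda>T. w T * u T - integral {a..T} ?d", OF ab(2)])
    fix e :: real assume e: "e > 0"
    obtain d where d: "d > 0" "\<And>s t. s \<in> {a..b} \<Longrightarrow> t \<in> {a..b} \<Longrightarrow> \<bar>t - s\<bar> < d \<Longrightarrow> \<bar>w t - w s\<bar> \<le> e"
      using unif_cont_modulus[OF cw[OF ab(1)] e] by auto
    show "\<exists>d>0. \<forall>s t. a \<le> s \<and> s \<le> t \<and> t \<le> b \<and> t - s < d \<longrightarrow>
        (w t * u t - integral {a..t} ?d) - (w s * u s - integral {a..s} ?d) \<le> e * (N t - N s)"
    proof (intro exI[of _ d] conjI allI impI; (elim conjE)?)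
      show "d > 0" by fact
      fix s t assume st: "a \<le> s" "s \<le> t" "t \<le> b" "t - s < d"
      have s0: "0 \<le> s" using st ab by auto
      note D = has_densityD[OF u s0 st(2)]
      have sp: "integral {a..t} f - integral {a..s} f = integral {s..t} f"
        if "f absolutely_integrable_on {a..b}" for f :: "real \<Rightarrow> real"
        by (rule indefinite_integral_split[OF st(1-3) abi[OF that]])
      have N: "N t - N s = integral {s..t} (\<lambda>x. \<bar>du x\<bar>)"
        using sp[OF set_integrable_abs[OF has_densityD(1)[OF u ab]]] by (simp add: N_def)
      have I: "integral {s..t} (\<lambda>x. (w t - w x) * du x) = w t * (u t - u s) - integral {s..t} ?d"
      proof -
        have "integral {s..t} (\<lambda>x. w t * du x - w x * du x) = integral {s..t} (\<lambda>x. w t * du x) - integral {s..t} ?d"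
          by (rule integral_diff) (use D(3) abi[OF ai[OF s0 st(2)]] in \<open>auto intro: integrable_on_mult_right\<close>)
        then show ?thesis using D(4) by (simp add: algebra_simps)
      qed
      have "(w t * u t - integral {a..t} ?d) - (w s * u s - integral {a..s} ?d) =
         (w t - w s) * u s + integral {s..t} (\<lambda>x. (w t - w x) * du x)"
        using sp[OF ai[OF ab]] I by (simp add: algebra_simps)
      also have "\<dots> \<le> integral {s..t} (\<lambda>x. (w t - w x) * du x)"
        using dec[OF s0 st(2)] pos[OF s0] by (simp add: mult_nonpos_nonneg)
      also have "\<dots> \<le> \<bar>integral {s..t} (\<lambda>x. (w t - w x) * du x)\<bar>" by simp
      also have "\<dots> \<le> e * integral {s..t} (\<lambda>x. \<bar>du x\<bar>)"
        by (rule integral_weighted_diff_le[OF D(1)])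
           (use st s0 cw[of s t] d(2) in \<open>auto intro!: continuous_intros\<close>)
      finally show "(w t * u t - integral {a..t} ?d) - (w s * u s - integral {a..s} ?d) \<le> e * (N t - N s)"
        using N by simp
    qed
  qed
  then show ?thesis by simp
qed

section \<open>Memory terms\<close>

lemma lborel_int_HK:
  fixes f :: "real \<Rightarrow> real"
  assumes "integrable lborel (\<lambda>t. indicator {a..b} t * f t)"
  shows "f absolutely_integrable_on {a..b}" "integral {a..b} f = (LINT t|lborel. indicator {a..b} t * f t)"
proof -
  have s: "set_integrable lborel {a..b} f" using assms by (simp add: set_integrable_def)
  show "f absolutely_integrable_on {a..b}"
    using integrable_completion[THEN iffD2] assms by (simp add: set_integrable_def integrable_completion borel_measurable_integrable)
  show "integral {a..b} f = (LINT t|lborel. indicator {a..b} t * f t)"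
    using set_borel_integral_eq_integral(2)[OF s] by (simp add: set_lebesgue_integral_def)
qed

text \<open>For \<open>m = - g'\<close> on the half-line this is \<open>g\<close>. With
  \<open>m\<close> as the primary object, the time derivative of the memory becomes an application
  of Fubini's theorem.\<close>

definition tail_kernel :: "(real \<Rightarrow> real) \<Rightarrow> real \<Rightarrow> real" where
  "tail_kernel m s = (LINT r|lborel. indicator {s<..} r * m r)"

definition memory :: "(real \<Rightarrow> real) \<Rightarrow> (real \<Rightarrow> real) \<Rightarrow> real \<Rightarrow> real" where
  "memory k u t = (LINT s|lborel. indicator {0..} s * (k s * u (t - s)))"

locale memory_kernel =
  fixes m :: "real \<Rightarrow> real"
  assumes m_int: "integrable lborel m"
    and m_nonneg: "\<And>r. 0 \<le> m r"
    and m_neg: "\<And>r. r < 0 \<Longrightarrow> m r = 0"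
begin

abbreviation "k \<equiv> tail_kernel m"

lemma m_borel [measurable]: "m \<in> borel_measurable borel"
  using borel_measurable_integrable[OF m_int] by simp

lemma int_ind: "A \<in> sets borel \<Longrightarrow> integrable lborel (\<lambda>r. indicator A r * m r)"
  using integrable_mult_indicator[OF _ m_int, of A] by simp

lemma k_nonneg: "0 \<le> k s"
  unfolding tail_kernel_def by (intro integral_nonneg_AE AE_I2) (auto simp: m_nonneg)

lemma k_antimono: "s \<le> t \<Longrightarrow> k t \<le> k s"
  unfolding tail_kernel_def
  by (intro integral_mono int_ind) (auto simp: m_nonneg indicator_def)

lemma k_borel [measurable]: "k \<in> borel_measurable borel"
proof -
  have "(\<lambda>x. - k x) \<in> borel_measurable borel"
    by (intro borel_measurable_mono monoI) (auto intro: k_antimono)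
  then show ?thesis using borel_measurable_uminus_eq by blast
qed

lemma k_neg: "s < 0 \<Longrightarrow> k s = (LINT r|lborel. m r)"
  unfolding tail_kernel_def by (intro Bochner_Integration.integral_cong) (auto simp: indicator_def m_neg)

lemma k_zero: "k 0 = (LINT r|lborel. m r)"
  unfolding tail_kernel_def
proof (rule integral_cong_AE)
  show "AE r in lborel. indicator {0<..} r * m r = m r"
    using AE_lborel_singleton[of 0] by eventually_elim (auto simp: indicator_def m_neg)
qed auto

text \<open>As \<open>m\<close> vanishes to the left of 0, its tail is constant there. This spares
  case distinctions in the formulas with shifted arguments.\<close>

lemma k_nonpos: "s \<le> 0 \<Longrightarrow> k s = k 0"
  using k_neg[of s] k_zero by (cases "s = 0") auto

text \<open>The inner integral of the Fubini argument: the weight that the input at time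
  \<open>\<sigma>\<close> loses between the times \<open>0\<close> and \<open>T\<close>. Inputs at
  positive times are covered because \<open>k\<close> is constant on nonpositive arguments.\<close>

lemma shifted_window:
  assumes "T \<ge> 0"
  shows "integrable lborel (\<lambda>t. indicator {0..T} t * m (t - \<sigma>))"
    and "(LINT t|lborel. indicator {0..T} t * m (t - \<sigma>)) = k (- \<sigma>) - k (T - \<sigma>)"
proof -
  have eq: "(\<lambda>r. indicator {0..T} (\<sigma> + 1 * r) * m (\<sigma> + 1 * r - \<sigma>)) = (\<lambda>r. indicator {-\<sigma>..T-\<sigma>} r * m r)"
    by (auto simp: indicator_def fun_eq_iff)
  have "integrable lborel (\<lambda>r. indicator {0..T} (\<sigma> + 1 * r) * m (\<sigma> + 1 * r - \<sigma>))"
    unfolding eq by (intro int_ind) auto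
  then show "integrable lborel (\<lambda>t. indicator {0..T} t * m (t - \<sigma>))"
    by (subst (asm) lborel_integrable_real_affine_iff) auto
  have "(LINT t|lborel. indicator {0..T} t * m (t - \<sigma>)) = (LINT r|lborel. indicator {-\<sigma>..T-\<sigma>} r * m r)"
    by (subst lborel_integral_real_affine[where c=1 and t=\<sigma>]) (auto simp: eq[simplified])
  also have "\<dots> = (LINT r|lborel. indicator {-\<sigma><..} r * m r - indicator {T-\<sigma><..} r * m r)"
  proof (rule integral_cong_AE)
    show "AE r in lborel. indicator {-\<sigma>..T-\<sigma>} r * m r = indicator {-\<sigma><..} r * m r - indicator {T-\<sigma><..} r * m r"
      using AE_lborel_singleton[of "-\<sigma>"] by eventually_elim (use assms in \<open>auto simp: indicator_def\<close>)
  qed auto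
  also have "\<dots> = k (- \<sigma>) - k (T - \<sigma>)"
    unfolding tail_kernel_def by (rule Bochner_Integration.integral_diff) (auto intro: int_ind)
  finally show "(LINT t|lborel. indicator {0..T} t * m (t - \<sigma>)) = k (- \<sigma>) - k (T - \<sigma>)" .
qed

end

locale memory_input = memory_kernel +
  fixes u :: "real \<Rightarrow> real"
  assumes u_borel [measurable]: "u \<in> borel_measurable borel"
    and u_bdd: "\<And>T. T \<ge> 0 \<Longrightarrow> \<exists>B. \<forall>t\<in>{0..T}. \<bar>u t\<bar> \<le> B"
    and u_hist: "integrable lborel (\<lambda>s. indicator {0..} s * (k s * u (- s)))"
begin

lemma hist_int: "integrable lborel (\<lambda>\<sigma>. indicator {..0} \<sigma> * (k (- \<sigma>) * u \<sigma>))"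
proof -
  have "integrable lborel (\<lambda>\<sigma>. indicator {0..} (0 + (-1) * \<sigma>) * (k (0 + (-1) * \<sigma>) * u (- (0 + (-1) * \<sigma>))))"
    using u_hist by (subst lborel_integrable_real_affine_iff) auto
  moreover have "(indicator {0..} (- \<sigma>) :: real) = indicator {..0} \<sigma>" for \<sigma> :: real
    by (auto simp: indicator_def)
  ultimately show ?thesis by simp
qed

lemma bdd_int:
  assumes "T \<ge> 0" shows "integrable lborel (\<lambda>\<sigma>. indicator {0..T} \<sigma> * u \<sigma>)"
proof -
  obtain B where B: "\<forall>t\<in>{0..T}. \<bar>u t\<bar> \<le> B" using u_bdd[OF assms] by blast
  have "integrable lborel (\<lambda>\<sigma>. indicator {0..T} \<sigma> * B)"
    by (intro integrable_mult_left integrable_real_indicator) (auto simp: emeasure_lborel_Icc_eq)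
  then show ?thesis
    by (rule Bochner_Integration.integrable_bound) (use B in \<open>auto simp: indicator_def intro!: AE_I2 intro: order_trans[OF _ abs_ge_self]\<close>)
qed

text \<open>Two majorants suffice for all weights that occur: the history is integrable against
  \<open>k (- \<sigma>)\<close>, and the later values are bounded on \<open>[0,T]\<close>.\<close>

lemma weighted_int:
  assumes "T \<ge> 0" and [measurable]: "w \<in> borel_measurable borel"
    and w: "\<And>\<sigma>. \<sigma> \<le> 0 \<Longrightarrow> \<bar>w \<sigma>\<bar> \<le> k (- \<sigma>)" "\<And>\<sigma>. \<sigma> \<in> {0<..T} \<Longrightarrow> \<bar>w \<sigma>\<bar> \<le> k 0" "\<And>\<sigma>. \<sigma> > T \<Longrightarrow> w \<sigma> = 0"
  shows "integrable lborel (\<lambda>\<sigma>. w \<sigma> * u \<sigma>)"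
proof (rule Bochner_Integration.integrable_bound)
  show "integrable lborel (\<lambda>\<sigma>. \<bar>indicator {..0} \<sigma> * (k (- \<sigma>) * u \<sigma>)\<bar> + k 0 * \<bar>indicator {0..T} \<sigma> * u \<sigma>\<bar>)"
    using hist_int bdd_int[OF assms(1)] by (intro Bochner_Integration.integrable_add integrable_mult_right integrable_abs)
  show "AE \<sigma> in lborel. norm (w \<sigma> * u \<sigma>) \<le> norm (\<bar>indicator {..0} \<sigma> * (k (- \<sigma>) * u \<sigma>)\<bar> + k 0 * \<bar>indicator {0..T} \<sigma> * u \<sigma>\<bar>)"
  proof (intro AE_I2)
    fix \<sigma> :: real
    consider "\<sigma> \<le> 0" | "\<sigma> \<in> {0<..T}" | "\<sigma> > T" by force
    then show "norm (w \<sigma> * u \<sigma>) \<le> norm (\<bar>indicator {..0} \<sigma> * (k (- \<sigma>) * u \<sigma>)\<bar> + k 0 * \<bar>indicator {0..T} \<sigma> * u \<sigma>\<bar>)"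
    proof cases
      case 1
      then have "\<bar>w \<sigma>\<bar> * \<bar>u \<sigma>\<bar> \<le> k (- \<sigma>) * \<bar>u \<sigma>\<bar>" by (intro mult_right_mono w) auto
      then show ?thesis using 1 k_nonneg[of "-\<sigma>"] k_nonneg[of 0] by (auto simp: abs_mult intro: order_trans[OF _ abs_ge_self] add_increasing2)
    next
      case 2
      then have "\<bar>w \<sigma>\<bar> * \<bar>u \<sigma>\<bar> \<le> k 0 * \<bar>u \<sigma>\<bar>" by (intro mult_right_mono w) auto
      then show ?thesis using 2 k_nonneg[of 0] by (auto simp: abs_mult)
    next
      case 3 then show ?thesis using w by simp
    qed
  qed
qed simp

text \<open>In the variable \<open>\<sigma> = t - s\<close> the time \<open>t\<close> occurs in the
  kernel only, so that the merely measurable input is neither translated nor differentiated.\<close>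

lemma memory_as_history:
  "memory k u t = (LINT \<sigma>|lborel. indicator {..t} \<sigma> * k (t - \<sigma>) * u \<sigma>)"
  unfolding memory_def
  by (subst lborel_integral_real_affine[where c="-1" and t=t])
     (auto simp: indicator_def intro!: Bochner_Integration.integral_cong)

lemma memory_integrable:
  assumes "t \<ge> 0"
  shows "integrable lborel (\<lambda>s. indicator {0..} s * (k s * u (t - s)))"
proof -
  have "integrable lborel (\<lambda>\<sigma>. indicator {..t} \<sigma> * k (t - \<sigma>) * u \<sigma>)"
  proof (rule weighted_int[OF assms])
    fix \<sigma> :: real assume "\<sigma> \<le> 0" then show "\<bar>indicator {..t} \<sigma> * k (t - \<sigma>)\<bar> \<le> k (- \<sigma>)"
      using assms k_nonneg k_antimono[of "-\<sigma>" "t-\<sigma>"] by (auto simp: indicator_def abs_mult)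
  next
    fix \<sigma> :: real assume "\<sigma> \<in> {0<..t}" then show "\<bar>indicator {..t} \<sigma> * k (t - \<sigma>)\<bar> \<le> k 0"
      using assms k_nonneg k_antimono[of "0" "t-\<sigma>"] by (auto simp: indicator_def abs_mult)
  qed auto
  then have "integrable lborel (\<lambda>s. indicator {..t} (t + (-1) * s) * k (t - (t + (-1) * s)) * u (t + (-1) * s))"
    by (subst lborel_integrable_real_affine_iff) auto
  moreover have "(indicator {..t} (t - s) :: real) = indicator {0..} s" for s :: real
    by (auto simp: indicator_def)
  ultimately show ?thesis by (simp add: mult.assoc)
qed

text \<open>Integrating the absolute value over \<open>t\<close> first gives
  \<open>(k (- \<sigma>) - k (T - \<sigma>)) * \<bar>u \<sigma>\<bar>\<close>, which
  \<open>weighted_int\<close> covers. In this order \<open>m\<close> may be unbounded.\<close>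

lemma product_integrable:
  assumes T: "T \<ge> 0"
  shows "integrable (lborel \<Otimes>\<^sub>M lborel) (\<lambda>(\<sigma>, t). indicator {0..T} t * m (t - \<sigma>) * u \<sigma>)"
proof (rule lborel_pair.Fubini_integrable)
  have "(\<lambda>\<sigma>. LINT t|lborel. norm (case (\<sigma>, t) of (\<sigma>, t) \<Rightarrow> indicator {0..T} t * m (t - \<sigma>) * u \<sigma>))
     = (\<lambda>\<sigma>. \<bar>(k (- \<sigma>) - k (T - \<sigma>)) * u \<sigma>\<bar>)"
  proof
    fix \<sigma>
    have "(LINT t|lborel. norm (case (\<sigma>, t) of (\<sigma>, t) \<Rightarrow> indicator {0..T} t * m (t - \<sigma>) * u \<sigma>))
      = (LINT t|lborel. indicator {0..T} t * m (t - \<sigma>) * \<bar>u \<sigma>\<bar>)"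
      by (intro Bochner_Integration.integral_cong) (auto simp: abs_mult m_nonneg)
    also have "\<dots> = (k (- \<sigma>) - k (T - \<sigma>)) * \<bar>u \<sigma>\<bar>" using shifted_window[OF T, of \<sigma>] by simp
    finally show "(LINT t|lborel. norm (case (\<sigma>, t) of (\<sigma>, t) \<Rightarrow> indicator {0..T} t * m (t - \<sigma>) * u \<sigma>))
      = \<bar>(k (- \<sigma>) - k (T - \<sigma>)) * u \<sigma>\<bar>"
      using k_antimono[of "-\<sigma>" "T-\<sigma>"] T by (simp add: abs_mult)
  qed
  moreover have "integrable lborel (\<lambda>\<sigma>. (k (- \<sigma>) - k (T - \<sigma>)) * u \<sigma>)"
  proof (rule weighted_int[OF T])
    fix \<sigma> :: real assume "\<sigma> \<le> 0" then show "\<bar>k (- \<sigma>) - k (T - \<sigma>)\<bar> \<le> k (- \<sigma>)"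
      using T k_nonneg[of "T-\<sigma>"] k_antimono[of "-\<sigma>" "T-\<sigma>"] by auto
  next
    fix \<sigma> :: real assume "\<sigma> \<in> {0<..T}" then show "\<bar>k (- \<sigma>) - k (T - \<sigma>)\<bar> \<le> k 0"
      using T k_nonneg[of "T-\<sigma>"] k_nonpos[of "-\<sigma>"] k_antimono[of "0" "T-\<sigma>"] by auto
  next
    fix \<sigma> :: real assume "\<sigma> > T" then show "k (- \<sigma>) - k (T - \<sigma>) = 0"
      using T k_nonpos[of "T-\<sigma>"] k_nonpos[of "-\<sigma>"] by auto
  qed auto
  ultimately show "integrable lborel (\<lambda>\<sigma>. LINT t|lborel. norm (case (\<sigma>, t) of (\<sigma>, t) \<Rightarrow> indicator {0..T} t * m (t - \<sigma>) * u \<sigma>))"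
    by simp
  show "AE \<sigma> in lborel. integrable lborel (\<lambda>t. case (\<sigma>, t) of (\<sigma>, t) \<Rightarrow> indicator {0..T} t * m (t - \<sigma>) * u \<sigma>)"
    using shifted_window(1)[OF T] by auto
qed measurable

lemma reflect_integrable_iff: 
  "integrable lborel (\<lambda>\<sigma>. m (t - \<sigma>) * u \<sigma>) \<longleftrightarrow> integrable lborel (\<lambda>r. m r * u (t - r))"
  using lborel_integrable_real_affine_iff[of "-1" "\<lambda>\<sigma>. m (t - \<sigma>) * u \<sigma>" t] by simp

lemma reflect_integral: 
  "(LINT \<sigma>|lborel. m (t - \<sigma>) * u \<sigma>) = (LINT r|lborel. m r * u (t - r))"
  by (subst lborel_integral_real_affine[where c="-1" and t=t]) auto

lemma AE_memory_integrable:
  assumes T: "T \<ge> 0"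
  shows "AE t in lborel. t \<in> {0..T} \<longrightarrow> integrable lborel (\<lambda>r. m r * u (t - r))"
  using lborel_pair.AE_integrable_snd[OF product_integrable[OF T]]
  by eventually_elim (auto simp: reflect_integrable_iff)

text \<open>Formally the derivative of the memory: integration by parts moves the derivative from
  the input to the kernel. Where the integral diverges its value is 0; by
  \<open>AE_memory_integrable\<close> this concerns almost no \<open>t\<close> in
  \<open>[0,T]\<close>.\<close>

abbreviation "memory_rate \<equiv> (\<lambda>t. LINT r|lborel. m r * (u t - u (t - r)))"

lemma memory_rate_eq:
  "integrable lborel (\<lambda>r. m r * u (t - r)) \<Longrightarrow> memory_rate t = k 0 * u t - (LINT r|lborel. m r * u (t - r))"
  using m_int by (simp add: right_diff_distrib k_zero)

lemma rate_integral:
  assumes T: "T \<ge> 0"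
  shows "integrable lborel (\<lambda>t. indicator {0..T} t * memory_rate t)"
    and "(LINT t|lborel. indicator {0..T} t * memory_rate t) = memory k u T - memory k u 0"
proof -
  define M where "M t = (LINT \<sigma>|lborel. indicator {0..T} t * m (t - \<sigma>) * u \<sigma>)" for t
  have M: "M t = indicator {0..T} t * (LINT r|lborel. m r * u (t - r))" for t
    unfolding M_def by (simp add: mult.assoc reflect_integral)
  have M_int: "integrable lborel M"
    using lborel_pair.integrable_snd[OF product_integrable[OF T]] unfolding M_def by simp
  have M_val: "(LINT t|lborel. M t) = (LINT \<sigma>|lborel. (k (- \<sigma>) - k (T - \<sigma>)) * u \<sigma>)"
    using lborel_pair.Fubini_integral[OF product_integrable[OF T]] shifted_window(2)[OF T]
    unfolding M_def by simp
  have uT: "integrable lborel (\<lambda>t. k 0 * (indicator {0..T} t * u t))"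
    using bdd_int[OF T] by (rule integrable_mult_right)
  have [measurable]: "memory_rate \<in> borel_measurable borel" by measurable
  have [measurable]: "M \<in> borel_measurable borel" using M_int by auto
  \<comment> \<open>The rate can be split into two integrals only where
    \<open>m r * u (t - r)\<close> is integrable in \<open>r\<close>, hence almost
    everywhere.\<close>
  have ae: "AE t in lborel. indicator {0..T} t * memory_rate t = k 0 * (indicator {0..T} t * u t) - M t"
    using AE_memory_integrable[OF T] by eventually_elim (auto simp: M memory_rate_eq indicator_def)
  have i: "integrable lborel (\<lambda>t. k 0 * (indicator {0..T} t * u t) - M t)"
    using uT M_int by simp
  show "integrable lborel (\<lambda>t. indicator {0..T} t * memory_rate t)"
    using i ae by (subst integrable_cong_AE[OF _ _ ae]) auto
  have j1: "integrable lborel (\<lambda>\<sigma>. indicator {..T} \<sigma> * k (T - \<sigma>) * u \<sigma>)"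
  proof (rule weighted_int[OF T])
    fix \<sigma> :: real assume "\<sigma> \<le> 0" then show "\<bar>indicator {..T} \<sigma> * k (T - \<sigma>)\<bar> \<le> k (- \<sigma>)"
      using T k_nonneg k_antimono[of "-\<sigma>" "T-\<sigma>"] by (auto simp: indicator_def abs_mult)
  next
    fix \<sigma> :: real assume "\<sigma> \<in> {0<..T}" then show "\<bar>indicator {..T} \<sigma> * k (T - \<sigma>)\<bar> \<le> k 0"
      using T k_nonneg k_antimono[of "0" "T-\<sigma>"] by (auto simp: indicator_def abs_mult)
  qed auto
  have j2: "integrable lborel (\<lambda>\<sigma>. indicator {..0} \<sigma> * k (0 - \<sigma>) * u \<sigma>)"
    using hist_int by (simp add: mult.assoc)
  have "(LINT t|lborel. indicator {0..T} t * memory_rate t) = (LINT t|lborel. k 0 * (indicator {0..T} t * u t) - M t)"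
    by (rule integral_cong_AE[OF _ _ ae]) auto
  also have "\<dots> = (LINT t|lborel. k 0 * (indicator {0..T} t * u t)) - (LINT t|lborel. M t)"
    by (rule Bochner_Integration.integral_diff[OF uT M_int])
  also have "\<dots> = (LINT t|lborel. k 0 * (indicator {0..T} t * u t)) - (LINT \<sigma>|lborel. (k (- \<sigma>) - k (T - \<sigma>)) * u \<sigma>)"
    by (simp only: M_val)
  \<comment> \<open>Negative \<open>\<sigma>\<close> carry the weights of both end times. For
    \<open>0 < \<sigma> \<le> T\<close> the value \<open>k (- \<sigma>) = k 0\<close> produces the
    undelayed term, and for \<open>\<sigma> > T\<close> both sides vanish. At
    \<open>\<sigma> = 0\<close> two indicators overlap, on a null set.\<close>
  also have "(LINT \<sigma>|lborel. (k (- \<sigma>) - k (T - \<sigma>)) * u \<sigma>) = 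
     (LINT \<sigma>|lborel. k 0 * (indicator {0..T} \<sigma> * u \<sigma>) + indicator {..0} \<sigma> * k (0 - \<sigma>) * u \<sigma> - indicator {..T} \<sigma> * k (T - \<sigma>) * u \<sigma>)"
  proof (rule integral_cong_AE)
    show "AE \<sigma> in lborel. (k (- \<sigma>) - k (T - \<sigma>)) * u \<sigma> =
        k 0 * (indicator {0..T} \<sigma> * u \<sigma>) + indicator {..0} \<sigma> * k (0 - \<sigma>) * u \<sigma> - indicator {..T} \<sigma> * k (T - \<sigma>) * u \<sigma>"
      using AE_lborel_singleton[of 0]
    proof eventually_elim
      case (elim \<sigma>)
      then consider "\<sigma> < 0" | "\<sigma> > 0" "\<sigma> \<le> T" | "\<sigma> > T" by linarith
      then show ?case
        using T k_nonpos[of "T-\<sigma>"] k_nonpos[of "-\<sigma>"] by cases (auto simp: algebra_simps)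
    qed
  qed auto
  also have "\<dots> = (LINT \<sigma>|lborel. k 0 * (indicator {0..T} \<sigma> * u \<sigma>) + indicator {..0} \<sigma> * k (0 - \<sigma>) * u \<sigma>) - memory k u T"
    unfolding memory_as_history by (rule Bochner_Integration.integral_diff) (use uT j1 j2 in auto)
  also have "(LINT \<sigma>|lborel. k 0 * (indicator {0..T} \<sigma> * u \<sigma>) + indicator {..0} \<sigma> * k (0 - \<sigma>) * u \<sigma>)
      = (LINT \<sigma>|lborel. k 0 * (indicator {0..T} \<sigma> * u \<sigma>)) + memory k u 0"
    unfolding memory_as_history[of 0] by (rule Bochner_Integration.integral_add[OF uT j2])
  finally show "(LINT t|lborel. indicator {0..T} t * memory_rate t) = memory k u T - memory k u 0" by simp
qed

theorem memory_has_density: "has_density (memory k u) memory_rate"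
  by (rule has_densityI) (use rate_integral lborel_int_HK in auto)

end

section \<open>The Lyapunov inequality for one mode\<close>

lemma young_eps: "e > 0 \<Longrightarrow> \<bar>x * y\<bar> \<le> e * x\<^sup>2 + y\<^sup>2 / (4 * e)" for e x y :: real
proof -
  assume e: "e > 0"
  have "0 \<le> (2 * e * \<bar>x\<bar> - \<bar>y\<bar>)\<^sup>2 / (4 * e)" using e by simp
  also have "\<dots> = e * x\<^sup>2 - \<bar>x * y\<bar> + y\<^sup>2 / (4 * e)"
    using e by (simp add: power2_diff abs_mult field_simps power2_eq_square)
  finally show ?thesis by simp
qed

text \<open>The rate of the Lyapunov functional at a fixed time, as an inequality between numbers:
  \<open>\<gamma> * P + W\<close> is the shear force divided by \<open>\<kappa>\<close>,
  \<open>\<Gamma>\<close> and \<open>\<Theta>\<close> are the memory energy and the dissipation, and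
  \<open>\<eta>\<close>, \<open>\<eta>1\<close>, \<open>N1\<close> belong to the auxiliary kernel on
  \<open>[0,1]\<close>. As \<open>Q\<close> has no sign, it is carried along exactly. The constants
  are fixed in the order \<open>M2\<close>, \<open>M1\<close>, \<open>N0\<close>, each absorbing
  what the earlier ones leave over.\<close>

lemma lyapunov_algebra:
  fixes \<rho>1 \<rho>2 b \<kappa> \<gamma> \<delta> k0 l :: real
  assumes pos: "\<rho>1 > 0" "\<rho>2 > 0" "b > 0" "\<kappa> > 0" "0 < \<gamma>" "\<gamma> < 1" "\<delta> > 0" "k0 \<ge> 0" "l > 0"
  obtains M1 M2 N0 m0 where "M1 > 0" "M2 > 0" "N0 > 0" "m0 > 0"
    "\<And>N \<alpha> \<beta> v P \<Gamma> W Q N1 \<Theta> D \<eta> \<eta>1 \<mu>. N \<ge> N0 \<Longrightarrow> \<mu> > 0 \<Longrightarrow> 1 / \<mu> \<le> l \<Longrightarrow> 2 * W * P = \<Gamma> + Q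
      \<Longrightarrow> W\<^sup>2 \<le> \<Gamma> \<Longrightarrow> \<eta>\<^sup>2 \<le> N1 \<Longrightarrow> \<eta>1\<^sup>2 \<le> N1 \<Longrightarrow> \<delta> * N1 \<le> \<Theta> \<Longrightarrow> D\<^sup>2 \<le> k0 * \<Theta> \<Longrightarrow>
      N * (- (\<kappa> / 2) * \<Theta>)
      + M1 * (- \<kappa> * (\<gamma> * P + W) * P + 2 * \<kappa> * (\<gamma> * P + W) * \<eta> + 2 * \<rho>1 / \<mu> * \<alpha> * \<eta>1)
      - M2 * (- \<kappa> * (\<gamma> * P + W)\<^sup>2 + \<rho>2 * \<beta>\<^sup>2 - \<rho>2 * \<beta> * D)
      + (\<kappa> * (\<gamma> * P + W) * \<eta> - \<rho>1 / (2 * \<mu>) * \<alpha> * (\<mu> * \<alpha> + \<beta>) + \<rho>1 / \<mu> * \<alpha> * \<eta>1)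
      + (\<rho>2 * \<beta>\<^sup>2 - b * v\<^sup>2 - \<kappa> * (\<gamma> * P + W) * (v / \<mu>))
      \<le> - m0 * ((\<rho>1 * \<alpha>\<^sup>2 + \<rho>2 * \<beta>\<^sup>2 + b * v\<^sup>2 + \<kappa> * \<gamma> * P\<^sup>2 + \<kappa> * \<Gamma>) / 2) - M1 * (\<kappa> / 2) * Q"
proof -
  define \<sigma> where "\<sigma> = \<kappa> * \<gamma> / 4"
  \<comment> \<open>\<open>M2 * (\<rho>2 / 2)\<close> exceeds the sum of the positive coefficients
    \<open>\<rho>2\<close> and \<open>\<rho>1 * l\<^sup>2 / 2\<close> of
    \<open>\<beta>\<^sup>2\<close> by \<open>\<rho>2\<close>.\<close>
  define M2 where "M2 = 2 * (2 * \<rho>2 + \<rho>1 * l\<^sup>2 / 2) / \<rho>2"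
  \<comment> \<open>\<open>M1 * \<sigma>\<close> pays for the multiples of
    \<open>P\<^sup>2 + \<Gamma>\<close> that come from the other three multipliers, with one unit to
    spare.\<close>
  define M1 where "M1 = (2 * \<kappa> * M2 + \<kappa> + \<kappa>\<^sup>2 * l\<^sup>2 / b + 1) / \<sigma>"
  have s: "\<sigma> > 0" using pos by (simp add: \<sigma>_def)
  have M2: "M2 > 0" using pos by (simp add: M2_def add_pos_nonneg)
  have M1: "M1 > 0" using pos M2 s by (auto simp: M1_def intro!: divide_pos_pos add_nonneg_pos)
  have M2': "M2 * (\<rho>2 / 2) = 2 * \<rho>2 + \<rho>1 * l\<^sup>2 / 2" using pos by (simp add: M2_def)
  have M1': "M1 * \<sigma> = 2 * \<kappa> * M2 + \<kappa> + \<kappa>\<^sup>2 * l\<^sup>2 / b + 1" using s by (simp add: M1_def)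
  \<comment> \<open>The first multiplier then spends only \<open>\<rho>1 / 8\<close> of the
    coefficient \<open>\<rho>1 / 4\<close> gained for \<open>\<alpha>\<^sup>2\<close>.\<close>
  define e where "e = \<rho>1 / (8 * M1)"
  have e: "e > 0" "M1 * e = \<rho>1 / 8" using M1 pos by (auto simp: e_def)
  define K1 where "K1 = 2 * \<kappa> * \<gamma> + 4 * \<kappa> + \<rho>1\<^sup>2 * l\<^sup>2 / e"
  define K where "K = M1 * K1 + \<kappa> / 2 + 2 * \<rho>1 * l\<^sup>2"
  have K: "K > 0" using pos e M1 by (auto simp: K_def K1_def intro!: add_pos_nonneg add_nonneg_pos mult_pos_pos)
  \<comment> \<open>The dissipation with this factor absorbs all multiples of \<open>N1\<close> and
    the \<open>D\<^sup>2\<close> of the second multiplier.\<close>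
  define N0 where "N0 = 2 / \<kappa> * (K / \<delta> + M2 * (\<rho>2 / 2) * k0)"
  have "K / \<delta> > 0" "M2 * (\<rho>2 / 2) * k0 \<ge> 0" using pos K M2 by auto
  then have N0: "N0 > 0" unfolding N0_def using pos(4) by (intro mult_pos_pos add_pos_nonneg) auto
  define m0 where "m0 = min (1/4) (2 / \<kappa>)"
  have m0: "m0 > 0" "m0 \<le> 1/4" "m0 * \<kappa> \<le> 2" using pos by (auto simp: m0_def min_def field_simps)
  show thesis
  proof (rule that[OF M1 M2 N0 m0(1)])
    fix N \<alpha> \<beta> v P \<Gamma> W Q N1 \<Theta> D \<eta> \<eta>1 \<mu> :: real
    assume N: "N \<ge> N0" and mu: "\<mu> > 0" "1 / \<mu> \<le> l" and Q: "2 * W * P = \<Gamma> + Q"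
      and W: "W\<^sup>2 \<le> \<Gamma>" and eta: "\<eta>\<^sup>2 \<le> N1" "\<eta>1\<^sup>2 \<le> N1" and Th: "\<delta> * N1 \<le> \<Theta>" "D\<^sup>2 \<le> k0 * \<Theta>"
    define S where "S = \<gamma> * P + W"
    define R where "R = P\<^sup>2 + \<Gamma>"
    have G0: "\<Gamma> \<ge> 0" using W zero_le_power2[of W] by linarith
    have N1: "N1 \<ge> 0" using eta zero_le_power2[of \<eta>] by linarith
    have Th0: "\<Theta> \<ge> 0" using Th(1) N1 pos by (smt (verit) mult_nonneg_nonneg)
    have g2: "\<gamma>\<^sup>2 \<le> 1" using pos by (simp add: power_le_one)
    have S2: "S\<^sup>2 \<le> 2 * R"
    proof -
      have "S\<^sup>2 \<le> 2 * (\<gamma>\<^sup>2 * P\<^sup>2) + 2 * W\<^sup>2"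
        unfolding S_def using zero_le_power2[of "\<gamma> * P - W"] by (simp add: power2_eq_square algebra_simps)
      also have "\<gamma>\<^sup>2 * P\<^sup>2 \<le> 1 * P\<^sup>2" using g2 by (intro mult_right_mono) auto
      finally show ?thesis using W by (simp add: R_def)
    qed
    have lmu: "\<bar>x / \<mu>\<bar> \<le> l * \<bar>x\<bar>" for x
      using mult_right_mono[OF mu(2), of "\<bar>x\<bar>"] mu(1) by simp
    have F1: "- \<kappa> * S * P + 2 * \<kappa> * S * \<eta> + 2 * \<rho>1 / \<mu> * \<alpha> * \<eta>1 \<le> - \<sigma> * R - \<kappa> / 2 * Q + e * \<alpha>\<^sup>2 + K1 * N1"
    proof -
      have a: "- \<kappa> * S * P = - \<kappa> * \<gamma> * P\<^sup>2 - \<kappa> / 2 * (\<Gamma> + Q)"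
        unfolding S_def Q[symmetric] by (simp add: power2_eq_square algebra_simps)
      have "\<bar>P * \<eta>\<bar> \<le> (1/4) * P\<^sup>2 + \<eta>\<^sup>2" using young_eps[of "1/4" P \<eta>] by simp
      then have "P * \<eta> \<le> (1/4) * P\<^sup>2 + N1" using eta by linarith
      then have b1: "2 * \<kappa> * \<gamma> * (P * \<eta>) \<le> 2 * \<kappa> * \<gamma> * ((1/4) * P\<^sup>2 + N1)"
        using pos by (intro mult_left_mono) auto
      have "\<bar>W * \<eta>\<bar> \<le> (1/8) * W\<^sup>2 + 2 * \<eta>\<^sup>2" using young_eps[of "1/8" W \<eta>] by simp
      then have "W * \<eta> \<le> (1/8) * \<Gamma> + 2 * N1" using eta W by linarith
      then have b2: "2 * \<kappa> * (W * \<eta>) \<le> 2 * \<kappa> * ((1/8) * \<Gamma> + 2 * N1)"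
        using pos by (intro mult_left_mono) auto
      have b3: "2 * \<rho>1 / \<mu> * \<alpha> * \<eta>1 \<le> e * \<alpha>\<^sup>2 + \<rho>1\<^sup>2 * l\<^sup>2 / e * N1"
      proof -
        have "2 * \<rho>1 / \<mu> * \<alpha> * \<eta>1 = 2 * \<rho>1 * (\<alpha> * \<eta>1) / \<mu>" by simp
        then have "2 * \<rho>1 / \<mu> * \<alpha> * \<eta>1 \<le> \<bar>2 * \<rho>1 * (\<alpha> * \<eta>1) / \<mu>\<bar>" by linarith
        also have "\<dots> \<le> l * \<bar>2 * \<rho>1 * (\<alpha> * \<eta>1)\<bar>" by (rule lmu)
        also have "\<dots> = \<bar>\<alpha> * (2 * \<rho>1 * l * \<eta>1)\<bar>" using pos by (simp add: abs_mult mult_ac)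
        also have "\<dots> \<le> e * \<alpha>\<^sup>2 + (2 * \<rho>1 * l * \<eta>1)\<^sup>2 / (4 * e)" by (rule young_eps[OF e(1)])
        also have "(2 * \<rho>1 * l * \<eta>1)\<^sup>2 / (4 * e) = \<rho>1\<^sup>2 * l\<^sup>2 / e * \<eta>1\<^sup>2" using e by (simp add: power_mult_distrib)
        also have "\<dots> \<le> \<rho>1\<^sup>2 * l\<^sup>2 / e * N1" using eta e by (intro mult_left_mono) auto
        finally show ?thesis by simp
      qed
      have c: "\<sigma> * R \<le> \<kappa> * \<gamma> / 2 * P\<^sup>2 + \<kappa> / 4 * \<Gamma>"
      proof -
        have "\<kappa> * \<gamma> * \<Gamma> \<le> \<kappa> * 1 * \<Gamma>" using pos G0 by (intro mult_right_mono mult_left_mono) auto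
        moreover have "0 \<le> \<kappa> * \<gamma> * P\<^sup>2" using pos by simp
        ultimately show ?thesis unfolding \<sigma>_def R_def by (simp add: algebra_simps)
      qed
      have "2 * \<kappa> * S * \<eta> = 2 * \<kappa> * \<gamma> * (P * \<eta>) + 2 * \<kappa> * (W * \<eta>)" unfolding S_def by (simp add: algebra_simps)
      then show ?thesis using a b1 b2 b3 c unfolding K1_def by (simp add: algebra_simps add_divide_distrib)
    qed
    have J: "- (- \<kappa> * S\<^sup>2 + \<rho>2 * \<beta>\<^sup>2 - \<rho>2 * \<beta> * D) \<le> 2 * \<kappa> * R - \<rho>2 / 2 * \<beta>\<^sup>2 + \<rho>2 / 2 * D\<^sup>2"
    proof -
      have "\<kappa> * S\<^sup>2 \<le> \<kappa> * (2 * R)" using S2 pos by (intro mult_left_mono) auto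
      moreover have "\<rho>2 * (\<beta> * D) \<le> \<rho>2 * (\<beta>\<^sup>2 / 2 + D\<^sup>2 / 2)"
        using young_eps[of "1/2" \<beta> D] pos by (intro mult_left_mono) auto
      ultimately show ?thesis by (simp add: algebra_simps)
    qed
    have I: "\<kappa> * S * \<eta> - \<rho>1 / (2 * \<mu>) * \<alpha> * (\<mu> * \<alpha> + \<beta>) + \<rho>1 / \<mu> * \<alpha> * \<eta>1
        \<le> \<kappa> * R - \<rho>1 / 4 * \<alpha>\<^sup>2 + \<rho>1 * l\<^sup>2 / 2 * \<beta>\<^sup>2 + (\<kappa> / 2 + 2 * \<rho>1 * l\<^sup>2) * N1"
    proof -
      have "S * \<eta> \<le> S\<^sup>2 / 2 + \<eta>\<^sup>2 / 2" using young_eps[of "1/2" S \<eta>] by auto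
      then have "\<kappa> * (S * \<eta>) \<le> \<kappa> * (R + N1 / 2)" using S2 eta pos by (intro mult_left_mono) auto
      moreover have "- (\<rho>1 / (2 * \<mu>) * \<alpha> * (\<mu> * \<alpha> + \<beta>)) = - \<rho>1 / 2 * \<alpha>\<^sup>2 - \<rho>1 / 2 * (\<alpha> * \<beta> / \<mu>)"
        using mu by (simp add: power2_eq_square field_simps)
      moreover have "\<bar>x * y / \<mu>\<bar> \<le> (1/8) * x\<^sup>2 + 2 * l\<^sup>2 * y\<^sup>2" for x y
      proof -
        have "\<bar>x * y / \<mu>\<bar> \<le> l * \<bar>x * y\<bar>" by (rule lmu)
        also have "\<dots> = \<bar>x * (l * y)\<bar>" using pos by (simp add: abs_mult mult_ac)
        also have "\<dots> \<le> (1/8) * x\<^sup>2 + 2 * l\<^sup>2 * y\<^sup>2" using young_eps[of "1/8" x "l * y"] by (simp add: power_mult_distrib)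
        finally show ?thesis .
      qed
      note y = this
      moreover have "- \<rho>1 / 2 * (\<alpha> * \<beta> / \<mu>) \<le> \<rho>1 / 8 * \<alpha>\<^sup>2 + \<rho>1 * l\<^sup>2 / 2 * \<beta>\<^sup>2"
      proof -
        have "\<bar>\<alpha> * \<beta> / \<mu>\<bar> \<le> l * \<bar>\<alpha> * \<beta>\<bar>" by (rule lmu)
        also have "\<dots> = \<bar>\<alpha> * (l * \<beta>)\<bar>" using pos by (simp add: abs_mult mult_ac)
        also have "\<dots> \<le> (1/4) * \<alpha>\<^sup>2 + l\<^sup>2 * \<beta>\<^sup>2" using young_eps[of "1/4" \<alpha> "l * \<beta>"] by (simp add: power_mult_distrib)
        finally have "- (\<alpha> * \<beta> / \<mu>) \<le> (1/4) * \<alpha>\<^sup>2 + l\<^sup>2 * \<beta>\<^sup>2" by linarith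
        then have "\<rho>1 / 2 * (- (\<alpha> * \<beta> / \<mu>)) \<le> \<rho>1 / 2 * ((1/4) * \<alpha>\<^sup>2 + l\<^sup>2 * \<beta>\<^sup>2)"
          using pos by (intro mult_left_mono) auto
        then show ?thesis by (simp add: algebra_simps)
      qed
      moreover have "\<rho>1 / \<mu> * \<alpha> * \<eta>1 \<le> \<rho>1 / 8 * \<alpha>\<^sup>2 + 2 * \<rho>1 * l\<^sup>2 * N1"
      proof -
        have "l\<^sup>2 * \<eta>1\<^sup>2 \<le> l\<^sup>2 * N1" using eta by (intro mult_left_mono) auto
        then have "\<alpha> * \<eta>1 / \<mu> \<le> (1/8) * \<alpha>\<^sup>2 + 2 * (l\<^sup>2 * \<eta>1\<^sup>2)" "l\<^sup>2 * \<eta>1\<^sup>2 \<le> l\<^sup>2 * N1"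
          using y[of \<alpha> \<eta>1] by linarith+
        then have "\<alpha> * \<eta>1 / \<mu> \<le> (1/8) * \<alpha>\<^sup>2 + 2 * (l\<^sup>2 * N1)" by linarith
        then have "\<rho>1 * (\<alpha> * \<eta>1 / \<mu>) \<le> \<rho>1 * ((1/8) * \<alpha>\<^sup>2 + 2 * (l\<^sup>2 * N1))"
          using pos by (intro mult_left_mono) auto
        then show ?thesis by (simp add: algebra_simps)
      qed
      ultimately show ?thesis by (simp add: algebra_simps)
    qed
    have B: "\<rho>2 * \<beta>\<^sup>2 - b * v\<^sup>2 - \<kappa> * S * (v / \<mu>) \<le> \<rho>2 * \<beta>\<^sup>2 - b / 2 * v\<^sup>2 + \<kappa>\<^sup>2 * l\<^sup>2 / b * R"
    proof -
      have "- (\<kappa> * S * (v / \<mu>)) = - (v * (\<kappa> * S) / \<mu>)" by (simp add: mult_ac)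
      then have "- (\<kappa> * S * (v / \<mu>)) \<le> \<bar>v * (\<kappa> * S) / \<mu>\<bar>"
        by (simp only: abs_ge_minus_self)
      also have "\<dots> \<le> l * \<bar>v * (\<kappa> * S)\<bar>" by (rule lmu)
      also have "\<dots> = \<bar>v * (l * \<kappa> * S)\<bar>" using pos by (simp add: abs_mult mult_ac)
      also have "\<dots> \<le> (b / 2) * v\<^sup>2 + (l * \<kappa> * S)\<^sup>2 / (4 * (b / 2))" using pos by (intro young_eps) auto
      also have "(l * \<kappa> * S)\<^sup>2 / (4 * (b / 2)) = \<kappa>\<^sup>2 * l\<^sup>2 / (2 * b) * S\<^sup>2" by (simp add: power_mult_distrib)
      also have "\<dots> \<le> \<kappa>\<^sup>2 * l\<^sup>2 / (2 * b) * (2 * R)" using S2 pos by (intro mult_left_mono) auto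
      finally show ?thesis by (simp add: algebra_simps)
    qed
    have F1': "M1 * (- \<kappa> * S * P + 2 * \<kappa> * S * \<eta> + 2 * \<rho>1 / \<mu> * \<alpha> * \<eta>1) \<le> 
        - (M1 * \<sigma>) * R - M1 * (\<kappa> / 2) * Q + (M1 * e) * \<alpha>\<^sup>2 + M1 * K1 * N1"
      using mult_left_mono[OF F1, of M1] M1 by (simp add: algebra_simps)
    have J': "- M2 * (- \<kappa> * S\<^sup>2 + \<rho>2 * \<beta>\<^sup>2 - \<rho>2 * \<beta> * D) \<le> 2 * \<kappa> * M2 * R - (M2 * (\<rho>2 / 2)) * \<beta>\<^sup>2 + M2 * (\<rho>2 / 2) * D\<^sup>2"
      using mult_left_mono[OF J, of M2] M2 by (simp add: algebra_simps)
    have T: "N * (- (\<kappa> / 2) * \<Theta>) \<le> - (K * N1) - M2 * (\<rho>2 / 2) * D\<^sup>2"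
    proof -
      have "K * N1 \<le> K / \<delta> * \<Theta>" using mult_left_mono[OF Th(1), of "K / \<delta>"] K pos by simp
      moreover have "M2 * (\<rho>2 / 2) * D\<^sup>2 \<le> M2 * (\<rho>2 / 2) * (k0 * \<Theta>)" using Th(2) M2 pos by (intro mult_left_mono) auto
      ultimately have "K * N1 + M2 * (\<rho>2 / 2) * D\<^sup>2 \<le> (K / \<delta> + M2 * (\<rho>2 / 2) * k0) * \<Theta>" by (simp add: algebra_simps)
      also have "\<dots> = \<kappa> / 2 * N0 * \<Theta>" using pos by (simp add: N0_def)
      also have "\<dots> \<le> \<kappa> / 2 * N * \<Theta>" using N Th0 pos by (intro mult_right_mono mult_left_mono) auto
      finally show ?thesis by (simp add: algebra_simps)
    qed
    have fin: "m0 * ((\<rho>1 * \<alpha>\<^sup>2 + \<rho>2 * \<beta>\<^sup>2 + b * v\<^sup>2 + \<kappa> * \<gamma> * P\<^sup>2 + \<kappa> * \<Gamma>) / 2) \<le> R + \<rho>1 / 8 * \<alpha>\<^sup>2 + \<rho>2 * \<beta>\<^sup>2 + b / 2 * v\<^sup>2"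
    proof -
      have c: "m0 * x \<le> x / 4" if "x \<ge> 0" for x using mult_right_mono[OF m0(2) that] by simp
      have "m0 * \<kappa> * \<gamma> * P\<^sup>2 \<le> 2 * 1 * P\<^sup>2" using m0 pos by (intro mult_right_mono mult_mono) auto
      moreover have "m0 * \<kappa> * \<Gamma> \<le> 2 * \<Gamma>" using m0 G0 by (intro mult_right_mono) auto
      moreover have "m0 * (\<rho>1 * \<alpha>\<^sup>2) \<le> \<rho>1 * \<alpha>\<^sup>2 / 4" "m0 * (\<rho>2 * \<beta>\<^sup>2) \<le> \<rho>2 * \<beta>\<^sup>2 / 4" "m0 * (b * v\<^sup>2) \<le> b * v\<^sup>2 / 4"
        using pos by (intro c; simp)+
      moreover have "0 \<le> \<rho>2 * \<beta>\<^sup>2" "0 \<le> b * v\<^sup>2" using pos by auto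
      ultimately show ?thesis unfolding R_def by (simp add: algebra_simps)
    qed
    show "N * (- (\<kappa> / 2) * \<Theta>)
      + M1 * (- \<kappa> * (\<gamma> * P + W) * P + 2 * \<kappa> * (\<gamma> * P + W) * \<eta> + 2 * \<rho>1 / \<mu> * \<alpha> * \<eta>1)
      - M2 * (- \<kappa> * (\<gamma> * P + W)\<^sup>2 + \<rho>2 * \<beta>\<^sup>2 - \<rho>2 * \<beta> * D)
      + (\<kappa> * (\<gamma> * P + W) * \<eta> - \<rho>1 / (2 * \<mu>) * \<alpha> * (\<mu> * \<alpha> + \<beta>) + \<rho>1 / \<mu> * \<alpha> * \<eta>1)
      + (\<rho>2 * \<beta>\<^sup>2 - b * v\<^sup>2 - \<kappa> * (\<gamma> * P + W) * (v / \<mu>))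
      \<le> - m0 * ((\<rho>1 * \<alpha>\<^sup>2 + \<rho>2 * \<beta>\<^sup>2 + b * v\<^sup>2 + \<kappa> * \<gamma> * P\<^sup>2 + \<kappa> * \<Gamma>) / 2) - M1 * (\<kappa> / 2) * Q"
    proof -
      define F0 where "F0 = - \<kappa> * S * P + 2 * \<kappa> * S * \<eta> + 2 * \<rho>1 / \<mu> * \<alpha> * \<eta>1"
      define J0 where "J0 = - \<kappa> * S\<^sup>2 + \<rho>2 * \<beta>\<^sup>2 - \<rho>2 * \<beta> * D"
      define I0 where "I0 = \<kappa> * S * \<eta> - \<rho>1 / (2 * \<mu>) * \<alpha> * (\<mu> * \<alpha> + \<beta>) + \<rho>1 / \<mu> * \<alpha> * \<eta>1"
      define B0 where "B0 = \<rho>2 * \<beta>\<^sup>2 - b * v\<^sup>2 - \<kappa> * S * (v / \<mu>)"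
      define E0 where "E0 = (\<rho>1 * \<alpha>\<^sup>2 + \<rho>2 * \<beta>\<^sup>2 + b * v\<^sup>2 + \<kappa> * \<gamma> * P\<^sup>2 + \<kappa> * \<Gamma>) / 2"
      define cR where "cR = \<kappa>\<^sup>2 * l\<^sup>2 / b"
      have 1: "M1 * F0 \<le> - (2 * \<kappa> * M2 + \<kappa> + cR + 1) * R - M1 * (\<kappa> / 2) * Q + \<rho>1 / 8 * \<alpha>\<^sup>2 + M1 * K1 * N1"
        using F1' unfolding F0_def[symmetric] M1' e(2) cR_def .
      have 2: "- M2 * J0 \<le> 2 * \<kappa> * M2 * R - (2 * \<rho>2 + \<rho>1 * l\<^sup>2 / 2) * \<beta>\<^sup>2 + M2 * (\<rho>2 / 2) * D\<^sup>2"
        using J' unfolding J0_def[symmetric] M2' .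
      note 3 = I[folded I0_def] and 4 = B[folded B0_def cR_def] and 5 = T[unfolded K_def] and 6 = fin[folded E0_def]
      have "N * (- (\<kappa> / 2) * \<Theta>) + M1 * F0 - M2 * J0 + I0 + B0 \<le> - m0 * E0 - M1 * (\<kappa> / 2) * Q"
        using 1 2 3 4 5 6 by (simp add: algebra_simps)
      then show ?thesis unfolding S_def[symmetric] F0_def J0_def I0_def B0_def E0_def .
    qed
  qed
qed

text \<open>Each multiplier is a product of two quantities controlled by the energy;
  \<open>\<eta>\<close> is one of them because of \<open>k1 * N1 \<le> \<Gamma>\<close>, and
  \<open>1 / \<mu> \<le> l\<close> keeps the constant independent of the mode. Adding more than
  \<open>C\<close> times the energy therefore gives a functional equivalent to the energy.\<close>

lemma lyapunov_bound:
  fixes \<rho>1 \<rho>2 b \<kappa> \<gamma> l M1 M2 k1 :: real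
  assumes pos: "\<rho>1 > 0" "\<rho>2 > 0" "b > 0" "\<kappa> > 0" "0 < \<gamma>" "\<gamma> < 1" "l > 0" "M1 > 0" "M2 > 0" "k1 > 0"
  obtains C where "C > 0"
    "\<And>\<alpha> \<beta> v P \<Gamma> W N1 \<eta> \<mu>. \<mu> > 0 \<Longrightarrow> 1 / \<mu> \<le> l \<Longrightarrow> W\<^sup>2 \<le> \<Gamma> \<Longrightarrow> \<eta>\<^sup>2 \<le> N1 \<Longrightarrow> k1 * N1 \<le> \<Gamma> \<Longrightarrow>
      \<bar>M1 * (\<rho>1 / \<mu> * (\<alpha> * P) - 2 * (\<rho>1 / \<mu> * (\<alpha> * \<eta>))) - M2 * (\<rho>2 * (\<beta> * (\<gamma> * P + W)) - \<rho>2 * (v * \<alpha>))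
        - \<rho>1 / \<mu> * (\<alpha> * \<eta>) + \<rho>2 / \<mu> * (\<beta> * v)\<bar>
      \<le> C * ((\<rho>1 * \<alpha>\<^sup>2 + \<rho>2 * \<beta>\<^sup>2 + b * v\<^sup>2 + \<kappa> * \<gamma> * P\<^sup>2 + \<kappa> * \<Gamma>) / 2)"
proof -
  define c where "c = min (min \<rho>1 \<rho>2) (min b (\<kappa> * \<gamma>)) / 2"
  have c: "c > 0" using pos by (simp add: c_def)
  have cle: "2 * c \<le> \<rho>1" "2 * c \<le> \<rho>2" "2 * c \<le> b" "2 * c \<le> \<kappa> * \<gamma>" "2 * c \<le> \<kappa>"
  proof -
    have "\<kappa> * \<gamma> \<le> \<kappa>" using pos by simp
    then show "2 * c \<le> \<rho>1" "2 * c \<le> \<rho>2" "2 * c \<le> b" "2 * c \<le> \<kappa> * \<gamma>" "2 * c \<le> \<kappa>"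
      unfolding c_def by linarith+
  qed
  define C0 where "C0 = M1 * \<rho>1 * l + (2 * M1 + 1) * \<rho>1 * l * (1 + 1 / k1) + 3 * M2 * \<rho>2 + \<rho>2 * l"
  have C0: "C0 > 0" using pos by (auto simp: C0_def intro!: add_pos_pos mult_pos_pos)
  show thesis
  proof (rule that[of "C0 / c"])
    show "C0 / c > 0" using C0 c by simp
    fix \<alpha> \<beta> v P \<Gamma> W N1 \<eta> \<mu> :: real
    assume mu: "\<mu> > 0" "1 / \<mu> \<le> l" and W: "W\<^sup>2 \<le> \<Gamma>" and eta: "\<eta>\<^sup>2 \<le> N1" "k1 * N1 \<le> \<Gamma>"
    define T where "T = \<alpha>\<^sup>2 + \<beta>\<^sup>2 + v\<^sup>2 + P\<^sup>2 + \<Gamma>"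
    have G0: "\<Gamma> \<ge> 0" using W zero_le_power2[of W] by linarith
    have sq: "0 \<le> \<alpha>\<^sup>2" "0 \<le> \<beta>\<^sup>2" "0 \<le> v\<^sup>2" "0 \<le> P\<^sup>2" by auto
    have T0: "T \<ge> 0" using sq G0 by (simp add: T_def)
    have yy: "\<bar>x * y\<bar> \<le> (x\<^sup>2 + y\<^sup>2) / 2" for x y :: real using young_eps[of "1/2" x y] by simp
    have e2: "\<eta>\<^sup>2 \<le> \<Gamma> / k1" 
    proof -
      have "k1 * \<eta>\<^sup>2 \<le> \<Gamma>" using mult_left_mono[OF eta(1), of k1] eta(2) pos by linarith
      then show ?thesis using pos by (simp add: field_simps)
    qed
    have t1: "\<bar>\<alpha> * P\<bar> \<le> T" "\<bar>v * \<alpha>\<bar> \<le> T" "\<bar>\<beta> * v\<bar> \<le> T" "\<bar>\<beta> * P\<bar> \<le> T" "\<bar>\<beta> * W\<bar> \<le> T"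
      using order_trans[OF yy[of \<alpha> P], of T] order_trans[OF yy[of v \<alpha>], of T] order_trans[OF yy[of \<beta> v], of T]
        order_trans[OF yy[of \<beta> P], of T] order_trans[OF yy[of \<beta> W], of T] sq G0 W by (auto simp: T_def)
    have t2: "\<bar>\<alpha> * \<eta>\<bar> \<le> (1 + 1 / k1) * T"
    proof -
      have "\<bar>\<alpha> * \<eta>\<bar> \<le> T + \<Gamma> / k1" 
      proof -
        define q where "q = \<Gamma> / k1"
        have "\<bar>\<alpha> * \<eta>\<bar> \<le> (\<alpha>\<^sup>2 + q) / 2" using yy[of \<alpha> \<eta>] e2 unfolding q_def by argo
        moreover have "q \<ge> 0" using G0 pos by (simp add: q_def)
        ultimately show ?thesis unfolding q_def[symmetric] T_def using sq G0 by argo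
      qed
      also have "\<Gamma> / k1 \<le> T / k1" using sq pos by (intro divide_right_mono) (auto simp: T_def)
      finally show ?thesis by (simp add: algebra_simps)
    qed
    have lmu: "\<bar>r / \<mu> * x\<bar> \<le> r * l * y" if "r \<ge> 0" "\<bar>x\<bar> \<le> y" for r x y
    proof -
      have "\<bar>r / \<mu> * x\<bar> = r * (1 / \<mu>) * \<bar>x\<bar>" using mu that by (simp add: abs_mult)
      also have "\<dots> \<le> r * l * y" using mu that pos by (intro mult_mono mult_left_mono) auto
      finally show ?thesis .
    qed
    have s: "\<bar>\<beta> * (\<gamma> * P + W)\<bar> \<le> 2 * T"
    proof -
      have "\<beta> * (\<gamma> * P + W) = \<gamma> * (\<beta> * P) + \<beta> * W" by (simp add: algebra_simps)
      moreover have "\<bar>\<gamma> * (\<beta> * P)\<bar> \<le> 1 * T" unfolding abs_mult[of \<gamma>] using pos t1 by (intro mult_mono) auto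
      ultimately show ?thesis using t1(5) by linarith
    qed
    have a1: "\<bar>M1 * (\<rho>1 / \<mu> * (\<alpha> * P))\<bar> \<le> M1 * (\<rho>1 * l * T)"
      unfolding abs_mult[of M1] using pos t1 by (intro mult_mono lmu) auto
    have a2: "\<bar>(2 * M1 + 1) * (\<rho>1 / \<mu> * (\<alpha> * \<eta>))\<bar> \<le> (2 * M1 + 1) * (\<rho>1 * l * ((1 + 1 / k1) * T))"
      unfolding abs_mult[of "2 * M1 + 1"] using pos t2 by (intro mult_mono lmu) auto
    have a3: "\<bar>M2 * (\<rho>2 * (\<beta> * (\<gamma> * P + W)) - \<rho>2 * (v * \<alpha>))\<bar> \<le> M2 * (\<rho>2 * (3 * T))"
    proof -
      have "\<bar>\<rho>2 * (\<beta> * (\<gamma> * P + W)) - \<rho>2 * (v * \<alpha>)\<bar> = \<rho>2 * \<bar>\<beta> * (\<gamma> * P + W) - v * \<alpha>\<bar>"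
        using pos by (simp add: abs_mult right_diff_distrib[symmetric])
      also have "\<dots> \<le> \<rho>2 * (3 * T)" using s t1(2) pos by (intro mult_left_mono) auto
      finally show ?thesis using pos by (simp add: abs_mult)
    qed
    have a4: "\<bar>\<rho>2 / \<mu> * (\<beta> * v)\<bar> \<le> \<rho>2 * l * T" using pos t1 by (intro lmu) auto
    have "\<bar>M1 * (\<rho>1 / \<mu> * (\<alpha> * P) - 2 * (\<rho>1 / \<mu> * (\<alpha> * \<eta>))) - M2 * (\<rho>2 * (\<beta> * (\<gamma> * P + W)) - \<rho>2 * (v * \<alpha>))
        - \<rho>1 / \<mu> * (\<alpha> * \<eta>) + \<rho>2 / \<mu> * (\<beta> * v)\<bar>
      = \<bar>M1 * (\<rho>1 / \<mu> * (\<alpha> * P)) - (2 * M1 + 1) * (\<rho>1 / \<mu> * (\<alpha> * \<eta>)) - M2 * (\<rho>2 * (\<beta> * (\<gamma> * P + W)) - \<rho>2 * (v * \<alpha>))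
        + \<rho>2 / \<mu> * (\<beta> * v)\<bar>" by (simp add: algebra_simps add_divide_distrib)
    also have "\<dots> \<le> M1 * (\<rho>1 * l * T) + (2 * M1 + 1) * (\<rho>1 * l * ((1 + 1 / k1) * T)) + M2 * (\<rho>2 * (3 * T)) + \<rho>2 * l * T"
      using a1 a2 a3 a4 by linarith
    also have "\<dots> = C0 * T" by (simp add: C0_def algebra_simps add_divide_distrib)
    also have "\<dots> = C0 / c * (c * T)" using c by simp
    also have "\<dots> \<le> C0 / c * ((\<rho>1 * \<alpha>\<^sup>2 + \<rho>2 * \<beta>\<^sup>2 + b * v\<^sup>2 + \<kappa> * \<gamma> * P\<^sup>2 + \<kappa> * \<Gamma>) / 2)"
    proof (rule mult_left_mono)
      have "2 * c * \<alpha>\<^sup>2 \<le> \<rho>1 * \<alpha>\<^sup>2" "2 * c * \<beta>\<^sup>2 \<le> \<rho>2 * \<beta>\<^sup>2" "2 * c * v\<^sup>2 \<le> b * v\<^sup>2" "2 * c * P\<^sup>2 \<le> \<kappa> * \<gamma> * P\<^sup>2" "2 * c * \<Gamma> \<le> \<kappa> * \<Gamma>"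
        using cle sq G0 by (auto intro!: mult_right_mono)
      then show "c * T \<le> (\<rho>1 * \<alpha>\<^sup>2 + \<rho>2 * \<beta>\<^sup>2 + b * v\<^sup>2 + \<kappa> * \<gamma> * P\<^sup>2 + \<kappa> * \<Gamma>) / 2"
        unfolding T_def by (simp add: algebra_simps)
    qed (use C0 c in auto)
    finally show "\<bar>M1 * (\<rho>1 / \<mu> * (\<alpha> * P) - 2 * (\<rho>1 / \<mu> * (\<alpha> * \<eta>))) - M2 * (\<rho>2 * (\<beta> * (\<gamma> * P + W)) - \<rho>2 * (v * \<alpha>))
        - \<rho>1 / \<mu> * (\<alpha> * \<eta>) + \<rho>2 / \<mu> * (\<beta> * v)\<bar>
      \<le> C0 / c * ((\<rho>1 * \<alpha>\<^sup>2 + \<rho>2 * \<beta>\<^sup>2 + b * v\<^sup>2 + \<kappa> * \<gamma> * P\<^sup>2 + \<kappa> * \<Gamma>) / 2)" .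
  qed
qed

text \<open>For \<open>A > 0\<close> the minimiser \<open>c = B / A\<close> is inserted. For
  \<open>A = 0\<close> the expression is affine in \<open>c\<close>, which forces
  \<open>B = 0\<close>.\<close>

lemma quadratic_discriminant:
  fixes A B C :: real
  assumes key: "\<And>c. 0 \<le> C - 2 * c * B + c\<^sup>2 * A" and A: "A \<ge> 0"
  shows "B\<^sup>2 \<le> A * C"
proof (cases "A = 0")
  case True
  have "B = 0"
  proof (rule ccontr)
    assume "B \<noteq> 0"
    then show False using key[of "(C + 1) / (2 * B)"] True by simp
  qed
  then show ?thesis using True by simp
next
  case False
  then have "A > 0" using A by simp
  then have "0 \<le> A * (C - 2 * (B / A) * B + (B / A)\<^sup>2 * A)" using key[of "B / A"] by simp
  also have "\<dots> = A * C - B\<^sup>2" using \<open>A > 0\<close> by (simp add: field_simps power2_eq_square)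
  finally show ?thesis by simp
qed

lemma weighted_cauchy_schwarz:
  fixes w f :: "'a \<Rightarrow> real"
  assumes i: "integrable M w" "integrable M (\<lambda>x. w x * f x)" "integrable M (\<lambda>x. w x * (f x)\<^sup>2)"
    and w: "\<And>x. w x \<ge> 0"
  shows "(LINT x|M. w x * f x)\<^sup>2 \<le> (LINT x|M. w x) * (LINT x|M. w x * (f x)\<^sup>2)"
proof -
  define A B C where "A = (LINT x|M. w x)" and "B = (LINT x|M. w x * f x)" and "C = (LINT x|M. w x * (f x)\<^sup>2)"
  have key: "0 \<le> C - 2 * c * B + c\<^sup>2 * A" for c
  proof -
    have "0 \<le> (LINT x|M. w x * (f x - c)\<^sup>2)" using w by (intro integral_nonneg_AE AE_I2) auto
    also have "\<dots> = (LINT x|M. w x * (f x)\<^sup>2 - 2 * c * (w x * f x) + c\<^sup>2 * w x)"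
      by (intro Bochner_Integration.integral_cong) (auto simp: power2_diff algebra_simps)
    also have "\<dots> = C - 2 * c * B + c\<^sup>2 * A"
      unfolding A_def B_def C_def using i by simp
    finally show ?thesis .
  qed
  have "A \<ge> 0" unfolding A_def using w by (intro integral_nonneg_AE AE_I2) auto
  then show ?thesis using quadratic_discriminant[OF key] unfolding A_def B_def C_def by simp
qed

text \<open>A density matters only up to null sets. This is needed because the formula for the rate
  of the energy in terms of the dissipation holds almost everywhere.\<close>

lemma has_density_AE_cong:
  assumes u: "has_density u du" and ae: "AE t in lborel. 0 \<le> t \<longrightarrow> du t = dv t"
  shows "has_density u dv"
proof -
  obtain N where N: "{t \<in> space lborel. \<not> (0 \<le> t \<longrightarrow> du t = dv t)} \<subseteq> N" "N \<in> null_sets lborel"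
    using ae by (auto elim!: AE_E simp: null_sets_def)
  have neg: "negligible N" using N(2) by (simp add: negligible_iff_null_sets null_sets_completionI)
  show ?thesis
    unfolding has_density_def
  proof (intro allI impI conjI)
    fix s t :: real assume st: "0 \<le> s" "s \<le> t"
    have eq: "dv x = du x" if "x \<in> {s..t} - N" for x
    proof (rule ccontr)
      assume "dv x \<noteq> du x"
      then have "x \<in> {t \<in> space lborel. \<not> (0 \<le> t \<longrightarrow> du t = dv t)}" using that st by auto
      then show False using N(1) that by blast
    qed
    show "dv absolutely_integrable_on {s..t}"
      using absolutely_integrable_spike[OF has_densityD(1)[OF u st] neg] eq by blast
    show "(dv has_integral u t - u s) {s..t}"
      by (rule has_integral_spike[OF neg _ has_densityD(2)[OF u st]]) (use eq in auto)
  qed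
qed

text \<open>The lower bound \<open>\<delta>\<close> for \<open>m = - g'\<close> on a unit interval
  lets the dissipation control displacements directly, although no inequality of the form
  \<open>m \<ge> c * k\<close> is assumed.\<close>

locale relaxation_kernel = memory_kernel +
  fixes \<delta> :: real
  assumes k_int: "integrable lborel (\<lambda>s. indicator {0..} s * k s)"
    and g0_pos: "0 < (LINT s|lborel. indicator {0..} s * k s)"
    and g0_less: "(LINT s|lborel. indicator {0..} s * k s) < 1"
    and \<delta>_pos: "\<delta> > 0" and m_lower: "\<And>r. r \<in> {0..1} \<Longrightarrow> \<delta> \<le> m r"
    and k_pos: "\<And>s. 0 < k s"
begin

abbreviation "g0 \<equiv> (LINT s|lborel. indicator {0..} s * k s)"

text \<open>The memory part \<open>g \<circ> u\<close> of the energy for one mode;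
  \<open>dissipation\<close> is the same expression with \<open>- g'\<close> in place of
  \<open>g\<close>.\<close>

definition shift_energy :: "(real \<Rightarrow> real) \<Rightarrow> real \<Rightarrow> real" where
  "shift_energy P t = (LINT s|lborel. indicator {0..} s * (k s * (P t - P (t - s))\<^sup>2))"

definition dissipation :: "(real \<Rightarrow> real) \<Rightarrow> real \<Rightarrow> real" where
  "dissipation P t = (LINT r|lborel. m r * (P t - P (t - r))\<^sup>2)"

end

text \<open>The indicator of \<open>[0,1]\<close> serves as a second \<open>m\<close>. Its tail
  kernel \<open>max 0 (1 - s)\<close> lives on the interval where \<open>\<delta> \<le> m\<close>,
  and its mass is 1/2, whence the term \<open>P t / 2\<close> in \<open>\<eta>\<close>.\<close>

lemma unit_memory_kernel: "memory_kernel (indicator {0..1})"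
  by standard (auto simp: emeasure_lborel_Icc_eq intro!: integrable_real_indicator)

lemma unit_tail_kernel:
  assumes "0 \<le> s" shows "tail_kernel (indicator {0..1}) s = max 0 (1 - s)"
proof -
  have "(\<lambda>r. indicator {s<..} r * indicator {0..1} r :: real) = indicator {s<..1}"
    using assms by (auto simp: indicator_def fun_eq_iff)
  then show ?thesis unfolding tail_kernel_def
    by (cases "s \<le> 1") auto
qed

lemma unit_tail_integral:
  "integrable lborel (\<lambda>s. indicator {0..} s * tail_kernel (indicator {0..1}) s)"
  "(LINT s|lborel. indicator {0..} s * tail_kernel (indicator {0..1}) s) = 1 / 2"
proof -
  have eq: "(\<lambda>s. indicator {0..} s * tail_kernel (indicator {0..1}) s) = (\<lambda>s. indicator {0..1} s *\<^sub>R (1 - s) :: real)"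
    by (auto simp: indicator_def unit_tail_kernel fun_eq_iff)
  have "has_bochner_integral lborel (\<lambda>s. indicator {0..1} s *\<^sub>R (1 - s) :: real) ((1 - 1\<^sup>2 / 2) - (0 - 0\<^sup>2/2))"
    by (rule has_bochner_integral_FTC_Icc)
      (auto simp: has_real_derivative_iff_has_vector_derivative[symmetric] intro!: derivative_eq_intros continuous_intros)
  then show "integrable lborel (\<lambda>s. indicator {0..} s * tail_kernel (indicator {0..1}) s)"
  "(LINT s|lborel. indicator {0..} s * tail_kernel (indicator {0..1}) s) = 1 / 2"
    unfolding eq by (auto simp: has_bochner_integral_iff)
qed

section \<open>The system of ordinary differential equations of one mode\<close>

locale timoshenko = relaxation_kernel +
  fixes \<rho>1 \<rho>2 b \<kappa> l :: real
  assumes pos: "\<rho>1 > 0" "\<rho>2 > 0" "b > 0" "\<kappa> > 0" "l > 0"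
    and equal_speeds: "\<kappa> * \<rho>2 = b * \<rho>1"
begin

definition mode_energy :: "(real \<Rightarrow> real) \<Rightarrow> (real \<Rightarrow> real) \<Rightarrow> (real \<Rightarrow> real) \<Rightarrow> (real \<Rightarrow> real) \<Rightarrow> real \<Rightarrow> real" where
  "mode_energy \<alpha> \<beta> v P t = (\<rho>1 * (\<alpha> t)\<^sup>2 + \<rho>2 * (\<beta> t)\<^sup>2 + b * (v t)\<^sup>2
     + \<kappa> * (1 - g0) * (P t)\<^sup>2 + \<kappa> * shift_energy P t) / 2"

end

text \<open>One Fourier mode: \<open>x\<close> and \<open>y\<close> are the coefficients of \<open>\<phi>\<close> and \<open>\<psi>\<close>, \<open>P\<close> that of
  \<open>\<phi>\<^sub>x + \<psi>\<close>, which is also given for negative times.\<close>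

locale timoshenko_mode = timoshenko +
  fixes \<mu> :: real and x y \<alpha> \<beta> P :: "real \<Rightarrow> real"
  assumes \<mu>: "\<mu> > 0" "1 / \<mu> \<le> l"
    and P_borel [measurable]: "P \<in> borel_measurable borel"
    and P_eq: "\<And>t. t \<ge> 0 \<Longrightarrow> P t = \<mu> * x t + y t"
    and P_hist: "integrable lborel (\<lambda>s. indicator {0..} s * (k s * (P (- s))\<^sup>2))"
    and dx: "\<And>t. t \<ge> 0 \<Longrightarrow> (x has_real_derivative \<alpha> t) (at t within {0..})"
    and dy: "\<And>t. t \<ge> 0 \<Longrightarrow> (y has_real_derivative \<beta> t) (at t within {0..})"
    and d\<alpha>: "\<And>t. t \<ge> 0 \<Longrightarrow> (\<alpha> has_real_derivative (- (\<kappa> / \<rho>1) * \<mu> * (P t - memory k P t))) (at t within {0..})"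
    and d\<beta>: "\<And>t. t \<ge> 0 \<Longrightarrow> (\<beta> has_real_derivative
        (- (1 / \<rho>2) * (b * \<mu>\<^sup>2 * y t + \<kappa> * (P t - memory k P t)))) (at t within {0..})"
begin

text \<open>\<open>S\<close> is the shear force divided by \<open>\<kappa>\<close> and equals
  \<open>(1 - g0) * P + W\<close>, where \<open>W\<close> integrates \<open>P t - P (t - s)\<close>
  with weight \<open>k\<close>; \<open>\<eta>\<close> does so with weight \<open>k1\<close>. The
  densities of \<open>Y\<close>, \<open>Z\<close> and \<open>memory k1 P\<close> are
  \<open>D\<close>, \<open>D2\<close> and \<open>\<eta>1\<close>.\<close>

abbreviation "Y \<equiv> memory k P"
abbreviation "Z \<equiv> memory k (\<lambda>t. (P t)\<^sup>2)"
abbreviation "D \<equiv> (\<lambda>t. LINT r|lborel. m r * (P t - P (t - r)))"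
abbreviation "D2 \<equiv> (\<lambda>t. LINT r|lborel. m r * ((P t)\<^sup>2 - (P (t - r))\<^sup>2))"
abbreviation "S \<equiv> (\<lambda>t. P t - Y t)"
abbreviation "W \<equiv> (\<lambda>t. g0 * P t - Y t)"
abbreviation "v \<equiv> (\<lambda>t. \<mu> * y t)"
abbreviation "k1 \<equiv> tail_kernel (indicator {0..1})"
abbreviation "\<eta> \<equiv> (\<lambda>t. P t / 2 - memory k1 P t)"
abbreviation "\<eta>1 \<equiv> (\<lambda>t. LINT r|lborel. indicator {0..1} r * (P t - P (t - r)))"
abbreviation "N1 \<equiv> (\<lambda>t. LINT r|lborel. indicator {0..1} r * (P t - P (t - r))\<^sup>2)"
abbreviation "\<Theta> \<equiv> dissipation P"
abbreviation "\<Gamma> \<equiv> shift_energy P"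
abbreviation "En \<equiv> mode_energy \<alpha> \<beta> v P"

lemma deriv_imp_cont:
  assumes "\<And>t. t \<ge> 0 \<Longrightarrow> (f has_real_derivative f' t) (at t within {0..})"
  shows "continuous_on {0..} f"
  using assms by (auto simp: continuous_on_eq_continuous_within intro!: DERIV_continuous)

lemma cont: "continuous_on {0..} x" "continuous_on {0..} y" "continuous_on {0..} \<alpha>" "continuous_on {0..} \<beta>"
  by (rule deriv_imp_cont, erule dx dy d\<alpha> d\<beta>)+

lemma P_cont: "continuous_on {0..} P"
proof -
  have "continuous_on {0..} (\<lambda>t. \<mu> * x t + y t)" by (intro continuous_intros cont)
  then show ?thesis by (rule continuous_on_eq) (auto simp: P_eq)
qed

lemma cont_bdd:
  assumes "continuous_on {0..} (f :: real \<Rightarrow> real)"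
  shows "\<exists>B. \<forall>t\<in>{0..T}. \<bar>f t\<bar> \<le> B"
proof -
  have "compact (f ` {0..T})"
    by (intro compact_continuous_image continuous_on_subset[OF assms]) auto
  then have "bounded (f ` {0..T})" by (rule compact_imp_bounded)
  then show ?thesis by (auto simp: bounded_iff)
qed

lemma kP_hist: "integrable lborel (\<lambda>s. indicator {0..} s * (k s * P (- s)))"
proof (rule Bochner_Integration.integrable_bound)
  show "integrable lborel (\<lambda>s. indicator {0..} s * k s + indicator {0..} s * (k s * (P (- s))\<^sup>2))"
    using k_int P_hist by simp
  show "AE s in lborel. norm (indicator {0..} s * (k s * P (- s)))
      \<le> norm (indicator {0..} s * k s + indicator {0..} s * (k s * (P (- s))\<^sup>2))"
  proof (rule AE_I2)
    fix s :: real
    have "\<bar>P (- s)\<bar> \<le> 1 + (P (- s))\<^sup>2" using young_eps[of "1" "P (-s)" 1] by simp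
    then have "k s * \<bar>P (- s)\<bar> \<le> k s * (1 + (P (- s))\<^sup>2)" by (intro mult_left_mono k_nonneg)
    then show "norm (indicator {0..} s * (k s * P (- s)))
      \<le> norm (indicator {0..} s * k s + indicator {0..} s * (k s * (P (- s))\<^sup>2))"
      using k_nonneg[of s] by (auto simp: indicator_def abs_mult algebra_simps)
  qed
qed simp

sublocale MP: memory_input m P
  by standard (use cont_bdd[OF P_cont] kP_hist in auto)

sublocale MP2: memory_input m "\<lambda>t. (P t)\<^sup>2"
proof standard
  have "continuous_on {0..} (\<lambda>t. (P t)\<^sup>2)" by (intro continuous_intros P_cont)
  then show "\<exists>B. \<forall>t\<in>{0..T}. \<bar>(P t)\<^sup>2\<bar> \<le> B" for T by (rule cont_bdd)
qed (use P_hist in auto)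

lemma k1_bounds: "0 \<le> s \<Longrightarrow> k1 s \<le> indicator {0..1} s" "0 \<le> s \<Longrightarrow> 0 \<le> k1 s"
  by (auto simp: unit_tail_kernel indicator_def)

lemma k1_weight:
  assumes "z \<ge> 0"
  shows "0 \<le> indicator {0..} s * k1 s * z" "indicator {0..} s * k1 s * z \<le> indicator {0..1} s * z"
proof -
  have "0 \<le> indicator {0..} s * k1 s" "indicator {0..} s * k1 s \<le> indicator {0..1} s"
    by (auto simp: unit_tail_kernel indicator_def)
  then show "0 \<le> indicator {0..} s * k1 s * z" "indicator {0..} s * k1 s * z \<le> indicator {0..1} s * z"
    using assms by (auto intro!: mult_right_mono mult_nonneg_nonneg)
qed

lemma indicator_le_k: "indicator {0..1} s * k 1 \<le> indicator {0..} s * k s"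
  using k_antimono[of s 1] k_nonneg[of s] by (auto simp: indicator_def)

sublocale UK: memory_kernel "indicator {0..1}" by (rule unit_memory_kernel)

text \<open>On the half-line \<open>k1 \<le> k / k 1\<close>, so a history that is integrable
  against \<open>k\<close> is integrable against \<open>k1\<close>.\<close>

sublocale MU: memory_input "indicator {0..1}" P
proof standard
  show "integrable lborel (\<lambda>s. indicator {0..} s * (k1 s * P (- s)))"
  proof (rule Bochner_Integration.integrable_bound)
    show "integrable lborel (\<lambda>s. inverse (k 1) * (indicator {0..} s * (k s * P (- s))))"
      using kP_hist by (rule integrable_mult_right)
    show "AE s in lborel. norm (indicator {0..} s * (k1 s * P (- s))) \<le> norm (inverse (k 1) * (indicator {0..} s * (k s * P (- s))))"
    proof (rule AE_I2)
      fix s :: real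
      have "k1 s \<le> inverse (k 1) * k s" if "s \<ge> 0"
      proof -
        have "k1 s * k 1 \<le> indicator {0..1} s * k 1" using k1_bounds[OF that] k_pos[of 1] by (intro mult_right_mono) auto
        also have "\<dots> \<le> k s" using indicator_le_k[of s] that by simp
        finally show ?thesis using k_pos[of 1] by (simp add: field_simps)
      qed
      then show "norm (indicator {0..} s * (k1 s * P (- s))) \<le> norm (inverse (k 1) * (indicator {0..} s * (k s * P (- s))))"
        using k1_bounds(2)[of s] k_nonneg[of s] k_pos[of 1]
        by (auto simp: indicator_def abs_mult mult.assoc[symmetric] intro!: mult_right_mono)
    qed
  qed simp
qed (use cont_bdd[OF P_cont] in auto)

lemma kshift_int:
  assumes t: "t \<ge> 0"
  shows "integrable lborel (\<lambda>s. indicator {0..} s * k s * (P t - P (t - s)))"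
    and "integrable lborel (\<lambda>s. indicator {0..} s * k s * (P t - P (t - s))\<^sup>2)"
    and "(LINT s|lborel. indicator {0..} s * k s * (P t - P (t - s))) = W t"
    and "\<Gamma> t = g0 * (P t)\<^sup>2 - 2 * P t * Y t + Z t"
proof -
  note i = k_int MP.memory_integrable[OF t] MP2.memory_integrable[OF t]
  have e1: "(\<lambda>s. indicator {0..} s * k s * (P t - P (t - s))) =
    (\<lambda>s. P t * (indicator {0..} s * k s) - indicator {0..} s * (k s * P (t - s)))" by (auto simp: algebra_simps)
  have e2: "(\<lambda>s. indicator {0..} s * k s * (P t - P (t - s))\<^sup>2) =
    (\<lambda>s. (P t)\<^sup>2 * (indicator {0..} s * k s) - 2 * P t * (indicator {0..} s * (k s * P (t - s))) + indicator {0..} s * (k s * (P (t - s))\<^sup>2))"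
    by (auto simp: algebra_simps power2_eq_square)
  show "integrable lborel (\<lambda>s. indicator {0..} s * k s * (P t - P (t - s)))"
    "integrable lborel (\<lambda>s. indicator {0..} s * k s * (P t - P (t - s))\<^sup>2)"
    unfolding e1 e2 using i by auto
  show "(LINT s|lborel. indicator {0..} s * k s * (P t - P (t - s))) = W t"
    unfolding e1 memory_def using i by simp
  have "\<Gamma> t = (LINT s|lborel. indicator {0..} s * k s * (P t - P (t - s))\<^sup>2)"
    by (simp add: shift_energy_def mult.assoc)
  also have "\<dots> = g0 * (P t)\<^sup>2 - 2 * P t * Y t + Z t"
    unfolding e2 memory_def using i by simp
  finally show "\<Gamma> t = g0 * (P t)\<^sup>2 - 2 * P t * Y t + Z t" .
qed

lemma \<Gamma>_nonneg: "\<Gamma> t \<ge> 0"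
  unfolding shift_energy_def by (intro integral_nonneg_AE AE_I2) (auto simp: k_nonneg)

lemma W_sq: assumes t: "t \<ge> 0" shows "(W t)\<^sup>2 \<le> \<Gamma> t"
proof -
  have "(W t)\<^sup>2 \<le> g0 * (LINT s|lborel. indicator {0..} s * k s * (P t - P (t - s))\<^sup>2)"
    unfolding kshift_int(3)[OF t, symmetric]
    by (rule weighted_cauchy_schwarz) (use k_int kshift_int[OF t] k_nonneg in auto)
  also have "\<dots> = g0 * \<Gamma> t" by (simp add: shift_energy_def mult.assoc)
  also have "\<dots> \<le> 1 * \<Gamma> t" using g0_less \<Gamma>_nonneg by (intro mult_right_mono) auto
  finally show ?thesis by simp
qed

text \<open>Separates from the cross term the part \<open>\<Gamma>\<close> contained in the energy.
  What remains is indefinite, but its time integral is at least minus that of the history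
  part.\<close>

lemma Q_eq: "t \<ge> 0 \<Longrightarrow> 2 * W t * P t = \<Gamma> t + (g0 * (P t)\<^sup>2 - Z t)"
  using kshift_int(4)[of t] by (simp add: algebra_simps power2_eq_square)

text \<open>Everything is compared with the integrand of \<open>\<Gamma>\<close>, using
  \<open>k 1 \<le> k\<close> on \<open>[0,1]\<close>.\<close>

lemma unit_int:
  assumes t: "t \<ge> 0"
  shows "integrable lborel (\<lambda>r. indicator {0..1} r * (P t - P (t - r))\<^sup>2)"
    and "integrable lborel (\<lambda>r. indicator {0..1} r * (P t - P (t - r)))"
    and "k 1 * N1 t \<le> \<Gamma> t"
proof -
  have le: "indicator {0..1} s * k 1 * z \<le> indicator {0..} s * k s * z" if "z \<ge> 0" for s z :: real
    using indicator_le_k that by (rule mult_right_mono)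
  show i2: "integrable lborel (\<lambda>r. indicator {0..1} r * (P t - P (t - r))\<^sup>2)"
  proof (rule Bochner_Integration.integrable_bound[OF integrable_mult_right[OF kshift_int(2)[OF t], of "inverse (k 1)"]])
    show "AE r in lborel. norm (indicator {0..1} r * (P t - P (t - r))\<^sup>2) \<le>
        norm (inverse (k 1) * (indicator {0..} r * k r * (P t - P (t - r))\<^sup>2))"
    proof (rule AE_I2)
      fix r
      define z where "z = (P t - P (t - r))\<^sup>2"
      have z: "z \<ge> 0" by (simp add: z_def)
      have "indicator {0..1} r * z = inverse (k 1) * (indicator {0..1} r * k 1 * z)" using k_pos[of 1] by simp
      also have "\<dots> \<le> inverse (k 1) * (indicator {0..} r * k r * z)" using le[OF z] k_pos[of 1] by (intro mult_left_mono) auto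
      finally have "indicator {0..1} r * z \<le> inverse (k 1) * (indicator {0..} r * k r * z)" .
      moreover have "0 \<le> indicator {0..1} r * z" using z by simp
      ultimately show "norm (indicator {0..1} r * (P t - P (t - r))\<^sup>2) \<le>
        norm (inverse (k 1) * (indicator {0..} r * k r * (P t - P (t - r))\<^sup>2))" unfolding z_def[symmetric] by simp
    qed
  qed simp
  have i0: "integrable lborel (\<lambda>r. indicator {0..1::real} r :: real)"
    by (intro integrable_real_indicator) (auto simp: emeasure_lborel_Icc_eq)
  show "integrable lborel (\<lambda>r. indicator {0..1} r * (P t - P (t - r)))"
  proof (rule Bochner_Integration.integrable_bound[OF Bochner_Integration.integrable_add[OF i0 i2]])
    show "AE r in lborel. norm (indicator {0..1} r * (P t - P (t - r))) \<le>
        norm (indicator {0..1} r + indicator {0..1} r * (P t - P (t - r))\<^sup>2)"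
    proof (rule AE_I2)
      fix r
      have "\<bar>P t - P (t - r)\<bar> \<le> 1 + (P t - P (t - r))\<^sup>2" using young_eps[of 1 "P t - P (t-r)" 1] by simp
      then show "norm (indicator {0..1} r * (P t - P (t - r))) \<le>
        norm (indicator {0..1} r + indicator {0..1} r * (P t - P (t - r))\<^sup>2)" by (auto simp: indicator_def)
    qed
  qed simp
  have "k 1 * N1 t = (LINT r|lborel. k 1 * (indicator {0..1} r * (P t - P (t - r))\<^sup>2))" by simp
  also have "\<dots> \<le> (LINT s|lborel. indicator {0..} s * k s * (P t - P (t - s))\<^sup>2)"
  proof (rule integral_mono)
    fix s show "k 1 * (indicator {0..1} s * (P t - P (t - s))\<^sup>2) \<le> indicator {0..} s * k s * (P t - P (t - s))\<^sup>2"
      using le[of "(P t - P (t - s))\<^sup>2" s] by (simp only: mult.assoc mult.left_commute zero_le_power2)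
  qed (use i2 kshift_int(2)[OF t] in auto)
  also have "\<dots> = \<Gamma> t" by (simp add: shift_energy_def mult.assoc)
  finally show "k 1 * N1 t \<le> \<Gamma> t" .
qed

lemma \<eta>1_sq: assumes t: "t \<ge> 0" shows "(\<eta>1 t)\<^sup>2 \<le> N1 t"
proof -
  have "(\<eta>1 t)\<^sup>2 \<le> (LINT r|lborel. indicator {0..1::real} r) * N1 t"
    by (rule weighted_cauchy_schwarz) (use unit_int[OF t] UK.m_int in auto)
  then show ?thesis by simp
qed

text \<open>Cauchy-Schwarz with the mass 1/2 of \<open>k1\<close>, followed by
  \<open>k1 \<le> 1\<close> on its support \<open>[0,1]\<close>.\<close>

lemma \<eta>_sq: assumes t: "t \<ge> 0" shows "(\<eta> t)\<^sup>2 \<le> N1 t"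
proof -
  have i: "integrable lborel (\<lambda>s. indicator {0..} s * k1 s * (P t - P (t - s))\<^sup>2)"
  proof (rule Bochner_Integration.integrable_bound[OF unit_int(1)[OF t]])
    show "AE r in lborel. norm (indicator {0..} r * k1 r * (P t - P (t - r))\<^sup>2) \<le> norm (indicator {0..1} r * (P t - P (t - r))\<^sup>2)"
      
    proof (rule AE_I2)
      fix r
      note w = k1_weight[of "(P t - P (t - r))\<^sup>2" r, OF zero_le_power2]
      show "norm (indicator {0..} r * k1 r * (P t - P (t - r))\<^sup>2) \<le> norm (indicator {0..1} r * (P t - P (t - r))\<^sup>2)"
        unfolding real_norm_def using w by linarith
    qed
  qed simp
  have e: "(\<lambda>s. indicator {0..} s * k1 s * (P t - P (t - s))) =
    (\<lambda>s. P t * (indicator {0..} s * k1 s) - indicator {0..} s * (k1 s * P (t - s)))" by (auto simp: algebra_simps)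
  have eta: "(LINT s|lborel. indicator {0..} s * k1 s * (P t - P (t - s))) = \<eta> t"
    unfolding e memory_def using MU.memory_integrable[OF t] unit_tail_integral by simp
  have N1: "(LINT s|lborel. indicator {0..} s * k1 s * (P t - P (t - s))\<^sup>2) \<le> N1 t"
    using k1_weight[OF zero_le_power2] by (intro integral_mono i unit_int(1)[OF t])
  have "0 \<le> N1 t" by (intro integral_nonneg_AE AE_I2) auto
  have "(\<eta> t)\<^sup>2 \<le> (1 / 2) * (LINT s|lborel. indicator {0..} s * k1 s * (P t - P (t - s))\<^sup>2)"
    unfolding eta[symmetric] unit_tail_integral(2)[symmetric]
  proof (rule weighted_cauchy_schwarz)
    show "integrable lborel (\<lambda>s. indicator {0..} s * k1 s * (P t - P (t - s)))"
      unfolding e using MU.memory_integrable[OF t] unit_tail_integral by simp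
    show "integrable lborel (\<lambda>s. indicator {0..} s * k1 s)" by (rule unit_tail_integral)
    show "0 \<le> indicator {0..} s * k1 s" for s using k1_weight(1)[of 1 s] by simp
  qed (rule i)
  then show ?thesis using N1 \<open>0 \<le> N1 t\<close> by linarith
qed

lemma AE_halfline:
  assumes "\<And>T::nat. AE t in lborel. t \<in> {0..real T} \<longrightarrow> Q t"
  shows "AE t in lborel. 0 \<le> t \<longrightarrow> Q t"
proof -
  have "AE t in lborel. \<forall>T::nat. t \<in> {0..real T} \<longrightarrow> Q t" unfolding AE_all_countable using assms by blast
  then show ?thesis
  proof eventually_elim
    case (elim t)
    obtain T :: nat where "t \<le> real T" using real_arch_simple by blast
    then show ?case using elim by auto
  qed
qed

lemma AE_good: "AE t in lborel. 0 \<le> t \<longrightarrow> integrable lborel (\<lambda>r. m r * P (t - r)) \<and> integrable lborel (\<lambda>r. m r * (P (t - r))\<^sup>2)"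
proof (rule AE_halfline)
  fix T :: nat
  show "AE t in lborel. t \<in> {0..real T} \<longrightarrow> integrable lborel (\<lambda>r. m r * P (t - r)) \<and> integrable lborel (\<lambda>r. m r * (P (t - r))\<^sup>2)"
    using MP.AE_memory_integrable[of T, OF of_nat_0_le_iff] MP2.AE_memory_integrable[of T, OF of_nat_0_le_iff]
    by eventually_elim auto
qed

text \<open>The identity \<open>(a - b)\<^sup>2 = 2 * a * (a - b) - (a\<^sup>2 - b\<^sup>2)\<close>
  expresses the dissipation through the densities of \<open>Y\<close> and \<open>Z\<close>. The two
  bounds are Cauchy-Schwarz with the mass \<open>k 0\<close> of \<open>m\<close>, and
  \<open>\<delta> \<le> m\<close> on \<open>[0,1]\<close>.\<close>

lemma AE_dissipation: "AE t in lborel. 0 \<le> t \<longrightarrow> integrable lborel (\<lambda>r. m r * (P t - P (t - r))\<^sup>2) \<and>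
   \<Theta> t = 2 * P t * D t - D2 t \<and> (D t)\<^sup>2 \<le> k 0 * \<Theta> t \<and> \<delta> * N1 t \<le> \<Theta> t"
  using AE_good
proof eventually_elim
  case (elim t)
  show ?case
  proof (intro impI)
    assume t: "0 \<le> t"
    with elim have i: "integrable lborel (\<lambda>r. m r * P (t - r))" "integrable lborel (\<lambda>r. m r * (P (t - r))\<^sup>2)" by auto
    have e1: "(\<lambda>r. m r * (P t - P (t - r))) = (\<lambda>r. P t * m r - m r * P (t - r))" by (auto simp: algebra_simps)
    have e3: "(\<lambda>r. m r * ((P t)\<^sup>2 - (P (t - r))\<^sup>2)) = (\<lambda>r. (P t)\<^sup>2 * m r - m r * (P (t - r))\<^sup>2)" by (auto simp: algebra_simps)
    have i1: "integrable lborel (\<lambda>r. m r * (P t - P (t - r)))" "integrable lborel (\<lambda>r. m r * ((P t)\<^sup>2 - (P (t - r))\<^sup>2))"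
      unfolding e1 e3 using i m_int by auto
    have e2: "(\<lambda>r. m r * (P t - P (t - r))\<^sup>2) = (\<lambda>r. 2 * P t * (m r * (P t - P (t - r))) - m r * ((P t)\<^sup>2 - (P (t - r))\<^sup>2))"
      by (auto simp: algebra_simps power2_eq_square)
    have i2: "integrable lborel (\<lambda>r. m r * (P t - P (t - r))\<^sup>2)" unfolding e2 using i1 by simp
    have "\<Theta> t = 2 * P t * D t - D2 t" unfolding dissipation_def e2 using i1 by simp
    moreover have "(D t)\<^sup>2 \<le> k 0 * \<Theta> t" unfolding k_zero dissipation_def
      by (rule weighted_cauchy_schwarz) (use m_int i1 i2 m_nonneg in auto)
    moreover have "\<delta> * N1 t \<le> \<Theta> t"
    proof -
      have "\<delta> * N1 t = (LINT r|lborel. \<delta> * (indicator {0..1} r * (P t - P (t - r))\<^sup>2))" by simp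
      also have "\<dots> \<le> \<Theta> t" unfolding dissipation_def
        using m_lower m_nonneg unit_int(1)[OF t] i2
        by (intro integral_mono) (auto simp: indicator_def intro!: mult_right_mono)
      finally show ?thesis .
    qed
    ultimately show "integrable lborel (\<lambda>r. m r * (P t - P (t - r))\<^sup>2) \<and>
      \<Theta> t = 2 * P t * D t - D2 t \<and> (D t)\<^sup>2 \<le> k 0 * \<Theta> t \<and> \<delta> * N1 t \<le> \<Theta> t" using i2 by blast
  qed
qed

section \<open>Rates of the energy and of the multipliers\<close>

lemma S_cont: "continuous_on {0..} S"
  by (intro continuous_intros P_cont has_density_continuous'[OF MP.memory_has_density])

lemma hd_x: "has_density x \<alpha>" and hd_y: "has_density y \<beta>"
  using dx dy cont by (auto intro!: has_density_C1)

lemma hd_\<alpha>: "has_density \<alpha> (\<lambda>t. - (\<kappa> / \<rho>1) * \<mu> * S t)"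
  using pos by (intro has_density_C1[OF d\<alpha>]) (auto intro!: continuous_intros S_cont)

lemma hd_\<beta>: "has_density \<beta> (\<lambda>t. - (1 / \<rho>2) * (b * \<mu>\<^sup>2 * y t + \<kappa> * S t))"
  using pos by (intro has_density_C1[OF d\<beta>]) (auto intro!: continuous_intros S_cont cont)

lemma hd_P: "has_density P (\<lambda>t. \<mu> * \<alpha> t + \<beta> t)"
  by (rule has_density_cong[OF has_density_add[OF has_density_cmult[OF hd_x, of \<mu>] hd_y]]) (auto simp: P_eq)

lemmas hd_Y = MP.memory_has_density
lemmas hd_Z = MP2.memory_has_density

lemma hd_S: "has_density S (\<lambda>t. \<mu> * \<alpha> t + \<beta> t - D t)"
  by (rule has_density_diff[OF hd_P hd_Y])

lemma hd_\<eta>: "has_density \<eta> (\<lambda>t. (\<mu> * \<alpha> t + \<beta> t) / 2 - \<eta>1 t)"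
  by (rule has_density_cong[OF has_density_diff[OF has_density_cmult[OF hd_P, of "1/2"] MU.memory_has_density]]) auto

text \<open>By \<open>kshift_int(4)\<close> the part of the energy that involves \<open>P\<close> is
  \<open>\<kappa> / 2 * (P\<^sup>2 - 2 * P * Y + Z)\<close>. Its rate contains
  \<open>\<kappa> * S\<close> times the rate of \<open>P\<close>, which cancels against the work of
  the shear force in the kinetic terms; \<open>\<kappa> * (D2 / 2 - P * D)\<close> is left.\<close>

lemma energy_density: "has_density En (\<lambda>t. - (\<kappa> / 2) * \<Theta> t)"
proof (rule has_density_AE_cong)
  note prods = has_density_mult[OF hd_\<alpha> hd_\<alpha>] has_density_mult[OF hd_\<beta> hd_\<beta>] has_density_mult[OF hd_y hd_y]
    has_density_mult[OF hd_P hd_P] has_density_mult[OF hd_P hd_Y]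
  note sumd = has_density_add[OF has_density_add[OF has_density_add[OF has_density_cmult[OF prods(1), of "\<rho>1 / 2"]
      has_density_cmult[OF prods(2), of "\<rho>2 / 2"]] has_density_cmult[OF prods(3), of "b * \<mu>\<^sup>2 / 2"]]
      has_density_cmult[OF has_density_add[OF has_density_diff[OF prods(4) has_density_cmult[OF prods(5), of 2]] hd_Z], of "\<kappa> / 2"]]
  show "has_density En (\<lambda>t. - (\<kappa> / 2) * (2 * P t * D t - D2 t))"
  proof (rule has_density_cong[OF sumd], goal_cases)
    case (1 t)
    show ?case unfolding mode_energy_def kshift_int(4)[OF 1]
      by (simp add: power2_eq_square algebra_simps)
  next
    case (2 t)
    show ?case using pos by (simp add: power2_eq_square algebra_simps)
  qed
  show "AE t in lborel. 0 \<le> t \<longrightarrow> - (\<kappa> / 2) * (2 * P t * D t - D2 t) = - (\<kappa> / 2) * \<Theta> t"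
    using AE_dissipation by eventually_elim auto
qed

text \<open>The multiplier \<open>\<rho>2 (\<beta> S - v \<alpha>)\<close> is the one that needs equal wave speeds: its two
  summands produce the terms \<open>b \<mu> v S\<close>, which cancel. Unlike \<open>W\<close>, the quantity \<open>\<eta>\<close> is
  controlled by the dissipation alone, as \<open>m\<close> is bounded below on \<open>[0,1]\<close>.\<close>

definition lyapunov :: "real \<Rightarrow> real \<Rightarrow> real \<Rightarrow> real \<Rightarrow> real" where
  "lyapunov N M1 M2 t = N * En t + (M1 * (\<rho>1 / \<mu> * (\<alpha> t * P t) - 2 * (\<rho>1 / \<mu> * (\<alpha> t * \<eta> t)))
     - M2 * (\<rho>2 * (\<beta> t * S t) - \<rho>2 * (v t * \<alpha> t))
     - \<rho>1 / \<mu> * (\<alpha> t * \<eta> t) + \<rho>2 / \<mu> * (\<beta> t * v t))"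

definition lyapunov_rate :: "real \<Rightarrow> real \<Rightarrow> real \<Rightarrow> real \<Rightarrow> real" where
  "lyapunov_rate N M1 M2 t = N * (- (\<kappa> / 2) * \<Theta> t)
      + M1 * (- \<kappa> * S t * P t + 2 * \<kappa> * S t * \<eta> t + 2 * \<rho>1 / \<mu> * \<alpha> t * \<eta>1 t)
      - M2 * (- \<kappa> * (S t)\<^sup>2 + \<rho>2 * (\<beta> t)\<^sup>2 - \<rho>2 * \<beta> t * D t)
      + (\<kappa> * S t * \<eta> t - \<rho>1 / (2 * \<mu>) * \<alpha> t * (\<mu> * \<alpha> t + \<beta> t) + \<rho>1 / \<mu> * \<alpha> t * \<eta>1 t)
      + (\<rho>2 * (\<beta> t)\<^sup>2 - b * (v t)\<^sup>2 - \<kappa> * S t * (v t / \<mu>))"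

lemma lyapunov_density: "has_density (lyapunov N M1 M2) (lyapunov_rate N M1 M2)"
proof -
  have hd_v: "has_density v (\<lambda>t. \<mu> * \<beta> t)" by (rule has_density_cmult[OF hd_y])
  have d1: "has_density (\<lambda>t. \<rho>1 / \<mu> * (\<alpha> t * P t)) (\<lambda>t. - \<kappa> * S t * P t + \<rho>1 / \<mu> * \<alpha> t * (\<mu> * \<alpha> t + \<beta> t))"
    by (rule has_density_cong[OF has_density_cmult[OF has_density_mult[OF hd_\<alpha> hd_P], of "\<rho>1 / \<mu>"]])
       (use pos \<mu> in \<open>auto simp: field_simps\<close>)
  have d2: "has_density (\<lambda>t. \<rho>1 / \<mu> * (\<alpha> t * \<eta> t))
      (\<lambda>t. - \<kappa> * S t * \<eta> t + \<rho>1 / \<mu> * \<alpha> t * ((\<mu> * \<alpha> t + \<beta> t) / 2 - \<eta>1 t))"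
    by (rule has_density_cong[OF has_density_cmult[OF has_density_mult[OF hd_\<alpha> hd_\<eta>], of "\<rho>1 / \<mu>"]])
       (use pos \<mu> in \<open>auto simp: field_simps\<close>)
  have d3: "has_density (\<lambda>t. \<rho>2 * (\<beta> t * S t))
      (\<lambda>t. \<rho>2 * \<beta> t * (\<mu> * \<alpha> t + \<beta> t - D t) - (b * \<mu>\<^sup>2 * y t + \<kappa> * S t) * S t)"
    by (rule has_density_cong[OF has_density_cmult[OF has_density_mult[OF hd_\<beta> hd_S], of "\<rho>2"]])
       (use pos \<mu> in \<open>auto simp: field_simps\<close>)
  have d4: "has_density (\<lambda>t. \<rho>2 * (v t * \<alpha> t)) (\<lambda>t. \<rho>2 * \<mu> * \<beta> t * \<alpha> t - b * \<mu> * v t * S t)"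
  proof (rule has_density_cong[OF has_density_cmult[OF has_density_mult[OF hd_v hd_\<alpha>], of "\<rho>2"]], goal_cases)
    case (2 t)
    have "\<rho>2 * (\<kappa> / \<rho>1) = b" using equal_speeds pos by (simp add: field_simps)
    then have "\<rho>2 * (v t * (- (\<kappa> / \<rho>1) * \<mu> * S t)) = - (b * \<mu> * v t * S t)"
      by (metis (no_types, opaque_lifting) mult.assoc mult.left_commute mult_minus_left mult_minus_right)
    then show ?case by (simp add: algebra_simps)
  qed auto
  have d5: "has_density (\<lambda>t. \<rho>2 / \<mu> * (\<beta> t * v t)) (\<lambda>t. \<rho>2 * (\<beta> t)\<^sup>2 - b * (v t)\<^sup>2 - \<kappa> * S t * (v t / \<mu>))"
    by (rule has_density_cong[OF has_density_cmult[OF has_density_mult[OF hd_\<beta> hd_v], of "\<rho>2 / \<mu>"]])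
       (use pos \<mu> in \<open>auto simp: field_simps power2_eq_square\<close>)
  note h = has_density_add[OF has_density_cmult[OF energy_density, of N]
     has_density_add[OF has_density_diff[OF has_density_diff[OF has_density_cmult[OF has_density_diff[OF d1 has_density_cmult[OF d2, of 2]], of M1]
       has_density_cmult[OF has_density_diff[OF d3 d4], of M2]] d2] d5]]
  show ?thesis
  proof (rule has_density_cong[OF h], goal_cases)
    case (1 t) show ?case by (simp add: lyapunov_def)
  next
    case (2 t)
    have j: "\<rho>2 * \<beta> t * (\<mu> * \<alpha> t + \<beta> t - D t) - (b * \<mu>\<^sup>2 * y t + \<kappa> * S t) * S t - (\<rho>2 * \<mu> * \<beta> t * \<alpha> t - b * \<mu> * v t * S t)
      = - \<kappa> * (S t)\<^sup>2 + \<rho>2 * (\<beta> t)\<^sup>2 - \<rho>2 * \<beta> t * D t" by (simp add: power2_eq_square algebra_simps)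
    have f: "- \<kappa> * S t * P t + r * \<alpha> t * w - 2 * (- \<kappa> * S t * e + r * \<alpha> t * (w / 2 - e1))
      = - \<kappa> * S t * P t + 2 * \<kappa> * S t * e + 2 * r * \<alpha> t * e1" for r w e e1
      by (simp add: algebra_simps)
    have i: "- (- \<kappa> * S t * e + r * \<alpha> t * (w / 2 - e1)) = \<kappa> * S t * e - r / 2 * \<alpha> t * w + r * \<alpha> t * e1" for r w e e1
      by (simp add: algebra_simps)
    have r: "2 * \<rho>1 / \<mu> = 2 * (\<rho>1 / \<mu>)" "\<rho>1 / (2 * \<mu>) = \<rho>1 / \<mu> / 2" by simp_all
    show ?case unfolding lyapunov_rate_def j f r
      using i[of "\<eta> t" "\<rho>1 / \<mu>" "\<mu> * \<alpha> t + \<beta> t" "\<eta>1 t"] by linarith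
  qed
qed

end

context timoshenko
begin

abbreviation "mode \<equiv> timoshenko_mode m \<delta> \<rho>1 \<rho>2 b \<kappa> l"

text \<open>The order of the quantifiers is the point: the constants come before the mode, because
  the algebraic bounds see it only through \<open>1 / \<mu> \<le> l\<close>. This is what permits
  summation.\<close>

theorem mode_lyapunov:
  obtains m0 M c C where "m0 > 0" "M > 0" "c > 0" "C > 0"
    "\<And>\<mu> x y \<alpha> \<beta> P. mode \<mu> x y \<alpha> \<beta> P \<Longrightarrow>
      \<exists>Ly dLy. has_density Ly dLy \<and>
        (AE t in lborel. 0 \<le> t \<longrightarrow> dLy t \<le> - m0 * mode_energy \<alpha> \<beta> (\<lambda>t. \<mu> * y t) P t
            - M * (g0 * (P t)\<^sup>2 - memory k (\<lambda>t. (P t)\<^sup>2) t)) \<and>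
        (\<forall>t\<ge>0. c * mode_energy \<alpha> \<beta> (\<lambda>t. \<mu> * y t) P t \<le> Ly t \<and> Ly t \<le> C * mode_energy \<alpha> \<beta> (\<lambda>t. \<mu> * y t) P t)"
proof -
  have g: "0 < 1 - g0" "1 - g0 < 1" using g0_pos g0_less by auto
  obtain M1 M2 N0 m0 where M: "M1 > 0" "M2 > 0" "N0 > 0" "m0 > 0" and alg:
    "\<And>N \<alpha> \<beta> v P \<Gamma> W Q N1 \<Theta> D \<eta> \<eta>1 \<mu>. N \<ge> N0 \<Longrightarrow> \<mu> > 0 \<Longrightarrow> 1 / \<mu> \<le> l \<Longrightarrow> 2 * W * P = \<Gamma> + Q
      \<Longrightarrow> W\<^sup>2 \<le> \<Gamma> \<Longrightarrow> \<eta>\<^sup>2 \<le> N1 \<Longrightarrow> \<eta>1\<^sup>2 \<le> N1 \<Longrightarrow> \<delta> * N1 \<le> \<Theta> \<Longrightarrow> D\<^sup>2 \<le> k 0 * \<Theta> \<Longrightarrow>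
      N * (- (\<kappa> / 2) * \<Theta>)
      + M1 * (- \<kappa> * ((1 - g0) * P + W) * P + 2 * \<kappa> * ((1 - g0) * P + W) * \<eta> + 2 * \<rho>1 / \<mu> * \<alpha> * \<eta>1)
      - M2 * (- \<kappa> * ((1 - g0) * P + W)\<^sup>2 + \<rho>2 * \<beta>\<^sup>2 - \<rho>2 * \<beta> * D)
      + (\<kappa> * ((1 - g0) * P + W) * \<eta> - \<rho>1 / (2 * \<mu>) * \<alpha> * (\<mu> * \<alpha> + \<beta>) + \<rho>1 / \<mu> * \<alpha> * \<eta>1)
      + (\<rho>2 * \<beta>\<^sup>2 - b * v\<^sup>2 - \<kappa> * ((1 - g0) * P + W) * (v / \<mu>))
      \<le> - m0 * ((\<rho>1 * \<alpha>\<^sup>2 + \<rho>2 * \<beta>\<^sup>2 + b * v\<^sup>2 + \<kappa> * (1 - g0) * P\<^sup>2 + \<kappa> * \<Gamma>) / 2) - M1 * (\<kappa> / 2) * Q"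
    by (rule lyapunov_algebra[OF pos(1-4) g \<delta>_pos k_nonneg[of 0] pos(5)]) (rule that)
  obtain C where C: "C > 0" and bd: 
    "\<And>\<alpha> \<beta> v P \<Gamma> W N1 \<eta> \<mu>. \<mu> > 0 \<Longrightarrow> 1 / \<mu> \<le> l \<Longrightarrow> W\<^sup>2 \<le> \<Gamma> \<Longrightarrow> \<eta>\<^sup>2 \<le> N1 \<Longrightarrow> k 1 * N1 \<le> \<Gamma> \<Longrightarrow>
      \<bar>M1 * (\<rho>1 / \<mu> * (\<alpha> * P) - 2 * (\<rho>1 / \<mu> * (\<alpha> * \<eta>))) - M2 * (\<rho>2 * (\<beta> * ((1 - g0) * P + W)) - \<rho>2 * (v * \<alpha>))
        - \<rho>1 / \<mu> * (\<alpha> * \<eta>) + \<rho>2 / \<mu> * (\<beta> * v)\<bar>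
      \<le> C * ((\<rho>1 * \<alpha>\<^sup>2 + \<rho>2 * \<beta>\<^sup>2 + b * v\<^sup>2 + \<kappa> * (1 - g0) * P\<^sup>2 + \<kappa> * \<Gamma>) / 2)"
    by (rule lyapunov_bound[OF pos(1-4) g pos(5) M(1,2) k_pos[of 1]]) (rule that)
  \<comment> \<open>The first bound lets the dissipation absorb the errors, the second one makes the
    functional equivalent to the energy.\<close>
  define N where "N = max N0 (C + 1)"
  have N: "N \<ge> N0" "N \<ge> C + 1" by (auto simp: N_def)
  show thesis
  proof (rule that[of m0 "M1 * (\<kappa> / 2)" 1 "N + C"])
    show "m0 > 0" "M1 * (\<kappa> / 2) > 0" "N + C > 0" "(1::real) > 0" using M pos C N by auto
    fix \<mu> x y \<alpha> \<beta> P
    assume "mode \<mu> x y \<alpha> \<beta> P"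
    then interpret md: timoshenko_mode m \<delta> \<rho>1 \<rho>2 b \<kappa> l \<mu> x y \<alpha> \<beta> P .
    have S: "(1 - g0) * P t + (g0 * P t - memory k P t) = P t - memory k P t" for t by (simp add: algebra_simps)
    have 1: "AE t in lborel. 0 \<le> t \<longrightarrow> md.lyapunov_rate N M1 M2 t \<le> - m0 * mode_energy \<alpha> \<beta> (\<lambda>t. \<mu> * y t) P t
            - M1 * (\<kappa> / 2) * (g0 * (P t)\<^sup>2 - memory k (\<lambda>t. (P t)\<^sup>2) t)"
      using md.AE_dissipation
    proof eventually_elim
      case (elim t)
      show ?case
      proof
        assume t: "0 \<le> t"
        with elim have D: "(md.D t)\<^sup>2 \<le> k 0 * dissipation P t" "\<delta> * md.N1 t \<le> dissipation P t" by auto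
        show "md.lyapunov_rate N M1 M2 t \<le> - m0 * mode_energy \<alpha> \<beta> (\<lambda>t. \<mu> * y t) P t
            - M1 * (\<kappa> / 2) * (g0 * (P t)\<^sup>2 - memory k (\<lambda>t. (P t)\<^sup>2) t)"
          unfolding md.lyapunov_rate_def mode_energy_def
          using alg[OF N(1) md.\<mu> md.Q_eq[OF t] md.W_sq[OF t] md.\<eta>_sq[OF t] md.\<eta>1_sq[OF t] D(2,1), of "\<alpha> t" "\<beta> t" "\<mu> * y t", unfolded S] .
      qed
    qed
    have 2: "1 * mode_energy \<alpha> \<beta> (\<lambda>t. \<mu> * y t) P t \<le> md.lyapunov N M1 M2 t
        \<and> md.lyapunov N M1 M2 t \<le> (N + C) * mode_energy \<alpha> \<beta> (\<lambda>t. \<mu> * y t) P t" if t: "t \<ge> 0" for t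
    proof -
      define E where "E = mode_energy \<alpha> \<beta> (\<lambda>t. \<mu> * y t) P t"
      have E0: "E \<ge> 0" unfolding E_def mode_energy_def using pos g md.\<Gamma>_nonneg[of t] by simp
      have "\<bar>md.lyapunov N M1 M2 t - N * E\<bar> \<le> C * E"
        unfolding md.lyapunov_def E_def mode_energy_def
        using bd[OF md.\<mu> md.W_sq[OF t] md.\<eta>_sq[OF t] md.unit_int(3)[OF t], of "\<alpha> t" "P t" "\<beta> t" "\<mu> * y t", unfolded S] by simp
      moreover have "(C + 1) * E \<le> N * E" using N(2) E0 by (rule mult_right_mono)
      ultimately show ?thesis unfolding E_def[symmetric] by (auto simp: abs_le_iff algebra_simps)
    qed
    show "\<exists>Ly dLy. has_density Ly dLy \<and>
        (AE t in lborel. 0 \<le> t \<longrightarrow> dLy t \<le> - m0 * mode_energy \<alpha> \<beta> (\<lambda>t. \<mu> * y t) P t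
            - M1 * (\<kappa> / 2) * (g0 * (P t)\<^sup>2 - memory k (\<lambda>t. (P t)\<^sup>2) t)) \<and>
        (\<forall>t\<ge>0. 1 * mode_energy \<alpha> \<beta> (\<lambda>t. \<mu> * y t) P t \<le> Ly t \<and> Ly t \<le> (N + C) * mode_energy \<alpha> \<beta> (\<lambda>t. \<mu> * y t) P t)"
      using md.lyapunov_density 1 2 by (intro exI[of _ "md.lyapunov N M1 M2"] exI[of _ "md.lyapunov_rate N M1 M2"]) auto
  qed
qed

end

section \<open>Splitting the memory into recent part, past part and tail\<close>

lemma abs_int_imp_int: "f absolutely_integrable_on S \<Longrightarrow> f integrable_on S" for f :: "real \<Rightarrow> real"
  using set_lebesgue_integral_eq_integral(1) by auto

lemma integral_mono_AE_halfline:
  fixes f h :: "real \<Rightarrow> real"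
  assumes "f absolutely_integrable_on {s..t}" "h absolutely_integrable_on {s..t}" "0 \<le> s"
    and ae: "AE x in lborel. 0 \<le> x \<longrightarrow> f x \<le> h x"
  shows "integral {s..t} f \<le> integral {s..t} h"
proof -
  have "AE x in lebesgue. 0 \<le> x \<longrightarrow> f x \<le> h x" using ae by (rule AE_completion)
  then have "AE x in lebesgue. x \<in> {s..t} \<longrightarrow> f x \<le> h x" by eventually_elim (use assms(3) in auto)
  then have "(LINT x:{s..t}|lebesgue. f x) \<le> (LINT x:{s..t}|lebesgue. h x)"
    by (intro set_integral_mono_AE assms)
  then show ?thesis using assms(1,2) by (simp add: set_lebesgue_integral_eq_integral(2))
qed

context timoshenko_mode
begin

text \<open>The share of negative times in \<open>Z t\<close>, and the contribution of one mode to
  \<open>h\<^sub>0\<close>.\<close>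

definition past :: "real \<Rightarrow> real" where
  "past t = (LINT s|lborel. indicator {0..} s * (k (t + s) * (P (- s))\<^sup>2))"

lemma \<Theta>_nonneg: "\<Theta> t \<ge> 0"
  unfolding dissipation_def by (intro integral_nonneg_AE AE_I2) (auto simp: m_nonneg)

lemma En_nonneg: "En t \<ge> 0"
  unfolding mode_energy_def using pos g0_less \<Gamma>_nonneg[of t] by simp

lemma P_sq_le: "\<kappa> * (1 - g0) / 2 * (P t)\<^sup>2 \<le> En t"
  unfolding mode_energy_def using pos \<Gamma>_nonneg[of t] by (simp add: field_simps)

lemma En_antimono:
  assumes "0 \<le> s" "s \<le> t" shows "En t \<le> En s"
proof -
  have "En t - En s = integral {s..t} (\<lambda>t. - (\<kappa> / 2) * \<Theta> t)"
    using has_densityD(4)[OF energy_density assms] by simp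
  also have "\<dots> \<le> integral {s..t} (\<lambda>t. 0)"
    by (rule integral_le) (use has_densityD(3)[OF energy_density assms] \<Theta>_nonneg pos in auto)
  finally show ?thesis by simp
qed

lemma past_int:
  assumes "t \<ge> 0" shows "integrable lborel (\<lambda>s. indicator {0..} s * (k (t + s) * (P (- s))\<^sup>2))"
proof (rule Bochner_Integration.integrable_bound[OF P_hist])
  show "AE s in lborel. norm (indicator {0..} s * (k (t + s) * (P (- s))\<^sup>2)) \<le> norm (indicator {0..} s * (k s * (P (- s))\<^sup>2))"
  proof (rule AE_I2)
    fix s :: real
    have "k (t + s) * (P (- s))\<^sup>2 \<le> k s * (P (- s))\<^sup>2" using assms k_antimono[of s "t + s"] by (intro mult_right_mono) auto
    then show "norm (indicator {0..} s * (k (t + s) * (P (- s))\<^sup>2)) \<le> norm (indicator {0..} s * (k s * (P (- s))\<^sup>2))"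
      using k_nonneg by (auto simp: indicator_def abs_mult)
  qed
qed simp

lemma past_nonneg: "past t \<ge> 0"
  unfolding past_def by (intro integral_nonneg_AE AE_I2) (auto simp: k_nonneg)

lemma past_shift:
  "past t = (LINT s|lborel. indicator {t..} s * (k s * (P (t - s))\<^sup>2))"
  "t \<ge> 0 \<Longrightarrow> integrable lborel (\<lambda>s. indicator {t..} s * (k s * (P (t - s))\<^sup>2))"
proof -
  have e: "(indicator {t..} (t + s) :: real) = indicator {0..} s" for s :: real by (auto simp: indicator_def)
  show "past t = (LINT s|lborel. indicator {t..} s * (k s * (P (t - s))\<^sup>2))"
    unfolding past_def by (subst lborel_integral_real_affine[where c=1 and t=t and f="\<lambda>s. indicator {t..} s * (k s * (P (t - s))\<^sup>2)"]) (simp_all add: e)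
  assume "t \<ge> 0"
  have "integrable lborel (\<lambda>s. indicator {t..} (t + 1 * s) * (k (t + 1 * s) * (P (t - (t + 1 * s)))\<^sup>2))"
    using past_int[OF \<open>t \<ge> 0\<close>] by (simp add: e)
  then show "integrable lborel (\<lambda>s. indicator {t..} s * (k s * (P (t - s))\<^sup>2))"
    by (subst (asm) lborel_integrable_real_affine_iff) auto
qed

lemma Z_cont: "continuous_on {0..} Z"
  by (rule has_density_continuous'[OF hd_Z])

text \<open>With the kernel \<open>\<integral>\<^sub>s\<^sup>\<infinity> k\<close> and the input \<open>P\<^sup>2\<close> cut off at time \<open>0\<close>, the memory is
  nonnegative and vanishes at time \<open>0\<close>, so its increments are nonnegative.\<close>

lemma past_abs_int: assumes T: "T \<ge> 0"
  shows "past absolutely_integrable_on {0..T}"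
    and "- integral {0..T} past \<le> integral {0..T} (\<lambda>t. g0 * (P t)\<^sup>2 - Z t)"
proof -
  define m' :: "real \<Rightarrow> real" where "m' s = indicator {0..} s * k s" for s
  define u where "u t = indicator {0..} t * (P t)\<^sup>2" for t
  interpret mk': memory_kernel m'
    by standard (use k_int k_nonneg in \<open>auto simp: m'_def[abs_def]\<close>)
  interpret mi': memory_input m' u
  proof standard
    show "u \<in> borel_measurable borel" unfolding u_def by measurable
    fix T :: real assume "T \<ge> 0"
    obtain B where "\<forall>t\<in>{0..T}. \<bar>(P t)\<^sup>2\<bar> \<le> B" using MP2.u_bdd[OF \<open>T \<ge> 0\<close>] by blast
    then show "\<exists>B. \<forall>t\<in>{0..T}. \<bar>u t\<bar> \<le> B" by (auto simp: u_def)
  next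
    have "AE s in lborel. indicator {0..} s * (tail_kernel m' s * u (- s)) = 0"
      using AE_lborel_singleton[of 0] by eventually_elim (auto simp: u_def indicator_def)
    then show "integrable lborel (\<lambda>s. indicator {0..} s * (tail_kernel m' s * u (- s)))"
      by (subst integrable_cong_AE[where g="\<lambda>_. 0"]) (auto simp: u_def)
  qed
  have [measurable]: "u \<in> borel_measurable borel" unfolding u_def by measurable
  \<comment> \<open>For \<open>s > t\<close> the cut-off removes \<open>P (t - s)\<close> from the
    difference, which amounts to adding \<open>past t\<close>. The overlap at \<open>s = t\<close>
    is a null set.\<close>
  have rate: "mi'.memory_rate t = g0 * (P t)\<^sup>2 - Z t + past t" if t: "t \<ge> 0" for t
  proof -
    note i1 = MP2.memory_integrable[OF t] and i2 = past_shift(2)[OF t]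
    have "mi'.memory_rate t = (LINT s|lborel. (P t)\<^sup>2 * (indicator {0..} s * k s) - indicator {0..} s * (k s * (P (t - s))\<^sup>2)
         + indicator {t..} s * (k s * (P (t - s))\<^sup>2))"
    proof (rule integral_cong_AE)
      show "AE s in lborel. m' s * (u t - u (t - s)) = (P t)\<^sup>2 * (indicator {0..} s * k s) - indicator {0..} s * (k s * (P (t - s))\<^sup>2)
         + indicator {t..} s * (k s * (P (t - s))\<^sup>2)"
        using AE_lborel_singleton[of t] by eventually_elim (use t in \<open>auto simp: u_def m'_def indicator_def algebra_simps\<close>)
    qed (auto simp: m'_def)
    also have "\<dots> = (P t)\<^sup>2 * g0 - Z t + past t"
      unfolding memory_def past_shift(1) using i1 i2 k_int by simp
    finally show ?thesis by simp
  qed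
  have d: "has_density (memory (tail_kernel m') u) (\<lambda>t. g0 * (P t)\<^sup>2 - Z t + past t)"
    by (rule has_density_cong[OF mi'.memory_has_density]) (auto simp: rate)
  have Qc: "continuous_on {0..} (\<lambda>t. g0 * (P t)\<^sup>2 - Z t)" by (intro continuous_intros P_cont Z_cont)
  have Qi: "(\<lambda>t. g0 * (P t)\<^sup>2 - Z t) absolutely_integrable_on {0..T}"
    by (rule absolutely_integrable_continuous_real[OF continuous_on_subset[OF Qc]]) auto
  have "(\<lambda>t. (g0 * (P t)\<^sup>2 - Z t + past t) - (g0 * (P t)\<^sup>2 - Z t)) absolutely_integrable_on {0..T}"
    using has_densityD(1)[OF d order_refl T] Qi by (rule set_integral_diff)
  then show pi: "past absolutely_integrable_on {0..T}" by simp
  have "memory (tail_kernel m') u 0 = 0"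
  proof -
    have "memory (tail_kernel m') u 0 = (LINT s::real|lborel. 0)"
      unfolding memory_def
    proof (rule integral_cong_AE)
      show "AE s in lborel. indicator {0..} s * (tail_kernel m' s * u (0 - s)) = 0"
        using AE_lborel_singleton[of 0] by eventually_elim (auto simp: u_def indicator_def)
    qed auto
    then show ?thesis by simp
  qed
  moreover have "memory (tail_kernel m') u T \<ge> 0"
    unfolding memory_def by (intro integral_nonneg_AE AE_I2) (auto simp: u_def mk'.k_nonneg)
  ultimately have "0 \<le> integral {0..T} (\<lambda>t. (g0 * (P t)\<^sup>2 - Z t) + past t)"
    using has_densityD(4)[OF d order_refl T] by simp
  also have "\<dots> = integral {0..T} (\<lambda>t. g0 * (P t)\<^sup>2 - Z t) + integral {0..T} past"
    by (rule integral_add) (use Qi pi abs_int_imp_int in auto)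
  finally show "- integral {0..T} past \<le> integral {0..T} (\<lambda>t. g0 * (P t)\<^sup>2 - Z t)" by simp
qed

section \<open>Displacements within \<open>[0,t]\<close>\<close>

definition recent :: "real \<Rightarrow> real" where
  "recent t = (LINT s|lborel. indicator {0..t} s * (k s * (P t - P (t - s))\<^sup>2))"

text \<open>The unweighted counterpart of \<open>recent\<close>: the additive constant of a tangent
  line inequality for the kernel multiplies it.\<close>

definition drift :: "real \<Rightarrow> real" where
  "drift t = (LINT s|lborel. indicator {0..t} s * (P t - P (t - s))\<^sup>2)"

lemma P_window_int:
  assumes t: "t \<ge> 0"
  shows "integrable lborel (\<lambda>s. indicator {0..t} s * (P (t - s))\<^sup>2)"
    "(LINT s|lborel. indicator {0..t} s * (P (t - s))\<^sup>2) = integral {0..t} (\<lambda>s. (P s)\<^sup>2)"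
    "integrable lborel (\<lambda>s. indicator {0..t} s * (P t - P (t - s))\<^sup>2)"
proof -
  have e: "(indicator {0..t} (t - s) :: real) = indicator {0..t} s" for s :: real by (auto simp: indicator_def)
  have i: "integrable lborel (\<lambda>s. indicator {0..t} s * (P s)\<^sup>2)" by (rule MP2.bdd_int[OF t])
  have "integrable lborel (\<lambda>s. indicator {0..t} (t + (-1) * s) * (P (t + (-1) * s))\<^sup>2)"
    using i by (subst lborel_integrable_real_affine_iff) auto
  then show i2: "integrable lborel (\<lambda>s. indicator {0..t} s * (P (t - s))\<^sup>2)" by (simp add: e)
  have "(LINT s|lborel. indicator {0..t} s * (P s)\<^sup>2) = (LINT s|lborel. indicator {0..t} s * (P (t - s))\<^sup>2)"
    by (subst lborel_integral_real_affine[where c="-1" and t=t]) (simp_all add: e)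
  then show "(LINT s|lborel. indicator {0..t} s * (P (t - s))\<^sup>2) = integral {0..t} (\<lambda>s. (P s)\<^sup>2)"
    using lborel_int_HK(2)[OF i] by simp
  have i0: "integrable lborel (\<lambda>s. indicator {0..t} s :: real)"
    by (intro integrable_real_indicator) (auto simp: emeasure_lborel_Icc_eq)
  have "integrable lborel (\<lambda>s. 2 * (P t)\<^sup>2 * indicator {0..t} s + 2 * (indicator {0..t} s * (P (t - s))\<^sup>2))"
    using i0 i2 by (intro Bochner_Integration.integrable_add integrable_mult_right)
  then show "integrable lborel (\<lambda>s. indicator {0..t} s * (P t - P (t - s))\<^sup>2)"
  proof (rule Bochner_Integration.integrable_bound)
    show "AE s in lborel. norm (indicator {0..t} s * (P t - P (t - s))\<^sup>2) \<le> norm (2 * (P t)\<^sup>2 * indicator {0..t} s + 2 * (indicator {0..t} s * (P (t - s))\<^sup>2))"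
    proof (rule AE_I2)
      fix s
      have "(P t - P (t - s))\<^sup>2 \<le> 2 * (P t)\<^sup>2 + 2 * (P (t - s))\<^sup>2"
        using zero_le_power2[of "P t + P (t - s)"] by (simp add: power2_eq_square algebra_simps)
      then show "norm (indicator {0..t} s * (P t - P (t - s))\<^sup>2) \<le> norm (2 * (P t)\<^sup>2 * indicator {0..t} s + 2 * (indicator {0..t} s * (P (t - s))\<^sup>2))"
        by (auto simp: indicator_def)
    qed
  qed simp
qed

lemma drift_le:
  assumes t: "t \<ge> 0"
  shows "drift t \<le> 2 * t * (P t)\<^sup>2 + 2 * integral {0..t} (\<lambda>s. (P s)\<^sup>2)"
proof -
  have i0: "integrable lborel (\<lambda>s. indicator {0..t} s :: real)"
    by (intro integrable_real_indicator) (auto simp: emeasure_lborel_Icc_eq)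
  have "drift t \<le> (LINT s|lborel. 2 * (P t)\<^sup>2 * indicator {0..t} s + 2 * (indicator {0..t} s * (P (t - s))\<^sup>2))"
    unfolding drift_def
  proof (rule integral_mono[OF P_window_int(3)[OF t]])
    show "integrable lborel (\<lambda>s. 2 * (P t)\<^sup>2 * indicator {0..t} s + 2 * (indicator {0..t} s * (P (t - s))\<^sup>2))"
      using i0 P_window_int(1)[OF t] by (intro Bochner_Integration.integrable_add integrable_mult_right)
    fix s
    have "(P t - P (t - s))\<^sup>2 \<le> 2 * (P t)\<^sup>2 + 2 * (P (t - s))\<^sup>2"
      using zero_le_power2[of "P t + P (t - s)"] by (simp add: power2_eq_square algebra_simps)
    then show "indicator {0..t} s * (P t - P (t - s))\<^sup>2 \<le> 2 * (P t)\<^sup>2 * indicator {0..t} s + 2 * (indicator {0..t} s * (P (t - s))\<^sup>2)"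
      by (auto simp: indicator_def)
  qed
  also have "\<dots> = 2 * (P t)\<^sup>2 * t + 2 * integral {0..t} (\<lambda>s. (P s)\<^sup>2)"
    using i0 P_window_int(1,2)[OF t] t by simp
  finally show ?thesis by (simp add: mult_ac)
qed

text \<open>Only displacements to negative times, \<open>s \<ge> t\<close>, are split by
  \<open>(a - b)\<^sup>2 \<le> 2 * a\<^sup>2 + 2 * b\<^sup>2\<close>. For \<open>s \<le> t\<close>
  the difference stays intact, because it is to be compared with the same difference in the
  dissipation.\<close>

lemma \<Gamma>_split:
  assumes t: "t \<ge> 0"
  shows "\<Gamma> t \<le> recent t + 2 * (P t)\<^sup>2 * (LINT s|lborel. indicator {0..} s * k (t + s)) + 2 * past t"
proof -
  have e: "(indicator {t..} (t + s) :: real) = indicator {0..} s" for s :: real by (auto simp: indicator_def)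
  have it: "integrable lborel (\<lambda>s. indicator {t..} s * k s)"
    by (rule Bochner_Integration.integrable_bound[OF k_int]) (use t k_nonneg in \<open>auto simp: indicator_def intro!: AE_I2\<close>)
  have tl: "(LINT s|lborel. indicator {t..} s * k s) = (LINT s|lborel. indicator {0..} s * k (t + s))"
    by (subst lborel_integral_real_affine[where c=1 and t=t]) (simp_all add: e)
  have i: "integrable lborel (\<lambda>s. indicator {0..} s * (k s * (P t - P (t - s))\<^sup>2))" using kshift_int(2)[OF t] by (simp add: mult.assoc)
  have ir: "integrable lborel (\<lambda>s. indicator {0..t} s * (k s * (P t - P (t - s))\<^sup>2))"
    by (rule Bochner_Integration.integrable_bound[OF i]) (use t k_nonneg in \<open>auto simp: indicator_def intro!: AE_I2\<close>)
  have "\<Gamma> t \<le> (LINT s|lborel. indicator {0..t} s * (k s * (P t - P (t - s))\<^sup>2) +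
     2 * (P t)\<^sup>2 * (indicator {t..} s * k s) + 2 * (indicator {t..} s * (k s * (P (t - s))\<^sup>2)))"
    unfolding shift_energy_def
  proof (rule integral_mono[OF i])
    show "integrable lborel (\<lambda>s. indicator {0..t} s * (k s * (P t - P (t - s))\<^sup>2) +
     2 * (P t)\<^sup>2 * (indicator {t..} s * k s) + 2 * (indicator {t..} s * (k s * (P (t - s))\<^sup>2)))"
      using ir it past_shift(2)[OF t] by (intro Bochner_Integration.integrable_add integrable_mult_right)
    fix s
    have "(P t - P (t - s))\<^sup>2 \<le> 2 * (P t)\<^sup>2 + 2 * (P (t - s))\<^sup>2"
      using zero_le_power2[of "P t + P (t - s)"] by (simp add: power2_eq_square algebra_simps)
    then have "k s * (P t - P (t - s))\<^sup>2 \<le> k s * (2 * (P t)\<^sup>2 + 2 * (P (t - s))\<^sup>2)" using k_nonneg by (intro mult_left_mono) auto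
    moreover have "0 \<le> k s * (P t)\<^sup>2" "0 \<le> k s * (P (t - s))\<^sup>2" using k_nonneg by auto
    ultimately show "indicator {0..} s * (k s * (P t - P (t - s))\<^sup>2) \<le> indicator {0..t} s * (k s * (P t - P (t - s))\<^sup>2) +
     2 * (P t)\<^sup>2 * (indicator {t..} s * k s) + 2 * (indicator {t..} s * (k s * (P (t - s))\<^sup>2))"
      by (auto simp: indicator_def algebra_simps)
  qed
  also have "\<dots> = recent t + 2 * (P t)\<^sup>2 * (LINT s|lborel. indicator {0..} s * k (t + s)) + 2 * past t"
    unfolding recent_def past_shift(1) tl[symmetric] using ir it past_shift(2)[OF t] by simp
  finally show ?thesis .
qed

text \<open>The tangent line inequality of the convex function \<open>H\<close> replaces Jensen's inequality.\<close>

lemma recent_tangent: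
  assumes t: "t \<ge> 0" and good: "integrable lborel (\<lambda>r. m r * (P t - P (t - r))\<^sup>2)"
    and c: "\<And>s. s \<in> {0..t} \<Longrightarrow> c * k s \<le> m s + d"
  shows "c * recent t \<le> \<Theta> t + d * drift t"
proof -
  have i: "integrable lborel (\<lambda>s. indicator {0..} s * (k s * (P t - P (t - s))\<^sup>2))" using kshift_int(2)[OF t] by (simp add: mult.assoc)
  have ir: "integrable lborel (\<lambda>s. indicator {0..t} s * (k s * (P t - P (t - s))\<^sup>2))"
    by (rule Bochner_Integration.integrable_bound[OF i]) (use t k_nonneg in \<open>auto simp: indicator_def intro!: AE_I2\<close>)
  have "c * recent t = (LINT s|lborel. c * (indicator {0..t} s * (k s * (P t - P (t - s))\<^sup>2)))"
    unfolding recent_def by simp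
  also have "\<dots> \<le> (LINT s|lborel. m s * (P t - P (t - s))\<^sup>2 + d * (indicator {0..t} s * (P t - P (t - s))\<^sup>2))"
  proof (rule integral_mono)
    show "integrable lborel (\<lambda>s. c * (indicator {0..t} s * (k s * (P t - P (t - s))\<^sup>2)))" using ir by simp
    show "integrable lborel (\<lambda>s. m s * (P t - P (t - s))\<^sup>2 + d * (indicator {0..t} s * (P t - P (t - s))\<^sup>2))"
      using good P_window_int(3)[OF t] by simp
    fix s
    show "c * (indicator {0..t} s * (k s * (P t - P (t - s))\<^sup>2)) \<le> m s * (P t - P (t - s))\<^sup>2 + d * (indicator {0..t} s * (P t - P (t - s))\<^sup>2)"
    proof (cases "s \<in> {0..t}")
      case True
      have "c * k s * (P t - P (t - s))\<^sup>2 \<le> (m s + d) * (P t - P (t - s))\<^sup>2" using c[OF True] by (intro mult_right_mono) auto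
      then show ?thesis using True by (simp add: algebra_simps)
    next
      case False
      then have "indicator {0..t} s = (0::real)" by simp
      then show ?thesis using m_nonneg[of s] by simp
    qed
  qed
  also have "\<dots> = \<Theta> t + d * drift t"
    unfolding dissipation_def drift_def using good P_window_int(3)[OF t] by simp
  finally show ?thesis .
qed

end

section \<open>Summation over the modes\<close>

lemma continuous_on_suminf_M_test:
  fixes f :: "nat \<Rightarrow> real \<Rightarrow> real"
  assumes "\<And>n. continuous_on A (f n)" "\<And>n x. x \<in> A \<Longrightarrow> \<bar>f n x\<bar> \<le> B n" "summable B"
  shows "continuous_on A (\<lambda>x. \<Sum>n. f n x)"
proof (rule uniform_limit_theorem)
  show "uniform_limit A (\<lambda>n x. \<Sum>i<n. f i x) (\<lambda>x. \<Sum>n. f n x) sequentially"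
    by (rule Weierstrass_m_test) (use assms in auto)
  show "\<forall>\<^sub>F n in sequentially. continuous_on A (\<lambda>x. \<Sum>i<n. f i x)"
    using assms(1) by (intro always_eventually allI continuous_on_sum) auto
qed simp

text \<open>Let \<open>s\<close> be the last time up to \<open>t\<close> with
  \<open>X s \<le> z s\<close>. After it \<open>X\<close> lies above \<open>z\<close>, and by
  continuity the two agree at \<open>s\<close>, so \<open>step\<close> on \<open>[s,t]\<close> gives
  a contradiction. The estimate is thus required only where \<open>X\<close> is above
  \<open>z\<close>; no uniqueness theorem for the comparison equation is involved.\<close>

lemma integral_crossing_comparison:
  fixes X z :: "real \<Rightarrow> real"
  assumes c: "continuous_on {0..} X" "continuous_on {0..} z" and init: "X 0 \<le> z 0"
    and step: "\<And>s t. 0 \<le> s \<Longrightarrow> s \<le> t \<Longrightarrow> (\<And>\<tau>. \<tau> \<in> {s..t} \<Longrightarrow> z \<tau> \<le> X \<tau>) \<Longrightarrow> X t - X s \<le> z t - z s"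
    and t: "t \<ge> 0"
  shows "X t \<le> z t"
proof (rule ccontr)
  assume neg: "\<not> X t \<le> z t"
  define K where "K = {\<tau> \<in> {0..t}. X \<tau> - z \<tau> \<in> {..0}}"
  have cd: "continuous_on {0..t} (\<lambda>\<tau>. X \<tau> - z \<tau>)"
    by (intro continuous_intros continuous_on_subset[OF c(1)] continuous_on_subset[OF c(2)]) auto
  have "closed ({0..t} \<inter> (\<lambda>\<tau>. X \<tau> - z \<tau>) -` {..0})" by (rule continuous_closed_preimage[OF cd]) auto
  moreover have "K = {0..t} \<inter> (\<lambda>\<tau>. X \<tau> - z \<tau>) -` {..0}" by (auto simp: K_def)
  ultimately have "closed K" by simp
  moreover have "bounded K" by (rule bounded_subset[of "{0..t}"]) (auto simp: K_def)
  ultimately have "compact K" by (simp add: compact_eq_bounded_closed)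
  moreover have "0 \<in> K" using init t by (simp add: K_def)
  ultimately obtain s where s: "s \<in> K" "\<And>\<tau>. \<tau> \<in> K \<Longrightarrow> \<tau> \<le> s" using compact_attains_sup[of K] by blast
  have s': "0 \<le> s" "s \<le> t" "X s \<le> z s" using s(1) by (auto simp: K_def)
  have "s < t" using s' neg by (cases "s = t") auto
  have gt: "z \<tau> < X \<tau>" if "\<tau> \<in> {s<..t}" for \<tau>
    using s(2)[of \<tau>] that s' by (force simp: K_def)
  have "z s \<le> X s"
  proof (rule ccontr)
    assume "\<not> z s \<le> X s"
    then have lt: "X s - z s < 0" by simp
    have "continuous (at s within {0..t}) (\<lambda>\<tau>. X \<tau> - z \<tau>)" using cd s' by (simp add: continuous_on_eq_continuous_within)
    then have "\<forall>\<^sub>F \<tau> in at s within {0..t}. X \<tau> - z \<tau> < 0"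
      using lt unfolding continuous_within by (rule order_tendstoD)
    then obtain d where d: "d > 0" "\<And>\<tau>. \<tau> \<in> {0..t} \<Longrightarrow> \<tau> \<noteq> s \<Longrightarrow> dist \<tau> s < d \<Longrightarrow> X \<tau> - z \<tau> < 0"
      unfolding eventually_at by blast
    define \<tau> where "\<tau> = min t (s + d / 2)"
    have "\<tau> \<in> {s<..t}" "dist \<tau> s < d" using \<open>s < t\<close> d by (auto simp: \<tau>_def dist_real_def)
    then show False using gt[of \<tau>] d(2)[of \<tau>] s' by auto
  qed
  then have "X t - X s \<le> z t - z s"
    using s' gt by (intro step) (force simp: less_eq_real_def)+
  then show False using s'(3) neg by simp
qed

text \<open>\<open>hist\<close> stands for the squared norm of the history and enters through
  Bessel's inequality for finitely many modes. \<open>H_tangent\<close> is the tangent line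
  inequality at \<open>u\<close> with the term \<open>H u \<ge> 0\<close> dropped; in this form it
  covers linear and nonlinear \<open>H\<close> alike.\<close>

locale timoshenko_family = timoshenko +
  fixes \<mu> :: "nat \<Rightarrow> real" and x y \<alpha> \<beta> P :: "nat \<Rightarrow> real \<Rightarrow> real" and hist \<xi> H H' :: "real \<Rightarrow> real"
  assumes modes: "\<And>n. timoshenko_mode m \<delta> \<rho>1 \<rho>2 b \<kappa> l (\<mu> n) (x n) (y n) (\<alpha> n) (\<beta> n) (P n)"
    and init: "summable (\<lambda>n. mode_energy (\<alpha> n) (\<beta> n) (\<lambda>t. \<mu> n * y n t) (P n) 0)"
    and hist_borel [measurable]: "hist \<in> borel_measurable borel"
    and hist_nonneg: "\<And>s. 0 \<le> hist s"
    and hist_int: "integrable lborel (\<lambda>s. indicator {0..} s * (k s * hist s))"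
    and hist_bessel: "\<And>N. AE s in lborel. 0 \<le> s \<longrightarrow> (\<Sum>n<N. (P n (- s))\<^sup>2) \<le> hist s"
    and \<xi>_pos: "\<And>t. t \<ge> 0 \<Longrightarrow> \<xi> t > 0"
    and \<xi>_antimono: "\<And>s t. 0 \<le> s \<Longrightarrow> s \<le> t \<Longrightarrow> \<xi> t \<le> \<xi> s"
    and \<xi>_cont: "continuous_on {0..} \<xi>"
    and H_tangent: "\<And>u z. 0 \<le> u \<Longrightarrow> 0 < z \<Longrightarrow> H' u * z \<le> H z + u * H' u"
    and H_nonneg: "\<And>z. 0 \<le> z \<Longrightarrow> 0 \<le> H z"
    and H'_nonneg: "\<And>u. 0 \<le> u \<Longrightarrow> 0 \<le> H' u"
    and H'_mono: "\<And>u z. 0 \<le> u \<Longrightarrow> u \<le> z \<Longrightarrow> H' u \<le> H' z"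
    and H'_cont: "continuous_on {0..} H'"
    and kernel_decay: "\<And>r. r \<ge> 0 \<Longrightarrow> \<xi> r * H (k r) \<le> m r"
begin

sublocale md: timoshenko_mode m \<delta> \<rho>1 \<rho>2 b \<kappa> l "\<mu> n" "x n" "y n" "\<alpha> n" "\<beta> n" "P n" for n
  by (rule modes)

section \<open>Total energy and history terms\<close>

definition E :: "nat \<Rightarrow> real \<Rightarrow> real" where
  "E n = mode_energy (\<alpha> n) (\<beta> n) (\<lambda>t. \<mu> n * y n t) (P n)"

definition Etot :: "real \<Rightarrow> real" where "Etot t = (\<Sum>n. E n t)"

text \<open>\<open>hist_tail\<close> and \<open>growth\<close> are \<open>h0\<close> and
  \<open>f_hist\<close>, written with the Borel measurable \<open>hist\<close>.\<close>

definition hist_tail :: "real \<Rightarrow> real" where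
  "hist_tail t = (LINT s|lborel. indicator {0..} s * (k (t + s) * (1 + hist s)))"

definition growth :: "real \<Rightarrow> real" where "growth t = 1 + integral {0..t} hist_tail"

lemma E_nonneg: "0 \<le> E n t" unfolding E_def by (rule md.En_nonneg)
lemma E_antimono: "0 \<le> s \<Longrightarrow> s \<le> t \<Longrightarrow> E n t \<le> E n s" unfolding E_def by (rule md.En_antimono)

lemma E_cont: "continuous_on {0..} (E n)"
  unfolding E_def by (rule has_density_continuous'[OF md.energy_density])

lemma E_le: "t \<ge> 0 \<Longrightarrow> E n t \<le> E n 0" by (rule E_antimono) auto

lemma summ0: "summable (\<lambda>n. E n 0)" using init by (simp add: E_def)

lemma summ: "t \<ge> 0 \<Longrightarrow> summable (\<lambda>n. E n t)"
  by (rule summable_comparison_test'[OF summ0, of 0]) (simp add: E_nonneg E_le)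

lemma Etot_nonneg: "t \<ge> 0 \<Longrightarrow> 0 \<le> Etot t"
  unfolding Etot_def by (rule suminf_nonneg[OF summ]) (simp_all add: E_nonneg)

lemma Etot_antimono: "0 \<le> s \<Longrightarrow> s \<le> t \<Longrightarrow> Etot t \<le> Etot s"
  unfolding Etot_def by (rule suminf_le) (auto intro: E_antimono summ)

lemma Etot_cont: "continuous_on {0..} Etot"
  unfolding Etot_def[abs_def]
  by (rule continuous_on_suminf_M_test[OF E_cont _ summ0]) (simp add: E_nonneg E_le)

lemma partial_le: "t \<ge> 0 \<Longrightarrow> (\<Sum>n<N. E n t) \<le> Etot t"
  unfolding Etot_def by (rule sum_le_suminf[OF summ]) (auto simp: E_nonneg)

definition rest :: "nat \<Rightarrow> real" where "rest N = Etot 0 - (\<Sum>n<N. E n 0)"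

lemma rest_tendsto: "rest \<longlonglongrightarrow> 0"
proof -
  have "(\<lambda>N. Etot 0 - (\<Sum>n<N. E n 0)) \<longlonglongrightarrow> Etot 0 - Etot 0"
    unfolding Etot_def by (intro tendsto_intros summable_LIMSEQ summ0)
  then show ?thesis by (simp add: rest_def[abs_def])
qed

text \<open>Every modal energy is nonincreasing, so the tail of the series at time \<open>t\<close>
  is at most its tail at time 0. The truncation error is therefore uniform in time.\<close>

lemma rest_bound:
  assumes "t \<ge> 0" shows "Etot t \<le> (\<Sum>n<N. E n t) + rest N"
proof -
  have e: "(\<Sum>n. E (n + N) t) = Etot t - (\<Sum>n<N. E n t)" if "t \<ge> 0" for t
    unfolding Etot_def by (rule suminf_minus_initial_segment[OF summ[OF that]])
  have "(\<Sum>n. E (n + N) t) \<le> (\<Sum>n. E (n + N) 0)"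
    using assms by (intro suminf_le E_le) (auto intro: summable_ignore_initial_segment summ summ0 assms)
  then show ?thesis using e[OF assms] e[of 0] by (simp add: rest_def)
qed

lemma hist_tail_int:
  assumes "t \<ge> 0"
  shows "integrable lborel (\<lambda>s. indicator {0..} s * k (t + s))"
    "integrable lborel (\<lambda>s. indicator {0..} s * (k (t + s) * hist s))"
    "integrable lborel (\<lambda>s. indicator {0..} s * (k (t + s) * (1 + hist s)))"
proof -
  have kle: "k (t + s) \<le> k s" for s using assms by (intro k_antimono) auto
  show 1: "integrable lborel (\<lambda>s. indicator {0..} s * k (t + s))"
    by (rule Bochner_Integration.integrable_bound[OF k_int]) (use kle k_nonneg in \<open>auto simp: indicator_def intro!: AE_I2\<close>)
  show 2: "integrable lborel (\<lambda>s. indicator {0..} s * (k (t + s) * hist s))"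
    by (rule Bochner_Integration.integrable_bound[OF hist_int])
       (use kle k_nonneg hist_nonneg in \<open>auto simp: indicator_def abs_mult intro!: AE_I2 mult_right_mono\<close>)
  have "integrable lborel (\<lambda>s. indicator {0..} s * k (t + s) + indicator {0..} s * (k (t + s) * hist s))"
    using 1 2 by simp
  then show "integrable lborel (\<lambda>s. indicator {0..} s * (k (t + s) * (1 + hist s)))"
    by (simp add: algebra_simps)
qed

lemma hist_tail_split:
  assumes "t \<ge> 0"
  shows "hist_tail t = (LINT s|lborel. indicator {0..} s * k (t + s)) + (LINT s|lborel. indicator {0..} s * (k (t + s) * hist s))"
proof -
  have "hist_tail t = (LINT s|lborel. indicator {0..} s * k (t + s) + indicator {0..} s * (k (t + s) * hist s))"
    unfolding hist_tail_def by (simp add: algebra_simps)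
  also have "\<dots> = (LINT s|lborel. indicator {0..} s * k (t + s)) + (LINT s|lborel. indicator {0..} s * (k (t + s) * hist s))"
    by (rule Bochner_Integration.integral_add) (use hist_tail_int[OF assms] in auto)
  finally show ?thesis .
qed

lemma hist_tail_nonneg: "0 \<le> hist_tail t"
  unfolding hist_tail_def using k_nonneg hist_nonneg by (intro integral_nonneg_AE AE_I2) auto

lemma hist_tail_le: "t \<ge> 0 \<Longrightarrow> hist_tail t \<le> hist_tail 0"
  unfolding hist_tail_def
  by (intro integral_mono hist_tail_int) (auto simp: indicator_def hist_nonneg intro!: mult_right_mono k_antimono)

lemma hist_tail_abs_int: assumes s: "0 \<le> s" shows "hist_tail absolutely_integrable_on {s..t}"
proof -
  have [measurable]: "hist_tail \<in> borel_measurable borel" unfolding hist_tail_def[abs_def] by measurable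
  have "integrable lborel (\<lambda>\<tau>. indicator {s..t} \<tau> * hist_tail 0)"
    by (intro integrable_mult_left integrable_real_indicator) (auto simp: emeasure_lborel_Icc_eq)
  then have "integrable lborel (\<lambda>\<tau>. indicator {s..t} \<tau> * hist_tail \<tau>)"
    by (rule Bochner_Integration.integrable_bound) (use s hist_tail_nonneg hist_tail_le in \<open>auto simp: indicator_def intro!: AE_I2\<close>)
  then show ?thesis by (rule lborel_int_HK)
qed

lemma growth_ge_1: "1 \<le> growth t"
proof -
  have "0 \<le> integral {0..t} hist_tail"
    by (rule Henstock_Kurzweil_Integration.integral_nonneg) (use abs_int_imp_int[OF hist_tail_abs_int] hist_tail_nonneg in auto)
  then show ?thesis by (simp add: growth_def)
qed

lemma growth_mono: assumes "0 \<le> s" "s \<le> t" shows "growth s \<le> growth t"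
proof -
  have "0 \<le> integral {s..t} hist_tail"
    by (rule Henstock_Kurzweil_Integration.integral_nonneg) (use abs_int_imp_int[OF hist_tail_abs_int] hist_tail_nonneg assms in auto)
  moreover have "integral {0..t} hist_tail - integral {0..s} hist_tail = integral {s..t} hist_tail"
    by (rule indefinite_integral_split[OF assms order_refl]) (use abs_int_imp_int[OF hist_tail_abs_int] in auto)
  ultimately show ?thesis by (simp add: growth_def)
qed

lemma growth_cont: "continuous_on {0..} growth"
proof (rule continuous_on_halfline)
  fix T :: real
  show "continuous_on {0..T} growth"
    unfolding growth_def[abs_def]
    by (intro continuous_intros indefinite_integral_continuous_1 abs_int_imp_int hist_tail_abs_int) auto
qed

abbreviation "tail_mass t \<equiv> (LINT s|lborel. indicator {0..} s * k (t + s))"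

lemma tail_mass_nonneg: "0 \<le> tail_mass t"
  using k_nonneg by (intro integral_nonneg_AE AE_I2) auto

lemma past_sum_le:
  assumes t: "t \<ge> 0" shows "tail_mass t + (\<Sum>n<N. md.past n t) \<le> hist_tail t"
proof -
  have "(\<Sum>n<N. md.past n t) = (LINT s|lborel. (\<Sum>n<N. indicator {0..} s * (k (t + s) * (P n (- s))\<^sup>2)))"
    unfolding md.past_def by (rule Bochner_Integration.integral_sum[symmetric]) (rule md.past_int[OF t])
  also have "\<dots> \<le> (LINT s|lborel. indicator {0..} s * (k (t + s) * hist s))"
  proof (rule integral_mono_AE)
    show "integrable lborel (\<lambda>s. \<Sum>n<N. indicator {0..} s * (k (t + s) * (P n (- s))\<^sup>2))"
      by (rule Bochner_Integration.integrable_sum) (rule md.past_int[OF t])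
    show "integrable lborel (\<lambda>s. indicator {0..} s * (k (t + s) * hist s))" by (rule hist_tail_int[OF t])
    show "AE s in lborel. (\<Sum>n<N. indicator {0..} s * (k (t + s) * (P n (- s))\<^sup>2)) \<le> indicator {0..} s * (k (t + s) * hist s)"
      using hist_bessel[of N]
    proof eventually_elim
      case (elim s)
      have "(\<Sum>n<N. indicator {0..} s * (k (t + s) * (P n (- s))\<^sup>2)) = indicator {0..} s * (k (t + s) * (\<Sum>n<N. (P n (- s))\<^sup>2))"
        by (simp add: sum_distrib_left)
      also have "\<dots> \<le> indicator {0..} s * (k (t + s) * hist s)"
        using elim k_nonneg by (auto simp: indicator_def intro!: mult_left_mono)
      finally show ?case .
    qed
  qed
  finally show ?thesis unfolding hist_tail_split[OF t] by simp
qed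

end

locale timoshenko_lyapunov = timoshenko_family +
  fixes m0 M cL CL :: real and Ly dLy :: "nat \<Rightarrow> real \<Rightarrow> real"
  assumes cpos: "m0 > 0" "M > 0" "cL > 0" "CL > 0"
    and Ly_density: "\<And>n. has_density (Ly n) (dLy n)"
    and Ly_rate: "\<And>n. AE t in lborel. 0 \<le> t \<longrightarrow> dLy n t \<le> - m0 * E n t
            - M * (g0 * (P n t)\<^sup>2 - memory k (\<lambda>t. (P n t)\<^sup>2) t)"
    and Ly_lower: "\<And>n t. t \<ge> 0 \<Longrightarrow> cL * E n t \<le> Ly n t"
    and Ly_upper: "\<And>n t. t \<ge> 0 \<Longrightarrow> Ly n t \<le> CL * E n t"
begin

section \<open>Time integral of the energy\<close>

lemma Ly_nonneg: "t \<ge> 0 \<Longrightarrow> 0 \<le> Ly n t"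
  by (rule order_trans[OF mult_nonneg_nonneg[OF less_imp_le[OF cpos(3)] E_nonneg[of n t]] Ly_lower])

lemma int_on: "continuous_on {0..} f \<Longrightarrow> 0 \<le> s \<Longrightarrow> f absolutely_integrable_on {s..t}" for f :: "real \<Rightarrow> real"
  by (rule absolutely_integrable_continuous_real, erule continuous_on_subset) auto

text \<open>The rate is integrated with \<open>Ly \<ge> 0\<close> at the right end and
  \<open>Ly \<le> CL * E\<close> at the left end. \<open>past_abs_int\<close> bounds the integral of
  the indefinite term by that of \<open>past\<close>.\<close>

lemma mode_energy_integral:
  assumes T: "T \<ge> 0"
  shows "m0 * integral {0..T} (E n) \<le> CL * E n 0 + M * integral {0..T} (md.past n)"
proof -
  let ?Q = "\<lambda>t. g0 * (P n t)\<^sup>2 - memory k (\<lambda>t. (P n t)\<^sup>2) t"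
  have cQ: "continuous_on {0..} ?Q" by (intro continuous_intros md.P_cont md.Z_cont)
  have iE: "E n absolutely_integrable_on {0..T}" by (rule int_on[OF E_cont order_refl])
  have iQ: "?Q absolutely_integrable_on {0..T}" by (rule int_on[OF cQ order_refl])
  have "Ly n T - Ly n 0 = integral {0..T} (dLy n)" using has_densityD(4)[OF Ly_density order_refl T] by simp
  also have "\<dots> \<le> integral {0..T} (\<lambda>t. - m0 * E n t - M * ?Q t)"
  proof (rule integral_mono_AE_halfline[OF _ _ order_refl Ly_rate])
    show "dLy n absolutely_integrable_on {0..T}" by (rule has_densityD(1)[OF Ly_density order_refl T])
    show "(\<lambda>t. - m0 * E n t - M * ?Q t) absolutely_integrable_on {0..T}"
      by (rule int_on) (auto intro!: continuous_intros E_cont cQ)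
  qed
  also have "\<dots> = - m0 * integral {0..T} (E n) - M * integral {0..T} ?Q"
    using abs_int_imp_int[OF iE] abs_int_imp_int[OF iQ]
    by (subst integral_diff) (auto intro!: integrable_neg integrable_on_mult_right)
  also have "\<dots> \<le> - m0 * integral {0..T} (E n) + M * integral {0..T} (md.past n)"
    using mult_left_mono[OF md.past_abs_int(2)[OF T, of n], of M] cpos by simp
  finally show ?thesis using Ly_nonneg[OF T, of n] Ly_upper[of 0 n] by simp
qed

text \<open>Finitely many modes are summed and the others contribute at most
  \<open>rest N * T\<close> to the integral, which vanishes as \<open>N\<close> grows while
  \<open>T\<close> is fixed.\<close>

lemma energy_integral:
  assumes T: "T \<ge> 0"
  shows "m0 * integral {0..T} Etot \<le> CL * Etot 0 + M * integral {0..T} hist_tail"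
proof (rule LIMSEQ_le_const)
  have "(\<lambda>N. CL * Etot 0 + M * integral {0..T} hist_tail + m0 * (rest N * T)) \<longlonglongrightarrow> CL * Etot 0 + M * integral {0..T} hist_tail + m0 * (0 * T)"
    by (intro tendsto_intros rest_tendsto)
  then show "(\<lambda>N. CL * Etot 0 + M * integral {0..T} hist_tail + m0 * (rest N * T)) \<longlonglongrightarrow> CL * Etot 0 + M * integral {0..T} hist_tail" by simp
  have iE: "E n integrable_on {0..T}" for n by (rule abs_int_imp_int[OF int_on[OF E_cont order_refl]])
  have ip: "md.past n integrable_on {0..T}" for n by (rule abs_int_imp_int[OF md.past_abs_int(1)[OF T]])
  show "\<exists>N. \<forall>n\<ge>N. m0 * integral {0..T} Etot \<le> CL * Etot 0 + M * integral {0..T} hist_tail + m0 * (rest n * T)"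
  proof (intro exI[of _ 0] allI impI)
    fix N
    have "integral {0..T} Etot \<le> integral {0..T} (\<lambda>t. (\<Sum>n<N. E n t) + rest N)"
      by (rule integral_le) (auto intro!: abs_int_imp_int[OF int_on] continuous_intros E_cont Etot_cont rest_bound)
    also have "\<dots> = integral {0..T} (\<lambda>t. \<Sum>n<N. E n t) + rest N * T"
      using T by (subst integral_add) (auto intro!: integrable_sum iE)
    also have "integral {0..T} (\<lambda>t. \<Sum>n<N. E n t) = (\<Sum>n<N. integral {0..T} (E n))"
      by (rule integral_sum) (auto intro: iE)
    finally have "m0 * integral {0..T} Etot \<le> m0 * ((\<Sum>n<N. integral {0..T} (E n)) + rest N * T)"
      using cpos by (intro mult_left_mono) auto
    also have "\<dots> = (\<Sum>n<N. m0 * integral {0..T} (E n)) + m0 * (rest N * T)"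
      by (simp add: distrib_left sum_distrib_left)
    also have "(\<Sum>n<N. m0 * integral {0..T} (E n)) \<le> (\<Sum>n<N. CL * E n 0 + M * integral {0..T} (md.past n))"
      by (rule sum_mono) (rule mode_energy_integral[OF T])
    also have "\<dots> = CL * (\<Sum>n<N. E n 0) + M * (\<Sum>n<N. integral {0..T} (md.past n))"
      by (simp add: sum.distrib sum_distrib_left)
    also have "(\<Sum>n<N. integral {0..T} (md.past n)) = integral {0..T} (\<lambda>t. \<Sum>n<N. md.past n t)"
      by (rule integral_sum[symmetric]) (auto intro: ip)
    also have "CL * (\<Sum>n<N. E n 0) + M * integral {0..T} (\<lambda>t. \<Sum>n<N. md.past n t) \<le> CL * Etot 0 + M * integral {0..T} hist_tail"
    proof (intro add_mono mult_left_mono)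
      show "(\<Sum>n<N. E n 0) \<le> Etot 0" by (rule partial_le) simp
      show "integral {0..T} (\<lambda>t. \<Sum>n<N. md.past n t) \<le> integral {0..T} hist_tail"
      proof (rule integral_le)
        show "(\<lambda>t. \<Sum>n<N. md.past n t) integrable_on {0..T}" by (intro integrable_sum ip) auto
        show "hist_tail integrable_on {0..T}" by (rule abs_int_imp_int[OF hist_tail_abs_int]) simp
        show "(\<Sum>n<N. md.past n t) \<le> hist_tail t" if "t \<in> {0..T}" for t
          using past_sum_le[of t N] tail_mass_nonneg[of t] that by simp
      qed
    qed (use cpos in auto)
    finally show "m0 * integral {0..T} Etot \<le> CL * Etot 0 + M * integral {0..T} hist_tail + m0 * (rest N * T)" by simp
  qed
qed

definition "pc = \<kappa> * (1 - g0) / 2"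

lemma pc: "pc > 0" using pos g0_less by (simp add: pc_def)

lemma P_sq_E: "(P n t)\<^sup>2 \<le> E n t / pc"
  using md.P_sq_le[of n t] pc unfolding E_def pc_def by (simp add: field_simps)

definition "C1 = 4 / pc * ((CL * Etot 0 + M) / m0)"

lemma C1_nonneg: "C1 \<ge> 0"
  unfolding C1_def using pc cpos Etot_nonneg[of 0] by simp

text \<open>As the energy is nonincreasing, \<open>t * Etot t\<close> is at most the integral of
  \<open>Etot\<close> over \<open>[0,t]\<close>. Both parts of the drift are thus bounded by this
  integral, which \<open>energy_integral\<close> bounds by a multiple of
  \<open>growth t\<close>.\<close>

lemma drift_sum_le:
  assumes t: "t \<ge> 0"
  shows "(\<Sum>n<N. timoshenko_mode.drift (P n) t) \<le> C1 * growth t"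
proof -
  have iE: "E n integrable_on {0..t}" for n by (rule abs_int_imp_int[OF int_on[OF E_cont order_refl]])
  have iEt: "Etot integrable_on {0..t}" by (rule abs_int_imp_int[OF int_on[OF Etot_cont order_refl]])
  have one: "timoshenko_mode.drift (P n) t \<le> 2 / pc * (t * E n t + integral {0..t} (E n))" for n
  proof -
    have "timoshenko_mode.drift (P n) t \<le> 2 * t * (P n t)\<^sup>2 + 2 * integral {0..t} (\<lambda>s. (P n s)\<^sup>2)" by (rule md.drift_le[OF t])
    also have "\<dots> \<le> 2 * t * (E n t / pc) + 2 * integral {0..t} (\<lambda>s. E n s / pc)"
    proof (intro add_mono mult_left_mono P_sq_E integral_le)
      have "continuous_on {0..} (\<lambda>s. (P n s)\<^sup>2)" by (intro continuous_intros md.P_cont)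
      then show "(\<lambda>s. (P n s)\<^sup>2) integrable_on {0..t}" by (rule abs_int_imp_int[OF int_on]) simp
      show "(\<lambda>s. E n s / pc) integrable_on {0..t}" using iE by (rule integrable_on_divide)
    qed (use t in auto)
    also have "\<dots> = 2 / pc * (t * E n t + integral {0..t} (E n))"
      using integral_divide[of "{0..t}" "E n" pc] by (simp add: algebra_simps)
    finally show ?thesis .
  qed
  have "(\<Sum>n<N. timoshenko_mode.drift (P n) t) \<le> (\<Sum>n<N. 2 / pc * (t * E n t + integral {0..t} (E n)))"
    by (rule sum_mono) (rule one)
  also have "\<dots> = 2 / pc * (t * (\<Sum>n<N. E n t) + integral {0..t} (\<lambda>s. \<Sum>n<N. E n s))"
    by (subst integral_sum) (auto simp: sum_distrib_left sum.distrib distrib_left iE)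
  also have "\<dots> \<le> 2 / pc * (integral {0..t} Etot + integral {0..t} Etot)"
  proof (intro mult_left_mono add_mono)
    have "integral {0..t} (\<lambda>_. Etot t) \<le> integral {0..t} Etot"
      by (rule integral_le) (use iEt Etot_antimono in auto)
    then have "t * Etot t \<le> integral {0..t} Etot" using t by simp
    then show "t * (\<Sum>n<N. E n t) \<le> integral {0..t} Etot" using mult_left_mono[OF partial_le[OF t] t, of N] by linarith
    show "integral {0..t} (\<lambda>s. \<Sum>n<N. E n s) \<le> integral {0..t} Etot"
      by (rule integral_le) (use iEt iE partial_le in \<open>auto intro!: integrable_sum\<close>)
  qed (use pc in auto)
  also have "\<dots> = 4 / pc * (m0 * integral {0..t} Etot / m0)" using cpos by simp
  also have "\<dots> \<le> 4 / pc * (((CL * Etot 0 + M) * growth t) / m0)"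
  proof (intro mult_left_mono divide_right_mono)
    have "m0 * integral {0..t} Etot \<le> CL * Etot 0 * 1 + M * integral {0..t} hist_tail" using energy_integral[OF t] by simp
    also have "\<dots> \<le> CL * Etot 0 * growth t + M * growth t"
      using cpos Etot_nonneg[of 0] growth_ge_1[of t] by (intro add_mono mult_left_mono) (auto simp: growth_def)
    finally show "m0 * integral {0..t} Etot \<le> (CL * Etot 0 + M) * growth t" by (simp add: algebra_simps)
  qed (use pc cpos in auto)
  also have "\<dots> = C1 * growth t" unfolding C1_def times_divide_eq_right times_divide_eq_left mult.assoc ..
  finally show ?thesis .
qed

section \<open>Decay of finite sums of modes\<close>

definition "C6 = M * (1 + 4 * M / (m0 * pc))"

lemma C6: "C6 > 0" unfolding C6_def using cpos pc by (auto intro!: mult_pos_pos add_pos_pos)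

text \<open>Now the indefinite term is estimated at a fixed time: it equals
  \<open>2 * W * P - \<Gamma>\<close>, with \<open>W\<^sup>2 \<le> \<Gamma>\<close>, so Young's
  inequality leaves a multiple of \<open>\<Gamma>\<close> and a small multiple of the
  energy.\<close>

lemma Ly_rate': "AE t in lborel. 0 \<le> t \<longrightarrow> dLy n t \<le> - (m0 / 2) * E n t + C6 * shift_energy (P n) t"
  using Ly_rate[of n]
proof eventually_elim
  case (elim t)
  show ?case
  proof
    assume t: "0 \<le> t"
    let ?Q = "g0 * (P n t)\<^sup>2 - memory k (\<lambda>t. (P n t)\<^sup>2) t"
    let ?W = "g0 * P n t - memory k (P n) t"
    let ?G = "shift_energy (P n) t"
    have Q: "- ?Q = ?G - 2 * (?W * P n t)" using md.Q_eq[OF t, of n] unfolding mult.assoc by linarith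
    have W: "?W\<^sup>2 \<le> ?G" by (rule md.W_sq[OF t])
    \<comment> \<open>With this \<open>e\<close> the \<open>P\<^sup>2\<close> term costs exactly
      \<open>m0 / 2 * E\<close>.\<close>
    define e where "e = m0 * pc / (4 * M)"
    have e: "e > 0" using cpos pc by (simp add: e_def)
    have "\<bar>P n t * ?W\<bar> \<le> e * (P n t)\<^sup>2 + ?W\<^sup>2 / (4 * e)" by (rule young_eps[OF e])
    also have "\<dots> \<le> e * (E n t / pc) + ?G / (4 * e)" using e W P_sq_E by (intro add_mono mult_left_mono divide_right_mono) auto
    finally have "- 2 * (?W * P n t) \<le> 2 * e * (E n t / pc) + ?G / (2 * e)"
      by (auto simp: abs_le_iff mult.commute)
    then have "- ?Q \<le> ?G + (2 * e * (E n t / pc) + ?G / (2 * e))" using Q by linarith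
    then have "M * (- ?Q) \<le> M * (?G + (2 * e * (E n t / pc) + ?G / (2 * e)))" using cpos by (intro mult_left_mono) auto
    also have "\<dots> = M * (1 + 1 / (2 * e)) * ?G + (M * 2 * e / pc) * E n t" by (simp add: algebra_simps)
    also have "M * 2 * e / pc = m0 / 2" using cpos pc by (simp add: e_def)
    also have "M * (1 + 1 / (2 * e)) * ?G \<le> C6 * ?G"
      unfolding C6_def e_def using cpos pc md.\<Gamma>_nonneg[of n t] by (intro mult_right_mono mult_left_mono) (auto simp: field_simps)
    finally show "dLy n t \<le> - (m0 / 2) * E n t + C6 * ?G" using elim t by (simp add: algebra_simps)
  qed
qed

definition "C8 = C6 * (2 * Etot 0 / pc + 2)"

lemma C8: "C8 > 0" unfolding C8_def using C6 pc Etot_nonneg[of 0] by (intro mult_pos_pos add_nonneg_pos) auto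

text \<open>The dissipation released by the energy pays for the recent part of the history.\<close>

lemma mode_rate:
  "AE t in lborel. 0 \<le> t \<longrightarrow> (\<forall>u\<ge>0. \<xi> t * H' u * dLy n t - C6 * dissipation (P n) t
     \<le> \<xi> t * H' u * (- (m0 / 2) * E n t + C6 * (2 * (E n t / pc) * tail_mass t + 2 * md.past n t))
       + C6 * (\<xi> t * u * H' u * timoshenko_mode.drift (P n) t))"
  using Ly_rate'[of n] md.AE_dissipation[of n]
proof eventually_elim
  case (elim t)
  show ?case
  proof (intro impI allI)
    fix u :: real assume t: "0 \<le> t" and u: "0 \<le> u"
    define w where "w = \<xi> t * H' u"
    have w: "w \<ge> 0" using \<xi>_pos[OF t] H'_nonneg[OF u] by (simp add: w_def)
    have rec: "w * timoshenko_mode.recent m (P n) t \<le> dissipation (P n) t + (\<xi> t * u * H' u) * timoshenko_mode.drift (P n) t"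
    proof (rule md.recent_tangent[OF t])
      show "integrable lborel (\<lambda>r. m r * (P n t - P n (t - r))\<^sup>2)" using elim t by blast
      fix s assume s: "s \<in> {0..t}"
      have "w * k s \<le> \<xi> t * (H (k s) + u * H' u)"
        unfolding w_def mult.assoc using H_tangent[OF u k_pos[of s]] \<xi>_pos[OF t] by (intro mult_left_mono) auto
      \<comment> \<open>The weight is frozen at time \<open>t\<close>. For \<open>s \<le> t\<close>
        the monotonicity of \<open>\<xi>\<close> replaces it by its value at \<open>s\<close>, where
        the inequality between \<open>m\<close> and \<open>H (k s)\<close> is available.\<close>
      moreover have "\<xi> t * H (k s) \<le> \<xi> s * H (k s)" using s H_nonneg k_nonneg by (intro mult_right_mono \<xi>_antimono) auto
      ultimately show "w * k s \<le> m s + \<xi> t * u * H' u" using kernel_decay[of s] s by (simp add: algebra_simps)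
    qed
    have 1: "w * dLy n t \<le> w * (- (m0 / 2) * E n t + C6 * shift_energy (P n) t)"
      using elim t w by (intro mult_left_mono) auto
    define r where "r = 2 * (E n t / pc) * tail_mass t + 2 * md.past n t"
    have "shift_energy (P n) t \<le> timoshenko_mode.recent m (P n) t + r"
      using md.\<Gamma>_split[OF t, of n] mult_right_mono[OF P_sq_E[of n t] tail_mass_nonneg[of t]] unfolding r_def by simp
    then have "w * (C6 * shift_energy (P n) t) \<le> w * (C6 * (timoshenko_mode.recent m (P n) t + r))"
      using w C6 by (intro mult_left_mono) auto
    then have "w * dLy n t \<le> w * (- (m0 / 2) * E n t + C6 * r) + C6 * (w * timoshenko_mode.recent m (P n) t)"
      using 1 by (simp add: algebra_simps)
    moreover have "C6 * (w * timoshenko_mode.recent m (P n) t) \<le> C6 * (dissipation (P n) t + (\<xi> t * u * H' u) * timoshenko_mode.drift (P n) t)"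
      using rec C6 by (intro mult_left_mono) auto
    ultimately have "w * dLy n t - C6 * dissipation (P n) t
        \<le> w * (- (m0 / 2) * E n t + C6 * r) + C6 * ((\<xi> t * u * H' u) * timoshenko_mode.drift (P n) t)"
      by (simp add: algebra_simps)
    then show "\<xi> t * H' u * dLy n t - C6 * dissipation (P n) t
     \<le> \<xi> t * H' u * (- (m0 / 2) * E n t + C6 * (2 * (E n t / pc) * tail_mass t + 2 * md.past n t))
       + C6 * (\<xi> t * u * H' u * timoshenko_mode.drift (P n) t)"
      unfolding w_def r_def .
  qed
qed

text \<open>\<open>u\<close> is quantified inside the almost everywhere statement because a function
  of time is substituted for it later. The summand with \<open>u * growth t\<close> is the error of
  the tangent line inequality.\<close>

lemma family_rate:
  "AE t in lborel. 0 \<le> t \<longrightarrow> (\<forall>u\<ge>0. (\<Sum>n<N. \<xi> t * H' u * dLy n t - C6 * dissipation (P n) t)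
     \<le> \<xi> t * H' u * (- (m0 / 2) * (\<Sum>n<N. E n t) + C8 * hist_tail t + C6 * C1 * (u * growth t)))"
proof -
  have "AE t in lborel. \<forall>n. 0 \<le> t \<longrightarrow> (\<forall>u\<ge>0. \<xi> t * H' u * dLy n t - C6 * dissipation (P n) t
     \<le> \<xi> t * H' u * (- (m0 / 2) * E n t + C6 * (2 * (E n t / pc) * tail_mass t + 2 * md.past n t))
       + C6 * (\<xi> t * u * H' u * timoshenko_mode.drift (P n) t))"
    unfolding AE_all_countable using mode_rate by blast
  then show ?thesis
  proof eventually_elim
    case (elim t)
    show ?case
    proof (intro impI allI)
      fix u :: real assume t: "0 \<le> t" and u: "0 \<le> u"
      define w where "w = \<xi> t * H' u"
      have w: "w \<ge> 0" using \<xi>_pos[OF t] H'_nonneg[OF u] by (simp add: w_def)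
      define SE where "SE = (\<Sum>n<N. E n t)"
      define Sp where "Sp = (\<Sum>n<N. md.past n t)"
      define Sd where "Sd = (\<Sum>n<N. timoshenko_mode.drift (P n) t)"
      have SE: "SE \<le> Etot 0" unfolding SE_def using partial_le[OF t] Etot_antimono[of 0 t] t by (metis order_refl order_trans)
      have SE0: "0 \<le> SE" unfolding SE_def by (intro sum_nonneg) (simp add: E_nonneg)
      have Sp: "0 \<le> Sp" unfolding Sp_def by (intro sum_nonneg) (simp add: md.past_nonneg)
      have "(\<Sum>n<N. \<xi> t * H' u * dLy n t - C6 * dissipation (P n) t)
        \<le> (\<Sum>n<N. \<xi> t * H' u * (- (m0 / 2) * E n t + C6 * (2 * (E n t / pc) * tail_mass t + 2 * md.past n t))
          + C6 * (\<xi> t * u * H' u * timoshenko_mode.drift (P n) t))"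
        by (rule sum_mono) (use elim t u in blast)
      also have "\<dots> = w * (- (m0 / 2) * SE + C6 * (2 * (SE / pc) * tail_mass t + 2 * Sp)) + C6 * (w * u * Sd)"
        unfolding w_def SE_def Sp_def Sd_def
        by (induction N) (simp_all add: algebra_simps add_divide_distrib)
      also have "\<dots> \<le> w * (- (m0 / 2) * SE + C8 * hist_tail t) + C6 * (w * u * (C1 * growth t))"
      proof (intro order_refl add_mono mult_left_mono)
        have "2 * (SE / pc) * tail_mass t + 2 * Sp \<le> 2 * (Etot 0 / pc) * hist_tail t + 2 * hist_tail t"
        proof (intro add_mono mult_mono mult_left_mono divide_right_mono)
          show "tail_mass t \<le> hist_tail t" "Sp \<le> hist_tail t"
            using past_sum_le[OF t, of N] Sp tail_mass_nonneg[of t] unfolding Sp_def by linarith+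
        qed (use SE SE0 Sp pc tail_mass_nonneg Etot_nonneg[of 0] in auto)
        then have "C6 * (2 * (SE / pc) * tail_mass t + 2 * Sp) \<le> C6 * (2 * (Etot 0 / pc) * hist_tail t + 2 * hist_tail t)"
          using C6 by (intro mult_left_mono) auto
        then show "C6 * (2 * (SE / pc) * tail_mass t + 2 * Sp) \<le> C8 * hist_tail t" unfolding C8_def by (simp add: algebra_simps)
        show "Sd \<le> C1 * growth t" unfolding Sd_def by (rule drift_sum_le[OF t])
      qed (use w u C6 in auto)
      also have "\<dots> = \<xi> t * H' u * (- (m0 / 2) * SE + C8 * hist_tail t + C6 * C1 * (u * growth t))"
        unfolding w_def by (simp add: algebra_simps)
      finally show "(\<Sum>n<N. \<xi> t * H' u * dLy n t - C6 * dissipation (P n) t)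
        \<le> \<xi> t * H' u * (- (m0 / 2) * (\<Sum>n<N. E n t) + C8 * hist_tail t + C6 * C1 * (u * growth t))"
        unfolding SE_def .
    qed
  qed
qed

end

section \<open>Comparison with a supersolution\<close>

context timoshenko_lyapunov
begin

context
  fixes q0 \<epsilon> :: real
  assumes q0: "q0 > 0" and \<epsilon>: "\<epsilon> > 0" and \<epsilon>_small: "C6 * C1 * (\<epsilon> * q0) \<le> m0 / 4" and \<epsilon>_init: "\<epsilon> * (q0 * Etot 0) \<le> 1"
begin

section \<open>The weighted functional\<close>

definition "q t = q0 / growth t"
definition "lev t = \<epsilon> * (q t * Etot t)"
definition "wt t = q t * (\<xi> t * H' (lev t))"
text \<open>Chosen so that the energy summand of \<open>Xn\<close> releases
  \<open>C10 * \<kappa> / 2 = C6\<close> times the dissipation, just what \<open>family_rate\<close>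
  subtracts.\<close>

definition "C10 = 2 * C6 / \<kappa>"
definition "Xn n t = wt t * Ly n t + C10 * (q t * E n t)"
definition "X t = (\<Sum>n. Xn n t)"
definition "K = \<xi> 0 * H' (lev 0) * CL + C10"

lemma growth_pos: "growth t > 0" using growth_ge_1[of t] by linarith

lemma q_pos: "q t > 0" unfolding q_def using q0 growth_pos by simp

lemma q_antimono: "0 \<le> s \<Longrightarrow> s \<le> t \<Longrightarrow> q t \<le> q s"
  unfolding q_def using q0 growth_pos by (intro divide_left_mono growth_mono mult_pos_pos) auto

lemma q_le: "q t \<le> q0" unfolding q_def using q0 growth_ge_1[of t] growth_pos[of t] by (simp add: field_simps)

lemma q_cont: "continuous_on {0..} q"
  unfolding q_def[abs_def] using growth_pos by (intro continuous_intros growth_cont) (auto simp: less_imp_neq[symmetric])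

lemma lev_nonneg: "t \<ge> 0 \<Longrightarrow> 0 \<le> lev t"
  unfolding lev_def using \<epsilon> q_pos[of t] Etot_nonneg by simp

lemma lev_antimono: "0 \<le> s \<Longrightarrow> s \<le> t \<Longrightarrow> lev t \<le> lev s"
  unfolding lev_def using \<epsilon> q_pos[THEN less_imp_le] Etot_nonneg
  by (intro mult_left_mono mult_mono q_antimono Etot_antimono) auto

lemma lev_cont: "continuous_on {0..} lev"
  unfolding lev_def[abs_def] by (intro continuous_intros q_cont Etot_cont)

lemma H'lev_cont: "continuous_on {0..} (\<lambda>t. H' (lev t))"
  by (rule continuous_on_compose2[OF H'_cont lev_cont]) (auto simp: lev_nonneg)

lemma wt_cont: "continuous_on {0..} wt"
  unfolding wt_def[abs_def] by (intro continuous_intros q_cont \<xi>_cont H'lev_cont)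

lemma wt_nonneg: "t \<ge> 0 \<Longrightarrow> 0 \<le> wt t"
  unfolding wt_def using q_pos[of t] \<xi>_pos[of t] H'_nonneg[OF lev_nonneg] by simp

lemma wt_antimono: "0 \<le> s \<Longrightarrow> s \<le> t \<Longrightarrow> wt t \<le> wt s"
  unfolding wt_def using q_pos[THEN less_imp_le] \<xi>_pos[THEN less_imp_le] H'_nonneg[OF lev_nonneg]
  by (intro mult_mono q_antimono \<xi>_antimono H'_mono lev_antimono mult_nonneg_nonneg) (auto simp: lev_nonneg)

lemma C10: "C10 > 0" unfolding C10_def using C6 pos by simp

lemma K_pos: "K > 0"
  unfolding K_def using C10 \<xi>_pos[of 0] H'_nonneg[OF lev_nonneg, of 0] cpos by (intro add_nonneg_pos) auto

lemma Xn_bounds: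
  assumes t: "t \<ge> 0"
  shows "C10 * (q t * E n t) \<le> Xn n t" "Xn n t \<le> K * (q t * E n t)" "\<bar>Xn n t\<bar> \<le> K * q0 * E n 0"
proof -
  show lower: "C10 * (q t * E n t) \<le> Xn n t" unfolding Xn_def using wt_nonneg[OF t] Ly_nonneg[OF t, of n] by simp
  have "wt t \<le> q t * (\<xi> 0 * H' (lev 0))"
    unfolding wt_def using t q_pos[of t] \<xi>_pos[THEN less_imp_le] H'_nonneg[OF lev_nonneg]
    by (intro mult_left_mono mult_mono \<xi>_antimono H'_mono lev_antimono) (auto simp: lev_nonneg)
  then have "wt t * Ly n t \<le> q t * (\<xi> 0 * H' (lev 0)) * (CL * E n t)"
    using wt_nonneg[OF t] Ly_upper[OF t, of n] Ly_nonneg[OF t, of n] by (intro mult_mono) auto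
  then show upper: "Xn n t \<le> K * (q t * E n t)" unfolding Xn_def K_def by (simp add: algebra_simps)
  have "q t * E n t \<le> q0 * E n 0" using q_le[of t] q_pos[of t] E_le[OF t, of n] E_nonneg q0 by (intro mult_mono) auto
  then have "K * (q t * E n t) \<le> K * (q0 * E n 0)" using K_pos by (intro mult_left_mono) auto
  moreover have "0 \<le> C10 * (q t * E n t)" using C10 q_pos[of t] E_nonneg by simp
  ultimately show "\<bar>Xn n t\<bar> \<le> K * q0 * E n 0" using lower upper by (simp add: mult.assoc)
qed

lemma Xn_summable: "t \<ge> 0 \<Longrightarrow> summable (\<lambda>n. Xn n t)"
  by (rule summable_comparison_test'[OF summable_mult[OF summ0, of "K * q0"], of 0]) (simp add: Xn_bounds(3))

lemma X_bounds:
  assumes t: "t \<ge> 0" shows "C10 * (q t * Etot t) \<le> X t" "X t \<le> K * (q t * Etot t)"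
proof -
  have e: "c * (q t * Etot t) = (\<Sum>n. c * (q t * E n t))" "summable (\<lambda>n. c * (q t * E n t))" for c
    unfolding Etot_def using suminf_mult[OF summ[OF t], of "c * q t"] summable_mult[OF summ[OF t], of "c * q t"]
    by (simp_all add: mult.assoc)
  show "C10 * (q t * Etot t) \<le> X t" "X t \<le> K * (q t * Etot t)"
    unfolding X_def e(1) by (intro suminf_le Xn_bounds[OF t] e(2) Xn_summable[OF t])+
qed

lemma Xn_cont: "continuous_on {0..} (Xn n)"
  unfolding Xn_def[abs_def]
  by (intro continuous_intros wt_cont q_cont E_cont has_density_continuous'[OF Ly_density])

lemma X_cont: "continuous_on {0..} X"
  unfolding X_def[abs_def]
  by (rule continuous_on_suminf_M_test[OF Xn_cont _ summable_mult[OF summ0, of "K * q0"]]) (simp add: Xn_bounds(3))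

lemma abs_int_sum:
  fixes f :: "nat \<Rightarrow> real \<Rightarrow> real"
  assumes "\<And>n. f n absolutely_integrable_on S" shows "(\<lambda>t. \<Sum>n<N. f n t) absolutely_integrable_on S"
  using assms by (intro absolutely_integrable_sum) auto

text \<open>Both weights are nonincreasing and multiply nonnegative functions, so their variation in
  time only helps. The sum is finite while \<open>lev\<close> contains the energy of all modes; this
  mismatch is the origin of the term with \<open>rest N\<close>.\<close>

lemma partial_step:
  assumes st: "0 \<le> s" "s \<le> t"
  shows "(\<Sum>n<N. Xn n t) - (\<Sum>n<N. Xn n s)
    \<le> integral {s..t} (\<lambda>\<tau>. wt \<tau> * (- (m0 / 4) * Etot \<tau> + C8 * hist_tail \<tau>)) + m0 / 2 * rest N * integral {s..t} wt"
proof -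
  have cs: "continuous_on {s..t} f" if "continuous_on {0..} f" for f :: "real \<Rightarrow> real"
    by (rule continuous_on_subset[OF that]) (use st in auto)
  have ai1: "(\<lambda>\<tau>. wt \<tau> * dLy n \<tau>) absolutely_integrable_on {s..t}" for n
    by (rule abs_integrable_mult_continuous[OF cs[OF wt_cont] has_densityD(1)[OF Ly_density st]])
  have ed: "has_density (E n) (\<lambda>t. - (\<kappa> / 2) * dissipation (P n) t)" for n
    unfolding E_def by (rule md.energy_density)
  have ai2: "(\<lambda>\<tau>. q \<tau> * (- (\<kappa> / 2) * dissipation (P n) \<tau>)) absolutely_integrable_on {s..t}" for n
    by (rule abs_integrable_mult_continuous[OF cs[OF q_cont] has_densityD(1)[OF ed st]])
  have ai3: "(\<lambda>\<tau>. wt \<tau> * dLy n \<tau> + C10 * (q \<tau> * (- (\<kappa> / 2) * dissipation (P n) \<tau>))) absolutely_integrable_on {s..t}" for n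
    by (intro set_integral_add ai1 set_integrable_mult_right ai2)
  have one: "Xn n t - Xn n s \<le> integral {s..t} (\<lambda>\<tau>. wt \<tau> * dLy n \<tau> + C10 * (q \<tau> * (- (\<kappa> / 2) * dissipation (P n) \<tau>)))" for n
  proof -
    have 1: "wt t * Ly n t - wt s * Ly n s \<le> integral {s..t} (\<lambda>\<tau>. wt \<tau> * dLy n \<tau>)"
      by (rule antimono_weight_density_le[OF Ly_density Ly_nonneg wt_cont wt_antimono st])
    have 2: "q t * E n t - q s * E n s \<le> integral {s..t} (\<lambda>\<tau>. q \<tau> * (- (\<kappa> / 2) * dissipation (P n) \<tau>))"
      by (rule antimono_weight_density_le[OF ed E_nonneg q_cont q_antimono st])
    have "integral {s..t} (\<lambda>\<tau>. wt \<tau> * dLy n \<tau> + C10 * (q \<tau> * (- (\<kappa> / 2) * dissipation (P n) \<tau>)))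
      = integral {s..t} (\<lambda>\<tau>. wt \<tau> * dLy n \<tau>) + C10 * integral {s..t} (\<lambda>\<tau>. q \<tau> * (- (\<kappa> / 2) * dissipation (P n) \<tau>))"
      unfolding integral_add[OF abs_int_imp_int[OF ai1] integrable_on_mult_right[OF abs_int_imp_int[OF ai2]]] integral_mult_right ..
    then show ?thesis using 1 mult_left_mono[OF 2, of C10] C10 unfolding Xn_def by (simp add: algebra_simps)
  qed
  have "(\<Sum>n<N. Xn n t) - (\<Sum>n<N. Xn n s) = (\<Sum>n<N. Xn n t - Xn n s)" by (simp add: sum_subtractf)
  also have "\<dots> \<le> (\<Sum>n<N. integral {s..t} (\<lambda>\<tau>. wt \<tau> * dLy n \<tau> + C10 * (q \<tau> * (- (\<kappa> / 2) * dissipation (P n) \<tau>))))"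
    by (rule sum_mono) (rule one)
  also have "\<dots> = integral {s..t} (\<lambda>\<tau>. \<Sum>n<N. wt \<tau> * dLy n \<tau> + C10 * (q \<tau> * (- (\<kappa> / 2) * dissipation (P n) \<tau>)))"
    by (rule integral_sum[symmetric]) (rule finite_lessThan, rule abs_int_imp_int[OF ai3])
  also have "\<dots> \<le> integral {s..t} (\<lambda>\<tau>. wt \<tau> * (- (m0 / 4) * Etot \<tau> + C8 * hist_tail \<tau>) + m0 / 2 * rest N * wt \<tau>)"
  proof (rule integral_mono_AE_halfline[OF _ _ st(1)])
    show "(\<lambda>\<tau>. \<Sum>n<N. wt \<tau> * dLy n \<tau> + C10 * (q \<tau> * (- (\<kappa> / 2) * dissipation (P n) \<tau>))) absolutely_integrable_on {s..t}"
      by (rule abs_int_sum) (rule ai3)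
    show "(\<lambda>\<tau>. wt \<tau> * (- (m0 / 4) * Etot \<tau> + C8 * hist_tail \<tau>) + m0 / 2 * rest N * wt \<tau>) absolutely_integrable_on {s..t}"
      by (intro set_integral_add abs_integrable_mult_continuous[OF cs[OF wt_cont]] set_integrable_mult_right
          hist_tail_abs_int st int_on wt_cont Etot_cont)
    show "AE \<tau> in lborel. 0 \<le> \<tau> \<longrightarrow> (\<Sum>n<N. wt \<tau> * dLy n \<tau> + C10 * (q \<tau> * (- (\<kappa> / 2) * dissipation (P n) \<tau>)))
        \<le> wt \<tau> * (- (m0 / 4) * Etot \<tau> + C8 * hist_tail \<tau>) + m0 / 2 * rest N * wt \<tau>"
      using family_rate[of N]
    proof eventually_elim
      case (elim \<tau>)
      show ?case
      proof
        assume \<tau>: "0 \<le> \<tau>"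
        define v where "v = \<xi> \<tau> * H' (lev \<tau>)"
        have v: "v \<ge> 0" unfolding v_def using \<xi>_pos[OF \<tau>] H'_nonneg[OF lev_nonneg[OF \<tau>]] by simp
        have "(\<Sum>n<N. wt \<tau> * dLy n \<tau> + C10 * (q \<tau> * (- (\<kappa> / 2) * dissipation (P n) \<tau>)))
          = q \<tau> * (\<Sum>n<N. v * dLy n \<tau> - C6 * dissipation (P n) \<tau>)"
          unfolding wt_def C10_def v_def[symmetric] sum_distrib_left using pos by (intro sum.cong) (auto simp: algebra_simps)
        also have "\<dots> \<le> q \<tau> * (v * (- (m0 / 2) * (\<Sum>n<N. E n \<tau>) + C8 * hist_tail \<tau> + C6 * C1 * (lev \<tau> * growth \<tau>)))"
          using elim \<tau> lev_nonneg[OF \<tau>] q_pos[of \<tau>] unfolding v_def by (intro mult_left_mono) auto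
        also have "\<dots> \<le> q \<tau> * (v * (- (m0 / 4) * Etot \<tau> + C8 * hist_tail \<tau> + m0 / 2 * rest N))"
        proof (intro mult_left_mono)
          \<comment> \<open>This is the purpose of the factor \<open>q\<close> in
            \<open>lev\<close>: it cancels \<open>growth\<close>, and by
            \<open>\<epsilon>_small\<close> half of the available decay absorbs the tangent line
            error.\<close>
          have "lev \<tau> * growth \<tau> = \<epsilon> * q0 * Etot \<tau>" unfolding lev_def q_def using growth_pos[of \<tau>] by simp
          then have "C6 * C1 * (lev \<tau> * growth \<tau>) \<le> m0 / 4 * Etot \<tau>"
            using mult_right_mono[OF \<epsilon>_small Etot_nonneg[OF \<tau>]] by (simp add: mult.assoc)
          moreover have "m0 / 2 * Etot \<tau> \<le> m0 / 2 * ((\<Sum>n<N. E n \<tau>) + rest N)"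
            using rest_bound[OF \<tau>, of N] cpos by (intro mult_left_mono) auto
          ultimately show "- (m0 / 2) * (\<Sum>n<N. E n \<tau>) + C8 * hist_tail \<tau> + C6 * C1 * (lev \<tau> * growth \<tau>)
            \<le> - (m0 / 4) * Etot \<tau> + C8 * hist_tail \<tau> + m0 / 2 * rest N" by (simp add: algebra_simps)
        qed (use v q_pos[of \<tau>] in auto)
        also have "\<dots> = wt \<tau> * (- (m0 / 4) * Etot \<tau> + C8 * hist_tail \<tau>) + m0 / 2 * rest N * wt \<tau>"
          unfolding wt_def v_def[symmetric] by (simp add: algebra_simps)
        finally show "(\<Sum>n<N. wt \<tau> * dLy n \<tau> + C10 * (q \<tau> * (- (\<kappa> / 2) * dissipation (P n) \<tau>)))
          \<le> wt \<tau> * (- (m0 / 4) * Etot \<tau> + C8 * hist_tail \<tau>) + m0 / 2 * rest N * wt \<tau>" .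
      qed
    qed
  qed
  also have "\<dots> = integral {s..t} (\<lambda>\<tau>. wt \<tau> * (- (m0 / 4) * Etot \<tau> + C8 * hist_tail \<tau>)) + m0 / 2 * rest N * integral {s..t} wt"
  proof (subst integral_add)
    show "(\<lambda>\<tau>. wt \<tau> * (- (m0 / 4) * Etot \<tau> + C8 * hist_tail \<tau>)) integrable_on {s..t}"
      by (intro abs_int_imp_int set_integral_add abs_integrable_mult_continuous[OF cs[OF wt_cont]] set_integrable_mult_right
          hist_tail_abs_int st int_on Etot_cont)
    show "(\<lambda>\<tau>. m0 / 2 * rest N * wt \<tau>) integrable_on {s..t}"
      by (intro integrable_on_mult_right abs_int_imp_int int_on wt_cont st)
  qed simp
  finally show ?thesis .
qed

lemma X_step:
  assumes st: "0 \<le> s" "s \<le> t"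
  shows "X t - X s \<le> integral {s..t} (\<lambda>\<tau>. wt \<tau> * (- (m0 / 4) * Etot \<tau> + C8 * hist_tail \<tau>))"
proof (rule LIMSEQ_le)
  show "(\<lambda>N. (\<Sum>n<N. Xn n t) - (\<Sum>n<N. Xn n s)) \<longlonglongrightarrow> X t - X s"
    unfolding X_def using st by (intro tendsto_intros summable_LIMSEQ Xn_summable) auto
  have "(\<lambda>N. integral {s..t} (\<lambda>\<tau>. wt \<tau> * (- (m0 / 4) * Etot \<tau> + C8 * hist_tail \<tau>)) + m0 / 2 * rest N * integral {s..t} wt)
    \<longlonglongrightarrow> integral {s..t} (\<lambda>\<tau>. wt \<tau> * (- (m0 / 4) * Etot \<tau> + C8 * hist_tail \<tau>)) + m0 / 2 * 0 * integral {s..t} wt"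
    by (intro tendsto_intros rest_tendsto)
  then show "(\<lambda>N. integral {s..t} (\<lambda>\<tau>. wt \<tau> * (- (m0 / 4) * Etot \<tau> + C8 * hist_tail \<tau>)) + m0 / 2 * rest N * integral {s..t} wt)
    \<longlonglongrightarrow> integral {s..t} (\<lambda>\<tau>. wt \<tau> * (- (m0 / 4) * Etot \<tau> + C8 * hist_tail \<tau>))" by simp
qed (use partial_step[OF st] in blast)

text \<open>The factor \<open>dl\<close> gives \<open>dl * X \<le> lev\<close>. Where
  \<open>Z \<le> dl * X\<close>, monotonicity of \<open>H'\<close> yields
  \<open>Z * H' Z \<le> lev * H' lev\<close>, and \<open>young\<close> at \<open>u = lev\<close>
  bounds the rate of \<open>dl * X\<close> by \<open>- c1 * \<xi> * B\<close>. As the increments of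
  \<open>Z\<close> are at least the integrals of this quantity, \<open>dl * X\<close> cannot rise
  above \<open>Z\<close>.\<close>

lemma comparison_with_supersolution:
  defines "dl \<equiv> \<epsilon> / K"
  defines "c1 \<equiv> m0 * dl / (8 * \<epsilon>)" and "a \<equiv> 8 * \<epsilon> * C8 / m0"
  assumes Z: "continuous_on {0..} Z" "1 \<le> Z 0" "\<And>t. t \<ge> 0 \<Longrightarrow> 0 \<le> Z t"
    and B: "continuous_on {0..} B"
    and young: "\<And>t u. t \<ge> 0 \<Longrightarrow> u \<ge> 0 \<Longrightarrow> a * (q t * hist_tail t) * H' u - u * H' u \<le> Z t * H' (Z t) - B t"
    and super: "\<And>s t. 0 \<le> s \<Longrightarrow> s \<le> t \<Longrightarrow> integral {s..t} (\<lambda>\<tau>. - c1 * \<xi> \<tau> * B \<tau>) \<le> Z t - Z s"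
    and t: "t \<ge> 0"
  shows "dl * C10 * (q t * Etot t) \<le> Z t"
proof -
  have dl: "dl > 0" using \<epsilon> K_pos by (simp add: dl_def)
  have c1: "c1 > 0" using dl \<epsilon> cpos by (simp add: c1_def)
  have Xlev: "dl * X t \<le> lev t" if "t \<ge> 0" for t
  proof -
    have "dl * X t \<le> dl * (K * (q t * Etot t))" using X_bounds(2)[OF that] dl by (intro mult_left_mono) auto
    then show ?thesis using K_pos by (simp add: dl_def lev_def)
  qed
  have "dl * X t \<le> Z t"
  proof (rule integral_crossing_comparison[OF _ Z(1) _ _ t])
    show "continuous_on {0..} (\<lambda>t. dl * X t)" by (intro continuous_intros X_cont)
    have "lev 0 \<le> 1" unfolding lev_def using \<epsilon>_init by (simp add: q_def growth_def)
    then show "dl * X 0 \<le> Z 0" using Xlev[of 0] Z(2) by simp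
    fix s t :: real assume st: "0 \<le> s" "s \<le> t" and ge: "\<And>\<tau>. \<tau> \<in> {s..t} \<Longrightarrow> Z \<tau> \<le> dl * X \<tau>"
    have cs: "continuous_on {s..t} f" if "continuous_on {0..} f" for f :: "real \<Rightarrow> real"
      by (rule continuous_on_subset[OF that]) (use st in auto)
    have "dl * X t - dl * X s \<le> dl * integral {s..t} (\<lambda>\<tau>. wt \<tau> * (- (m0 / 4) * Etot \<tau> + C8 * hist_tail \<tau>))"
      using mult_left_mono[OF X_step[OF st], of dl] dl by (simp add: algebra_simps)
    also have "\<dots> = integral {s..t} (\<lambda>\<tau>. dl * (wt \<tau> * (- (m0 / 4) * Etot \<tau> + C8 * hist_tail \<tau>)))" by simp
    also have "\<dots> \<le> integral {s..t} (\<lambda>\<tau>. - c1 * \<xi> \<tau> * B \<tau>)"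
    proof (rule integral_le)
      show "(\<lambda>\<tau>. dl * (wt \<tau> * (- (m0 / 4) * Etot \<tau> + C8 * hist_tail \<tau>))) integrable_on {s..t}"
        by (intro integrable_on_mult_right abs_int_imp_int set_integral_add abs_integrable_mult_continuous[OF cs[OF wt_cont]]
            set_integrable_mult_right hist_tail_abs_int st int_on Etot_cont)
      show "(\<lambda>\<tau>. - c1 * \<xi> \<tau> * B \<tau>) integrable_on {s..t}"
        by (intro abs_int_imp_int int_on st continuous_intros \<xi>_cont B)
      fix \<tau> assume \<tau>: "\<tau> \<in> {s..t}"
      then have \<tau>0: "\<tau> \<ge> 0" using st by auto
      define h where "h = H' (lev \<tau>)"
      have h: "h \<ge> 0" unfolding h_def by (rule H'_nonneg[OF lev_nonneg[OF \<tau>0]])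
      have zl: "Z \<tau> \<le> lev \<tau>" using ge[OF \<tau>] Xlev[OF \<tau>0] by simp
      have "Z \<tau> * H' (Z \<tau>) \<le> lev \<tau> * h"
        unfolding h_def using zl Z(3)[OF \<tau>0] lev_nonneg[OF \<tau>0] by (intro mult_mono H'_mono H'_nonneg) auto
      \<comment> \<open>One \<open>lev * h\<close> stems from \<open>young\<close>, the other one
        replaces \<open>Z * H' Z\<close>. Their sum is matched with \<open>m0 / 4 * Etot\<close> by
        the factor 8 in \<open>c1\<close> and \<open>a\<close>.\<close>
      then have y: "a * (q \<tau> * hist_tail \<tau>) * h - 2 * (lev \<tau> * h) \<le> - B \<tau>"
        using young[OF \<tau>0 lev_nonneg[OF \<tau>0]] unfolding h_def by linarith
      have "dl * (wt \<tau> * (- (m0 / 4) * Etot \<tau> + C8 * hist_tail \<tau>)) = c1 * \<xi> \<tau> * (a * (q \<tau> * hist_tail \<tau>) * h - 2 * (lev \<tau> * h))"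
        unfolding wt_def h_def[symmetric] c1_def a_def using \<epsilon> cpos by (simp add: lev_def field_simps)
      also have "\<dots> \<le> c1 * \<xi> \<tau> * (- B \<tau>)" using y c1 \<xi>_pos[OF \<tau>0] by (intro mult_left_mono) auto
      finally show "dl * (wt \<tau> * (- (m0 / 4) * Etot \<tau> + C8 * hist_tail \<tau>)) \<le> - c1 * \<xi> \<tau> * B \<tau>" by simp
    qed
    also have "\<dots> \<le> Z t - Z s" by (rule super[OF st])
    finally show "dl * X t - dl * X s \<le> Z t - Z s" .
  qed
  moreover have "dl * (C10 * (q t * Etot t)) \<le> dl * X t" using X_bounds(1)[OF t] dl by (intro mult_left_mono) auto
  ultimately show ?thesis unfolding mult.assoc by linarith
qed

end

end

text \<open>\<open>a\<close>, \<open>c1\<close> and \<open>cE\<close> are independent of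
  \<open>Z\<close> and \<open>B\<close>; hence the constants of the final statement can be fixed
  before \<open>chi\<close> is given.\<close>

theorem (in timoshenko_family) decay:
  assumes q0: "q0 > 0"
  obtains a c1 cE where "a > 0" "c1 > 0" "cE > 0"
    "\<And>Z B t. continuous_on {0..} Z \<Longrightarrow> 1 \<le> Z 0 \<Longrightarrow> (\<And>t. t \<ge> 0 \<Longrightarrow> 0 \<le> Z t) \<Longrightarrow> continuous_on {0..} B \<Longrightarrow>
      (\<And>t u. t \<ge> 0 \<Longrightarrow> u \<ge> 0 \<Longrightarrow> a * (q0 / growth t * hist_tail t) * H' u - u * H' u \<le> Z t * H' (Z t) - B t) \<Longrightarrow>
      (\<And>s t. 0 \<le> s \<Longrightarrow> s \<le> t \<Longrightarrow> integral {s..t} (\<lambda>\<tau>. - c1 * \<xi> \<tau> * B \<tau>) \<le> Z t - Z s) \<Longrightarrow>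
      t \<ge> 0 \<Longrightarrow> cE * (q0 / growth t * Etot t) \<le> Z t"
proof -
  obtain m0 M c C where cpos: "m0 > 0" "M > 0" "c > 0" "C > 0" and lyap:
    "\<And>\<mu> x y \<alpha> \<beta> P. mode \<mu> x y \<alpha> \<beta> P \<Longrightarrow>
      \<exists>Ly dLy. has_density Ly dLy \<and>
        (AE t in lborel. 0 \<le> t \<longrightarrow> dLy t \<le> - m0 * mode_energy \<alpha> \<beta> (\<lambda>t. \<mu> * y t) P t
            - M * (g0 * (P t)\<^sup>2 - memory k (\<lambda>t. (P t)\<^sup>2) t)) \<and>
        (\<forall>t\<ge>0. c * mode_energy \<alpha> \<beta> (\<lambda>t. \<mu> * y t) P t \<le> Ly t \<and> Ly t \<le> C * mode_energy \<alpha> \<beta> (\<lambda>t. \<mu> * y t) P t)"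
    by (rule mode_lyapunov) (rule that)
  \<comment> \<open>Functional and density form a pair, so that a single choice over the modes
    suffices.\<close>
  have ex: "\<forall>n. \<exists>Ld. has_density (fst Ld) (snd Ld) \<and>
        (AE t in lborel. 0 \<le> t \<longrightarrow> snd Ld t \<le> - m0 * E n t - M * (g0 * (P n t)\<^sup>2 - memory k (\<lambda>t. (P n t)\<^sup>2) t)) \<and>
        (\<forall>t\<ge>0. c * E n t \<le> fst Ld t \<and> fst Ld t \<le> C * E n t)"
  proof
    fix n
    obtain Ly dLy where "has_density Ly dLy \<and>
        (AE t in lborel. 0 \<le> t \<longrightarrow> dLy t \<le> - m0 * E n t - M * (g0 * (P n t)\<^sup>2 - memory k (\<lambda>t. (P n t)\<^sup>2) t)) \<and>
        (\<forall>t\<ge>0. c * E n t \<le> Ly t \<and> Ly t \<le> C * E n t)"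
      using lyap[OF modes[of n]] unfolding E_def by blast
    then show "\<exists>Ld. has_density (fst Ld) (snd Ld) \<and>
        (AE t in lborel. 0 \<le> t \<longrightarrow> snd Ld t \<le> - m0 * E n t - M * (g0 * (P n t)\<^sup>2 - memory k (\<lambda>t. (P n t)\<^sup>2) t)) \<and>
        (\<forall>t\<ge>0. c * E n t \<le> fst Ld t \<and> fst Ld t \<le> C * E n t)"
      by (intro exI[of _ "(Ly, dLy)"]) simp
  qed
  from choice[OF ex] obtain Ld where Ld: "\<forall>n. has_density (fst (Ld n)) (snd (Ld n)) \<and>
        (AE t in lborel. 0 \<le> t \<longrightarrow> snd (Ld n) t \<le> - m0 * E n t - M * (g0 * (P n t)\<^sup>2 - memory k (\<lambda>t. (P n t)\<^sup>2) t)) \<and>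
        (\<forall>t\<ge>0. c * E n t \<le> fst (Ld n) t \<and> fst (Ld n) t \<le> C * E n t)"
    by (elim exE) (rule that)
  interpret L: timoshenko_lyapunov m \<delta> \<rho>1 \<rho>2 b \<kappa> l \<mu> x y \<alpha> \<beta> P hist \<xi> H H' m0 M c C "\<lambda>n. fst (Ld n)" "\<lambda>n. snd (Ld n)"
    by (intro_locales, unfold_locales) (use cpos Ld in auto)
  \<comment> \<open>The first bound makes the tangent line error absorbable, the second one puts the
    initial value below \<open>1 \<le> Z 0\<close>. The summands 1 keep the denominators positive if
    the energy vanishes.\<close>
  define \<epsilon> where "\<epsilon> = min (m0 / (4 * (L.C6 * L.C1 * q0 + 1))) (1 / (q0 * Etot 0 + 1))"
  have n0: "0 \<le> L.C6 * L.C1 * q0" "0 \<le> q0 * Etot 0"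
    using L.C6 L.C1_nonneg q0 Etot_nonneg[of 0] by auto
  have \<epsilon>: "\<epsilon> > 0" unfolding \<epsilon>_def using cpos n0 by simp
  have e1: "\<epsilon> \<le> m0 / (4 * (L.C6 * L.C1 * q0 + 1))" and e2: "\<epsilon> \<le> 1 / (q0 * Etot 0 + 1)" by (auto simp: \<epsilon>_def)
  have small: "L.C6 * L.C1 * (\<epsilon> * q0) \<le> m0 / 4"
  proof -
    have "\<epsilon> * (L.C6 * L.C1 * q0) \<le> \<epsilon> * (L.C6 * L.C1 * q0 + 1)" using \<epsilon> by simp
    also have "\<dots> \<le> m0 / (4 * (L.C6 * L.C1 * q0 + 1)) * (L.C6 * L.C1 * q0 + 1)"
      using e1 n0 by (intro mult_right_mono) auto
    also have "\<dots> = m0 / 4"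
    proof -
      have "m0 / (4 * d) * d = m0 / 4" if "d > 0" for d using that by simp
      then show ?thesis using n0(1) by (metis add_nonneg_pos zero_less_one)
    qed
    finally show ?thesis by (simp add: mult_ac)
  qed
  have ini: "\<epsilon> * (q0 * Etot 0) \<le> 1"
  proof -
    have "\<epsilon> * (q0 * Etot 0) \<le> \<epsilon> * (q0 * Etot 0 + 1)" using \<epsilon> by simp
    also have "\<dots> \<le> 1 / (q0 * Etot 0 + 1) * (q0 * Etot 0 + 1)" using e2 n0 by (intro mult_right_mono) auto
    finally show ?thesis using n0 by simp
  qed
  note hyp = q0 \<epsilon> small ini
  define dl where "dl = \<epsilon> / L.K q0 \<epsilon>"
  have dl: "dl > 0" unfolding dl_def using \<epsilon> L.K_pos[OF hyp] by simp
  note cmp = L.comparison_with_supersolution[OF hyp, folded dl_def, unfolded L.q_def[OF hyp]]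
  show thesis
    by (rule that[of "8 * \<epsilon> * L.C8 / m0" "m0 * dl / (8 * \<epsilon>)" "dl * L.C10"])
       (use cmp \<epsilon> L.C8 cpos dl L.C10[OF hyp] in auto)
qed

section \<open>Orthonormal systems on a bounded interval\<close>

locale interval =
  fixes L :: real
  assumes L_pos: "L > 0"
begin

abbreviation "I \<equiv> {0<..<L}"
abbreviation "M \<equiv> lebesgue_on {0<..<L}"
abbreviation "ip \<equiv> l2_inner L"

lemma set_integral_M: "(LINT x:I|lebesgue. f x) = (LINT x|M. f x)" for f :: "real \<Rightarrow> real"
  unfolding set_lebesgue_integral_def by (simp add: integral_restrict_space)

lemma set_integrable_M: "set_integrable lebesgue I f \<longleftrightarrow> integrable M f" for f :: "real \<Rightarrow> real"
  unfolding set_integrable_def by (simp add: integrable_restrict_space)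

lemma finite_measure_M: "finite_measure M"
  by (rule finite_measureI) (use L_pos in \<open>simp add: emeasure_restrict_space emeasure_lborel_Ioo\<close>)

lemma integrable_const_M: "integrable M (\<lambda>x. c :: real)"
  by (rule finite_measure.integrable_const[OF finite_measure_M])

lemma L2_iff: "L2 L u \<longleftrightarrow> u \<in> borel_measurable M \<and> integrable M (\<lambda>x. (u x)\<^sup>2)"
  unfolding L2_def set_integrable_M set_borel_measurable_def
  by (simp add: borel_measurable_restrict_space_iff)

lemma L2_measurable: "L2 L u \<Longrightarrow> u \<in> borel_measurable M"
  by (simp add: L2_iff)

lemma ip_eq: "ip u v = (LINT x|M. u x * v x)"
  unfolding l2_inner_def by (rule set_integral_M)

lemma ip_commute: "ip u v = ip v u" by (simp add: ip_eq mult.commute)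

lemma l2_norm_sq: "(l2_norm L u)\<^sup>2 = ip u u"
  unfolding l2_norm_def set_integral_M ip_eq by (simp add: power2_eq_square real_sqrt_pow2 integral_nonneg_AE)

lemma l2_norm_nonneg: "0 \<le> l2_norm L u"
  unfolding l2_norm_def set_integral_M by (simp add: integral_nonneg_AE)

lemma ip_self_nonneg: "0 \<le> ip u u"
  unfolding l2_norm_sq[symmetric] by simp

lemma prod_integrable:
  assumes "L2 L u" "L2 L v" shows "integrable M (\<lambda>x. u x * v x)"
proof (rule Bochner_Integration.integrable_bound)
  show "integrable M (\<lambda>x. (u x)\<^sup>2 + (v x)\<^sup>2)" using assms by (simp add: L2_iff)
  show "(\<lambda>x. u x * v x) \<in> borel_measurable M" using assms[THEN L2_measurable] by simp
  show "AE x in M. norm (u x * v x) \<le> norm ((u x)\<^sup>2 + (v x)\<^sup>2)"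
  proof (rule AE_I2)
    fix x show "norm (u x * v x) \<le> norm ((u x)\<^sup>2 + (v x)\<^sup>2)"
      using young_eps[of "1/2" "u x" "v x"] zero_le_power2[of "u x"] zero_le_power2[of "v x"] by simp
  qed
qed

lemma L2_scale: "L2 L u \<Longrightarrow> L2 L (\<lambda>x. c * u x)"
  by (auto simp: L2_iff power_mult_distrib)

lemma L2_add: assumes "L2 L u" "L2 L v" shows "L2 L (\<lambda>x. u x + v x)"
proof -
  have "integrable M (\<lambda>x. (u x)\<^sup>2 + 2 * (u x * v x) + (v x)\<^sup>2)"
    using prod_integrable[OF assms] assms by (simp add: L2_iff)
  moreover have "(\<lambda>x. u x + v x) \<in> borel_measurable M" using assms[THEN L2_measurable] by simp
  ultimately show ?thesis by (simp add: L2_iff power2_sum algebra_simps)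
qed

lemma L2_diff: assumes "L2 L u" "L2 L v" shows "L2 L (\<lambda>x. u x - v x)"
  using L2_add[OF assms(1) L2_scale[OF assms(2), of "-1"]] by simp

lemma L2_sum: assumes "\<And>n. n < N \<Longrightarrow> L2 L (f n)" shows "L2 L (\<lambda>x. \<Sum>n<(N::nat). f n x)"
  using assms by (induction N) (auto simp: L2_iff[of "\<lambda>x. 0"] intro!: L2_add)

lemma L2_bounded:
  assumes "u \<in> borel_measurable M" "\<And>x. x \<in> I \<Longrightarrow> \<bar>u x\<bar> \<le> B" shows "L2 L u"
  unfolding L2_iff
proof
  show "integrable M (\<lambda>x. (u x)\<^sup>2)"
  proof (rule Bochner_Integration.integrable_bound[OF integrable_const_M[of "B\<^sup>2"]])
    show "AE x in M. norm ((u x)\<^sup>2) \<le> norm (B\<^sup>2)"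
      by (rule AE_I2) (use assms(2) in \<open>auto simp: abs_le_square_iff[symmetric] intro: order_trans[OF _ abs_ge_self]\<close>)
  qed (use assms in auto)
qed (rule assms)

lemma L2_bdd_continuous:
  assumes "continuous_on I u" "\<And>x. x \<in> I \<Longrightarrow> \<bar>u x\<bar> \<le> B" shows "L2 L u"
  using assms by (intro L2_bounded continuous_imp_measurable_on_sets_lebesgue) auto

lemma L2_continuous: assumes "continuous_on {0..L} u" shows "L2 L u"
proof -
  have "bounded (u ` {0..L})" by (intro compact_imp_bounded compact_continuous_image assms) auto
  then obtain B where B: "\<forall>x\<in>{0..L}. \<bar>u x\<bar> \<le> B" by (auto simp: bounded_iff)
  then show ?thesis by (intro L2_bdd_continuous[of _ B] continuous_on_subset[OF assms]) (use B in auto)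
qed

lemma ip_add_left: "L2 L u \<Longrightarrow> L2 L v \<Longrightarrow> L2 L w \<Longrightarrow> ip (\<lambda>x. u x + v x) w = ip u w + ip v w"
  unfolding ip_eq distrib_right by (rule Bochner_Integration.integral_add) (auto intro: prod_integrable)

lemma ip_diff_left: "L2 L u \<Longrightarrow> L2 L v \<Longrightarrow> L2 L w \<Longrightarrow> ip (\<lambda>x. u x - v x) w = ip u w - ip v w"
  unfolding ip_eq left_diff_distrib by (rule Bochner_Integration.integral_diff) (auto intro: prod_integrable)

lemma ip_scale_left: "ip (\<lambda>x. c * u x) w = c * ip u w"
  unfolding ip_eq by (simp add: mult.assoc)

lemma ip_diff_right: "L2 L u \<Longrightarrow> L2 L v \<Longrightarrow> L2 L w \<Longrightarrow> ip w (\<lambda>x. u x - v x) = ip w u - ip w v"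
  by (simp add: ip_commute[of w] ip_diff_left)

lemma ip_scale_right: "ip w (\<lambda>x. c * u x) = c * ip w u"
  by (simp add: ip_commute[of w] ip_scale_left)

lemma ip_sum_right:
  assumes "\<And>n. n < N \<Longrightarrow> L2 L (f n)" "L2 L w"
  shows "ip w (\<lambda>x. \<Sum>n<(N::nat). f n x) = (\<Sum>n<N. ip w (f n))"
proof -
  have "ip w (\<lambda>x. \<Sum>n<N. f n x) = (LINT x|M. (\<Sum>n<N. w x * f n x))" by (simp add: ip_eq sum_distrib_left)
  also have "\<dots> = (\<Sum>n<N. ip w (f n))" unfolding ip_eq
    by (rule Bochner_Integration.integral_sum) (auto intro: prod_integrable assms)
  finally show ?thesis .
qed

lemma norm_diff_sq:
  assumes "L2 L u" "L2 L v"
  shows "ip (\<lambda>x. u x - v x) (\<lambda>x. u x - v x) = ip u u - 2 * ip u v + ip v v"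
  using assms L2_diff[OF assms] by (simp add: ip_diff_left ip_diff_right ip_commute[of v u])

lemma cauchy_schwarz_sq:
  assumes "L2 L u" "L2 L v" shows "(ip u v)\<^sup>2 \<le> ip v v * ip u u"
proof (rule quadratic_discriminant)
  fix c
  have "0 \<le> ip (\<lambda>x. u x - c * v x) (\<lambda>x. u x - c * v x)" by (rule ip_self_nonneg)
  then show "0 \<le> ip u u - 2 * c * ip u v + c\<^sup>2 * ip v v"
    using assms by (simp add: norm_diff_sq L2_scale ip_scale_left ip_scale_right power2_eq_square algebra_simps)
qed (rule ip_self_nonneg)

lemma cauchy_schwarz:
  assumes "L2 L u" "L2 L v" shows "\<bar>ip u v\<bar> \<le> l2_norm L u * l2_norm L v"
proof (rule power2_le_imp_le)
  show "\<bar>ip u v\<bar>\<^sup>2 \<le> (l2_norm L u * l2_norm L v)\<^sup>2"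
    using cauchy_schwarz_sq[OF assms] by (simp add: power_mult_distrib l2_norm_sq mult.commute)
qed (simp add: l2_norm_nonneg)

lemma ip_tendsto:
  assumes "\<And>n. L2 L (u n)" "L2 L v" "L2 L w" and lim: "((\<lambda>n. l2_norm L (\<lambda>x. u n x - v x)) \<longlongrightarrow> 0) F"
  shows "((\<lambda>n. ip (u n) w) \<longlongrightarrow> ip v w) F"
proof -
  have "((\<lambda>n. ip (u n) w - ip v w) \<longlongrightarrow> 0) F"
  proof (rule Lim_null_comparison)
    show "\<forall>\<^sub>F n in F. norm (ip (u n) w - ip v w) \<le> l2_norm L (\<lambda>x. u n x - v x) * l2_norm L w"
      using cauchy_schwarz[OF L2_diff[OF assms(1,2)] assms(3)] by (intro always_eventually) (simp add: ip_diff_left assms)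
    show "((\<lambda>n. l2_norm L (\<lambda>x. u n x - v x) * l2_norm L w) \<longlongrightarrow> 0) F" using tendsto_mult_left_zero[OF lim] .
  qed
  then show ?thesis by (simp add: LIM_zero_iff)
qed

lemma triangle_sq: "ip (\<lambda>x. u x - w x) (\<lambda>x. u x - w x) \<le> 2 * ip (\<lambda>x. u x - v x) (\<lambda>x. u x - v x) + 2 * ip (\<lambda>x. v x - w x) (\<lambda>x. v x - w x)"
  if "L2 L u" "L2 L v" "L2 L w"
proof -
  have i: "integrable M (\<lambda>x. (f x - h x) * (f x - h x))" if "L2 L f" "L2 L h" for f h
    using prod_integrable[OF L2_diff[OF that] L2_diff[OF that]] .
  have "ip (\<lambda>x. u x - w x) (\<lambda>x. u x - w x) \<le> (LINT x|M. 2 * ((u x - v x) * (u x - v x)) + 2 * ((v x - w x) * (v x - w x)))"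
    unfolding ip_eq
  proof (rule integral_mono)
    fix x
    show "(u x - w x) * (u x - w x) \<le> 2 * ((u x - v x) * (u x - v x)) + 2 * ((v x - w x) * (v x - w x))"
      using zero_le_square[of "(u x - v x) - (v x - w x)"] by (simp add: algebra_simps)
  qed (use i that in auto)
  also have "\<dots> = 2 * ip (\<lambda>x. u x - v x) (\<lambda>x. u x - v x) + 2 * ip (\<lambda>x. v x - w x) (\<lambda>x. v x - w x)"
    unfolding ip_eq using i that by simp
  finally show ?thesis .
qed

lemma ip_continuous:
  assumes "continuous_on {0..L} u" "continuous_on {0..L} v"
  shows "ip u v = integral {0..L} (\<lambda>x. u x * v x)"
proof -
  have "integrable M (\<lambda>x. u x * v x)" by (rule prod_integrable) (intro L2_continuous assms)+
  then have "(\<lambda>x. u x * v x) absolutely_integrable_on I" by (simp add: set_integrable_M)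
  then have "ip u v = integral I (\<lambda>x. u x * v x)"
    unfolding l2_inner_def by (rule set_lebesgue_integral_eq_integral(2))
  then show ?thesis by (simp add: integral_open_interval_real)
qed

lemma dominated_L2:
  assumes u: "L2 L u" and m: "\<And>n. f n \<in> borel_measurable M"
    and lim: "AE x in M. (\<lambda>n. f n x) \<longlonglongrightarrow> u x"
    and bd: "\<And>n. AE x in M. \<bar>f n x - u x\<bar> \<le> B x" and B: "L2 L B"
  shows "(\<lambda>n. ip (\<lambda>x. f n x - u x) (\<lambda>x. f n x - u x)) \<longlonglongrightarrow> 0"
proof -
  have "(\<lambda>n. LINT x|M. (f n x - u x) * (f n x - u x)) \<longlonglongrightarrow> (LINT x|M. 0)"
  proof (rule integral_dominated_convergence[where w="\<lambda>x. (B x)\<^sup>2"])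
    show "AE x in M. (\<lambda>n. (f n x - u x) * (f n x - u x)) \<longlonglongrightarrow> 0"
      using lim by eventually_elim (use LIM_zero tendsto_mult_zero in blast)
    show "AE x in M. norm ((f n x - u x) * (f n x - u x)) \<le> (B x)\<^sup>2" for n
      using bd[of n]
    proof eventually_elim
      case (elim x)
      then have "\<bar>f n x - u x\<bar> * \<bar>f n x - u x\<bar> \<le> B x * B x" by (intro mult_mono) auto
      then show ?case by (simp add: abs_mult power2_eq_square)
    qed
  qed (use u m B in \<open>auto simp: L2_iff\<close>)
  then show ?thesis by (simp add: ip_eq)
qed

section \<open>Density of continuous functions\<close>

definition clip :: "real \<Rightarrow> real \<Rightarrow> real" where "clip K y = max (- K) (min K y)"

lemma clip_cont: "continuous_on S f \<Longrightarrow> continuous_on S (\<lambda>x. clip K (f x))"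
  unfolding clip_def by (intro continuous_intros)

lemma clip_bound: "K \<ge> 0 \<Longrightarrow> \<bar>clip K y\<bar> \<le> K" by (auto simp: clip_def)
lemma clip_le: "K \<ge> 0 \<Longrightarrow> \<bar>clip K y\<bar> \<le> \<bar>y\<bar>" "K \<ge> 0 \<Longrightarrow> \<bar>clip K y - y\<bar> \<le> \<bar>y\<bar>" by (auto simp: clip_def)
lemma clip_tendsto_self: "(\<lambda>n. clip (real n) y) \<longlonglongrightarrow> y"
proof (rule tendsto_eventually)
  obtain N :: nat where "\<bar>y\<bar> \<le> real N" using real_arch_simple by blast
  then show "\<forall>\<^sub>F n in sequentially. clip (real n) y = y"
    unfolding eventually_sequentially clip_def by (intro exI[of _ N]) auto
qed

definition approximable :: "(real \<Rightarrow> real) set \<Rightarrow> (real \<Rightarrow> real) \<Rightarrow> bool" where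
  "approximable A u \<longleftrightarrow> (\<forall>e>0. \<exists>f\<in>A. L2 L f \<and> ip (\<lambda>x. u x - f x) (\<lambda>x. u x - f x) < e)"

lemma approximable_trans:
  assumes u: "L2 L u" and 1: "\<And>e. e > 0 \<Longrightarrow> \<exists>v. L2 L v \<and> approximable A v \<and> ip (\<lambda>x. u x - v x) (\<lambda>x. u x - v x) < e"
  shows "approximable A u"
  unfolding approximable_def
proof (intro allI impI)
  fix e :: real assume e: "e > 0"
  obtain v where v: "L2 L v" "approximable A v" "ip (\<lambda>x. u x - v x) (\<lambda>x. u x - v x) < e / 4" using 1[of "e/4"] e by auto
  obtain f where f: "f \<in> A" "L2 L f" "ip (\<lambda>x. v x - f x) (\<lambda>x. v x - f x) < e / 4"
    using v(2) e unfolding approximable_def by (meson divide_pos_pos zero_less_numeral)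
  show "\<exists>f\<in>A. L2 L f \<and> ip (\<lambda>x. u x - f x) (\<lambda>x. u x - f x) < e"
    using triangle_sq[OF u v(1) f(2)] v(3) f by (intro bexI[of _ f]) auto
qed

lemma ip_diff_swap: "ip (\<lambda>x. u x - v x) (\<lambda>x. u x - v x) = ip (\<lambda>x. v x - u x) (\<lambda>x. v x - u x)"
  unfolding ip_eq by (intro Bochner_Integration.integral_cong) (auto simp: algebra_simps)

lemma approximable_limit:
  assumes u: "L2 L u" and v: "\<And>n. L2 L (v n)" "\<And>n. approximable A (v n)"
    and lim: "(\<lambda>n. ip (\<lambda>x. v n x - u x) (\<lambda>x. v n x - u x)) \<longlonglongrightarrow> 0"
  shows "approximable A u"
proof (rule approximable_trans[OF u])
  fix e :: real assume e: "e > 0"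
  obtain n where "ip (\<lambda>x. v n x - u x) (\<lambda>x. v n x - u x) < e"
    using order_tendstoD(2)[OF lim e] unfolding eventually_sequentially by blast
  then show "\<exists>v. L2 L v \<and> approximable A v \<and> ip (\<lambda>x. u x - v x) (\<lambda>x. u x - v x) < e"
    using v by (intro exI[of _ "v n"]) (simp add: ip_diff_swap[of u])
qed

text \<open>The extension of \<open>u\<close> by 0 is a limit of continuous functions outside a null
  set. Clipping at level \<open>k\<close> supplies the bound for dominated convergence, and a second
  limit in \<open>k\<close> removes the clipping.\<close>

lemma L2_approximable:
  assumes cont: "\<And>f. continuous_on {0..L} f \<Longrightarrow> approximable A f" and u: "L2 L u"
  shows "approximable A u"
proof -
  have um: "u \<in> borel_measurable M" using u by (simp add: L2_iff)
  have "(\<lambda>x. if x \<in> I then u x else 0) \<in> borel_measurable lebesgue"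
    by (rule borel_measurable_if_I[OF um]) simp
  then have "(\<lambda>x. if x \<in> I then u x else 0) measurable_on UNIV"
    by (intro lebesgue_measurable_imp_measurable_on_real) auto
  then obtain N g where N: "negligible N" and g: "\<And>n. continuous_on UNIV (g n)"
    and gl: "\<And>x. x \<notin> N \<Longrightarrow> (\<lambda>n. g n x) \<longlonglongrightarrow> (if x \<in> I then u x else 0)"
    unfolding measurable_on_def by auto
  have "AE x in lebesgue. x \<notin> N" using N by (simp add: negligible_iff_null_sets AE_not_in)
  then have aeN: "AE x in M. x \<notin> N" by (subst AE_restrict_space_iff) auto
  have cm: "(\<lambda>x. clip K (f x)) \<in> borel_measurable M" if "f \<in> borel_measurable M" for K f
    unfolding clip_def using that by simp
  have clipL2: "L2 L (\<lambda>x. clip (real k) (u x))" for k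
    by (rule L2_bounded[OF cm[OF um], of _ "real k"]) (simp add: clip_bound)
  have appk: "approximable A (\<lambda>x. clip (real k) (u x))" for k :: nat
  proof (rule approximable_limit[OF clipL2])
    have c: "continuous_on S (\<lambda>x. clip (real k) (g n x))" for n S
      by (rule clip_cont[OF continuous_on_subset[OF g]]) auto
    show "L2 L (\<lambda>x. clip (real k) (g n x))" for n by (rule L2_continuous[OF c])
    show "approximable A (\<lambda>x. clip (real k) (g n x))" for n by (rule cont[OF c])
    show "(\<lambda>n. ip (\<lambda>x. clip (real k) (g n x) - clip (real k) (u x)) (\<lambda>x. clip (real k) (g n x) - clip (real k) (u x))) \<longlonglongrightarrow> 0"
    proof (rule dominated_L2[OF clipL2, where B="\<lambda>x. 2 * real k"])
      show "(\<lambda>x. clip (real k) (g n x)) \<in> borel_measurable M" for n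
        by (intro continuous_imp_measurable_on_sets_lebesgue c) auto
      have "AE x in M. x \<in> I" by (rule AE_I2) simp
      with aeN show "AE x in M. (\<lambda>n. clip (real k) (g n x)) \<longlonglongrightarrow> clip (real k) (u x)"
      proof eventually_elim
        case (elim x)
        then have "(\<lambda>n. g n x) \<longlonglongrightarrow> u x" using gl[of x] by simp
        then show ?case unfolding clip_def by (intro tendsto_intros)
      qed
      show "AE x in M. \<bar>clip (real k) (g n x) - clip (real k) (u x)\<bar> \<le> 2 * real k" for n
      proof (rule AE_I2)
        fix x show "\<bar>clip (real k) (g n x) - clip (real k) (u x)\<bar> \<le> 2 * real k"
          using clip_bound[of "real k" "g n x"] clip_bound[of "real k" "u x"] by (auto simp: abs_le_iff)
      qed
      show "L2 L (\<lambda>x. 2 * real k)" by (rule L2_continuous) simp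
    qed
  qed
  show ?thesis
  proof (rule approximable_limit[OF u clipL2 appk])
    show "(\<lambda>n. ip (\<lambda>x. clip (real n) (u x) - u x) (\<lambda>x. clip (real n) (u x) - u x)) \<longlonglongrightarrow> 0"
    proof (rule dominated_L2[OF u, where B="\<lambda>x. \<bar>u x\<bar>"])
      show "L2 L (\<lambda>x. \<bar>u x\<bar>)" using u by (auto simp: L2_iff)
      show "(\<lambda>x. clip (real n) (u x)) \<in> borel_measurable M" for n by (rule cm[OF um])
      show "AE x in M. (\<lambda>n. clip (real n) (u x)) \<longlonglongrightarrow> u x" by (intro AE_I2 clip_tendsto_self)
      show "AE x in M. \<bar>clip (real n) (u x) - u x\<bar> \<le> \<bar>u x\<bar>" for n by (intro AE_I2 clip_le) simp
    qed
  qed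
qed

section \<open>Inequalities of Bessel and Parseval type\<close>

definition orthonormal :: "(nat \<Rightarrow> real \<Rightarrow> real) \<Rightarrow> bool" where
  "orthonormal e \<longleftrightarrow> (\<forall>n. L2 L (e n)) \<and> (\<forall>i j. ip (e i) (e j) = (if i = j then 1 else 0))"

text \<open>Pythagoras. The Fourier coefficients as \<open>c\<close> give Bessel's inequality; for
  arbitrary \<open>c\<close> the identity shows that they are the best choice.\<close>

lemma projection_sq:
  assumes e: "orthonormal e" and u: "L2 L u"
  shows "ip (\<lambda>x. u x - (\<Sum>n<N. c n * e n x)) (\<lambda>x. u x - (\<Sum>n<N. c n * e n x))
     = ip u u - (\<Sum>n<N. (ip u (e n))\<^sup>2) + (\<Sum>n<N. (ip u (e n) - c n)\<^sup>2)"
proof -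
  have eL: "L2 L (e n)" for n using e by (simp add: orthonormal_def)
  have ceL: "L2 L (\<lambda>x. c n * e n x)" for n using eL by (rule L2_scale)
  have sL: "L2 L (\<lambda>x. \<Sum>n<N. c n * e n x)" by (rule L2_sum) (rule ceL)
  have uS: "ip u (\<lambda>x. \<Sum>n<N. c n * e n x) = (\<Sum>n<N. c n * ip u (e n))"
    by (simp add: ip_sum_right[OF ceL u] ip_scale_right)
  have "ip (\<lambda>x. \<Sum>n<N. c n * e n x) (e k) = (if k < N then c k else 0)" for k
  proof -
    have "ip (e k) (\<lambda>x. \<Sum>n<N. c n * e n x) = (\<Sum>n<N. c n * (if k = n then 1 else 0))"
      using e by (simp add: ip_sum_right[OF ceL eL] ip_scale_right orthonormal_def)
    also have "\<dots> = (if k < N then c k else 0)" by (simp add: if_distrib cong: if_cong)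
    finally show ?thesis by (simp add: ip_commute)
  qed
  then have SS: "ip (\<lambda>x. \<Sum>n<N. c n * e n x) (\<lambda>x. \<Sum>n<N. c n * e n x) = (\<Sum>n<N. (c n)\<^sup>2)"
    by (simp add: ip_sum_right[OF ceL sL] ip_scale_right power2_eq_square)
  show ?thesis unfolding norm_diff_sq[OF u sL] uS SS
    by (simp add: power2_diff sum.distrib sum_subtractf sum_distrib_left algebra_simps)
qed

lemma bessel:
  assumes "orthonormal e" "L2 L u" shows "(\<Sum>n<N. (ip u (e n))\<^sup>2) \<le> ip u u"
  using projection_sq[OF assms, where N=N and c="\<lambda>n. ip u (e n)"]
    ip_self_nonneg[of "\<lambda>x. u x - (\<Sum>n<N. ip u (e n) * e n x)"] by simp

text \<open>No combination of the first \<open>N\<close> basis elements comes closer to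
  \<open>u\<close> than the Fourier sum, whose squared error is the defect in Bessel's inequality.
  Approximability makes this defect vanish in the limit.\<close>

lemma parseval:
  assumes e: "orthonormal e" and u: "L2 L u" and app: "approximable {f. \<exists>N c. \<forall>x. f x = (\<Sum>n<N. c n * e n x)} u"
  shows "(\<lambda>n. (ip u (e n))\<^sup>2) sums ip u u"
proof -
  have s: "summable (\<lambda>n. (ip u (e n))\<^sup>2)"
    by (rule summableI_nonneg_bounded[where x="ip u u"]) (auto intro: bessel[OF e u])
  have le: "(\<Sum>n. (ip u (e n))\<^sup>2) \<le> ip u u" by (rule suminf_le_const[OF s]) (rule bessel[OF e u])
  have "ip u u \<le> (\<Sum>n. (ip u (e n))\<^sup>2) + d" if d0: "d > 0" for d
  proof -
    obtain f where f0: "f \<in> {f. \<exists>N c. \<forall>x. f x = (\<Sum>n<N. c n * e n x)}" "ip (\<lambda>x. u x - f x) (\<lambda>x. u x - f x) < d"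
      using app d0 unfolding approximable_def by blast
    then obtain N c where f: "\<forall>x. f x = (\<Sum>n<N. c n * e n x)" "ip (\<lambda>x. u x - f x) (\<lambda>x. u x - f x) < d"
      by blast
    have "f = (\<lambda>x. \<Sum>n<N. c n * e n x)" using f(1) by auto
    then have "ip u u - (\<Sum>n<N. (ip u (e n))\<^sup>2) + (\<Sum>n<N. (ip u (e n) - c n)\<^sup>2) < d"
      using f(2) projection_sq[OF e u, where N=N and c=c] by simp
    moreover have "0 \<le> (\<Sum>n<N. (ip u (e n) - c n)\<^sup>2)" by (intro sum_nonneg) auto
    moreover have "(\<Sum>n<N. (ip u (e n))\<^sup>2) \<le> (\<Sum>n. (ip u (e n))\<^sup>2)" by (rule sum_le_suminf[OF s]) auto
    ultimately show ?thesis by linarith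
  qed
  then have "ip u u \<le> (\<Sum>n. (ip u (e n))\<^sup>2)" by (rule field_le_epsilon)
  then show ?thesis using le summable_sums[OF s] by simp
qed

end

section \<open>The sine and cosine bases\<close>

definition fin_span :: "(nat \<Rightarrow> real \<Rightarrow> real) \<Rightarrow> (real \<Rightarrow> real) set" where
  "fin_span e = {f. \<exists>N c. \<forall>x. f x = (\<Sum>n<N. c n * e n x)}"

lemma fin_spanI: "(\<And>x. f x = (\<Sum>n<N. c n * e n x)) \<Longrightarrow> f \<in> fin_span e"
  unfolding fin_span_def by blast

lemma fin_span_base: "(\<lambda>x. c * e n x) \<in> fin_span e"
proof -
  have "c * e n x = (\<Sum>i<Suc n. (if i = n then c else 0) * e i x)" for x
    by (simp add: if_distrib[of "\<lambda>z. z * _"] cong: if_cong)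
  then show ?thesis by (rule fin_spanI)
qed

lemma fin_span_scale: "f \<in> fin_span e \<Longrightarrow> (\<lambda>x. a * f x) \<in> fin_span e"
proof -
  assume "f \<in> fin_span e"
  then obtain N c where "\<forall>x. f x = (\<Sum>n<N. c n * e n x)" unfolding fin_span_def by blast
  then have "a * f x = (\<Sum>n<N. (a * c n) * e n x)" for x by (simp add: sum_distrib_left mult.assoc)
  then show ?thesis by (rule fin_spanI)
qed

lemma fin_span_zero: "(\<lambda>x. 0) \<in> fin_span e"
  unfolding fin_span_def by (auto intro!: exI[of _ 0])

lemma fin_span_add:
  assumes "f \<in> fin_span e" "h \<in> fin_span e" shows "(\<lambda>x. f x + h x) \<in> fin_span e"
proof -
  obtain N c where f: "\<And>x. f x = (\<Sum>n<N. c n * e n x)" using assms unfolding fin_span_def by blast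
  obtain N' c' where h: "\<And>x. h x = (\<Sum>n<N'. c' n * e n x)" using assms unfolding fin_span_def by blast
  have ext: "(\<Sum>n<K. d n * e n x) = (\<Sum>n<K + J. (if n < K then d n else 0) * e n x)" for K J d x
    by (rule sum.mono_neutral_cong_left) auto
  have "f x + h x = (\<Sum>n<N + N'. ((if n < N then c n else 0) + (if n < N' then c' n else 0)) * e n x)" for x
    unfolding f h ext[where d=c and K=N and J=N'] ext[where d=c' and K=N' and J=N] by (simp add: sum.distrib distrib_right add.commute)
  then show ?thesis by (rule fin_spanI)
qed

lemma fin_span_sum: "(\<And>i. i \<in> A \<Longrightarrow> f i \<in> fin_span e) \<Longrightarrow> (\<lambda>x. \<Sum>i\<in>A. f i x) \<in> fin_span e"
  by (induction A rule: infinite_finite_induct) (auto intro: fin_span_zero fin_span_add)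

context interval
begin

text \<open>The index is shifted: \<open>n = 0\<close> has frequency \<open>pi / L\<close>, so that
  every mode has positive frequency. The constant function occurs only as
  \<open>cc 0\<close>.\<close>

definition freq :: "nat \<Rightarrow> real" where "freq n = real (Suc n) * pi / L"
definition sn :: "nat \<Rightarrow> real \<Rightarrow> real" where "sn n x = sqrt (2 / L) * sin (freq n * x)"
definition cn :: "nat \<Rightarrow> real \<Rightarrow> real" where "cn n x = sqrt (2 / L) * cos (freq n * x)"
definition cc :: "nat \<Rightarrow> real \<Rightarrow> real" where
  "cc n x = (case n of 0 \<Rightarrow> sqrt (1 / L) | Suc k \<Rightarrow> cn k x)"

lemma freq_pos: "freq n > 0" using L_pos by (simp add: freq_def)

lemma freq_lower: "1 / freq n \<le> L / pi"
proof -
  have "L / (real (Suc n) * pi) \<le> L / (1 * pi)" using L_pos by (intro divide_left_mono mult_right_mono mult_pos_pos) auto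
  then show ?thesis by (simp add: freq_def)
qed

lemma sn_cont: "continuous_on S (sn n)" and cn_cont: "continuous_on S (cn n)"
  unfolding sn_def[abs_def] cn_def[abs_def] by (intro continuous_intros)+

lemma cc_cont: "continuous_on S (cc n)"
  unfolding cc_def[abs_def] by (cases n) (auto simp: cn_cont)

lemma L2_sn: "L2 L (sn n)" and L2_cn: "L2 L (cn n)" and L2_cc: "L2 L (cc n)"
  by (intro L2_continuous sn_cont cn_cont cc_cont)+

lemma sn_deriv: "(sn n has_real_derivative freq n * cn n x) (at x)"
  unfolding sn_def[abs_def] cn_def by (auto intro!: derivative_eq_intros)

lemma cn_deriv: "(cn n has_real_derivative - freq n * sn n x) (at x)"
  unfolding cn_def[abs_def] sn_def by (auto intro!: derivative_eq_intros)

lemma cos_integral: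
  "((\<lambda>x. cos (of_int j * pi * x / L)) has_integral (if j = 0 then L else 0)) {0..L}" for j :: int
proof (cases "j = 0")
  case True then show ?thesis using has_integral_const_real[of "1::real" 0 L] L_pos by simp
next
  case False
  define w where "w = of_int j * pi / L"
  have w: "w \<noteq> 0" using False L_pos by (simp add: w_def)
  have "((\<lambda>x. cos (w * x)) has_integral (sin (w * L) / w - sin (w * 0) / w)) {0..L}"
    using L_pos w by (intro fundamental_theorem_of_calculus)
      (auto simp: has_real_derivative_iff_has_vector_derivative[symmetric] intro!: derivative_eq_intros)
  moreover have "sin (w * L) = 0"
    unfolding w_def sin_zero_iff_int2 using L_pos by (intro exI[of _ j]) simp
  moreover have "(\<lambda>x. cos (w * x)) = (\<lambda>x. cos (of_int j * pi * x / L))" by (simp add: w_def)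
  ultimately show ?thesis using False by simp
qed

lemma cos_pair_integral:
  fixes i j :: nat
  shows "((\<lambda>x. cos (real i * pi * x / L) * cos (real j * pi * x / L)) has_integral
      ((if i = j then L / 2 else 0) + (if i + j = 0 then L / 2 else 0))) {0..L}" (is ?c)
    and "((\<lambda>x. sin (real i * pi * x / L) * sin (real j * pi * x / L)) has_integral
      ((if i = j then L / 2 else 0) - (if i + j = 0 then L / 2 else 0))) {0..L}" (is ?s)
proof -
  define a where "a x = real i * pi * x / L" for x
  define d where "d x = real j * pi * x / L" for x
  have e: "cos (of_int (int i - int j) * pi * x / L) = cos (a x - d x)" "cos (of_int (int i + int j) * pi * x / L) = cos (a x + d x)" for x
    by (simp_all add: a_def d_def algebra_simps diff_divide_distrib add_divide_distrib)
  note c = cos_integral[of "int i - int j", unfolded e] and s = cos_integral[of "int i + int j", unfolded e]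
  have "((\<lambda>x. (cos (a x - d x) + cos (a x + d x)) / 2) has_integral
     (((if i = j then L else 0) + (if i + j = 0 then L else 0)) / 2)) {0..L}"
    using has_integral_divide[OF has_integral_add[OF c s], of 2] by (simp only: right_minus_eq of_nat_eq_iff of_nat_add[symmetric] of_nat_eq_0_iff)
  then show ?c unfolding a_def[symmetric] d_def[symmetric] cos_times_cos by (auto simp: add_divide_distrib split: if_splits)
  have "((\<lambda>x. (cos (a x - d x) - cos (a x + d x)) / 2) has_integral
     (((if i = j then L else 0) - (if i + j = 0 then L else 0)) / 2)) {0..L}"
    using has_integral_divide[OF has_integral_diff[OF c s], of 2] by (simp only: right_minus_eq of_nat_eq_iff of_nat_add[symmetric] of_nat_eq_0_iff)
  then show ?s unfolding a_def[symmetric] d_def[symmetric] sin_times_sin by (auto simp: diff_divide_distrib split: if_splits)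
qed

lemma cc_alt: "cc n x = (if n = 0 then sqrt (1 / L) else sqrt (2 / L)) * cos (real n * pi * x / L)"
  by (cases n) (simp_all add: cc_def cn_def freq_def)

lemma sn_alt: "sn n x = sqrt (2 / L) * sin (real (Suc n) * pi * x / L)"
  by (simp add: sn_def freq_def)

lemma orthonormal_sn: "orthonormal sn"
  unfolding orthonormal_def
proof (intro conjI allI L2_sn)
  fix i j
  have r: "sqrt (2 / L) * sqrt (2 / L) = 2 / L" using L_pos by (simp add: real_sqrt_mult_self)
  have "ip (sn i) (sn j) = integral {0..L} (\<lambda>x. 2 / L * (sin (real (Suc i) * pi * x / L) * sin (real (Suc j) * pi * x / L)))"
    unfolding ip_continuous[OF sn_cont sn_cont]
  proof (rule arg_cong[of _ _ "integral {0..L}"], rule ext)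
    fix x
    have "sn i x * sn j x = (sqrt (2 / L) * sqrt (2 / L)) * (sin (real (Suc i) * pi * x / L) * sin (real (Suc j) * pi * x / L))"
      unfolding sn_alt by (simp only: mult_ac)
    then show "sn i x * sn j x = 2 / L * (sin (real (Suc i) * pi * x / L) * sin (real (Suc j) * pi * x / L))"
      unfolding r .
  qed
  also have "\<dots> = 2 / L * (if Suc i = Suc j then L / 2 else 0)"
    using integral_unique[OF has_integral_mult_right[OF cos_pair_integral(2)[of "Suc i" "Suc j"], of "2 / L"]] by simp
  also have "\<dots> = (if i = j then 1 else 0)" using L_pos by simp
  finally show "ip (sn i) (sn j) = (if i = j then 1 else 0)" .
qed

lemma orthonormal_cc: "orthonormal cc"
  unfolding orthonormal_def
proof (intro conjI allI L2_cc)
  fix i j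
  define a where "a n = (if n = 0 then sqrt (1 / L) else sqrt (2 / L))" for n :: nat
  have "ip (cc i) (cc j) = integral {0..L} (\<lambda>x. (a i * a j) * (cos (real i * pi * x / L) * cos (real j * pi * x / L)))"
    unfolding ip_continuous[OF cc_cont cc_cont] cc_alt a_def[symmetric] by (simp only: mult_ac)
  also have "\<dots> = (a i * a j) * ((if i = j then L / 2 else 0) + (if i + j = 0 then L / 2 else 0))"
    using integral_unique[OF has_integral_mult_right[OF cos_pair_integral(1)[of i j], of "a i * a j"]] by simp
  also have "\<dots> = (if i = j then 1 else 0)" using L_pos by (auto simp: a_def real_sqrt_mult_self)
  finally show "ip (cc i) (cc j) = (if i = j then 1 else 0)" .
qed

section \<open>Completeness of the cosines and sines\<close>

lemma cos_in_span: "(\<lambda>x. c * cos (real n * pi * x / L)) \<in> fin_span cc"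
proof -
  define a where "a = (if n = 0 then sqrt (1 / L) else sqrt (2 / L))"
  have "a \<noteq> 0" using L_pos by (simp add: a_def)
  then have "(\<lambda>x. c * cos (real n * pi * x / L)) = (\<lambda>x. (c / a) * cc n x)" by (auto simp: cc_alt a_def[symmetric])
  then show ?thesis by (simp only: fin_span_base)
qed

lemma sin_in_span: "(\<lambda>x. c * sin (real n * pi * x / L)) \<in> fin_span sn"
proof (cases n)
  case (Suc k)
  have "sqrt (2 / L) \<noteq> 0" using L_pos by simp
  then have "(\<lambda>x. c * sin (real n * pi * x / L)) = (\<lambda>x. (c / sqrt (2 / L)) * sn k x)" by (auto simp: sn_alt Suc)
  then show ?thesis by (simp only: fin_span_base)
qed (simp add: fin_span_zero)

text \<open>A product of cosines is half the sum of the cosines of sum and difference of the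
  arguments. By induction the span contains all polynomials in
  \<open>cos (pi * x / L)\<close>.\<close>

lemma cos_mult_span:
  assumes "f \<in> fin_span cc" shows "(\<lambda>x. cos (pi * x / L) * f x) \<in> fin_span cc"
proof -
  have one: "(\<lambda>x. cos (pi * x / L) * (c * cc n x)) \<in> fin_span cc" for c n
  proof (cases n)
    case 0
    then show ?thesis using cos_in_span[of "c * sqrt (1 / L)" 1] by (simp add: cc_alt mult_ac)
  next
    case (Suc k)
    define d where "d = c * sqrt (2 / L) / 2"
    have "cos (pi * x / L) * (c * cc n x) = d * cos (real (Suc (Suc k)) * pi * x / L) + d * cos (real k * pi * x / L)" for x
    proof -
      define t where "t = pi * x / L"
      define w where "w = real (Suc k) * pi * x / L"
      have a: "real (Suc (Suc k)) * pi * x / L = w + t" "real k * pi * x / L = w - t"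
        by (simp_all add: t_def w_def algebra_simps add_divide_distrib)
      have n: "cc n x = sqrt (2 / L) * cos w" by (simp add: cc_alt w_def Suc)
      show ?thesis unfolding n a t_def[symmetric] d_def cos_add cos_diff by (simp add: algebra_simps add_divide_distrib diff_divide_distrib)
    qed
    then show ?thesis using fin_span_add[OF cos_in_span cos_in_span, of d "Suc (Suc k)" d k] by simp
  qed
  obtain N c where f: "\<forall>x. f x = (\<Sum>n<N. c n * cc n x)" using assms unfolding fin_span_def by blast
  have "(\<lambda>x. cos (pi * x / L) * f x) = (\<lambda>x. \<Sum>n<N. cos (pi * x / L) * (c n * cc n x))" using f by (simp add: sum_distrib_left)
  then show ?thesis using fin_span_sum[of "{..<N}" "\<lambda>n x. cos (pi * x / L) * (c n * cc n x)", OF one] by simp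
qed

text \<open>The product formula for sine and cosine; it transfers density from the cosines to the
  sines.\<close>

lemma sin_mult_span:
  assumes "f \<in> fin_span cc" shows "(\<lambda>x. sin (pi * x / L) * f x) \<in> fin_span sn"
proof -
  have one: "(\<lambda>x. sin (pi * x / L) * (c * cc n x)) \<in> fin_span sn" for c n
  proof (cases n)
    case 0
    then show ?thesis using sin_in_span[of "c * sqrt (1 / L)" 1] by (simp add: cc_alt mult_ac)
  next
    case (Suc k)
    define d where "d = c * sqrt (2 / L) / 2"
    have "sin (pi * x / L) * (c * cc n x) = d * sin (real (Suc (Suc k)) * pi * x / L) + (- d) * sin (real k * pi * x / L)" for x
    proof -
      define t where "t = pi * x / L"
      define w where "w = real (Suc k) * pi * x / L"
      have a: "real (Suc (Suc k)) * pi * x / L = w + t" "real k * pi * x / L = w - t"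
        by (simp_all add: t_def w_def algebra_simps add_divide_distrib)
      have n: "cc n x = sqrt (2 / L) * cos w" by (simp add: cc_alt w_def Suc)
      show ?thesis unfolding n a t_def[symmetric] d_def sin_add sin_diff by (simp add: algebra_simps add_divide_distrib diff_divide_distrib)
    qed
    then show ?thesis using fin_span_add[OF sin_in_span sin_in_span, of d "Suc (Suc k)" "-d" k] by simp
  qed
  obtain N c where f: "\<forall>x. f x = (\<Sum>n<N. c n * cc n x)" using assms unfolding fin_span_def by blast
  have "(\<lambda>x. sin (pi * x / L) * f x) = (\<lambda>x. \<Sum>n<N. sin (pi * x / L) * (c n * cc n x))" using f by (simp add: sum_distrib_left)
  then show ?thesis using fin_span_sum[of "{..<N}" "\<lambda>n x. sin (pi * x / L) * (c n * cc n x)", OF one] by simp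
qed

lemma cos_poly_span:
  assumes "real_polynomial_function p" shows "(\<lambda>x. p (cos (pi * x / L))) \<in> fin_span cc"
proof -
  have pw: "(\<lambda>x. cos (pi * x / L) ^ i) \<in> fin_span cc" for i
  proof (induction i)
    case 0 then show ?case using cos_in_span[of 1 0] by simp
  next
    case (Suc i) then show ?case using cos_mult_span by simp
  qed
  obtain a n where p: "p = (\<lambda>x. \<Sum>i\<le>n. a i * x ^ i)" using assms unfolding real_polynomial_function_iff_sum by blast
  show ?thesis unfolding p by (intro fin_span_sum fin_span_scale pw)
qed

lemma span_cont: "f \<in> fin_span cc \<Longrightarrow> continuous_on S f"
proof -
  assume "f \<in> fin_span cc"
  then obtain N c where "\<forall>x. f x = (\<Sum>n<N. c n * cc n x)" unfolding fin_span_def by blast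
  then have "f = (\<lambda>x. \<Sum>n<N. c n * cc n x)" by auto
  then show ?thesis by (auto intro!: continuous_intros cc_cont)
qed

text \<open>\<open>cos (pi * x / L)\<close> maps \<open>[0,L]\<close> bijectively onto
  \<open>[-1,1]\<close>, so Weierstrass' theorem applies to
  \<open>f (L / pi * arccos y)\<close>.\<close>

lemma continuous_approximable_cos:
  assumes f: "continuous_on {0..L} f" shows "approximable (fin_span cc) f"
  unfolding approximable_def
proof (intro allI impI)
  fix e :: real assume e: "e > 0"
  \<comment> \<open>A uniform error \<open>d\<close> contributes at most
    \<open>d * d * L = e / 2\<close> to the squared norm.\<close>
  define d where "d = sqrt (e / (2 * L))"
  have d: "d > 0" "d * d * L = e / 2" using e L_pos by (simp_all add: d_def real_sqrt_mult_self)
  define F where "F y = f (L / pi * arccos y)" for y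
  have F: "continuous_on {-1..1} F"
    unfolding F_def
  proof (rule continuous_on_compose2[OF f])
    show "continuous_on {- 1..1} (\<lambda>y. L / pi * arccos y)" by (intro continuous_intros) auto
    show "(\<lambda>y. L / pi * arccos y) ` {- 1..1} \<subseteq> {0..L}"
    proof clarify
      fix y :: real assume y: "y \<in> {-1..1}"
      have "0 \<le> arccos y" "arccos y \<le> pi" using arccos_lbound arccos_ubound y by auto
      then show "L / pi * arccos y \<in> {0..L}" using L_pos by (auto simp: field_simps)
    qed
  qed
  obtain p where p: "real_polynomial_function p" "\<And>y. y \<in> {-1..1} \<Longrightarrow> \<bar>F y - p y\<bar> < d"
    by (rule Stone_Weierstrass_real_polynomial_function[OF compact_Icc F d(1)]) (rule that)
  define h where "h x = p (cos (pi * x / L))" for x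
  have hs: "h \<in> fin_span cc" unfolding h_def[abs_def] by (rule cos_poly_span[OF p(1)])
  have hc: "continuous_on {0..L} h" by (rule span_cont[OF hs])
  have near: "\<bar>f x - h x\<bar> \<le> d" if "x \<in> {0..L}" for x
  proof -
    have "arccos (cos (pi * x / L)) = pi * x / L" using that L_pos by (intro arccos_cos) (auto simp: field_simps)
    then have "F (cos (pi * x / L)) = f x" using L_pos by (simp add: F_def)
    then show ?thesis using p(2)[of "cos (pi * x / L)"] unfolding h_def by simp
  qed
  have "ip (\<lambda>x. f x - h x) (\<lambda>x. f x - h x) = integral {0..L} (\<lambda>x. (f x - h x) * (f x - h x))"
    by (intro ip_continuous continuous_intros f hc)
  also have "\<dots> \<le> integral {0..L} (\<lambda>x. d * d)"
  proof (rule integral_le)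
    show "(\<lambda>x. (f x - h x) * (f x - h x)) integrable_on {0..L}"
      by (intro integrable_continuous_real continuous_intros f hc)
    fix x assume "x \<in> {0..L}"
    then have "\<bar>f x - h x\<bar> * \<bar>f x - h x\<bar> \<le> d * d" using near d(1) by (intro mult_mono) auto
    then show "(f x - h x) * (f x - h x) \<le> d * d" by simp
  qed (intro integrable_continuous_real continuous_intros)
  also have "\<dots> = d * d * L" using L_pos by simp
  also have "\<dots> < e" unfolding d(2) using e by simp
  finally show "\<exists>h\<in>fin_span cc. L2 L h \<and> ip (\<lambda>x. f x - h x) (\<lambda>x. f x - h x) < e"
    using hs L2_continuous[OF hc] by blast
qed

lemma approximable_cos: "L2 L u \<Longrightarrow> approximable (fin_span cc) u"
  by (rule L2_approximable[OF continuous_approximable_cos])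

lemma L2_mult_bounded:
  assumes "L2 L u" "w \<in> borel_measurable M" "\<And>x. \<bar>w x\<bar> \<le> 1"
  shows "L2 L (\<lambda>x. w x * u x)" "ip (\<lambda>x. w x * u x) (\<lambda>x. w x * u x) \<le> ip u u"
proof -
  have le: "(w x * u x)\<^sup>2 \<le> (u x)\<^sup>2" for x
    using mult_right_mono[OF assms(3)[of x], of "\<bar>u x\<bar>"] by (simp add: abs_le_square_iff[symmetric] abs_mult)
  have i: "integrable M (\<lambda>x. (u x)\<^sup>2)" using assms by (simp add: L2_iff)
  have wm: "(\<lambda>x. w x * u x) \<in> borel_measurable M" using assms(2) L2_measurable[OF assms(1)] by simp
  have i2: "integrable M (\<lambda>x. (w x * u x)\<^sup>2)"
  proof (rule Bochner_Integration.integrable_bound[OF i])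
    show "(\<lambda>x. (w x * u x)\<^sup>2) \<in> borel_measurable M" using wm by simp
    show "AE x in M. norm ((w x * u x)\<^sup>2) \<le> norm ((u x)\<^sup>2)" by (rule AE_I2) (simp only: real_norm_def abs_power2 le)
  qed
  show "L2 L (\<lambda>x. w x * u x)" using i2 wm unfolding L2_iff by blast
  show "ip (\<lambda>x. w x * u x) (\<lambda>x. w x * u x) \<le> ip u u"
    unfolding ip_eq power2_eq_square[symmetric] by (rule integral_mono[OF i2 i le])
qed

text \<open>\<open>s = sin (pi * x / L)\<close> is positive inside the interval. The quotient
  \<open>u / s\<close> is clipped, since it may fail to be square integrable near the ends; the
  clipped quotient is approximated by cosines, and multiplication by \<open>s\<close> leads into the
  span of the sines.\<close>

lemma approximable_sin:
  assumes u: "L2 L u" shows "approximable (fin_span sn) u"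
proof -
  define s where "s x = sin (pi * x / L)" for x
  have scont: "continuous_on S s" for S unfolding s_def using L_pos by (intro continuous_intros) auto
  have sm: "s \<in> borel_measurable M" by (intro continuous_imp_measurable_on_sets_lebesgue scont) auto
  have s1: "\<bar>s x\<bar> \<le> 1" for x by (simp add: s_def)
  have spos: "s x > 0" if "x \<in> I" for x
    unfolding s_def using that L_pos by (intro sin_gt_zero) (auto simp: field_simps)
  have um: "u \<in> borel_measurable M" by (rule L2_measurable[OF u])
  define v where "v k x = clip (real k) (u x / s x)" for k x
  have vL: "L2 L (v k)" for k
    unfolding v_def by (rule L2_bounded[of _ "real k"]) (use um sm in \<open>auto simp: clip_def intro!: borel_measurable_max borel_measurable_min\<close>)
  have svL: "L2 L (\<lambda>x. s x * v k x)" for k by (rule L2_mult_bounded(1)[OF vL sm s1])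
  have app: "approximable (fin_span sn) (\<lambda>x. s x * v k x)" for k
    unfolding approximable_def
  proof (intro allI impI)
    fix e :: real assume "e > 0"
    then obtain f where f: "f \<in> fin_span cc" "L2 L f" "ip (\<lambda>x. v k x - f x) (\<lambda>x. v k x - f x) < e"
      using approximable_cos[OF vL] unfolding approximable_def by meson
    have "ip (\<lambda>x. s x * (v k x - f x)) (\<lambda>x. s x * (v k x - f x)) < e"
      using L2_mult_bounded(2)[OF L2_diff[OF vL f(2)] sm s1] f(3) by (rule le_less_trans)
    then show "\<exists>h\<in>fin_span sn. L2 L h \<and> ip (\<lambda>x. s x * v k x - h x) (\<lambda>x. s x * v k x - h x) < e"
      using sin_mult_span[OF f(1), folded s_def] L2_mult_bounded(1)[OF f(2) sm s1]
      by (intro bexI[of _ "\<lambda>x. s x * f x"]) (auto simp: right_diff_distrib)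
  qed
  show ?thesis
  proof (rule approximable_limit[OF u svL app])
    show "(\<lambda>k. ip (\<lambda>x. s x * v k x - u x) (\<lambda>x. s x * v k x - u x)) \<longlonglongrightarrow> 0"
    proof (rule dominated_L2[OF u, where B="\<lambda>x. \<bar>u x\<bar>"])
      show "L2 L (\<lambda>x. \<bar>u x\<bar>)" using u by (auto simp: L2_iff)
      show "(\<lambda>x. s x * v k x) \<in> borel_measurable M" for k by (rule L2_measurable[OF svL])
      have eq: "s x * (u x / s x) = u x" if "x \<in> I" for x using spos[OF that] by simp
      show "AE x in M. (\<lambda>k. s x * v k x) \<longlonglongrightarrow> u x"
      proof (rule AE_I2)
        fix x assume "x \<in> space M"
        then have "(\<lambda>k. s x * v k x) \<longlonglongrightarrow> s x * (u x / s x)" unfolding v_def by (intro tendsto_intros clip_tendsto_self)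
        then show "(\<lambda>k. s x * v k x) \<longlonglongrightarrow> u x" using eq \<open>x \<in> space M\<close> by simp
      qed
      show "AE x in M. \<bar>s x * v k x - u x\<bar> \<le> \<bar>u x\<bar>" for k
      proof (rule AE_I2)
        fix x assume "x \<in> space M"
        then have x: "x \<in> I" by simp
        have "\<bar>s x * v k x - u x\<bar> = \<bar>s x\<bar> * \<bar>v k x - u x / s x\<bar>"
          unfolding abs_mult[symmetric] right_diff_distrib eq[OF x] ..
        also have "\<dots> \<le> \<bar>s x\<bar> * \<bar>u x / s x\<bar>" unfolding v_def by (intro mult_left_mono clip_le) auto
        also have "\<dots> = \<bar>u x\<bar>" unfolding abs_mult[symmetric] eq[OF x] ..
        finally show "\<bar>s x * v k x - u x\<bar> \<le> \<bar>u x\<bar>" .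
      qed
    qed
  qed
qed

lemma parseval_sin: "L2 L u \<Longrightarrow> (\<lambda>n. (ip u (sn n))\<^sup>2) sums ip u u"
  using parseval[OF orthonormal_sn _ approximable_sin[unfolded fin_span_def]] .

lemma parseval_cos:
  assumes "L2 L u" and mean: "ip u (\<lambda>x. 1) = 0" shows "(\<lambda>n. (ip u (cn n))\<^sup>2) sums ip u u"
proof -
  have cS: "cc (Suc n) = cn n" for n by (auto simp: cc_def)
  have "ip u (cc 0) = 0"
    using ip_scale_right[of u "sqrt (1 / L)" "\<lambda>x. 1"] mean by (simp add: cc_def[abs_def])
  then show ?thesis
    using parseval[OF orthonormal_cc assms(1) approximable_cos[OF assms(1), unfolded fin_span_def]]
      sums_Suc_iff[of "\<lambda>n. (ip u (cc n))\<^sup>2" "ip u u"] by (simp add: cS)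
qed

lemma orthonormal_cn: "orthonormal cn"
  using orthonormal_cc unfolding orthonormal_def
  by (metis (no_types, lifting) cc_def nat.case(2) nat.inject ext)

lemma bessel_cos: "L2 L u \<Longrightarrow> (\<Sum>n<N. (ip u (cn n))\<^sup>2) \<le> ip u u"
  by (rule bessel[OF orthonormal_cn])

end

section \<open>Test functions and weak derivatives\<close>

text \<open>Polynomials in \<open>1 / y\<close> times the flat function
  \<open>exp (- (1 / y))\<close> form a family that is closed under differentiation.\<close>

definition bump :: "real poly \<Rightarrow> real \<Rightarrow> real" where
  "bump p y = (if y > 0 then poly p (1 / y) * exp (- (1 / y)) else 0)"

lemma poly_exp_tendsto_0: "((\<lambda>z. poly p z * exp (- z)) \<longlongrightarrow> 0) at_top" for p :: "real poly"
proof -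
  have "((\<lambda>z. \<Sum>i\<le>degree p. coeff p i * (z ^ i / exp z)) \<longlongrightarrow> (\<Sum>i\<le>degree p. coeff p i * 0)) at_top"
    by (intro tendsto_intros tendsto_power_div_exp_0)
  then show ?thesis by (simp add: poly_altdef exp_minus field_simps sum_distrib_right sum_divide_distrib)
qed

text \<open>With \<open>z = 1 / y\<close> the chain rule produces the polynomial
  \<open>z\<^sup>2 * (p - p')\<close>. At 0 the right difference quotient is a polynomial in
  \<open>z\<close> times \<open>exp (- z)\<close>, which tends to 0.\<close>

lemma bump_deriv:
  "(bump p has_real_derivative bump (monom 1 2 * (p - pderiv p)) y) (at y)"
proof -
  consider "y > 0" | "y < 0" | "y = 0" by linarith
  then show ?thesis
  proof cases
    case 1
    have "((\<lambda>y. poly p (1 / y) * exp (- (1 / y))) has_real_derivative bump (monom 1 2 * (p - pderiv p)) y) (at y)"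
      using 1 by (auto intro!: derivative_eq_intros poly_DERIV[THEN DERIV_chain2] simp: bump_def poly_monom power2_eq_square field_simps)
    then show ?thesis
      by (rule has_field_derivative_transform_within_open[where S="{0<..}"]) (use 1 in \<open>auto simp: bump_def\<close>)
  next
    case 2
    have "((\<lambda>y. 0) has_real_derivative 0) (at y)" by simp
    then have "(bump p has_real_derivative 0) (at y)"
      by (rule has_field_derivative_transform_within_open[where S="{..<0}"]) (use 2 in \<open>auto simp: bump_def\<close>)
    then show ?thesis using 2 by (simp add: bump_def)
  next
    case 3
    have r: "((\<lambda>h. bump p h / h) \<longlongrightarrow> 0) (at_right 0)"
    proof (rule Lim_transform_eventually)
      show "((\<lambda>h. poly (pCons 0 p) (inverse h) * exp (- (inverse h))) \<longlongrightarrow> 0) (at_right 0)"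
        by (rule filterlim_compose[OF poly_exp_tendsto_0 filterlim_inverse_at_top_right])
      show "\<forall>\<^sub>F h in at_right 0. poly (pCons 0 p) (inverse h) * exp (- (inverse h)) = bump p h / h"
        using eventually_at_right_less[of "0::real"] by eventually_elim (auto simp: bump_def field_simps)
    qed
    have l: "((\<lambda>h. bump p h / h) \<longlongrightarrow> 0) (at_left 0)"
    proof (rule Lim_transform_eventually[OF tendsto_const])
      have "\<forall>\<^sub>F h in at_left (0::real). h < 0" by (simp add: eventually_at_filter)
      then show "\<forall>\<^sub>F h in at_left 0. 0 = bump p h / h" by eventually_elim (auto simp: bump_def)
    qed
    have "((\<lambda>h. bump p h / h) \<longlongrightarrow> 0) (at 0)" using filterlim_split_at[OF l r] .
    moreover have "bump r 0 = 0" for r by (simp add: bump_def)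
    ultimately show ?thesis unfolding 3 DERIV_def by simp
  qed
qed

text \<open>A set of functions closed under differentiation yields derivatives of all orders at
  once. The phase in the sine makes its derivative a sine again.\<close>

inductive_set smooth_alg :: "(real \<Rightarrow> real) set" where
  bump: "(\<lambda>x. bump p (a * x + b)) \<in> smooth_alg"
| sin: "(\<lambda>x. c * sin (a * x + b)) \<in> smooth_alg"
| add: "f \<in> smooth_alg \<Longrightarrow> h \<in> smooth_alg \<Longrightarrow> (\<lambda>x. f x + h x) \<in> smooth_alg"
| mult: "f \<in> smooth_alg \<Longrightarrow> h \<in> smooth_alg \<Longrightarrow> (\<lambda>x. f x * h x) \<in> smooth_alg"

lemma smooth_alg_deriv: "f \<in> smooth_alg \<Longrightarrow> \<exists>f'\<in>smooth_alg. \<forall>x. (f has_real_derivative f' x) (at x)"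
proof (induction rule: smooth_alg.induct)
  case (bump p a b)
  have "((\<lambda>x. bump p (a * x + b)) has_real_derivative bump (smult a (monom 1 2 * (p - pderiv p))) (a * x + b)) (at x)" for x
  proof -
    have d: "((\<lambda>x. a * x + b) has_real_derivative a) (at x)" by (auto intro!: derivative_eq_intros)
    have e: "bump (monom 1 2 * (p - pderiv p)) (a * x + b) * a = bump (smult a (monom 1 2 * (p - pderiv p))) (a * x + b)"
      by (simp add: bump_def mult_ac)
    show ?thesis unfolding e[symmetric] by (rule DERIV_chain2[where f="bump p" and g="\<lambda>x. a * x + b", OF bump_deriv d])
  qed
  then show ?case by (intro bexI[OF _ smooth_alg.bump] allI)
next
  case (sin c a b)
  have "((\<lambda>x. c * sin (a * x + b)) has_real_derivative (c * a) * sin (a * x + (b + pi / 2))) (at x)" for x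
    by (auto intro!: derivative_eq_intros simp: sin_add cos_add algebra_simps)
  then show ?case by (intro bexI[OF _ smooth_alg.sin] allI)
next
  case (add f h)
  then obtain f' h' where "f' \<in> smooth_alg" "h' \<in> smooth_alg" "\<forall>x. (f has_real_derivative f' x) (at x)" "\<forall>x. (h has_real_derivative h' x) (at x)" by blast
  then show ?case by (intro bexI[of _ "\<lambda>x. f' x + h' x"]) (auto intro!: derivative_intros smooth_alg.add)
next
  case (mult f h)
  then obtain f' h' where "f' \<in> smooth_alg" "h' \<in> smooth_alg" "\<forall>x. (f has_real_derivative f' x) (at x)" "\<forall>x. (h has_real_derivative h' x) (at x)" by blast
  then show ?case using mult.hyps
    by (intro bexI[of _ "\<lambda>x. f' x * h x + h' x * f x"]) (auto intro!: DERIV_mult smooth_alg.add smooth_alg.mult)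
qed

lemma smooth_alg_deriv_funpow: "f \<in> smooth_alg \<Longrightarrow> (deriv ^^ k) f \<in> smooth_alg"
proof (induction k)
  case (Suc k)
  then obtain f' where "f' \<in> smooth_alg" "\<forall>x. ((deriv ^^ k) f has_real_derivative f' x) (at x)" using smooth_alg_deriv by blast
  moreover from this have "deriv ((deriv ^^ k) f) = f'" using DERIV_imp_deriv by blast
  ultimately show ?case by simp
qed simp

lemma smooth_alg_differentiable: "f \<in> smooth_alg \<Longrightarrow> (deriv ^^ k) f differentiable_on UNIV"
proof -
  assume "f \<in> smooth_alg"
  then obtain f' where "\<forall>x. ((deriv ^^ k) f has_real_derivative f' x) (at x)"
    using smooth_alg_deriv[OF smooth_alg_deriv_funpow] by blast
  then show ?thesis unfolding differentiable_on_def by (auto simp: real_differentiable_def)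
qed

definition "bump0 = bump 1"
definition "bump1 = bump (monom 1 2)"

lemma bump0_deriv: "(bump0 has_real_derivative bump1 y) (at y)"
  unfolding bump0_def bump1_def using bump_deriv[of 1 y] by simp

lemma bump0_range: "0 \<le> bump0 y" "bump0 y \<le> 1"
  by (auto simp: bump0_def bump_def)

lemma bump1_nonneg: "0 \<le> bump1 y"
  by (simp add: bump1_def bump_def poly_monom)

text \<open>In the cut-off below, \<open>u + 1\<close> is \<open>Suc j * x\<close>: the derivative
  of the cut-off carries the factor \<open>Suc j\<close>, the sine vanishes like \<open>x\<close> at
  the end, and their product is governed by \<open>(u + 1) * bump1 u\<close>.\<close>

lemma bump1_bound: "(u + 1) * bump1 u \<le> 4" "u \<ge> 1 \<Longrightarrow> (u + 1) * bump1 u \<le> 2 / u"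
proof -
  have large: "(u + 1) * bump1 u \<le> 2 / u" if "u \<ge> 1" for u
  proof -
    have "(u + 1) * bump1 u = (u + 1) / u\<^sup>2 * exp (- (1 / u))" using that by (simp add: bump1_def bump_def poly_monom power_divide)
    also have "\<dots> \<le> (u + 1) / u\<^sup>2 * 1" using that by (intro mult_left_mono) auto
    also have "\<dots> \<le> (2 * u) / u\<^sup>2 * 1" using that by (intro mult_right_mono divide_right_mono) auto
    also have "\<dots> = 2 / u" using that by (simp add: power2_eq_square)
    finally show ?thesis .
  qed
  show "u \<ge> 1 \<Longrightarrow> (u + 1) * bump1 u \<le> 2 / u" by (rule large)
  consider "u \<le> 0" | "0 < u" "u < 1" | "u \<ge> 1" by linarith
  then show "(u + 1) * bump1 u \<le> 4"
  proof cases
    case 1 then show ?thesis by (simp add: bump1_def bump_def)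
  next
    case 2
    define z where "z = 1 / u"
    have "0 \<le> z" using 2 by (simp add: z_def)
    then have "1 + z + z\<^sup>2 / 2 \<le> exp z" by (rule exp_lower_Taylor_quadratic)
    then have "z\<^sup>2 \<le> 2 * exp z" using \<open>0 \<le> z\<close> by linarith
    then have "z\<^sup>2 * exp (- z) \<le> 2 * exp z * exp (- z)" by (intro mult_right_mono) auto
    also have "2 * exp z * exp (- z) = 2" by (simp add: exp_minus)
    also have "z\<^sup>2 * exp (- z) = bump1 u" using 2 by (simp add: bump1_def bump_def poly_monom z_def)
    finally have b: "bump1 u \<le> 2" .
    have "(u + 1) * bump1 u \<le> 2 * 2" using 2 b bump1_nonneg by (intro mult_mono) auto
    then show ?thesis by simp
  next
    case 3
    then have "2 / u \<le> 4" by (simp add: field_simps)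
    then show ?thesis using large[OF 3] by linarith
  qed
qed

lemma bump1_weight_tendsto: "((\<lambda>u. (u + 1) * bump1 u) \<longlongrightarrow> 0) at_top"
proof (rule Lim_null_comparison)
  show "\<forall>\<^sub>F u in at_top. norm ((u + 1) * bump1 u) \<le> 2 / u"
    using eventually_ge_at_top[of "1::real"]
  proof eventually_elim
    case (elim u)
    have "0 \<le> (u + 1) * bump1 u" using elim bump1_nonneg by simp
    then show ?case using bump1_bound(2)[OF elim] by simp
  qed
  show "((\<lambda>u::real. 2 / u) \<longlongrightarrow> 0) at_top"
    by (intro tendsto_divide_0[OF tendsto_const] filterlim_at_top_imp_at_infinity filterlim_ident)
qed

lemma bump0_tendsto: "(bump0 \<longlongrightarrow> 1) at_top"
proof (rule Lim_transform_eventually)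
  have "((\<lambda>u::real. exp (- (1 / u))) \<longlongrightarrow> exp (- 0)) at_top"
    by (intro tendsto_intros tendsto_divide_0[OF tendsto_const] filterlim_at_top_imp_at_infinity filterlim_ident)
  then show "((\<lambda>u::real. exp (- (1 / u))) \<longlongrightarrow> 1) at_top" by simp
  show "\<forall>\<^sub>F u in at_top. exp (- (1 / u)) = bump0 u"
    using eventually_gt_at_top[of "0::real"] by eventually_elim (auto simp: bump0_def bump_def)
qed

context interval
begin

section \<open>Test functions that approximate the sines\<close>

lemma test_has_deriv: "test_function L \<eta> \<Longrightarrow> (\<eta> has_real_derivative deriv \<eta> x) (at x)"
  unfolding test_function_def using DERIV_deriv_iff_real_differentiable[of \<eta> x]
  by (metis UNIV_I differentiable_on_def funpow_0)

lemma test_deriv_cont: "test_function L \<eta> \<Longrightarrow> continuous_on S (deriv \<eta>)"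
proof -
  assume "test_function L \<eta>"
  then have "(deriv ^^ 1) \<eta> differentiable_on UNIV" unfolding test_function_def by blast
  then have "continuous_on UNIV (deriv \<eta>)" by (simp add: differentiable_imp_continuous_on)
  then show ?thesis by (rule continuous_on_subset) auto
qed

lemma test_cont: "test_function L \<eta> \<Longrightarrow> continuous_on S \<eta>"
  using test_has_deriv by (meson DERIV_isCont continuous_at_imp_continuous_on)

lemma test_boundary: "test_function L \<eta> \<Longrightarrow> \<eta> 0 = 0" "test_function L \<eta> \<Longrightarrow> \<eta> L = 0"
  unfolding test_function_def by force+

lemma test_L2: "test_function L \<eta> \<Longrightarrow> L2 L \<eta>" "test_function L \<eta> \<Longrightarrow> L2 L (deriv \<eta>)"
  by (auto intro: L2_continuous test_cont test_deriv_cont)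

lemma test_by_parts:
  assumes \<eta>: "test_function L \<eta>" and w: "\<And>x. (w has_real_derivative w' x) (at x)" and w': "continuous_on {0..L} w'"
  shows "ip w (deriv \<eta>) = - ip w' \<eta>"
proof -
  have wc: "continuous_on {0..L} w" using w by (meson DERIV_isCont continuous_at_imp_continuous_on)
  have "((\<lambda>x. w' x * \<eta> x + deriv \<eta> x * w x) has_integral (w L * \<eta> L - w 0 * \<eta> 0)) {0..L}"
    using L_pos by (intro fundamental_theorem_of_calculus)
      (auto simp: has_real_derivative_iff_has_vector_derivative[symmetric] intro!: DERIV_mult DERIV_subset[OF w] DERIV_subset[OF test_has_deriv[OF \<eta>]])
  then have z: "((\<lambda>x. w' x * \<eta> x + deriv \<eta> x * w x) has_integral 0) {0..L}" using test_boundary[OF \<eta>] by simp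
  have "integral {0..L} (\<lambda>x. w' x * \<eta> x + w x * deriv \<eta> x) = integral {0..L} (\<lambda>x. w' x * \<eta> x) + integral {0..L} (\<lambda>x. w x * deriv \<eta> x)"
    by (rule integral_add) (intro integrable_continuous_real continuous_intros w' wc test_cont[OF \<eta>] test_deriv_cont[OF \<eta>])+
  then show ?thesis
    using integral_unique[OF z] ip_continuous[OF wc test_deriv_cont[OF \<eta>]] ip_continuous[OF w' test_cont[OF \<eta>]]
    by (simp add: mult.commute[of "deriv \<eta> _"])
qed

lemma l2_norm_eq: "l2_norm L u = sqrt (ip u u)"
  using l2_norm_sq[of u] l2_norm_nonneg[of u] by (metis real_sqrt_abs abs_of_nonneg)

lemma l2_norm_tendsto: "(\<lambda>j. ip (u j) (u j)) \<longlonglongrightarrow> 0 \<Longrightarrow> (\<lambda>j. l2_norm L (u j)) \<longlonglongrightarrow> 0"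
  unfolding l2_norm_eq using tendsto_real_sqrt[of _ 0] by fastforce

text \<open>Vanishes within distance \<open>1 / Suc j\<close> of the end points and tends to 1
  inside as \<open>j\<close> grows.\<close>

definition cutoff :: "nat \<Rightarrow> real \<Rightarrow> real" where
  "cutoff j x = bump0 (real (Suc j) * x - 1) * bump0 (real (Suc j) * (L - x) - 1)"

definition cutoff' :: "nat \<Rightarrow> real \<Rightarrow> real" where
  "cutoff' j x = real (Suc j) * bump1 (real (Suc j) * x - 1) * bump0 (real (Suc j) * (L - x) - 1)
      - real (Suc j) * bump1 (real (Suc j) * (L - x) - 1) * bump0 (real (Suc j) * x - 1)"

lemma cutoff_deriv: "(cutoff j has_real_derivative cutoff' j x) (at x)"
proof -
  have "((\<lambda>x. bump0 (real (Suc j) * x - 1)) has_real_derivative bump1 (real (Suc j) * x - 1) * real (Suc j)) (at x)"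
    by (rule DERIV_chain2[OF bump0_deriv]) (auto intro!: derivative_eq_intros)
  moreover have "((\<lambda>x. bump0 (real (Suc j) * (L - x) - 1)) has_real_derivative bump1 (real (Suc j) * (L - x) - 1) * (- real (Suc j))) (at x)"
    by (rule DERIV_chain2[OF bump0_deriv]) (auto intro!: derivative_eq_intros)
  ultimately show ?thesis unfolding cutoff_def[abs_def] cutoff'_def
    by (rule DERIV_cong[OF DERIV_mult]) (simp add: algebra_simps)
qed

text \<open>The sines vanish to first order at both ends, at \<open>L\<close> because
  \<open>freq n * L\<close> is a multiple of \<open>pi\<close>.\<close>

lemma sn_abs_le: assumes "x \<in> I" shows "\<bar>sn n x\<bar> \<le> sqrt (2 / L) * freq n * x" "\<bar>sn n x\<bar> \<le> sqrt (2 / L) * freq n * (L - x)"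
proof -
  have s: "sqrt (2 / L) \<ge> 0" using L_pos by simp
  have a: "\<bar>sin y\<bar> \<le> y" if "y \<ge> 0" for y :: real using abs_sin_x_le_abs_x[of y] that by simp
  have p: "0 \<le> freq n * x" "0 \<le> freq n * (L - x)" using assms freq_pos[of n] by auto
  have e: "\<bar>sn n x\<bar> = sqrt (2 / L) * \<bar>sin (freq n * x)\<bar>" using s by (simp add: sn_def abs_mult)
  show "\<bar>sn n x\<bar> \<le> sqrt (2 / L) * freq n * x" unfolding e mult.assoc by (intro mult_left_mono a p s)
  have fL: "freq n * L = real (Suc n) * pi" using L_pos by (simp add: freq_def)
  have "sin (freq n * (L - x)) = sin (real (Suc n) * pi) * cos (freq n * x) - cos (real (Suc n) * pi) * sin (freq n * x)"
    unfolding right_diff_distrib fL by (rule sin_diff)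
  also have "sin (real (Suc n) * pi) = 0" by (rule sin_npi)
  finally have "\<bar>sin (freq n * (L - x))\<bar> = \<bar>cos (real (Suc n) * pi)\<bar> * \<bar>sin (freq n * x)\<bar>" by (simp add: abs_mult)
  also have "\<bar>cos (real (Suc n) * pi)\<bar> = 1" by (simp only: cos_npi) simp
  finally have "\<bar>sin (freq n * x)\<bar> = \<bar>sin (freq n * (L - x))\<bar>" by simp
  then show "\<bar>sn n x\<bar> \<le> sqrt (2 / L) * freq n * (L - x)" unfolding e mult.assoc using a[OF p(2)] s by (simp add: mult_left_mono)
qed

definition test_sn :: "nat \<Rightarrow> nat \<Rightarrow> real \<Rightarrow> real" where "test_sn n j x = cutoff j x * sn n x"

lemma test_sn_test: "test_function L (test_sn n j)"
  unfolding test_function_def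
proof
  have "(\<lambda>x. (bump 1 (real (Suc j) * x + (-1)) * bump 1 ((- real (Suc j)) * x + (real (Suc j) * L - 1))) * (sqrt (2 / L) * sin (freq n * x + 0))) \<in> smooth_alg"
    by (intro smooth_alg.mult smooth_alg.bump smooth_alg.sin)
  moreover have "test_sn n j = (\<lambda>x. (bump 1 (real (Suc j) * x + (-1)) * bump 1 ((- real (Suc j)) * x + (real (Suc j) * L - 1))) * (sqrt (2 / L) * sin (freq n * x + 0)))"
  proof
    fix x
    have "real (Suc j) * (L - x) - 1 = (- real (Suc j)) * x + (real (Suc j) * L - 1)" by (simp add: algebra_simps)
    then show "test_sn n j x = (bump 1 (real (Suc j) * x + (-1)) * bump 1 ((- real (Suc j)) * x + (real (Suc j) * L - 1))) * (sqrt (2 / L) * sin (freq n * x + 0))"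
      unfolding test_sn_def cutoff_def bump0_def sn_def by (simp only: add_0_right diff_conv_add_uminus)
  qed
  ultimately show "\<forall>k. (deriv ^^ k) (test_sn n j) differentiable_on UNIV" using smooth_alg_differentiable by metis
  show "\<exists>\<alpha> \<beta>. 0 < \<alpha> \<and> \<beta> < L \<and> (\<forall>x. x \<notin> {\<alpha>..\<beta>} \<longrightarrow> test_sn n j x = 0)"
  proof (rule exI[of _ "1 / real (Suc j)"], rule exI[of _ "L - 1 / real (Suc j)"], intro conjI allI impI)
    fix x assume "x \<notin> {1 / real (Suc j)..L - 1 / real (Suc j)}"
    then have "x < 1 / real (Suc j) \<or> L - x < 1 / real (Suc j)" by auto
    then have "real (Suc j) * x - 1 \<le> 0 \<or> real (Suc j) * (L - x) - 1 \<le> 0"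
      by (simp only: pos_less_divide_eq of_nat_0_less_iff zero_less_Suc mult.commute[of "real (Suc j)"]) linarith
    then show "test_sn n j x = 0" by (auto simp: test_sn_def cutoff_def bump0_def bump_def)
  qed auto
qed

lemma test_sn_deriv: "deriv (test_sn n j) x = cutoff' j x * sn n x + cutoff j x * (freq n * cn n x)"
  unfolding test_sn_def[abs_def] using DERIV_mult[OF cutoff_deriv[of j x] sn_deriv[of n x]]
  by (intro DERIV_imp_deriv) (simp add: mult.commute)

lemma cutoff_range: "0 \<le> cutoff j x" "cutoff j x \<le> 1"
  unfolding cutoff_def by (intro mult_nonneg_nonneg mult_le_one bump0_range)+

lemma scale_at_top: "x > 0 \<Longrightarrow> filterlim (\<lambda>j. real (Suc j) * x - 1) at_top sequentially"
proof -
  assume x: "x > 0"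
  have "filterlim (\<lambda>j. real (Suc j)) at_top sequentially"
    using filterlim_compose[OF filterlim_real_sequentially filterlim_Suc] by simp
  then have "filterlim (\<lambda>j. (-1) + real (Suc j) * x) at_top sequentially"
    by (intro filterlim_tendsto_add_at_top[OF tendsto_const] filterlim_at_top_mult_tendsto_pos[OF tendsto_const x])
  then show ?thesis by simp
qed

lemma cutoff_tendsto: "x \<in> I \<Longrightarrow> (\<lambda>j. cutoff j x) \<longlonglongrightarrow> 1"
  unfolding cutoff_def
  using tendsto_mult[OF filterlim_compose[OF bump0_tendsto scale_at_top[of x]] filterlim_compose[OF bump0_tendsto scale_at_top[of "L - x"]]]
  by simp

lemma cutoff'_sn_bound:
  assumes x: "x \<in> I"
  shows "\<bar>cutoff' j x * sn n x\<bar> \<le> sqrt (2 / L) * freq n * ((real (Suc j) * x - 1 + 1) * bump1 (real (Suc j) * x - 1)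
     + (real (Suc j) * (L - x) - 1 + 1) * bump1 (real (Suc j) * (L - x) - 1))"
proof -
  define J where "J = real (Suc j)"
  define a where "a = J * bump1 (J * x - 1)"
  define d where "d = J * bump1 (J * (L - x) - 1)"
  have n: "0 \<le> a" "0 \<le> d" using bump1_nonneg by (auto simp: a_def d_def J_def)
  have "\<bar>cutoff' j x\<bar> \<le> \<bar>a * bump0 (J * (L - x) - 1)\<bar> + \<bar>d * bump0 (J * x - 1)\<bar>"
    unfolding cutoff'_def J_def[symmetric] a_def[symmetric] d_def[symmetric] by (rule abs_triangle_ineq4)
  also have "\<dots> \<le> a * 1 + d * 1"
    using n bump0_range by (simp only: abs_mult abs_of_nonneg) (intro add_mono mult_left_mono; simp)
  finally have "\<bar>cutoff' j x\<bar> * \<bar>sn n x\<bar> \<le> (a + d) * \<bar>sn n x\<bar>" by (intro mult_right_mono) auto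
  also have "\<dots> \<le> a * (sqrt (2 / L) * freq n * x) + d * (sqrt (2 / L) * freq n * (L - x))"
    unfolding distrib_right using n sn_abs_le[OF x] by (intro add_mono mult_left_mono)
  also have "\<dots> = sqrt (2 / L) * freq n * ((J * x - 1 + 1) * bump1 (J * x - 1) + (J * (L - x) - 1 + 1) * bump1 (J * (L - x) - 1))"
    unfolding a_def d_def by (simp add: algebra_simps)
  finally show ?thesis unfolding abs_mult J_def .
qed

text \<open>Dominated convergence: the derivative of the cut-off times the sine is bounded uniformly
  in \<open>j\<close> and tends to 0 at every interior point.\<close>

lemma test_sn_tendsto:
  "(\<lambda>j. l2_norm L (\<lambda>x. test_sn n j x - sn n x)) \<longlonglongrightarrow> 0"
  "(\<lambda>j. l2_norm L (\<lambda>x. deriv (test_sn n j) x - freq n * cn n x)) \<longlonglongrightarrow> 0"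
proof -
  have ae: "AE x in M. Q x" if "\<And>x. x \<in> I \<Longrightarrow> Q x" for Q by (rule AE_I2) (use that in auto)
  have absL2: "L2 L (\<lambda>x. \<bar>u x\<bar>)" if "L2 L u" for u using that by (auto simp: L2_iff)
  show "(\<lambda>j. l2_norm L (\<lambda>x. test_sn n j x - sn n x)) \<longlonglongrightarrow> 0"
  proof (rule l2_norm_tendsto, rule dominated_L2[OF L2_sn, where B="\<lambda>x. \<bar>sn n x\<bar>"])
    show "test_sn n j \<in> borel_measurable M" for j by (rule L2_measurable[OF test_L2(1)[OF test_sn_test]])
    show "AE x in M. (\<lambda>j. test_sn n j x) \<longlonglongrightarrow> sn n x"
    proof (rule ae)
      fix x assume x: "x \<in> I"
      show "(\<lambda>j. test_sn n j x) \<longlonglongrightarrow> sn n x"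
        unfolding test_sn_def using tendsto_mult[OF cutoff_tendsto[OF x] tendsto_const[of "sn n x"]] by simp
    qed
    show "AE x in M. \<bar>test_sn n j x - sn n x\<bar> \<le> \<bar>sn n x\<bar>" for j
    proof (rule ae)
      fix x
      have "test_sn n j x - sn n x = (cutoff j x - 1) * sn n x" by (simp add: test_sn_def algebra_simps)
      moreover have "\<bar>cutoff j x - 1\<bar> \<le> 1" using cutoff_range[of j x] by simp
      ultimately show "\<bar>test_sn n j x - sn n x\<bar> \<le> \<bar>sn n x\<bar>" by (simp add: abs_mult mult_left_le_one_le)
    qed
  qed (rule absL2[OF L2_sn])
  let ?K = "sqrt (2 / L) * freq n"
  have K: "?K \<ge> 0" using L_pos freq_pos[of n] by simp
  show "(\<lambda>j. l2_norm L (\<lambda>x. deriv (test_sn n j) x - freq n * cn n x)) \<longlonglongrightarrow> 0"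
  proof (rule l2_norm_tendsto, rule dominated_L2[OF L2_scale[OF L2_cn], where B="\<lambda>x. ?K * 8 + \<bar>freq n * cn n x\<bar>"])
    show "L2 L (\<lambda>x. ?K * 8 + \<bar>freq n * cn n x\<bar>)"
      by (intro L2_continuous continuous_intros cn_cont)
    show "deriv (test_sn n j) \<in> borel_measurable M" for j by (rule L2_measurable[OF test_L2(2)[OF test_sn_test]])
    show "AE x in M. (\<lambda>j. deriv (test_sn n j) x) \<longlonglongrightarrow> freq n * cn n x"
    proof (rule ae)
      fix x assume x: "x \<in> I"
      have "(\<lambda>j. ?K * ((real (Suc j) * x - 1 + 1) * bump1 (real (Suc j) * x - 1)
         + (real (Suc j) * (L - x) - 1 + 1) * bump1 (real (Suc j) * (L - x) - 1))) \<longlonglongrightarrow> ?K * (0 + 0)"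
        using x by (intro tendsto_intros filterlim_compose[OF bump1_weight_tendsto scale_at_top]) auto
      then have "(\<lambda>j. ?K * ((real (Suc j) * x - 1 + 1) * bump1 (real (Suc j) * x - 1)
         + (real (Suc j) * (L - x) - 1 + 1) * bump1 (real (Suc j) * (L - x) - 1))) \<longlonglongrightarrow> 0" by simp
      with always_eventually have "(\<lambda>j. cutoff' j x * sn n x) \<longlonglongrightarrow> 0"
        by (rule Lim_null_comparison) (intro allI, unfold real_norm_def, rule cutoff'_sn_bound[OF x])
      then have "(\<lambda>j. cutoff' j x * sn n x + cutoff j x * (freq n * cn n x)) \<longlonglongrightarrow> 0 + 1 * (freq n * cn n x)"
        by (intro tendsto_intros cutoff_tendsto x)
      then show "(\<lambda>j. deriv (test_sn n j) x) \<longlonglongrightarrow> freq n * cn n x" by (simp add: test_sn_deriv)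
    qed
    show "AE x in M. \<bar>deriv (test_sn n j) x - freq n * cn n x\<bar> \<le> ?K * 8 + \<bar>freq n * cn n x\<bar>" for j
    proof (rule ae)
      fix x assume x: "x \<in> I"
      have 1: "\<bar>cutoff' j x * sn n x\<bar> \<le> ?K * (4 + 4)"
        by (rule order_trans[OF cutoff'_sn_bound[OF x]]) (intro mult_left_mono add_mono bump1_bound K)
      have "\<bar>cutoff j x - 1\<bar> \<le> 1" using cutoff_range[of j x] by simp
      then have 2: "\<bar>(cutoff j x - 1) * (freq n * cn n x)\<bar> \<le> \<bar>freq n * cn n x\<bar>" by (simp only: abs_mult[of "cutoff j x - 1"]) (simp add: mult_left_le_one_le)
      have "deriv (test_sn n j) x - freq n * cn n x = cutoff' j x * sn n x + (cutoff j x - 1) * (freq n * cn n x)"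
        by (simp add: test_sn_deriv algebra_simps)
      then show "\<bar>deriv (test_sn n j) x - freq n * cn n x\<bar> \<le> ?K * 8 + \<bar>freq n * cn n x\<bar>"
        using 1 2 abs_triangle_ineq[of "cutoff' j x * sn n x" "(cutoff j x - 1) * (freq n * cn n x)"] by simp
    qed
  qed
qed

text \<open>The sines are limits of test functions, so \<open>d\<close> is orthogonal to all of
  them, and Parseval's identity applies.\<close>

lemma orthogonal_to_tests_zero:
  assumes d: "L2 L d" and z: "\<And>\<eta>. test_function L \<eta> \<Longrightarrow> ip d \<eta> = 0"
  shows "ip d d = 0"
proof -
  have "ip d (sn n) = 0" for n
  proof (rule LIMSEQ_unique)
    show "(\<lambda>j. ip (test_sn n j) d) \<longlonglongrightarrow> ip d (sn n)"
      unfolding ip_commute[of d] by (rule ip_tendsto[OF test_L2(1)[OF test_sn_test] L2_sn d test_sn_tendsto(1)])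
    show "(\<lambda>j. ip (test_sn n j) d) \<longlonglongrightarrow> 0" using z[OF test_sn_test] by (simp add: ip_commute)
  qed
  then have "(\<lambda>n. 0) sums ip d d" using parseval_sin[OF d] by simp
  then show ?thesis using sums_unique2 sums_zero by blast
qed

lemma ip_zero_left: "L2 L d \<Longrightarrow> ip d d = 0 \<Longrightarrow> L2 L w \<Longrightarrow> ip w d = 0"
  using cauchy_schwarz_sq[of w d] by simp

section \<open>Weak derivatives and boundary conditions\<close>

lemma weak_deriv_L2: "is_weak_deriv L u v \<Longrightarrow> L2 L v" by (simp add: is_weak_deriv_def)

lemma wderiv_weak: "is_weak_deriv L u v \<Longrightarrow> is_weak_deriv L u (wderiv L u)"
  unfolding wderiv_def by (rule someI[of "is_weak_deriv L u"])

lemma H1_wderiv: "H1 L u \<Longrightarrow> is_weak_deriv L u (wderiv L u)"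
  unfolding H1_def using wderiv_weak by blast

lemma weak_deriv_unique:
  assumes "is_weak_deriv L u v" "is_weak_deriv L u v'"
  shows "ip (\<lambda>x. v x - v' x) (\<lambda>x. v x - v' x) = 0"
proof (rule orthogonal_to_tests_zero)
  show "L2 L (\<lambda>x. v x - v' x)" using assms by (intro L2_diff weak_deriv_L2)
  fix \<eta> assume "test_function L \<eta>"
  then show "ip (\<lambda>x. v x - v' x) \<eta> = 0"
    using assms test_L2(1) unfolding is_weak_deriv_def by (simp add: ip_diff_left)
qed

text \<open>Inner products do not see which representative \<open>wderiv\<close> selects; thus every
  known weak derivative may be used in its place.\<close>

lemma ip_wderiv:
  assumes "is_weak_deriv L u v" "L2 L w" shows "ip w (wderiv L u) = ip w v"
proof -
  have L: "L2 L v" "L2 L (wderiv L u)" using assms(1) wderiv_weak weak_deriv_L2 by blast+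
  have "ip w (\<lambda>x. wderiv L u x - v x) = 0"
    by (rule ip_zero_left[OF L2_diff[OF L(2,1)] weak_deriv_unique[OF wderiv_weak[OF assms(1)] assms(1)] assms(2)])
  then show ?thesis using ip_diff_right[OF L(2,1) assms(2)] by simp
qed

lemma weak_deriv_sn: "is_weak_deriv L (sn n) (\<lambda>x. freq n * cn n x)"
  unfolding is_weak_deriv_def
  by (auto intro!: L2_scale L2_cn test_by_parts sn_deriv continuous_intros cn_cont)

lemma weak_deriv_cn: "is_weak_deriv L (cn n) (\<lambda>x. - freq n * sn n x)"
  unfolding is_weak_deriv_def
proof (intro conjI allI impI)
  show "L2 L (\<lambda>x. - freq n * sn n x)" by (rule L2_scale[OF L2_sn])
  show "ip (cn n) (deriv \<eta>) = - ip (\<lambda>x. - freq n * sn n x) \<eta>" if "test_function L \<eta>" for \<eta>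
    by (rule test_by_parts[OF that cn_deriv]) (intro continuous_intros sn_cont)
qed

lemma H1_0_sn: "H1_0 L (sn n)"
  unfolding H1_0_def
proof (intro conjI exI[of _ "test_sn n"] allI test_sn_test test_sn_tendsto)
  show "H1 L (sn n)" unfolding H1_def using L2_sn weak_deriv_sn by blast
  let ?v = "\<lambda>x. freq n * cn n x" and ?w = "wderiv L (sn n)"
  have L: "L2 L ?v" "L2 L ?w" using weak_deriv_L2 wderiv_weak weak_deriv_sn by blast+
  have "(\<lambda>j. ip (\<lambda>x. deriv (test_sn n j) x - ?w x) (\<lambda>x. deriv (test_sn n j) x - ?w x)) \<longlonglongrightarrow> 0"
  proof (rule Lim_null_comparison[OF always_eventually])
    have "(\<lambda>j. 2 * (l2_norm L (\<lambda>x. deriv (test_sn n j) x - ?v x))\<^sup>2) \<longlonglongrightarrow> 2 * 0\<^sup>2"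
      by (intro tendsto_intros test_sn_tendsto(2))
    then show "(\<lambda>j. 2 * (l2_norm L (\<lambda>x. deriv (test_sn n j) x - ?v x))\<^sup>2) \<longlonglongrightarrow> 0" by simp
    show "\<forall>j. norm (ip (\<lambda>x. deriv (test_sn n j) x - ?w x) (\<lambda>x. deriv (test_sn n j) x - ?w x)) \<le> 2 * (l2_norm L (\<lambda>x. deriv (test_sn n j) x - ?v x))\<^sup>2"
      using triangle_sq[OF test_L2(2)[OF test_sn_test] L] weak_deriv_unique[OF weak_deriv_sn wderiv_weak[OF weak_deriv_sn]]
      by (simp add: l2_norm_sq ip_self_nonneg)
  qed
  then show "(\<lambda>j. l2_norm L (\<lambda>x. deriv (test_sn n j) x - ?w x)) \<longlonglongrightarrow> 0" by (rule l2_norm_tendsto)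
qed

lemma ip_cn_one: "ip (cn n) (\<lambda>x. 1) = 0"
proof -
  have "ip (cc (Suc n)) (cc 0) = 0" using orthonormal_cc unfolding orthonormal_def by simp
  then have "sqrt (1 / L) * ip (cn n) (\<lambda>x. 1) = 0"
    using ip_scale_right[of "cn n" "sqrt (1 / L)" "\<lambda>x. 1"] by (simp add: cc_def[abs_def])
  then show ?thesis using L_pos by simp
qed

lemma mean_eq: "(LINT x:I|lebesgue. u x) = ip u (\<lambda>x. 1)"
  by (simp add: l2_inner_def)

lemma H1_star_cn: "H1_star L (cn n)"
  unfolding H1_star_def H1_def mean_eq ip_cn_one using L2_cn weak_deriv_cn by blast

text \<open>For the approximating test functions there are no boundary terms, so \<open>w\<close>
  may be a cosine or a constant.\<close>

lemma H1_0_by_parts: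
  assumes u: "H1_0 L u" and w: "\<And>x. (w has_real_derivative w' x) (at x)" and w': "continuous_on {0..L} w'"
  shows "ip (wderiv L u) w = - ip u w'"
proof -
  obtain \<eta> where \<eta>: "\<And>n. test_function L (\<eta> n)" "(\<lambda>n. l2_norm L (\<lambda>x. \<eta> n x - u x)) \<longlonglongrightarrow> 0"
    "(\<lambda>n. l2_norm L (\<lambda>x. deriv (\<eta> n) x - wderiv L u x)) \<longlonglongrightarrow> 0"
    using u unfolding H1_0_def by blast
  have H: "L2 L u" "L2 L (wderiv L u)" using u H1_wderiv weak_deriv_L2 unfolding H1_0_def H1_def by blast+
  have wc: "continuous_on {0..L} w" using w by (meson DERIV_isCont continuous_at_imp_continuous_on)
  have wL: "L2 L w" "L2 L w'" by (intro L2_continuous wc w')+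
  show ?thesis
  proof (rule LIMSEQ_unique)
    show "(\<lambda>n. ip (deriv (\<eta> n)) w) \<longlonglongrightarrow> ip (wderiv L u) w"
      by (rule ip_tendsto[OF test_L2(2)[OF \<eta>(1)] H(2) wL(1) \<eta>(3)])
    have "(\<lambda>n. - ip (\<eta> n) w') \<longlonglongrightarrow> - ip u w'"
      by (intro tendsto_minus ip_tendsto[OF test_L2(1)[OF \<eta>(1)] H(1) wL(2) \<eta>(2)])
    then show "(\<lambda>n. ip (deriv (\<eta> n)) w) \<longlonglongrightarrow> - ip u w'"
      using test_by_parts[OF \<eta>(1) w w'] by (simp add: ip_commute)
  qed
qed

text \<open>Here the sine carries the boundary condition instead of \<open>u\<close>: the weak
  derivative is tested with \<open>test_sn n j\<close>, and \<open>j\<close> tends to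
  infinity.\<close>

lemma H1_wderiv_sn:
  assumes u: "H1 L u" shows "ip (wderiv L u) (sn n) = - freq n * ip u (cn n)"
proof -
  have W: "is_weak_deriv L u (wderiv L u)" by (rule H1_wderiv[OF u])
  have H: "L2 L u" "L2 L (wderiv L u)" using u W weak_deriv_L2 unfolding H1_def by blast+
  show ?thesis
  proof (rule LIMSEQ_unique)
    show "(\<lambda>j. ip (test_sn n j) (wderiv L u)) \<longlonglongrightarrow> ip (wderiv L u) (sn n)"
      unfolding ip_commute[of "wderiv L u"] by (rule ip_tendsto[OF test_L2(1)[OF test_sn_test] L2_sn H(2) test_sn_tendsto(1)])
    have "(\<lambda>j. - ip (deriv (test_sn n j)) u) \<longlonglongrightarrow> - ip (\<lambda>x. freq n * cn n x) u"
      by (intro tendsto_minus ip_tendsto[OF test_L2(2)[OF test_sn_test] L2_scale[OF L2_cn] H(1) test_sn_tendsto(2)])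
    moreover have "- ip (deriv (test_sn n j)) u = ip (test_sn n j) (wderiv L u)" for j
      using W test_sn_test unfolding is_weak_deriv_def by (simp add: ip_commute)
    moreover have "- ip (\<lambda>x. freq n * cn n x) u = - freq n * ip u (cn n)" by (simp add: ip_scale_left ip_commute)
    ultimately show "(\<lambda>j. ip (test_sn n j) (wderiv L u)) \<longlonglongrightarrow> - freq n * ip u (cn n)" by simp
  qed
qed

end

section \<open>The decay rate\<close>

locale decay_rate =
  fixes H' :: "real \<Rightarrow> real"
  assumes H'_cont: "continuous_on {0..} H'"
    and H'_pos: "\<And>s. s > 0 \<Longrightarrow> H' s > 0"
    and H'_mono: "\<And>s t. 0 < s \<Longrightarrow> s \<le> t \<Longrightarrow> H' s \<le> H' t"
begin

lemma integrand_cont: "y > 0 \<Longrightarrow> continuous_on {y..z} (\<lambda>s. 1 / (s * H' s))"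
  by (intro continuous_intros continuous_on_subset[OF H'_cont]) (use H'_pos in \<open>auto simp: less_imp_neq[symmetric]\<close>)

lemma G1_eq: assumes "y > 0" shows "G1 H' y = integral {y..1} (\<lambda>s. 1 / (s * H' s))"
  unfolding G1_def
  by (rule set_lebesgue_integral_eq_integral(2)[OF absolutely_integrable_continuous_real[OF integrand_cont[OF assms]]])

lemma G1_deriv_within:
  assumes "e > 0" "y \<in> {e..1}"
  shows "(G1 H' has_real_derivative - (1 / (y * H' y))) (at y within {e..1})"
  by (rule has_field_derivative_transform_within[OF integral_has_real_derivative'[OF integrand_cont[OF assms(1)] assms(2)], of 1])
     (use assms G1_eq in auto)

lemma G1_deriv: assumes "0 < y" "y < 1" shows "(G1 H' has_real_derivative - (1 / (y * H' y))) (at y)"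
proof -
  have "at y within {y/2..1} = at y" by (rule at_within_interior) (use assms in auto)
  then show ?thesis using G1_deriv_within[of "y/2" y] assms by simp
qed

lemma G1_cont: "e > 0 \<Longrightarrow> continuous_on {e..1} (G1 H')"
  by (auto simp: continuous_on_eq_continuous_within intro!: DERIV_continuous[OF G1_deriv_within])

lemma G1_decreasing: assumes "0 < y" "y < z" "z \<le> 1" shows "G1 H' z < G1 H' y"
proof (rule DERIV_neg_imp_decreasing_open[OF assms(2)])
  show "\<exists>d. (G1 H' has_real_derivative d) (at x) \<and> d < 0" if "y < x" "x < z" for x
    using G1_deriv[of x] H'_pos[of x] assms that by (intro exI[of _ "- (1 / (x * H' x))"]) auto
  show "continuous_on {y..z} (G1 H')" by (rule continuous_on_subset[OF G1_cont[OF assms(1)]]) (use assms in auto)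
qed

lemma G1_inj: "inj_on (G1 H') {0<..1}"
  by (rule linorder_inj_onI) (use G1_decreasing in force)+

lemma G1_one: "G1 H' 1 = 0" by (subst G1_eq) auto

text \<open>Monotonicity gives \<open>1 / (s * H' s) \<ge> 1 / (s * H' 1)\<close> on
  \<open>(0,1]\<close>, and this lower bound has a logarithmically divergent integral.
  \<open>e\<close> inverts the logarithm.\<close>

lemma G1_large: assumes "v \<ge> 0" obtains e where "0 < e" "e \<le> 1" "v \<le> G1 H' e"
proof -
  define h where "h = H' 1"
  have h: "h > 0" unfolding h_def by (rule H'_pos) simp
  define e where "e = exp (- (v * h))"
  have e: "0 < e" "e \<le> 1" using assms h by (auto simp: e_def)
  have "((\<lambda>s. 1 / (s * h)) has_integral (ln 1 / h - ln e / h)) {e..1}"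
    using e h by (intro fundamental_theorem_of_calculus)
      (auto simp: has_real_derivative_iff_has_vector_derivative[symmetric] field_simps intro!: derivative_eq_intros)
  then have i: "((\<lambda>s. 1 / (s * h)) has_integral v) {e..1}" using h by (simp add: e_def)
  have "v \<le> G1 H' e"
    unfolding G1_eq[OF e(1)]
  proof (rule has_integral_le[OF i])
    show "((\<lambda>s. 1 / (s * H' s)) has_integral integral {e..1} (\<lambda>s. 1 / (s * H' s))) {e..1}"
      by (intro integrable_integral integrable_continuous_real integrand_cont e)
    fix s assume "s \<in> {e..1}"
    then show "1 / (s * h) \<le> 1 / (s * H' s)"
      using e H'_pos[of s] H'_mono[of s 1] unfolding h_def by (intro divide_left_mono mult_left_mono mult_pos_pos) auto
  qed
  then show ?thesis using that e by blast
qed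

lemma G1_image: assumes "0 < e" "e \<le> 1" shows "G1 H' ` {e..1} = {0..G1 H' e}"
proof
  show "G1 H' ` {e..1} \<subseteq> {0..G1 H' e}"
  proof clarify
    fix y assume "y \<in> {e..1}"
    then show "G1 H' y \<in> {0..G1 H' e}"
      using G1_decreasing[of e y] G1_decreasing[of y 1] assms G1_one by (cases "y = e"; cases "y = 1") auto
  qed
  show "{0..G1 H' e} \<subseteq> G1 H' ` {e..1}"
  proof
    fix v assume "v \<in> {0..G1 H' e}"
    then have "\<exists>x. e \<le> x \<and> x \<le> 1 \<and> G1 H' x = v" using assms G1_one by (intro IVT2' G1_cont) auto
    then show "v \<in> G1 H' ` {e..1}" by auto
  qed
qed

section \<open>The inverse of \<open>G1\<close>\<close>

abbreviation "Ginv \<equiv> inv_into {0<..1} (G1 H')"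

lemma Ginv: assumes "v \<ge> 0" shows "0 < Ginv v" "Ginv v \<le> 1" "G1 H' (Ginv v) = v"
proof -
  obtain e where "0 < e" "e \<le> 1" "v \<le> G1 H' e" by (rule G1_large[OF assms])
  then have "v \<in> G1 H' ` {e..1}" using G1_image[of e] assms by auto
  then have v: "v \<in> G1 H' ` {0<..1}" using \<open>0 < e\<close> by auto
  show "G1 H' (Ginv v) = v" by (rule f_inv_into_f[OF v])
  show "0 < Ginv v" "Ginv v \<le> 1" using inv_into_into[OF v] by auto
qed

lemma Ginv_zero: "Ginv 0 = 1"
  using inv_into_f_f[OF G1_inj, of 1] G1_one by simp

lemma Ginv_less_one: "v > 0 \<Longrightarrow> Ginv v < 1"
  using Ginv[of v] G1_one by (cases "Ginv v = 1") auto

lemma Ginv_cont: "continuous_on {0..} Ginv"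
proof (rule continuous_on_halfline)
  fix T :: real
  show "continuous_on {0..T} Ginv"
  proof (cases "T \<ge> 0")
    case True
    obtain e where e: "0 < e" "e \<le> 1" "T \<le> G1 H' e" by (rule G1_large[OF True])
    have "continuous_on (G1 H' ` {e..1}) Ginv"
      by (rule continuous_on_inv[OF G1_cont[OF e(1)]]) (use e inv_into_f_f[OF G1_inj] in auto)
    then show ?thesis unfolding G1_image[OF e(1,2)] by (rule continuous_on_subset) (use e in auto)
  qed auto
qed

text \<open>The inverse function rule: \<open>Ginv\<close> solves the autonomous equation with
  right-hand side \<open>- G2\<close>. Positive \<open>v\<close> has a neighbourhood in the range of
  \<open>G1\<close> on \<open>(0,1]\<close>, whereas 0 is its end point.\<close>

lemma Ginv_deriv:
  assumes "v > 0" shows "(Ginv has_real_derivative - (Ginv v * H' (Ginv v))) (at v)"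
proof -
  note i = Ginv[of v] Ginv_less_one[OF assms]
  have "(Ginv has_real_derivative inverse (- (1 / (Ginv v * H' (Ginv v))))) (at v)"
  proof (rule DERIV_inverse_function[where a=0 and b="v + 1"])
    show "(G1 H' has_real_derivative - (1 / (Ginv v * H' (Ginv v)))) (at (Ginv v))" using i assms by (intro G1_deriv) auto
    show "- (1 / (Ginv v * H' (Ginv v))) \<noteq> 0" using i H'_pos[of "Ginv v"] assms by auto
    show "isCont Ginv v"
      by (rule continuous_on_interior[OF Ginv_cont]) (use assms in \<open>auto simp: interior_real_atLeast\<close>)
    show "\<And>y. 0 < y \<Longrightarrow> y < v + 1 \<Longrightarrow> G1 H' (Ginv y) = y" using Ginv by auto
  qed (use assms in auto)
  then show ?thesis by simp
qed

context
  fixes \<xi> :: "real \<Rightarrow> real" and c1 :: real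
  assumes \<xi>_cont: "continuous_on {0..} \<xi>" and \<xi>_pos: "\<And>t. t \<ge> 0 \<Longrightarrow> \<xi> t > 0" and c1: "c1 > 0"
begin

section \<open>\<open>G5\<close> and the supersolutions built from it\<close>

lemma G5_eq: "t \<ge> 0 \<Longrightarrow> G5 H' \<xi> c1 t = Ginv (c1 * integral {0..t} \<xi>)"
  unfolding G5_def
  by (subst set_lebesgue_integral_eq_integral(2)) (auto intro!: absolutely_integrable_continuous_real continuous_on_subset[OF \<xi>_cont])

lemma clock_deriv: assumes "t > 0" shows "((\<lambda>t. c1 * integral {0..t} \<xi>) has_real_derivative c1 * \<xi> t) (at t)"
proof -
  have "((\<lambda>x. integral {0..x} \<xi>) has_real_derivative \<xi> t) (at t within {0..t + 1})"
    by (rule integral_has_real_derivative[OF continuous_on_subset[OF \<xi>_cont]]) (use assms in auto)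
  moreover have "at t within {0..t + 1} = at t" by (rule at_within_interior) (use assms in auto)
  ultimately show ?thesis by (auto intro!: derivative_eq_intros)
qed

lemma clock_cont: "continuous_on {0..} (\<lambda>t. c1 * integral {0..t} \<xi>)"
  by (intro continuous_intros continuous_on_halfline indefinite_integral_continuous_1 integrable_continuous_real continuous_on_subset[OF \<xi>_cont]) auto

lemma clock_nonneg: "t \<ge> 0 \<Longrightarrow> 0 \<le> c1 * integral {0..t} \<xi>"
  using c1 \<xi>_pos
  by (intro mult_nonneg_nonneg Henstock_Kurzweil_Integration.integral_nonneg integrable_continuous_real continuous_on_subset[OF \<xi>_cont])
     (auto intro: less_imp_le)

lemma clock_pos: assumes "t > 0" shows "0 < c1 * integral {0..t} \<xi>"
proof -
  have "c1 * integral {0..0} \<xi> < c1 * integral {0..t} \<xi>"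
  proof (rule DERIV_pos_imp_increasing_open[OF assms, where f="\<lambda>t. c1 * integral {0..t} \<xi>"])
    show "\<exists>y. ((\<lambda>t. c1 * integral {0..t} \<xi>) has_real_derivative y) (at x) \<and> 0 < y" if "0 < x" "x < t" for x
      using clock_deriv[OF that(1)] c1 \<xi>_pos[of x] that by (intro exI[of _ "c1 * \<xi> x"]) auto
    show "continuous_on {0..t} (\<lambda>t. c1 * integral {0..t} \<xi>)" by (rule continuous_on_subset[OF clock_cont]) auto
  qed
  then show ?thesis by simp
qed

lemma G5_range: "t \<ge> 0 \<Longrightarrow> 0 < G5 H' \<xi> c1 t" "t \<ge> 0 \<Longrightarrow> G5 H' \<xi> c1 t \<le> 1"
  using Ginv[OF clock_nonneg] by (simp_all add: G5_eq)

lemma G5_zero: "G5 H' \<xi> c1 0 = 1"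
  by (simp add: G5_eq Ginv_zero)

lemma G5_cont: "continuous_on {0..} (G5 H' \<xi> c1)"
proof (rule continuous_on_eq)
  show "continuous_on {0..} (\<lambda>t. Ginv (c1 * integral {0..t} \<xi>))"
    by (rule continuous_on_compose2[OF Ginv_cont clock_cont]) (auto simp: clock_nonneg)
qed (simp add: G5_eq)

lemma G5_deriv:
  assumes "t > 0"
  shows "(G5 H' \<xi> c1 has_real_derivative - (c1 * \<xi> t * G2 H' (G5 H' \<xi> c1 t))) (at t)"
proof -
  have "((\<lambda>t. Ginv (c1 * integral {0..t} \<xi>)) has_real_derivative
      - (Ginv (c1 * integral {0..t} \<xi>) * H' (Ginv (c1 * integral {0..t} \<xi>))) * (c1 * \<xi> t)) (at t)"
    by (rule DERIV_chain2[OF Ginv_deriv[OF clock_pos[OF assms]] clock_deriv[OF assms]])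
  then have "(G5 H' \<xi> c1 has_real_derivative
      - (Ginv (c1 * integral {0..t} \<xi>) * H' (Ginv (c1 * integral {0..t} \<xi>))) * (c1 * \<xi> t)) (at t)"
    by (rule has_field_derivative_transform_within_open[where S="{0<..}"]) (use assms in \<open>auto simp: G5_eq\<close>)
  then show ?thesis using assms by (simp add: G2_def G5_eq mult_ac)
qed

text \<open>The derivative of \<open>G5\<close> is \<open>- c1 * \<xi>\<close> times
  \<open>G2\<close> of \<open>G5\<close>. Division by the nonincreasing \<open>chi\<close> adds the
  term \<open>- G5 * chi' / chi\<^sup>2\<close>, which is nonnegative.\<close>

lemma quotient_supersolution:
  assumes chi: "\<And>t. t \<ge> 0 \<Longrightarrow> 0 < chi t" "\<And>t. t \<ge> 0 \<Longrightarrow> (chi has_real_derivative chi' t) (at t within {0..})" "\<And>t. t \<ge> 0 \<Longrightarrow> chi' t \<le> 0"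
    and st: "0 \<le> s" "s \<le> t"
  shows "continuous_on {0..} (\<lambda>t. G5 H' \<xi> c1 t / chi t)" "continuous_on {0..} (\<lambda>t. G2 H' (G5 H' \<xi> c1 t) / chi t)"
    "integral {s..t} (\<lambda>\<tau>. - c1 * \<xi> \<tau> * (G2 H' (G5 H' \<xi> c1 \<tau>) / chi \<tau>)) \<le> G5 H' \<xi> c1 t / chi t - G5 H' \<xi> c1 s / chi s"
proof -
  let ?G = "G5 H' \<xi> c1"
  have chic: "continuous_on {0..} chi"
    using chi(2) by (auto simp: continuous_on_eq_continuous_within intro!: DERIV_continuous)
  have chi0: "\<forall>t\<in>{0..}. chi t \<noteq> 0" using chi(1) by (auto simp: less_imp_neq[symmetric])
  show Zc: "continuous_on {0..} (\<lambda>t. ?G t / chi t)" by (intro continuous_intros G5_cont chic chi0)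
  have "continuous_on {0..} (\<lambda>t. H' (?G t))"
    by (rule continuous_on_compose2[OF H'_cont G5_cont]) (auto simp: G5_range less_imp_le)
  then show Bc: "continuous_on {0..} (\<lambda>t. G2 H' (?G t) / chi t)"
    unfolding G2_def by (intro continuous_intros G5_cont chic chi0)
  define Z' where "Z' t = (- (c1 * \<xi> t * G2 H' (?G t)) * chi t - ?G t * chi' t) / (chi t * chi t)" for t
  have sub: "continuous_on {s..t} f" if "continuous_on {0..} f" for f :: "real \<Rightarrow> real"
    by (rule continuous_on_subset[OF that]) (use st in auto)
  have d: "((\<lambda>t. ?G t / chi t) has_vector_derivative Z' x) (at x)" if "x \<in> {s<..<t}" for x
  proof -
    have x: "x > 0" using that st by auto
    have "at x within {0..} = at x" by (rule at_within_interior) (use x in \<open>auto simp: interior_real_atLeast\<close>)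
    then have "(chi has_real_derivative chi' x) (at x)" using chi(2)[of x] x by simp
    then show ?thesis unfolding Z'_def has_real_derivative_iff_has_vector_derivative[symmetric]
      using DERIV_divide[OF G5_deriv[OF x]] chi(1)[of x] x by simp
  qed
  \<comment> \<open>The derivative of \<open>G5\<close> is known at positive times only and
    \<open>s\<close> may be 0; hence the fundamental theorem with interior derivatives.\<close>
  have i: "(Z' has_integral (?G t / chi t - ?G s / chi s)) {s..t}"
    by (rule fundamental_theorem_of_calculus_interior[OF st(2) sub[OF Zc] d])
  have xc: "continuous_on {s..t} (\<lambda>\<tau>. - c1 * \<xi> \<tau> * (G2 H' (?G \<tau>) / chi \<tau>))"
    by (intro continuous_intros sub[OF \<xi>_cont] sub[OF Bc])
  show "integral {s..t} (\<lambda>\<tau>. - c1 * \<xi> \<tau> * (G2 H' (?G \<tau>) / chi \<tau>)) \<le> ?G t / chi t - ?G s / chi s"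
  proof (rule has_integral_le[OF integrable_integral[OF integrable_continuous_real[OF xc]] i])
    fix x assume "x \<in> {s..t}"
    then have x: "x \<ge> 0" using st by auto
    have "- c1 * \<xi> x * (G2 H' (?G x) / chi x) = - (c1 * \<xi> x * G2 H' (?G x)) * chi x / (chi x * chi x)"
      using chi(1)[OF x] by simp
    also have "\<dots> \<le> Z' x" unfolding Z'_def
      using mult_nonneg_nonpos[OF less_imp_le[OF G5_range(1)[OF x]] chi(3)[OF x]] by (intro divide_right_mono) auto
    finally show "- c1 * \<xi> x * (G2 H' (?G x) / chi x) \<le> Z' x" .
  qed
qed

end

end

text \<open>Convexity is given on the open half-line and provides tangents there. The tangent at 0
  is the zero function, so at \<open>u = 0\<close> positivity of \<open>H\<close> takes its
  place.\<close>

lemma nonlinear_H_facts: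
  assumes A: "\<forall>s\<ge>0. H s \<ge> 0 \<and> (H has_real_derivative H' s) (at s within {0..})" and N: "hyp_H_nonlinear H H'"
  shows "\<And>s t. 0 \<le> s \<Longrightarrow> s < t \<Longrightarrow> H' s < H' t" "\<And>u z. 0 \<le> u \<Longrightarrow> 0 < z \<Longrightarrow> H u + H' u * (z - u) \<le> H z"
    "\<And>s t. 0 < s \<Longrightarrow> s \<le> t \<Longrightarrow> H s \<le> H t" "\<And>s. 0 < s \<Longrightarrow> 0 < H s"
proof -
  have H0: "H 0 = 0" "H' 0 = 0" and sm: "strict_mono_on {0<..} H" and sc: "strictly_convex_on {0<..} H"
    using N unfolding hyp_H_nonlinear_def by auto
  have d: "(H has_real_derivative H' s) (at s within {0<..})" if "s > 0" for s
  proof -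
    have "(H has_real_derivative H' s) (at s within {0..})" using A that by simp
    then show ?thesis by (rule DERIV_subset) auto
  qed
  have cv: "convex_on {0<..} H"
  proof (rule convex_onI)
    fix t x y :: real assume *: "0 < t" "t < 1" "x \<in> {0<..}" "y \<in> {0<..}"
    show "H ((1 - t) *\<^sub>R x + t *\<^sub>R y) \<le> (1 - t) * H x + t * H y"
    proof (cases "x = y")
      case False
      then show ?thesis using sc * unfolding strictly_convex_on_def by (intro less_imp_le) auto
    qed (simp add: algebra_simps)
  qed auto
  have tan: "H u + H' u * (z - u) \<le> H z" if "u > 0" "z > 0" for u z
    using convex_on_imp_above_tangent[OF cv _ _ _ d[OF that(1)], of z] that by (simp add: interior_open)
  show mono: "H s \<le> H t" if "0 < s" "s \<le> t" for s t
    using sm that unfolding strict_mono_on_def by (cases "s = t") (auto intro: less_imp_le)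
  show Hp: "0 < H s" if "0 < s" for s
  proof -
    have "H (s / 2) < H s" using sm that unfolding strict_mono_on_def by auto
    moreover have "0 \<le> H (s / 2)" using A that by simp
    ultimately show ?thesis by linarith
  qed
  show "H u + H' u * (z - u) \<le> H z" if "0 \<le> u" "0 < z" for u z
  proof (cases "u = 0")
    case True then show ?thesis using H0 Hp[OF that(2)] by simp
  qed (use tan that in auto)
  show "H' s < H' t" if st: "0 \<le> s" "s < t" for s t
  proof (cases "s = 0")
    case True
    have t: "t > 0" using st by auto
    \<comment> \<open>The tangent at \<open>t\<close>, evaluated at \<open>t / 2\<close>, is at most
      \<open>H (t / 2) < H t\<close>, which forces its slope to be positive.\<close>
    have "H t + H' t * (t / 2 - t) \<le> H (t / 2)" using tan[OF t, of "t / 2"] t by simp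
    moreover have "H (t / 2) < H t" using sm t unfolding strict_mono_on_def by auto
    ultimately have "0 < H' t * (t / 2)" by (simp add: algebra_simps)
    then have "0 < H' t" using t by (simp add: zero_less_mult_iff)
    then show ?thesis using True H0 by simp
  next
    case False
    then have s: "s > 0" "t > 0" using st by auto
    \<comment> \<open>The tangents at \<open>s\<close> and \<open>t\<close>, both evaluated at the
      midpoint, are compared with strict convexity there; this separates the slopes.\<close>
    define w where "w = (1/2) * s + (1/2) * t"
    have "H w < (1/2) * H s + (1/2) * H t"
    proof -
      have "H (u * x + v * y) < u * H x + v * H y" if "0 < x" "0 < y" "0 < u" "0 < v" "x \<noteq> y" "u + v = 1" for x y u v
        using sc that unfolding strictly_convex_on_def by blast
      from this[of s t "1/2" "1/2"] show ?thesis unfolding w_def using s st by simp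
    qed
    moreover have "H s + H' s * (w - s) \<le> H w" "H t + H' t * (w - t) \<le> H w" using tan[of s w] tan[of t w] s unfolding w_def by auto
    moreover have "w - s = (t - s) / 2" "w - t = - ((t - s) / 2)" by (auto simp: w_def field_simps)
    ultimately have "H' s * ((t - s) / 2) < H' t * ((t - s) / 2)" by simp
    then show ?thesis using st by (simp add: mult_less_cancel_right)
  qed
qed

section \<open>From the boundary value problem to the modes\<close>

text \<open>The problem is posed with Lebesgue measure, whereas the memory calculus works with Borel
  functions; this translates between the two.\<close>

lemma lebesgue_lborel:
  fixes f f' :: "real \<Rightarrow> real"
  assumes m: "f' \<in> borel_measurable borel" and ae: "AE x in lborel. f x = f' x"
  shows "(LINT x|lebesgue. f x) = (LINT x|lborel. f' x)" "integrable lebesgue f \<longleftrightarrow> integrable lborel f'"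
    "f \<in> borel_measurable lebesgue"
proof -
  have m': "f' \<in> borel_measurable lborel" using m by simp
  have ae': "AE x in lebesgue. f' x = f x" using ae by (intro AE_completion) (auto elim: AE_mp)
  have fm': "f' \<in> borel_measurable lebesgue" using m' by (rule measurable_completion)
  show fm: "f \<in> borel_measurable lebesgue" by (rule borel_measurable_AE[OF fm' ae'])
  have "(LINT x|lebesgue. f' x) = (LINT x|lebesgue. f x)" by (rule integral_cong_AE[OF fm' fm ae'])
  then show "(LINT x|lebesgue. f x) = (LINT x|lborel. f' x)" using integral_completion[OF m'] by simp
  have "integrable lebesgue f' \<longleftrightarrow> integrable lebesgue f" by (rule integrable_cong_AE[OF fm' fm ae'])
  then show "integrable lebesgue f \<longleftrightarrow> integrable lborel f'" using integrable_completion[OF m'] by simp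
qed

text \<open>Monotonicity bounds \<open>T * g T\<close> by the integral of \<open>g\<close>, so
  \<open>g\<close> decays at least like \<open>1 / T\<close>.\<close>

lemma antimono_integrable_tendsto_0:
  fixes g :: "real \<Rightarrow> real"
  assumes pos: "\<And>t. t \<ge> 0 \<Longrightarrow> g t > 0" and anti: "\<And>s t. 0 \<le> s \<Longrightarrow> s \<le> t \<Longrightarrow> g t \<le> g s" and int: "set_integrable lebesgue {0..} g"
  shows "(g \<longlongrightarrow> 0) at_top"
proof (rule Lim_null_comparison)
  define G where "G = (LINT s:{0..}|lebesgue. g s)"
  have le: "T * g T \<le> G" if "T > 0" for T
  proof -
    have i: "set_integrable lebesgue {0..T} g" by (rule set_integrable_subset[OF int]) auto
    have c: "set_integrable lebesgue {0..T} (\<lambda>_. g T)" by (intro absolutely_integrable_continuous_real continuous_intros)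
    have "T * g T = (LINT s:{0..T}|lebesgue. g T)" using set_lebesgue_integral_eq_integral(2)[OF c] that by simp
    also have "\<dots> \<le> (LINT s:{0..T}|lebesgue. g s)" by (rule set_integral_mono[OF c i]) (use anti in auto)
    also have "\<dots> \<le> G" unfolding G_def
      unfolding set_lebesgue_integral_def using i int pos unfolding set_integrable_def
      by (intro integral_mono) (auto simp: indicator_def intro: less_imp_le)
    finally show ?thesis .
  qed
  show "\<forall>\<^sub>F T in at_top. norm (g T) \<le> G / T"
    using eventually_gt_at_top[of "0::real"]
  proof eventually_elim
    case (elim T)
    then show ?case using le[OF elim] pos[of T] by (simp add: field_simps)
  qed
  show "((\<lambda>T. G / T) \<longlongrightarrow> 0) at_top"
    by (intro tendsto_divide_0[OF tendsto_const] filterlim_at_top_imp_at_infinity filterlim_ident)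
qed

text \<open>\<open>m\<close> is \<open>- g'\<close>, extended by 0. As \<open>g'\<close> may be
  discontinuous, \<open>g\<close> is recovered by the fundamental theorem for nonnegative measurable
  integrands; together with the limit 0 of \<open>g\<close> this also yields the integrability of
  \<open>m\<close>.\<close>

lemma relaxation_density:
  fixes g \<xi> H :: "real \<Rightarrow> real"
  assumes pos: "\<And>t. t \<ge> 0 \<Longrightarrow> g t > 0" and anti: "\<And>s t. 0 \<le> s \<Longrightarrow> s \<le> t \<Longrightarrow> g t \<le> g s" and int: "set_integrable lebesgue {0..} g"
    and der: "\<And>t. t \<ge> 0 \<Longrightarrow> \<exists>D. (g has_real_derivative D) (at t within {0..}) \<and> D \<le> - \<xi> t * H (g t)"
    and \<xi>: "\<And>t. t \<ge> 0 \<Longrightarrow> \<xi> t > 0" and H: "\<And>s. s \<ge> 0 \<Longrightarrow> H s \<ge> 0"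
  obtains m where "memory_kernel m" "\<And>s. s \<ge> 0 \<Longrightarrow> tail_kernel m s = g s" "\<And>r. r \<ge> 0 \<Longrightarrow> \<xi> r * H (g r) \<le> m r"
proof -
  have "\<forall>t. \<exists>D. t \<ge> 0 \<longrightarrow> (g has_real_derivative D) (at t within {0..}) \<and> D \<le> - \<xi> t * H (g t)" using der by blast
  from choice[OF this] obtain g' where "\<forall>t. t \<ge> 0 \<longrightarrow> (g has_real_derivative g' t) (at t within {0..}) \<and> g' t \<le> - \<xi> t * H (g t)" by blast
  then have g': "\<And>t. t \<ge> 0 \<Longrightarrow> (g has_real_derivative g' t) (at t within {0..})" and g'le: "\<And>t. t \<ge> 0 \<Longrightarrow> \<xi> t * H (g t) \<le> - g' t"
    by auto
  define m where "m r = (if r \<ge> 0 then - g' r else 0)" for r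
  have m_lower: "\<xi> r * H (g r) \<le> m r" if "r \<ge> 0" for r using g'le[OF that] that by (simp add: m_def)
  have m_nonneg: "0 \<le> m r" for r
  proof (cases "r \<ge> 0")
    case True
    have "0 \<le> \<xi> r * H (g r)" using \<xi>[OF True] H[of "g r"] pos[OF True] by simp
    then show ?thesis using m_lower[OF True] by simp
  qed (simp add: m_def)
  have gc: "continuous_on {0..} g" using g' by (auto simp: continuous_on_eq_continuous_within intro!: DERIV_continuous)
  define gg where "gg t = g (max 0 t)" for t
  have "continuous_on UNIV gg" unfolding gg_def by (rule continuous_on_compose2[OF gc]) (auto intro!: continuous_intros)
  then have ggm [measurable]: "gg \<in> borel_measurable borel" by (rule borel_measurable_continuous_onI)
  \<comment> \<open>A pointwise limit of difference quotients taken to the right, which make sense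
    at 0 as well.\<close>
  have m_borel: "m \<in> borel_measurable borel"
  proof (rule borel_measurable_LIMSEQ_real)
    fix r :: real
    show "(\<lambda>n. indicator {0..} r * (- ((gg (r + 1 / real (Suc n)) - gg r) / (1 / real (Suc n))))) \<longlonglongrightarrow> m r"
    proof (cases "r \<ge> 0")
      case True
      have "((\<lambda>y. (g y - g r) / (y - r)) \<longlongrightarrow> g' r) (at r within {0..})" using g'[OF True] unfolding has_field_derivative_iff .
      then have seq: "\<And>X. (\<forall>i. X i \<in> {0..} - {r}) \<Longrightarrow> X \<longlonglongrightarrow> r \<Longrightarrow> ((\<lambda>y. (g y - g r) / (y - r)) \<circ> X) \<longlonglongrightarrow> g' r"
        unfolding tendsto_at_iff_sequentially by blast
      have "(\<lambda>n. r + 1 / real (Suc n)) \<longlonglongrightarrow> r + 0"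
        by (intro tendsto_intros) (rule LIMSEQ_inverse_real_of_nat[unfolded inverse_eq_divide])
      then have "((\<lambda>y. (g y - g r) / (y - r)) \<circ> (\<lambda>n. r + 1 / real (Suc n))) \<longlonglongrightarrow> g' r"
        using True by (intro seq) auto
      from tendsto_minus[OF this] show ?thesis using True by (simp add: m_def gg_def o_def)
    qed (simp add: m_def)
  qed measurable
  \<comment> \<open>The affine extension to the left makes the derivative at 0 two-sided.\<close>
  define ge where "ge t = (if 0 \<le> t then g t else g 0 + g' 0 * t)" for t
  have gder: "((\<lambda>t. - ge t) has_real_derivative m t) (at t)" if "t \<ge> 0" for t
  proof (cases "t = 0")
    case False
    have "at t within {0..} = at t" by (rule at_within_interior) (use False that in \<open>auto simp: interior_real_atLeast\<close>)
    then have "(g has_real_derivative g' t) (at t)" using g'[OF that] by simp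
    then have "(ge has_real_derivative g' t) (at t)"
      by (rule has_field_derivative_transform_within_open[where S="{0<..}"]) (use False that in \<open>auto simp: ge_def\<close>)
    from DERIV_minus[OF this] show ?thesis using that by (simp add: m_def)
  next
    case True
    have "((\<lambda>y. (g y - g 0) / (y - 0)) \<longlongrightarrow> g' 0) (at_right 0)"
      using g'[of 0] unfolding has_field_derivative_iff by (simp add: at_within_Ici_at_right)
    then have r: "((\<lambda>y. (ge y - ge 0) / (y - 0)) \<longlongrightarrow> g' 0) (at_right 0)"
      by (rule Lim_transform_eventually) (auto simp: eventually_at_filter ge_def)
    have l: "((\<lambda>y. (ge y - ge 0) / (y - 0)) \<longlongrightarrow> g' 0) (at_left 0)"
      by (rule Lim_transform_eventually[OF tendsto_const]) (auto simp: eventually_at_filter ge_def)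
    have "(ge has_real_derivative g' 0) (at 0)"
      unfolding has_field_derivative_iff using filterlim_split_at[OF l r] .
    from DERIV_minus[OF this] show ?thesis using True by (simp add: m_def)
  qed
  have lim: "((\<lambda>t. - ge t) \<longlongrightarrow> 0) at_top"
  proof (rule Lim_transform_eventually)
    show "((\<lambda>t. - g t) \<longlongrightarrow> 0) at_top" using tendsto_minus[OF antimono_integrable_tendsto_0[OF pos anti int]] by simp
    show "\<forall>\<^sub>F t in at_top. - g t = - ge t" using eventually_ge_at_top[of "0::real"] by eventually_elim (auto simp: ge_def)
  qed
  have tail: "has_bochner_integral lborel (\<lambda>x. m x * indicator {a..} x) (g a)" if "a \<ge> 0" for a
  proof (rule has_bochner_integral_nn_integral)
    have "(\<integral>\<^sup>+ x. ennreal (m x) * indicator {a..} x \<partial>lborel) = 0 - (- ge a)"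
      by (rule nn_integral_FTC_atLeast[OF m_borel gder _ lim]) (use that m_nonneg in auto)
    then show "(\<integral>\<^sup>+ x. ennreal (m x * indicator {a..} x) \<partial>lborel) = ennreal (g a)"
      using that by (simp add: ge_def ennreal_mult' m_nonneg ennreal_indicator)
  qed (use m_borel m_nonneg pos[OF that] in \<open>auto intro: less_imp_le\<close>)
  have mk: "memory_kernel m"
  proof
    have "(\<lambda>x. m x * indicator {0..} x) = m" by (auto simp: m_def indicator_def)
    then show "integrable lborel m" using tail[of 0] by (simp add: has_bochner_integral_iff)
    show "0 \<le> m r" for r by (rule m_nonneg)
    show "r < 0 \<Longrightarrow> m r = 0" for r by (simp add: m_def)
  qed
  show thesis
  proof (rule that[OF mk _ m_lower])
    fix s :: real assume s: "s \<ge> 0"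
    have "tail_kernel m s = (LINT x|lborel. m x * indicator {s..} x)"
      unfolding tail_kernel_def
    proof (rule integral_cong_AE)
      show "AE x in lborel. indicator {s<..} x * m x = m x * indicator {s..} x"
        using AE_lborel_singleton[of s] by eventually_elim (auto simp: indicator_def)
    qed (use m_borel in auto)
    then show "tail_kernel m s = g s" using tail[OF s] by (simp add: has_bochner_integral_iff)
  qed
qed

context interval
begin

lemma AE_M: "AE x in lebesgue. x \<in> I \<longrightarrow> Q x \<Longrightarrow> AE x in M. Q x"
  by (subst AE_restrict_space_iff) auto

lemma ae_eq_M: "ae_eq L u v \<Longrightarrow> AE x in M. u x = v x"
  unfolding ae_eq_def by (rule AE_M)

lemma L2_ae: assumes "ae_eq L u v" "L2 L v" shows "L2 L u"
proof -
  have "(\<lambda>x. if x \<in> I then v x else 0) \<in> borel_measurable lebesgue"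
    by (rule borel_measurable_if_I[OF L2_measurable[OF assms(2)]]) simp
  moreover have "AE x in lebesgue. (if x \<in> I then v x else 0) = (if x \<in> I then u x else 0)"
    using assms(1) unfolding ae_eq_def by eventually_elim auto
  ultimately have "(\<lambda>x. if x \<in> I then u x else 0) \<in> borel_measurable lebesgue" by (rule borel_measurable_AE)
  then have um: "u \<in> borel_measurable M" by (rule borel_measurable_if_D)
  have "integrable M (\<lambda>x. (v x)\<^sup>2)" using assms(2) by (simp add: L2_iff)
  moreover have "AE x in M. (v x)\<^sup>2 = (u x)\<^sup>2" using ae_eq_M[OF assms(1)] by eventually_elim auto
  ultimately have "integrable M (\<lambda>x. (u x)\<^sup>2)"
    using um L2_measurable[OF assms(2)] by (subst (asm) integrable_cong_AE) auto
  then show ?thesis using um by (simp add: L2_iff)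
qed

lemma ip_ae: assumes "ae_eq L u v" "L2 L v" "L2 L w" shows "ip u w = ip v w"
  unfolding ip_eq
proof (rule integral_cong_AE)
  show "(\<lambda>x. u x * w x) \<in> borel_measurable M" "(\<lambda>x. v x * w x) \<in> borel_measurable M"
    using L2_measurable[OF L2_ae[OF assms(1,2)]] L2_measurable[OF assms(2)] L2_measurable[OF assms(3)] by auto
  show "AE x in M. u x * w x = v x * w x" using ae_eq_M[OF assms(1)] by eventually_elim auto
qed

text \<open>Functions that agree almost everywhere have the same weak derivatives, so the choice
  operator returns literally the same function.\<close>

lemma wderiv_ae: assumes "ae_eq L u v" "L2 L v" shows "wderiv L u = wderiv L v"
proof -
  have "is_weak_deriv L u w \<longleftrightarrow> is_weak_deriv L v w" for w
    unfolding is_weak_deriv_def using ip_ae[OF assms test_L2(2)] by auto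
  then have "is_weak_deriv L u = is_weak_deriv L v" by (intro ext) simp
  then show ?thesis unfolding wderiv_def by simp
qed

lemma tderiv_spec: "C1_L2 L u \<Longrightarrow> t \<ge> 0 \<Longrightarrow> is_tderiv_L2 L u t (tderiv L u t)"
  unfolding C1_L2_def tderiv_def by (metis someI_ex)

lemma tderiv_L2: "C1_L2 L u \<Longrightarrow> t \<ge> 0 \<Longrightarrow> L2 L (tderiv L u t)"
  using tderiv_spec unfolding is_tderiv_L2_def by blast

text \<open>Cauchy-Schwarz turns the norm convergence of the difference quotients into convergence
  of the coefficients.\<close>

lemma ip_tderiv:
  assumes u: "C1_L2 L u" and t: "t \<ge> 0" and v: "L2 L v"
  shows "((\<lambda>s. ip (u s) v) has_real_derivative ip (tderiv L u t) v) (at t within {0..})"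
  unfolding has_field_derivative_iff
proof -
  have uL: "L2 L (u s)" if "s \<ge> 0" for s using u that unfolding C1_L2_def cont_L2_def by blast
  have dL: "L2 L (tderiv L u t)" by (rule tderiv_L2[OF u t])
  have lim: "((\<lambda>s. l2_norm L (\<lambda>x. (u s x - u t x) / (s - t) - tderiv L u t x)) \<longlongrightarrow> 0) (at t within {0..})"
    using tderiv_spec[OF u t] unfolding is_tderiv_L2_def by blast
  have "((\<lambda>s. (ip (u s) v - ip (u t) v) / (s - t) - ip (tderiv L u t) v) \<longlongrightarrow> 0) (at t within {0..})"
  proof (rule Lim_null_comparison)
    show "((\<lambda>s. l2_norm L (\<lambda>x. (u s x - u t x) / (s - t) - tderiv L u t x) * l2_norm L v) \<longlongrightarrow> 0) (at t within {0..})"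
      by (rule tendsto_mult_left_zero[OF lim])
    show "\<forall>\<^sub>F s in at t within {0..}. norm ((ip (u s) v - ip (u t) v) / (s - t) - ip (tderiv L u t) v)
        \<le> l2_norm L (\<lambda>x. (u s x - u t x) / (s - t) - tderiv L u t x) * l2_norm L v"
      unfolding eventually_at_filter
    proof (intro always_eventually allI impI)
      fix s :: real assume "s \<in> {0..}"
      then have s: "s \<ge> 0" by simp
      have dq: "L2 L (\<lambda>x. (u s x - u t x) / (s - t))"
        using L2_scale[OF L2_diff[OF uL[OF s] uL[OF t]], of "1 / (s - t)"] by simp
      have "ip (\<lambda>x. (u s x - u t x) / (s - t)) v = (ip (u s) v - ip (u t) v) / (s - t)"
        using ip_scale_left[of "1 / (s - t)" "\<lambda>x. u s x - u t x" v] ip_diff_left[OF uL[OF s] uL[OF t] v] by simp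
      then have "(ip (u s) v - ip (u t) v) / (s - t) - ip (tderiv L u t) v
          = ip (\<lambda>x. (u s x - u t x) / (s - t) - tderiv L u t x) v"
        using ip_diff_left[OF dq dL v] by simp
      then show "norm ((ip (u s) v - ip (u t) v) / (s - t) - ip (tderiv L u t) v)
        \<le> l2_norm L (\<lambda>x. (u s x - u t x) / (s - t) - tderiv L u t x) * l2_norm L v"
        using cauchy_schwarz[OF L2_diff[OF dq dL] v] by simp
    qed
  qed
  then show "((\<lambda>s. (ip (u s) v - ip (u t) v) / (s - t)) \<longlongrightarrow> ip (tderiv L u t) v) (at t within {0..})"
    by (rule LIM_zero_cancel)
qed

end

locale timoshenko_problem = interval L for L +
  fixes \<rho>1 \<rho>2 b \<kappa> \<delta> :: real and g \<xi> H H' m :: "real \<Rightarrow> real"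
    and \<phi>0 \<psi>0 \<phi> \<psi> :: "real \<Rightarrow> real \<Rightarrow> real" and \<phi>1 \<psi>1 :: "real \<Rightarrow> real"
  assumes pos: "\<rho>1 > 0" "\<rho>2 > 0" "b > 0" "\<kappa> > 0" and speeds: "\<kappa> / \<rho>1 = b / \<rho>2"
    and kernel: "memory_kernel m" and tail: "\<And>s. s \<ge> 0 \<Longrightarrow> tail_kernel m s = g s"
    and kernel_decay: "\<And>r. r \<ge> 0 \<Longrightarrow> \<xi> r * H (g r) \<le> m r"
    and \<delta>: "\<delta> > 0" "\<And>r. r \<in> {0..1} \<Longrightarrow> \<delta> \<le> m r"
    and g_pos: "\<And>t. t \<ge> 0 \<Longrightarrow> g t > 0" and g_int: "set_integrable lebesgue {0..} g"
    and g_mass: "0 < (LINT s:{0..}|lebesgue. g s)" "(LINT s:{0..}|lebesgue. g s) < 1"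
    and \<xi>: "\<And>t. t \<ge> 0 \<Longrightarrow> \<xi> t > 0" "\<And>s t. 0 \<le> s \<Longrightarrow> s \<le> t \<Longrightarrow> \<xi> t \<le> \<xi> s" "continuous_on {0..} \<xi>"
    and H: "\<And>u z. 0 \<le> u \<Longrightarrow> 0 < z \<Longrightarrow> H' u * z \<le> H z + u * H' u" "\<And>z. 0 \<le> z \<Longrightarrow> 0 \<le> H z"
      "\<And>u. 0 \<le> u \<Longrightarrow> 0 \<le> H' u" "\<And>u z. 0 \<le> u \<Longrightarrow> u \<le> z \<Longrightarrow> H' u \<le> H' z" "continuous_on {0..} H'"
    and \<phi>0: "\<forall>s\<ge>0. H1_0 L (\<phi>0 s)" and \<psi>0: "\<forall>s\<ge>0. H1_star L (\<psi>0 s)"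
    and meas: "measurable_history L \<phi>0 \<psi>0"
    and sol: "weak_solution L \<rho>1 \<rho>2 b \<kappa> g \<phi>0 \<phi>1 \<psi>0 \<psi>1 \<phi> \<psi>"
    and fin: "finite_initial_energy L g \<phi> \<psi>"
begin

abbreviation "kk \<equiv> tail_kernel m"
abbreviation "Q \<equiv> px L \<phi> \<psi>"

sublocale K: memory_kernel m by (rule kernel)

lemma gk_eq: "indicator {0..} s * g s = indicator {0..} s * kk s"
  by (auto simp: indicator_def tail)

lemma g_mass_eq: "integrable lborel (\<lambda>s. indicator {0..} s * kk s)"
  "(LINT s:{0..}|lebesgue. g s) = (LINT s|lborel. indicator {0..} s * kk s)"
proof -
  have b: "(\<lambda>s. indicator {0..} s * kk s) \<in> borel_measurable borel" by measurable
  have ae: "AE s in lborel. indicator {0..} s *\<^sub>R g s = indicator {0..} s * kk s" using gk_eq by simp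
  show "integrable lborel (\<lambda>s. indicator {0..} s * kk s)"
    using g_int lebesgue_lborel(2)[OF b ae] unfolding set_integrable_def by simp
  show "(LINT s:{0..}|lebesgue. g s) = (LINT s|lborel. indicator {0..} s * kk s)"
    using lebesgue_lborel(1)[OF b ae] unfolding set_lebesgue_integral_def by simp
qed

text \<open>\<open>L / pi\<close> is the inverse of the lowest frequency.\<close>

sublocale T: timoshenko m \<delta> \<rho>1 \<rho>2 b \<kappa> "L / pi"
proof
  show "integrable lborel (\<lambda>s. indicator {0..} s * kk s)" by (rule g_mass_eq)
  show "0 < (LINT s|lborel. indicator {0..} s * kk s)" "(LINT s|lborel. indicator {0..} s * kk s) < 1"
    using g_mass g_mass_eq(2) by auto
  show "0 < kk s" for s using g_pos[of s] tail[of s] g_pos[of 0] tail[of 0] K.k_nonpos[of s] by (cases "s \<ge> 0") auto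
  show "\<kappa> * \<rho>2 = b * \<rho>1" using speeds pos by (simp add: field_simps)
  show "0 < L / pi" using L_pos by simp
qed (use \<delta> pos in auto)

lemma \<phi>_facts: "t \<ge> 0 \<Longrightarrow> H1_0 L (\<phi> t)" "C1_L2 L \<phi>" "t \<ge> 0 \<Longrightarrow> L2 L (\<phi> t)"
  and \<psi>_facts: "t \<ge> 0 \<Longrightarrow> H1_star L (\<psi> t)" "C1_L2 L \<psi>" "t \<ge> 0 \<Longrightarrow> L2 L (\<psi> t)" "t \<ge> 0 \<Longrightarrow> L2_star L (tderiv L \<psi> t)"
  and hist_eq: "s \<ge> 0 \<Longrightarrow> ae_eq L (\<phi> (- s)) (\<phi>0 s)" "s \<ge> 0 \<Longrightarrow> ae_eq L (\<psi> (- s)) (\<psi>0 s)"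
  using sol unfolding weak_solution_def H1_0_def H1_star_def H1_def by auto

lemmas weak_eq1 = sol[unfolded weak_solution_def, THEN conjunct2, THEN conjunct2, THEN conjunct2, THEN conjunct2, THEN conjunct2, THEN conjunct2, THEN conjunct2, THEN conjunct2, THEN conjunct2, THEN conjunct2, THEN conjunct1, THEN spec, THEN mp, THEN spec, THEN mp]
  and weak_eq2 = sol[unfolded weak_solution_def, THEN conjunct2, THEN conjunct2, THEN conjunct2, THEN conjunct2, THEN conjunct2, THEN conjunct2, THEN conjunct2, THEN conjunct2, THEN conjunct2, THEN conjunct2, THEN conjunct2, THEN spec, THEN mp, THEN spec, THEN mp]

lemma px_L2: assumes "H1_0 L u" "H1_star L v" shows "L2 L (\<lambda>x. wderiv L u x + v x)"
  using assms H1_wderiv weak_deriv_L2 unfolding H1_0_def H1_star_def H1_def by (blast intro: L2_add)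

text \<open>The weak derivative of an element of \<open>H1_0\<close> has mean zero, as integration
  by parts against 1 shows. Hence \<open>p\<^sub>x\<close> expands into cosines without the
  constant.\<close>

lemma px_mean: assumes "H1_0 L u" "H1_star L v" shows "ip (\<lambda>x. wderiv L u x + v x) (\<lambda>x. 1) = 0"
proof -
  have L: "L2 L (wderiv L u)" "L2 L v" "L2 L u"
    using assms H1_wderiv weak_deriv_L2 unfolding H1_0_def H1_star_def H1_def by blast+
  have one: "L2 L (\<lambda>x. 1)" by (rule L2_continuous) simp
  have "ip (wderiv L u) (\<lambda>x. 1) = - ip u (\<lambda>x. 0)" by (rule H1_0_by_parts[OF assms(1)]) auto
  then have "ip (wderiv L u) (\<lambda>x. 1) = 0" by (simp add: ip_eq)
  moreover have "ip v (\<lambda>x. 1) = 0" using assms(2) unfolding H1_star_def mean_eq by simp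
  ultimately show ?thesis using ip_add_left[OF L(1,2) one] by simp
qed

lemma Q_past: assumes "s \<ge> 0" shows "ae_eq L (Q (- s)) (px L \<phi>0 \<psi>0 s)"
proof -
  have "L2 L (\<phi>0 s)" using \<phi>0 assms unfolding H1_0_def H1_def by blast
  then have "wderiv L (\<phi> (- s)) = wderiv L (\<phi>0 s)" by (rule wderiv_ae[OF hist_eq(1)[OF assms]])
  then show ?thesis using hist_eq(2)[OF assms] unfolding px_def ae_eq_def by auto
qed

lemma Q_L2: "L2 L (Q t)"
proof (cases "t \<ge> 0")
  case True then show ?thesis using px_L2[OF \<phi>_facts(1) \<psi>_facts(1)] unfolding px_def by blast
next
  case False
  then show ?thesis using L2_ae[OF Q_past[of "- t"]] px_L2[of "\<phi>0 (- t)" "\<psi>0 (- t)"] \<phi>0 \<psi>0 unfolding px_def by auto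
qed

lemma Q_past_ip: "s \<ge> 0 \<Longrightarrow> L2 L w \<Longrightarrow> ip (Q (- s)) w = ip (px L \<phi>0 \<psi>0 s) w"
  using ip_ae[OF Q_past] px_L2[of "\<phi>0 s" "\<psi>0 s"] \<phi>0 \<psi>0 unfolding px_def by auto

lemma Q_mean: "ip (Q t) (\<lambda>x. 1) = 0"
proof (cases "t \<ge> 0")
  case True then show ?thesis using px_mean[OF \<phi>_facts(1) \<psi>_facts(1)] unfolding px_def by blast
next
  case False
  have one: "L2 L (\<lambda>x. 1)" by (rule L2_continuous) simp
  have "ip (px L \<phi>0 \<psi>0 (- t)) (\<lambda>x. 1) = 0" using px_mean[of "\<phi>0 (- t)" "\<psi>0 (- t)"] \<phi>0 \<psi>0 False unfolding px_def by auto
  then show ?thesis using Q_past_ip[OF _ one, of "- t"] False by simp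
qed

section \<open>Fourier coefficients of the solution\<close>

definition "xc n t = ip (\<phi> t) (sn n)"
definition "yc n t = ip (\<psi> t) (cn n)"
definition "ac n t = ip (tderiv L \<phi> t) (sn n)"
definition "bc n t = ip (tderiv L \<psi> t) (cn n)"
definition "pc n t = ip (Q t) (cn n)"
definition "N2 t = ip (Q t) (Q t)"

lemma pc_eq: assumes "t \<ge> 0" shows "pc n t = freq n * xc n t + yc n t"
proof -
  have L: "L2 L (wderiv L (\<phi> t))" "L2 L (\<psi> t)"
    using \<phi>_facts(1)[OF assms] \<psi>_facts(3)[OF assms] H1_wderiv weak_deriv_L2 unfolding H1_0_def by blast+
  have "ip (wderiv L (\<phi> t)) (cn n) = - ip (\<phi> t) (\<lambda>x. - freq n * sn n x)"
    by (rule H1_0_by_parts[OF \<phi>_facts(1)[OF assms] cn_deriv]) (intro continuous_intros sn_cont)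
  also have "\<dots> = freq n * xc n t" unfolding xc_def ip_scale_right by simp
  finally show ?thesis unfolding pc_def yc_def px_def[abs_def] using ip_add_left[OF L L2_cn] by simp
qed

lemma xc_deriv: "t \<ge> 0 \<Longrightarrow> (xc n has_real_derivative ac n t) (at t within {0..})"
  unfolding xc_def[abs_def] ac_def by (rule ip_tderiv[OF \<phi>_facts(2) _ L2_sn])

lemma yc_deriv: "t \<ge> 0 \<Longrightarrow> (yc n has_real_derivative bc n t) (at t within {0..})"
  unfolding yc_def[abs_def] bc_def by (rule ip_tderiv[OF \<psi>_facts(2) _ L2_cn])

lemma pc_measurable: "(\<lambda>s. indicator {0..} s * pc n (- s)) \<in> borel_measurable lebesgue"
proof -
  have "(\<lambda>s. indicator {0..} s *\<^sub>R ip (px L \<phi>0 \<psi>0 s) (cn n)) \<in> borel_measurable lebesgue"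
    using meas L2_cn unfolding measurable_history_def set_borel_measurable_def by blast
  moreover have "(\<lambda>s. indicator {0..} s *\<^sub>R ip (px L \<phi>0 \<psi>0 s) (cn n)) = (\<lambda>s. indicator {0..} s * pc n (- s))"
    by (auto simp: indicator_def pc_def Q_past_ip L2_cn)
  ultimately show ?thesis by (simp only:)
qed

lemma N2_sums: "(\<lambda>n. (pc n t)\<^sup>2) sums N2 t"
  unfolding pc_def N2_def by (rule parseval_cos[OF Q_L2 Q_mean])

lemma N2_measurable: "(\<lambda>s. indicator {0..} s * N2 (- s)) \<in> borel_measurable lebesgue"
proof (rule borel_measurable_LIMSEQ_real)
  show "(\<lambda>N. \<Sum>n<N. (indicator {0..} s * pc n (- s))\<^sup>2) \<longlonglongrightarrow> indicator {0..} s * N2 (- s)" for s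
    using N2_sums[of "- s"] unfolding sums_def by (cases "s \<ge> 0") auto
  show "(\<lambda>s. \<Sum>n<N. (indicator {0..} s * pc n (- s))\<^sup>2) \<in> borel_measurable lebesgue" for N
    using pc_measurable by measurable
qed

text \<open>The coefficients of the history are Lebesgue measurable only. Borel versions are used,
  because the product measure in Fubini's theorem is not complete.\<close>

definition "pb n = (SOME f. f \<in> borel_measurable borel \<and> (AE s in lborel. indicator {0..} s * pc n (- s) = f s))"
definition "hb = (SOME f. f \<in> borel_measurable borel \<and> (AE s in lborel. indicator {0..} s * N2 (- s) = f s))"
definition "hist s = \<bar>hb s\<bar>"
definition "Pc n t = (if 0 \<le> t then freq n * xc n (max 0 t) + yc n (max 0 t) else pb n (- t))"

lemma pb: "pb n \<in> borel_measurable borel" "AE s in lborel. indicator {0..} s * pc n (- s) = pb n s"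
proof -
  have "\<exists>f. f \<in> borel_measurable borel \<and> (AE s in lborel. indicator {0..} s * pc n (- s) = f s)"
    using completion_ex_borel_measurable_real[OF pc_measurable[of n]] by auto
  from someI_ex[OF this] show "pb n \<in> borel_measurable borel" "AE s in lborel. indicator {0..} s * pc n (- s) = pb n s"
    unfolding pb_def[symmetric] by auto
qed

lemma hb: "hb \<in> borel_measurable borel" "AE s in lborel. indicator {0..} s * N2 (- s) = hb s"
proof -
  have "\<exists>f. f \<in> borel_measurable borel \<and> (AE s in lborel. indicator {0..} s * N2 (- s) = f s)"
    using completion_ex_borel_measurable_real[OF N2_measurable] by auto
  from someI_ex[OF this] show "hb \<in> borel_measurable borel" "AE s in lborel. indicator {0..} s * N2 (- s) = hb s"
    unfolding hb_def[symmetric] by auto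
qed

lemma hist_borel [measurable]: "hist \<in> borel_measurable borel"
  unfolding hist_def[abs_def] using hb(1) by measurable

lemma hist_N2: "AE s in lborel. 0 \<le> s \<longrightarrow> hist s = N2 (- s)"
  using hb(2)
proof eventually_elim
  case (elim s)
  then show ?case unfolding hist_def N2_def using ip_self_nonneg[of "Q (- s)"] by (auto simp: indicator_def)
qed

lemma Pc_eq: "t \<ge> 0 \<Longrightarrow> Pc n t = freq n * xc n t + yc n t"
  by (simp add: Pc_def)

lemma Pc_borel [measurable]: "Pc n \<in> borel_measurable borel"
proof -
  have c: "continuous_on {0..} (\<lambda>t. freq n * xc n t + yc n t)"
    using xc_deriv yc_deriv by (intro continuous_intros) (auto simp: continuous_on_eq_continuous_within intro!: DERIV_continuous)
  have "continuous_on UNIV (\<lambda>t. freq n * xc n (max 0 t) + yc n (max 0 t))"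
    by (rule continuous_on_compose2[OF c, of UNIV "max 0"]) (auto intro!: continuous_intros)
  then have [measurable]: "(\<lambda>t. freq n * xc n (max 0 t) + yc n (max 0 t)) \<in> borel_measurable borel"
    by (rule borel_measurable_continuous_onI)
  note [measurable] = pb(1)
  show ?thesis unfolding Pc_def[abs_def] by measurable
qed

lemma Pc_ae: "AE s in lborel. \<forall>n. Pc n (- s) = pc n (- s) \<or> s < 0"
  unfolding AE_all_countable
proof
  fix n
  show "AE s in lborel. Pc n (- s) = pc n (- s) \<or> s < 0"
    using pb(2)[of n] AE_lborel_singleton[of 0] by eventually_elim (auto simp: Pc_def indicator_def)
qed

text \<open>At nonnegative times the two coefficients agree everywhere; negative times
  \<open>t - s\<close> are covered by a translate of one null set.\<close>

lemma Pc_shift: assumes t: "t \<ge> 0" shows "AE s in lborel. \<forall>n. Pc n (t - s) = pc n (t - s)"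
proof -
  obtain N where N: "{s \<in> space lborel. \<not> (\<forall>n. Pc n (- s) = pc n (- s) \<or> s < 0)} \<subseteq> N" "N \<in> null_sets lborel"
    using Pc_ae by (auto elim!: AE_E simp: null_sets_def)
  have "AE s in lborel. s \<notin> N" by (rule AE_not_in[OF N(2)])
  moreover have [measurable]: "N \<in> sets borel" using N(2) by auto
  ultimately have "AE s in lborel. - t + 1 * s \<notin> N" by (intro AE_borel_affine) auto
  then show ?thesis
  proof eventually_elim
    case (elim s)
    show ?case
    proof (cases "s \<le> t")
      case True then show ?thesis using Pc_eq pc_eq by auto
    next
      case False
      have "s - t \<notin> {s \<in> space lborel. \<not> (\<forall>n. Pc n (- s) = pc n (- s) \<or> s < 0)}"
        by (rule contra_subsetD[OF N(1)]) (use elim in simp)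
      then have "\<forall>n. Pc n (- (s - t)) = pc n (- (s - t)) \<or> s - t < 0" by (simp del: minus_diff_eq)
      then show ?thesis using False by auto
    qed
  qed
qed

lemma memory_eq:
  assumes t: "t \<ge> 0" shows "memory kk (Pc n) t = (LINT s:{0..}|lebesgue. g s * pc n (t - s))"
proof -
  have b: "(\<lambda>s. indicator {0..} s * (kk s * Pc n (t - s))) \<in> borel_measurable borel" by measurable
  have ae: "AE s in lborel. indicator {0..} s *\<^sub>R (g s * pc n (t - s)) = indicator {0..} s * (kk s * Pc n (t - s))"
    using Pc_shift[OF t] by eventually_elim (auto simp: indicator_def tail)
  show ?thesis using lebesgue_lborel(1)[OF b ae] unfolding set_lebesgue_integral_def memory_def by simp
qed

text \<open>The first equation is tested with \<open>sn n\<close>, whose weak derivative is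
  \<open>freq n * cn n\<close> up to the choice of a representative.\<close>

lemma ac_deriv:
  assumes t: "t \<ge> 0"
  shows "(ac n has_real_derivative - (\<kappa> / \<rho>1) * freq n * (Pc n t - memory kk (Pc n) t)) (at t within {0..})"
proof -
  have w: "ip (Q s) (wderiv L (sn n)) = freq n * pc n s" for s
    using ip_wderiv[OF weak_deriv_sn Q_L2] by (simp add: ip_scale_right pc_def)
  have "((\<lambda>\<tau>. \<rho>1 * ip (tderiv L \<phi> \<tau>) (sn n)) has_real_derivative
           (- \<kappa> * ip (Q t) (wderiv L (sn n)) + \<kappa> * (LINT s:{0..}|lebesgue. g s * ip (Q (t - s)) (wderiv L (sn n)))))
         (at t within {0..})"
    by (rule weak_eq1[OF H1_0_sn t])
  then have "((\<lambda>\<tau>. \<rho>1 * ac n \<tau>) has_real_derivative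
           (- \<kappa> * (freq n * pc n t) + \<kappa> * (LINT s:{0..}|lebesgue. freq n * (g s * pc n (t - s))))) (at t within {0..})"
    unfolding w ac_def by (simp add: mult.left_commute)
  then have "((\<lambda>\<tau>. \<rho>1 * ac n \<tau>) has_real_derivative
           (- \<kappa> * (freq n * pc n t) + \<kappa> * (freq n * memory kk (Pc n) t))) (at t within {0..})"
    unfolding memory_eq[OF t] by simp
  then have "((\<lambda>\<tau>. (1 / \<rho>1) * (\<rho>1 * ac n \<tau>)) has_real_derivative
      (1 / \<rho>1) * (- \<kappa> * (freq n * pc n t) + \<kappa> * (freq n * memory kk (Pc n) t))) (at t within {0..})"
    by (rule DERIV_cmult)
  moreover have "(1 / \<rho>1) * (- \<kappa> * (freq n * pc n t) + \<kappa> * (freq n * memory kk (Pc n) t))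
     = - (\<kappa> / \<rho>1) * freq n * (Pc n t - memory kk (Pc n) t)"
    using pc_eq[OF t] Pc_eq[OF t] pos by (simp add: field_simps)
  moreover have "(\<lambda>\<tau>. (1 / \<rho>1) * (\<rho>1 * ac n \<tau>)) = ac n" using pos by auto
  ultimately show ?thesis by simp
qed

lemma bc_deriv:
  assumes t: "t \<ge> 0"
  shows "(bc n has_real_derivative - (1 / \<rho>2) * (b * (freq n)\<^sup>2 * yc n t + \<kappa> * (Pc n t - memory kk (Pc n) t))) (at t within {0..})"
proof -
  have H1: "H1 L (\<psi> t)" using \<psi>_facts(1)[OF t] unfolding H1_star_def by blast
  have "ip (wderiv L (\<psi> t)) (wderiv L (cn n)) = ip (wderiv L (\<psi> t)) (\<lambda>x. - freq n * sn n x)"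
    by (rule ip_wderiv[OF weak_deriv_cn weak_deriv_L2[OF H1_wderiv[OF H1]]])
  also have "\<dots> = (freq n)\<^sup>2 * yc n t"
    unfolding ip_scale_right H1_wderiv_sn[OF H1] yc_def by (simp add: power2_eq_square)
  finally have w: "ip (wderiv L (\<psi> t)) (wderiv L (cn n)) = (freq n)\<^sup>2 * yc n t" .
  have "((\<lambda>\<tau>. \<rho>2 * ip (tderiv L \<psi> \<tau>) (cn n)) has_real_derivative
           (- b * ip (wderiv L (\<psi> t)) (wderiv L (cn n)) - \<kappa> * ip (Q t) (cn n)
            + \<kappa> * (LINT s:{0..}|lebesgue. g s * ip (Q (t - s)) (cn n)))) (at t within {0..})"
    by (rule weak_eq2[OF H1_star_cn t])
  then have "((\<lambda>\<tau>. \<rho>2 * bc n \<tau>) has_real_derivative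
           (- b * ((freq n)\<^sup>2 * yc n t) - \<kappa> * pc n t + \<kappa> * memory kk (Pc n) t)) (at t within {0..})"
    unfolding w memory_eq[OF t] bc_def pc_def .
  then have "((\<lambda>\<tau>. (1 / \<rho>2) * (\<rho>2 * bc n \<tau>)) has_real_derivative
      (1 / \<rho>2) * (- b * ((freq n)\<^sup>2 * yc n t) - \<kappa> * pc n t + \<kappa> * memory kk (Pc n) t)) (at t within {0..})"
    by (rule DERIV_cmult)
  moreover have "(1 / \<rho>2) * (- b * ((freq n)\<^sup>2 * yc n t) - \<kappa> * pc n t + \<kappa> * memory kk (Pc n) t)
     = - (1 / \<rho>2) * (b * (freq n)\<^sup>2 * yc n t + \<kappa> * (Pc n t - memory kk (Pc n) t))"
    using pc_eq[OF t] Pc_eq[OF t] pos by (simp add: field_simps)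
  moreover have "(\<lambda>\<tau>. (1 / \<rho>2) * (\<rho>2 * bc n \<tau>)) = bc n" using pos by auto
  ultimately show ?thesis by simp
qed

section \<open>Parseval's identity for the energy\<close>

definition "dist2 t s = ip (\<lambda>x. Q t x - Q s x) (\<lambda>x. Q t x - Q s x)"

lemma dist2_sums: "(\<lambda>n. (pc n t - pc n s)\<^sup>2) sums dist2 t s"
proof -
  have one: "L2 L (\<lambda>x. 1)" by (rule L2_continuous) simp
  have "ip (\<lambda>x. Q t x - Q s x) (\<lambda>x. 1) = 0" using ip_diff_left[OF Q_L2 Q_L2 one] Q_mean by simp
  from parseval_cos[OF L2_diff[OF Q_L2 Q_L2] this] show ?thesis
    unfolding dist2_def pc_def using ip_diff_left[OF Q_L2 Q_L2 L2_cn] by simp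
qed

lemma sq_norm_Q: "(l2_norm L (Q t))\<^sup>2 = N2 t" "(l2_norm L (\<lambda>x. Q t x - Q s x))\<^sup>2 = dist2 t s"
  unfolding l2_norm_sq N2_def dist2_def by simp_all

lemma fin': "integrable lebesgue (\<lambda>s. indicator {0..} s * (g s * dist2 0 (- s)))"
  using fin unfolding finite_initial_energy_def set_integrable_def sq_norm_Q by simp

lemma N2_le: "N2 s \<le> 2 * dist2 t s + 2 * N2 t"
proof -
  have z: "L2 L (\<lambda>x. 0)" by (rule L2_continuous) simp
  have "ip (\<lambda>x. Q s x - Q t x) (\<lambda>x. Q s x - Q t x) = dist2 t s" unfolding dist2_def by (rule ip_diff_swap)
  then show ?thesis using triangle_sq[OF Q_L2[of s] Q_L2[of t] z] unfolding N2_def by simp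
qed

text \<open>Finite initial energy controls only the distance of the history to the state at time 0.
  The triangle inequality adds a multiple of the mass of \<open>g\<close>.\<close>

lemma hist_int: "integrable lborel (\<lambda>s. indicator {0..} s * (kk s * hist s))"
proof -
  have b: "(\<lambda>s. indicator {0..} s * (kk s * hist s)) \<in> borel_measurable borel" by measurable
  have ae: "AE s in lborel. indicator {0..} s * (g s * N2 (- s)) = indicator {0..} s * (kk s * hist s)"
    using hist_N2 by eventually_elim (auto simp: indicator_def tail)
  have gi: "integrable lebesgue (\<lambda>s. indicator {0..} s * g s)" using g_int unfolding set_integrable_def by simp
  have "integrable lebesgue (\<lambda>s. indicator {0..} s * (g s * N2 (- s)))"
  proof (rule Bochner_Integration.integrable_bound)
    show "integrable lebesgue (\<lambda>s. 2 * (indicator {0..} s * (g s * dist2 0 (- s))) + 2 * N2 0 * (indicator {0..} s * g s))"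
      using fin' gi by (intro Bochner_Integration.integrable_add integrable_mult_right)
    show "(\<lambda>s. indicator {0..} s * (g s * N2 (- s))) \<in> borel_measurable lebesgue" by (rule lebesgue_lborel(3)[OF b ae])
    show "AE s in lebesgue. norm (indicator {0..} s * (g s * N2 (- s))) \<le>
        norm (2 * (indicator {0..} s * (g s * dist2 0 (- s))) + 2 * N2 0 * (indicator {0..} s * g s))"
    proof (rule AE_I2)
      fix s :: real
      show "norm (indicator {0..} s * (g s * N2 (- s))) \<le>
        norm (2 * (indicator {0..} s * (g s * dist2 0 (- s))) + 2 * N2 0 * (indicator {0..} s * g s))"
      proof (cases "s \<ge> 0")
        case True
        have "g s * N2 (- s) \<le> g s * (2 * dist2 0 (- s) + 2 * N2 0)"
          using N2_le g_pos[OF True] by (intro mult_left_mono) auto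
        moreover have "0 \<le> g s * N2 (- s)" using g_pos[OF True] unfolding N2_def by (simp add: ip_self_nonneg)
        ultimately show ?thesis using True by (simp add: algebra_simps)
      qed simp
    qed
  qed
  then show ?thesis using lebesgue_lborel(2)[OF b ae] by simp
qed

lemma hist_bessel: "AE s in lborel. 0 \<le> s \<longrightarrow> (\<forall>N. (\<Sum>n<N. (Pc n (- s))\<^sup>2) \<le> hist s)"
  using hist_N2 Pc_ae
proof eventually_elim
  case (elim s)
  show ?case
  proof (intro impI allI)
    fix N assume s: "0 \<le> s"
    have "(\<Sum>n<N. (Pc n (- s))\<^sup>2) = (\<Sum>n<N. (ip (Q (- s)) (cn n))\<^sup>2)" using elim s unfolding pc_def by (intro sum.cong) auto
    also have "\<dots> \<le> hist s" using bessel_cos[OF Q_L2] elim s unfolding N2_def by simp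
    finally show "(\<Sum>n<N. (Pc n (- s))\<^sup>2) \<le> hist s" .
  qed
qed

lemma Pc_hist: "integrable lborel (\<lambda>s. indicator {0..} s * (kk s * (Pc n (- s))\<^sup>2))"
proof (rule Bochner_Integration.integrable_bound[OF hist_int])
  show "AE s in lborel. norm (indicator {0..} s * (kk s * (Pc n (- s))\<^sup>2)) \<le> norm (indicator {0..} s * (kk s * hist s))"
    using hist_bessel
  proof eventually_elim
    case (elim s)
    show ?case
    proof (cases "s \<ge> 0")
      case True
      have "(Pc n (- s))\<^sup>2 \<le> (\<Sum>i<Suc n. (Pc i (- s))\<^sup>2)" by (rule member_le_sum) auto
      also have "\<dots> \<le> hist s" using elim True by blast
      finally have "kk s * (Pc n (- s))\<^sup>2 \<le> kk s * hist s" by (intro mult_left_mono K.k_nonneg)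
      then show ?thesis using K.k_nonneg[of s] by (simp add: True abs_mult hist_def)
    qed simp
  qed
qed simp

lemma modes: "timoshenko_mode m \<delta> \<rho>1 \<rho>2 b \<kappa> (L / pi) (freq n) (xc n) (yc n) (ac n) (bc n) (Pc n)"
  by unfold_locales (rule freq_pos freq_lower Pc_borel Pc_hist | erule Pc_eq xc_deriv yc_deriv ac_deriv bc_deriv)+

lemma shift_energy_eq: "t \<ge> 0 \<Longrightarrow> T.shift_energy (Pc n) t = (LINT s:{0..}|lebesgue. g s * (pc n t - pc n (t - s))\<^sup>2)"
  "t \<ge> 0 \<Longrightarrow> integrable lebesgue (\<lambda>s. indicator {0..} s * (g s * (pc n t - pc n (t - s))\<^sup>2))"
proof -
  assume t: "t \<ge> 0"
  interpret md: timoshenko_mode m \<delta> \<rho>1 \<rho>2 b \<kappa> "L / pi" "freq n" "xc n" "yc n" "ac n" "bc n" "Pc n" by (rule modes)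
  have b: "(\<lambda>s. indicator {0..} s * (kk s * (Pc n t - Pc n (t - s))\<^sup>2)) \<in> borel_measurable borel" by measurable
  have ae: "AE s in lborel. indicator {0..} s * (g s * (pc n t - pc n (t - s))\<^sup>2) = indicator {0..} s * (kk s * (Pc n t - Pc n (t - s))\<^sup>2)"
    using Pc_shift[OF t] by eventually_elim (use Pc_eq[OF t] pc_eq[OF t] in \<open>auto simp: indicator_def tail\<close>)
  show "T.shift_energy (Pc n) t = (LINT s:{0..}|lebesgue. g s * (pc n t - pc n (t - s))\<^sup>2)"
    using lebesgue_lborel(1)[OF b ae] unfolding set_lebesgue_integral_def T.shift_energy_def by simp
  show "integrable lebesgue (\<lambda>s. indicator {0..} s * (g s * (pc n t - pc n (t - s))\<^sup>2))"
    using lebesgue_lborel(2)[OF b ae] md.kshift_int(2)[OF t] by (simp add: mult.assoc)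
qed

definition "me n t = T.mode_energy (ac n) (bc n) (\<lambda>t. freq n * yc n t) (Pc n) t"

lemma norms:
  assumes t: "t \<ge> 0"
  shows "(\<lambda>n. (ac n t)\<^sup>2) sums (l2_norm L (tderiv L \<phi> t))\<^sup>2" "(\<lambda>n. (bc n t)\<^sup>2) sums (l2_norm L (tderiv L \<psi> t))\<^sup>2"
    "(\<lambda>n. (freq n * yc n t)\<^sup>2) sums (l2_norm L (wderiv L (\<psi> t)))\<^sup>2" "(\<lambda>n. (Pc n t)\<^sup>2) sums (l2_norm L (Q t))\<^sup>2"
proof -
  show "(\<lambda>n. (ac n t)\<^sup>2) sums (l2_norm L (tderiv L \<phi> t))\<^sup>2"
    unfolding ac_def l2_norm_sq by (rule parseval_sin[OF tderiv_L2[OF \<phi>_facts(2) t]])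
  show "(\<lambda>n. (bc n t)\<^sup>2) sums (l2_norm L (tderiv L \<psi> t))\<^sup>2"
    unfolding bc_def l2_norm_sq
    using \<psi>_facts(4)[OF t] unfolding L2_star_def mean_eq by (intro parseval_cos) auto
  have H1: "H1 L (\<psi> t)" using \<psi>_facts(1)[OF t] unfolding H1_star_def by blast
  show "(\<lambda>n. (freq n * yc n t)\<^sup>2) sums (l2_norm L (wderiv L (\<psi> t)))\<^sup>2"
    using parseval_sin[OF weak_deriv_L2[OF H1_wderiv[OF H1]]] unfolding H1_wderiv_sn[OF H1] yc_def l2_norm_sq by simp
  show "(\<lambda>n. (Pc n t)\<^sup>2) sums (l2_norm L (Q t))\<^sup>2" using N2_sums[of t] unfolding sq_norm_Q Pc_eq[OF t] pc_eq[OF t] .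
qed

text \<open>At time 0 the partial sums are bounded by the memory integral whose finiteness is the
  assumption on the initial energy.\<close>

lemma initial_shift_summable: "summable (\<lambda>n. T.shift_energy (Pc n) 0)"
proof (rule summableI_nonneg_bounded)
  show "0 \<le> T.shift_energy (Pc n) 0" for n
    unfolding T.shift_energy_def using K.k_nonneg by (intro integral_nonneg_AE AE_I2) auto
  fix N
  have "(\<Sum>n<N. T.shift_energy (Pc n) 0) = (\<Sum>n<N. LINT s|lebesgue. indicator {0..} s * (g s * (pc n 0 - pc n (- s))\<^sup>2))"
    by (simp add: shift_energy_eq(1) set_lebesgue_integral_def)
  also have "\<dots> = (LINT s|lebesgue. (\<Sum>n<N. indicator {0..} s * (g s * (pc n 0 - pc n (- s))\<^sup>2)))"
    by (rule Bochner_Integration.integral_sum[symmetric]) (use shift_energy_eq(2)[of 0] in simp)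
  also have "\<dots> \<le> (LINT s|lebesgue. indicator {0..} s * (g s * dist2 0 (- s)))"
  proof (rule integral_mono)
    show "integrable lebesgue (\<lambda>s. \<Sum>n<N. indicator {0..} s * (g s * (pc n 0 - pc n (- s))\<^sup>2))"
      by (rule Bochner_Integration.integrable_sum) (use shift_energy_eq(2)[of 0] in simp)
    show "integrable lebesgue (\<lambda>s. indicator {0..} s * (g s * dist2 0 (- s)))" by (rule fin')
    fix s :: real
    have "(\<Sum>n<N. (pc n 0 - pc n (- s))\<^sup>2) \<le> dist2 0 (- s)"
      using sum_le_suminf[OF sums_summable[OF dist2_sums], of "{..<N}" 0 "- s"] sums_unique[OF dist2_sums, of 0 "- s"] by simp
    then show "(\<Sum>n<N. indicator {0..} s * (g s * (pc n 0 - pc n (- s))\<^sup>2)) \<le> indicator {0..} s * (g s * dist2 0 (- s))"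
      using g_pos[of s] by (cases "s \<ge> 0") (auto simp: sum_distrib_left[symmetric])
  qed
  finally show "(\<Sum>n<N. T.shift_energy (Pc n) 0) \<le> (LINT s|lebesgue. indicator {0..} s * (g s * dist2 0 (- s)))" .
qed

lemma me_summable: assumes t: "t \<ge> 0" and s: "summable (\<lambda>n. T.shift_energy (Pc n) t)" shows "summable (\<lambda>n. me n t)"
  unfolding me_def T.mode_energy_def
  by (intro summable_divide summable_add summable_mult s norms[OF t, THEN sums_summable])

sublocale F: timoshenko_family m \<delta> \<rho>1 \<rho>2 b \<kappa> "L / pi" freq xc yc ac bc Pc hist \<xi> H H'
proof (rule timoshenko_family.intro[OF T.timoshenko_axioms timoshenko_family_axioms.intro])
  show "T.mode (freq n) (xc n) (yc n) (ac n) (bc n) (Pc n)" for n by (rule modes)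
  show "summable (\<lambda>n. T.mode_energy (ac n) (bc n) (\<lambda>t. freq n * yc n t) (Pc n) 0)"
    using me_summable[OF order_refl initial_shift_summable] unfolding me_def .
  show "AE s in lborel. 0 \<le> s \<longrightarrow> (\<Sum>n<N. (Pc n (- s))\<^sup>2) \<le> hist s" for N
    using hist_bessel by eventually_elim auto
  show "\<xi> r * H (kk r) \<le> m r" if "r \<ge> 0" for r using kernel_decay[OF that] tail[OF that] by simp
  show "0 \<le> hist s" for s by (simp add: hist_def)
  show "hist \<in> borel_measurable borel" by (rule hist_borel)
qed (fact hist_int \<xi> H | (rule \<xi> H; assumption))+

text \<open>At later times summability is inherited from the nonincreasing modal energies, so that
  finiteness of the energy is a conclusion.\<close>

lemma shift_summable: assumes t: "t \<ge> 0" shows "summable (\<lambda>n. T.shift_energy (Pc n) t)"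
proof (rule summable_comparison_test'[of "\<lambda>n. 2 / \<kappa> * F.E n t" 0])
  show "summable (\<lambda>n. 2 / \<kappa> * F.E n t)" by (intro summable_mult F.summ t)
  fix n
  have "\<kappa> / 2 * T.shift_energy (Pc n) t \<le> F.E n t"
  proof -
    have "0 \<le> \<kappa> * (1 - (LINT s|lborel. indicator {0..} s * kk s)) * (Pc n t)\<^sup>2" using pos T.g0_less by simp
    moreover have "0 \<le> \<rho>1 * (ac n t)\<^sup>2" "0 \<le> \<rho>2 * (bc n t)\<^sup>2" "0 \<le> b * (freq n * yc n t)\<^sup>2" using pos by auto
    ultimately show ?thesis unfolding F.E_def T.mode_energy_def by argo
  qed
  then show "norm (T.shift_energy (Pc n) t) \<le> 2 / \<kappa> * F.E n t"
    using pos F.md.\<Gamma>_nonneg[of n t] by (simp add: field_simps)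
qed

text \<open>The integrands are nonnegative, so sum and integral commute as soon as the integrals are
  summable; Parseval's identity sums the integrands.\<close>

lemma g_circ_sums:
  assumes t: "t \<ge> 0" shows "(\<lambda>n. T.shift_energy (Pc n) t) sums g_circ L g Q t"
proof -
  let ?f = "\<lambda>n s. indicator {0..} s * (g s * (pc n t - pc n (t - s))\<^sup>2)"
  have f0: "0 \<le> ?f n s" for n s using g_pos[of s] by (auto simp: indicator_def)
  have sm: "(\<lambda>n. ?f n s) sums (indicator {0..} s * (g s * dist2 t (t - s)))" for s
    by (intro sums_mult dist2_sums)
  have i: "integrable lebesgue (?f n)" for n by (rule shift_energy_eq(2)[OF t])
  have e: "T.shift_energy (Pc n) t = (LINT s|lebesgue. ?f n s)" for n
    by (simp add: shift_energy_eq(1)[OF t] set_lebesgue_integral_def)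
  have "(\<lambda>n. LINT s|lebesgue. ?f n s) sums (LINT s|lebesgue. (\<Sum>n. ?f n s))"
  proof (rule sums_integral[OF i])
    show "AE s in lebesgue. summable (\<lambda>n. norm (?f n s))"
      using sums_summable[OF sm] f0 by (intro AE_I2) (simp add: abs_of_nonneg)
    show "summable (\<lambda>n. LINT s|lebesgue. norm (?f n s))"
      using shift_summable[OF t] f0 unfolding e by (simp add: abs_of_nonneg)
  qed
  also have "(LINT s|lebesgue. (\<Sum>n. ?f n s)) = g_circ L g Q t"
    unfolding g_circ_def sq_norm_Q set_lebesgue_integral_def
    by (intro Bochner_Integration.integral_cong) (auto simp: sums_unique[OF sm, symmetric])
  finally show ?thesis unfolding e .
qed

lemma energy_eq:
  assumes t: "t \<ge> 0" shows "energy L \<rho>1 \<rho>2 b \<kappa> g \<phi> \<psi> t = F.Etot t"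
proof -
  have "(\<lambda>n. F.E n t) sums ((\<rho>1 * (l2_norm L (tderiv L \<phi> t))\<^sup>2 + \<rho>2 * (l2_norm L (tderiv L \<psi> t))\<^sup>2 + b * (l2_norm L (wderiv L (\<psi> t)))\<^sup>2
     + \<kappa> * (1 - (LINT s|lborel. indicator {0..} s * kk s)) * (l2_norm L (Q t))\<^sup>2 + \<kappa> * g_circ L g Q t) / 2)"
    unfolding F.E_def T.mode_energy_def by (intro sums_divide sums_add sums_mult norms[OF t] g_circ_sums[OF t])
  then have "F.Etot t = (\<rho>1 * (l2_norm L (tderiv L \<phi> t))\<^sup>2 + \<rho>2 * (l2_norm L (tderiv L \<psi> t))\<^sup>2 + b * (l2_norm L (wderiv L (\<psi> t)))\<^sup>2
     + \<kappa> * (1 - (LINT s|lborel. indicator {0..} s * kk s)) * (l2_norm L (Q t))\<^sup>2 + \<kappa> * g_circ L g Q t) / 2"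
    unfolding F.Etot_def by (rule sums_unique[symmetric])
  then show ?thesis unfolding energy_def g_mass_eq(2) by (simp add: add_divide_distrib)
qed

section \<open>Functions of the history and the two cases of the theorem\<close>

lemma h0_eq: assumes t: "t \<ge> 0" shows "h0 L g Q t = F.hist_tail t"
proof -
  have b: "(\<lambda>s. indicator {0..} s * (kk (t + s) * (1 + hist s))) \<in> borel_measurable borel" by measurable
  have ae: "AE s in lborel. indicator {0..} s *\<^sub>R (g (t + s) * (1 + N2 (- s))) = indicator {0..} s * (kk (t + s) * (1 + hist s))"
    using hist_N2 by eventually_elim (use t tail in \<open>auto simp: indicator_def\<close>)
  show ?thesis using lebesgue_lborel(1)[OF b ae] unfolding h0_def F.hist_tail_def set_lebesgue_integral_def sq_norm_Q by simp
qed

lemma f_hist_eq: assumes t: "t \<ge> 0" shows "f_hist L g Q t = F.growth t"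
proof -
  have "(LINT s:{0..t}|lebesgue. h0 L g Q s) = (LINT s:{0..t}|lebesgue. F.hist_tail s)"
    by (rule set_lebesgue_integral_cong) (auto simp: h0_eq)
  also have "\<dots> = integral {0..t} F.hist_tail"
    by (rule set_lebesgue_integral_eq_integral(2)[OF F.hist_tail_abs_int]) simp
  finally show ?thesis unfolding f_hist_def F.growth_def by simp
qed

lemma h0_0_pos: "0 < h0 L g Q 0"
proof -
  have "0 < F.tail_mass 0" using T.g0_pos by simp
  also have "\<dots> \<le> F.hist_tail 0" using F.past_sum_le[of 0 0] by simp
  finally show ?thesis using h0_eq[of 0] by simp
qed

end

context timoshenko_problem
begin

lemma q_fun_eq: "t \<ge> 0 \<Longrightarrow> q_fun L g Q q0 t = q0 / F.growth t"
  by (simp add: q_fun_def f_hist_eq)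

text \<open>The supersolution is \<open>Z = G5 / chi\<close> with \<open>B = G2 (G5) / chi\<close>;
  it starts above 1 because \<open>G5\<close> is 1 at time 0 and \<open>chi \<le> 1\<close>.\<close>

lemma decay_nonlinear:
  assumes strict: "\<And>s t. 0 \<le> s \<Longrightarrow> s < t \<Longrightarrow> H' s < H' t" and zero: "H' 0 = 0"
  shows "\<exists>q0 c d c1 c2. 0 < q0 \<and> q0 < 1 \<and> c > 0 \<and> d > 0 \<and> c1 > 0 \<and> c2 > 0 \<and>
    (\<forall>chi \<in> class_S L g \<xi> H' Q q0 c d c1 c2. \<exists>C>0. \<forall>t\<ge>0.
       energy L \<rho>1 \<rho>2 b \<kappa> g \<phi> \<psi> t \<le> C * G5 H' \<xi> c1 t / (chi t * q_fun L g Q q0 t))"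
proof -
  interpret R: decay_rate H'
    by standard (use H(5) strict[of 0] zero H(4) in auto)
  have inj: "inj_on H' {0..}" by (rule linorder_inj_onI) (use strict in force)+
  have G3H: "G3 H' (H' u) = H' u * u" if "u \<ge> 0" for u
    unfolding G3_def using inv_into_f_f[OF inj, of u] that by simp
  obtain a c1 cE where pos': "a > 0" "c1 > 0" "cE > 0" and decay:
    "\<And>Z B t. continuous_on {0..} Z \<Longrightarrow> 1 \<le> Z 0 \<Longrightarrow> (\<And>t. t \<ge> 0 \<Longrightarrow> 0 \<le> Z t) \<Longrightarrow> continuous_on {0..} B \<Longrightarrow>
      (\<And>t u. t \<ge> 0 \<Longrightarrow> u \<ge> 0 \<Longrightarrow> a * ((1/2) / F.growth t * F.hist_tail t) * H' u - u * H' u \<le> Z t * H' (Z t) - B t) \<Longrightarrow>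
      (\<And>s t. 0 \<le> s \<Longrightarrow> s \<le> t \<Longrightarrow> integral {s..t} (\<lambda>\<tau>. - c1 * \<xi> \<tau> * B \<tau>) \<le> Z t - Z s) \<Longrightarrow>
      t \<ge> 0 \<Longrightarrow> cE * ((1/2) / F.growth t * F.Etot t) \<le> Z t"
    by (rule F.decay[of "1/2"]; simp)
  show ?thesis
  \<comment> \<open>\<open>c = a\<close> and \<open>d = 1\<close> reproduce the coefficient required
    by \<open>decay\<close>, and \<open>c2 = c1\<close> lets this factor cancel in the inequality
    that defines the class.\<close>
  proof (rule exI[of _ "1/2"], rule exI[of _ a], rule exI[of _ 1], rule exI[of _ c1], rule exI[of _ c1], intro conjI ballI)
    show "(0::real) < 1/2" "(1/2::real) < 1" "(0::real) < 1" "a > 0" "c1 > 0" "c1 > 0" using pos' by auto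
    fix chi assume S: "chi \<in> class_S L g \<xi> H' Q (1/2) a 1 c1 c1"
    then obtain chi' where chi: "\<And>t. t \<ge> 0 \<Longrightarrow> 0 < chi t" "\<And>t. t \<ge> 0 \<Longrightarrow> chi t \<le> 1"
        "\<And>t. t \<ge> 0 \<Longrightarrow> (chi has_real_derivative chi' t) (at t within {0..})" "\<And>t. t \<ge> 0 \<Longrightarrow> chi' t \<le> 0"
      unfolding class_S_def by blast
    have cond: "ereal c1 * G4 H' (a / 1 * q_fun L g Q (1/2) t * h0 L g Q t)
        \<le> ereal (c1 * (G2 H' (G5 H' \<xi> c1 t / chi t) - G2 H' (G5 H' \<xi> c1 t) / chi t))" if "t \<ge> 0" for t
      using S that unfolding class_S_def by blast
    let ?Z = "\<lambda>t. G5 H' \<xi> c1 t / chi t" and ?B = "\<lambda>t. G2 H' (G5 H' \<xi> c1 t) / chi t"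
    note sup = R.quotient_supersolution[OF \<xi>(3,1) pos'(2) chi(1,3,4)]
    have bound: "cE * ((1/2) / F.growth t * F.Etot t) \<le> ?Z t" if t: "t \<ge> 0" for t
    proof (rule decay[OF _ _ _ _ _ _ t])
      show "continuous_on {0..} ?Z" "continuous_on {0..} ?B" using sup(1,2)[of 0 0] by auto
      show "1 \<le> ?Z 0" using R.G5_zero[OF \<xi>(3,1) pos'(2)] chi(1,2)[of 0] by simp
      show "0 \<le> ?Z t" if "t \<ge> 0" for t using R.G5_range(1)[OF \<xi>(3,1) pos'(2) that] chi(1)[OF that] by simp
      show "integral {s..t} (\<lambda>\<tau>. - c1 * \<xi> \<tau> * ?B \<tau>) \<le> ?Z t - ?Z s" if "0 \<le> s" "s \<le> t" for s t
        by (rule sup(3)) (use that in auto)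
      fix t u :: real assume t: "t \<ge> 0" and u: "u \<ge> 0"
      define z where "z = a * ((1/2) / F.growth t * F.hist_tail t)"
      \<comment> \<open>Young's inequality: the supremum is tested at \<open>H' u\<close>, where
        \<open>G3\<close> takes the value \<open>u * H' u\<close>.\<close>
      have "ereal (z * H' u - G3 H' (H' u)) \<le> G4 H' z"
        unfolding G4_def young_conjugate_def by (rule SUP_upper) (use H(3)[OF u] in simp)
      then have "ereal c1 * ereal (z * H' u - u * H' u) \<le> ereal c1 * G4 H' z"
        unfolding G3H[OF u] mult.commute[of "H' u" u] using pos' by (intro ereal_mult_left_mono) auto
      also have "\<dots> \<le> ereal (c1 * (G2 H' (?Z t) - ?B t))"
        using cond[OF t] unfolding z_def q_fun_eq[OF t] h0_eq[OF t] by (simp add: mult.assoc)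
      finally have "c1 * (z * H' u - u * H' u) \<le> c1 * (G2 H' (?Z t) - ?B t)" by simp
      then show "a * ((1/2) / F.growth t * F.hist_tail t) * H' u - u * H' u \<le> ?Z t * H' (?Z t) - ?B t"
        using pos' unfolding z_def[symmetric] by (simp add: G2_def)
    qed
    show "\<exists>C>0. \<forall>t\<ge>0. energy L \<rho>1 \<rho>2 b \<kappa> g \<phi> \<psi> t \<le> C * G5 H' \<xi> c1 t / (chi t * q_fun L g Q (1/2) t)"
    proof (intro exI[of _ "1 / cE"] conjI allI impI)
      fix t :: real assume t: "t \<ge> 0"
      define q where "q = (1/2) / F.growth t"
      have q: "q > 0" unfolding q_def using F.growth_ge_1[of t] by simp
      have "F.Etot t = cE * (q * F.Etot t) / (cE * q)" using q pos' by simp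
      also have "\<dots> \<le> ?Z t / (cE * q)" using bound[OF t] q pos' unfolding q_def by (intro divide_right_mono) auto
      also have "\<dots> = 1 / cE * G5 H' \<xi> c1 t / (chi t * q)" by simp
      finally show "energy L \<rho>1 \<rho>2 b \<kappa> g \<phi> \<psi> t \<le> 1 / cE * G5 H' \<xi> c1 t / (chi t * q_fun L g Q (1/2) t)"
        unfolding energy_eq[OF t] q_fun_eq[OF t] q_def .
    qed (use pos' in simp)
  qed
qed

text \<open>For linear \<open>H\<close> the right-hand side in the definition of the class vanishes, while the
  left-hand side is positive at time \<open>0\<close> for large \<open>c\<close>: the class is empty.\<close>

lemma decay_linear:
  assumes a: "a > 0" and lin: "\<And>s. s \<ge> 0 \<Longrightarrow> H' s = a"
  shows "\<exists>q0 c d c1 c2. 0 < q0 \<and> q0 < 1 \<and> c > 0 \<and> d > 0 \<and> c1 > 0 \<and> c2 > 0 \<and>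
    (\<forall>chi \<in> class_S L g \<xi> H' Q q0 c d c1 c2. \<exists>C>0. \<forall>t\<ge>0.
       energy L \<rho>1 \<rho>2 b \<kappa> g \<phi> \<psi> t \<le> C * G5 H' \<xi> c1 t / (chi t * q_fun L g Q q0 t))"
proof -
  interpret R: decay_rate H'
    by standard (use H(5) a lin in auto)
  \<comment> \<open>An unspecified value, which equals \<open>G3 H' 1\<close>; the conjugate is
    tested at 1 below.\<close>
  define i where "i = inv_into {0..} H' 1"
  \<comment> \<open>At time 0 the argument of \<open>G4\<close> becomes
    \<open>\<bar>i\<bar> + 1\<close>, so that the test at 1 gives the positive lower bound
    \<open>\<bar>i\<bar> + 1 - i\<close>.\<close>
  define c where "c = 2 * (\<bar>i\<bar> + 1) / h0 L g Q 0"
  have c: "c > 0" using h0_0_pos by (simp add: c_def)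
  have q: "q_fun L g Q (1/2) 0 = 1/2" using q_fun_eq[of 0] by (simp add: F.growth_def)
  have "class_S L g \<xi> H' Q (1/2) c 1 1 1 = {}"
  proof (rule ccontr)
    assume "class_S L g \<xi> H' Q (1/2) c 1 1 1 \<noteq> {}"
    then obtain chi where S: "chi \<in> class_S L g \<xi> H' Q (1/2) c 1 1 1" by blast
    have "\<forall>t\<ge>0. 0 < chi t \<and> chi t \<le> 1" using S unfolding class_S_def by blast
    then have chi: "chi 0 > 0" by simp
    have s: "c / 1 * q_fun L g Q (1/2) 0 * h0 L g Q 0 = \<bar>i\<bar> + 1" using h0_0_pos by (simp add: q c_def)
    have "\<forall>t\<ge>0. ereal 1 * G4 H' (c / 1 * q_fun L g Q (1/2) t * h0 L g Q t)
        \<le> ereal (1 * (G2 H' (G5 H' \<xi> 1 t / chi t) - G2 H' (G5 H' \<xi> 1 t) / chi t))"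
      using S unfolding class_S_def by blast
    then have "ereal 1 * G4 H' (\<bar>i\<bar> + 1) \<le> ereal (1 * (G2 H' (G5 H' \<xi> 1 0 / chi 0) - G2 H' (G5 H' \<xi> 1 0) / chi 0))"
      unfolding s[symmetric] by blast
    then have "G4 H' (\<bar>i\<bar> + 1) \<le> 0"
      using R.G5_zero[OF \<xi>(3,1), of 1] chi lin[of "1 / chi 0"] lin[of 1] by (simp add: G2_def zero_ereal_def)
    moreover have "ereal ((\<bar>i\<bar> + 1) * 1 - G3 H' 1) \<le> G4 H' (\<bar>i\<bar> + 1)"
      unfolding G4_def young_conjugate_def by (rule SUP_upper) simp
    ultimately have "ereal ((\<bar>i\<bar> + 1) * 1 - G3 H' 1) \<le> 0" by (rule order_trans[rotated])
    then show False unfolding G3_def i_def[symmetric] by (simp add: zero_ereal_def)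
  qed
  then show ?thesis using c by (intro exI[of _ "1/2"] exI[of _ c] exI[of _ 1] conjI) auto
qed

end

theorem theorem4p1:
  fixes L \<rho>1 \<rho>2 b \<kappa> :: real
    and g \<xi> H H' :: "real \<Rightarrow> real"
    and \<phi>0 \<psi>0 \<phi> \<psi> :: "real \<Rightarrow> real \<Rightarrow> real"
    and \<phi>1 \<psi>1 :: "real \<Rightarrow> real"
  assumes "L > 0" "\<rho>1 > 0" "\<rho>2 > 0" "b > 0" "\<kappa> > 0"
    and "hyp_A1 L \<rho>1 \<rho>2 g"
    and "hyp_A2 g \<xi> H H'"
    and "\<forall>s\<ge>0. H1_0 L (\<phi>0 s)" and "L2 L \<phi>1"
    and "\<forall>s\<ge>0. H1_star L (\<psi>0 s)" and "L2_star L \<psi>1"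
    and "measurable_history L \<phi>0 \<psi>0"
    and "weak_solution L \<rho>1 \<rho>2 b \<kappa> g \<phi>0 \<phi>1 \<psi>0 \<psi>1 \<phi> \<psi>"
    and "finite_initial_energy L g \<phi> \<psi>"
    and "\<kappa> / \<rho>1 = b / \<rho>2"
  shows "\<exists>q0 c d c1 c2. 0 < q0 \<and> q0 < 1 \<and> c > 0 \<and> d > 0 \<and> c1 > 0 \<and> c2 > 0 \<and>
    (\<forall>chi \<in> class_S L g \<xi> H' (px L \<phi> \<psi>) q0 c d c1 c2. \<exists>C>0. \<forall>t\<ge>0.
       energy L \<rho>1 \<rho>2 b \<kappa> g \<phi> \<psi> t
         \<le> C * G5 H' \<xi> c1 t / (chi t * q_fun L g (px L \<phi> \<psi>) q0 t))"
proof -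
  have g: "\<And>t. t \<ge> 0 \<Longrightarrow> g t > 0" "\<And>s t. 0 \<le> s \<Longrightarrow> s \<le> t \<Longrightarrow> g t \<le> g s" "set_integrable lebesgue {0..} g"
      "(LINT s:{0..}|lebesgue. g s) < 1" "0 < (LINT s:{0..}|lebesgue. g s)"
    using \<open>hyp_A1 L \<rho>1 \<rho>2 g\<close> unfolding hyp_A1_def by (auto simp: monotone_on_def)
  have \<xi>: "\<And>t. t \<ge> 0 \<Longrightarrow> \<xi> t > 0" "\<And>s t. 0 \<le> s \<Longrightarrow> s \<le> t \<Longrightarrow> \<xi> t \<le> \<xi> s" "continuous_on {0..} \<xi>"
    and H_deriv: "\<forall>s\<ge>0. H s \<ge> 0 \<and> (H has_real_derivative H' s) (at s within {0..})" and H'_cont: "continuous_on {0..} H'"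
    and cases: "(\<exists>a>0. \<forall>s\<ge>0. H s = a * s) \<or> hyp_H_nonlinear H H'"
    and der: "\<And>t. t \<ge> 0 \<Longrightarrow> \<exists>D. (g has_real_derivative D) (at t within {0..}) \<and> D \<le> - \<xi> t * H (g t)"
    using \<open>hyp_A2 g \<xi> H H'\<close> unfolding hyp_A2_def by (auto simp: monotone_on_def intro: differentiable_imp_continuous_on)
  from H_deriv have H_nonneg: "\<And>z. 0 \<le> z \<Longrightarrow> 0 \<le> H z" by blast
  obtain m where m: "memory_kernel m" "\<And>s. s \<ge> 0 \<Longrightarrow> tail_kernel m s = g s" "\<And>r. r \<ge> 0 \<Longrightarrow> \<xi> r * H (g r) \<le> m r"
    by (rule relaxation_density[OF g(1-3) der \<xi>(1) H_nonneg], assumption+) (rule that)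
  have linear: "H' s = a" if "a > 0" "\<forall>s\<ge>0. H s = a * s" "s \<ge> 0" for a s
  proof -
    have "((\<lambda>s. a * s) has_real_derivative a) (at s within {0..})"
      by (auto intro!: derivative_eq_intros)
    then have "(H has_real_derivative a) (at s within {0..})"
      by (rule has_field_derivative_transform_within[OF _ zero_less_one]) (use that in auto)
    moreover have "(H has_real_derivative H' s) (at s within {0..})" using H_deriv that by blast
    moreover have "s islimpt {0..}" by (rule islimpt_subset[of _ "{s..s+1}"]) (use that in auto)
    then have "at s within {0..} \<noteq> bot" by (simp add: trivial_limit_within)
    ultimately show ?thesis by (intro has_field_derivative_unique)
  qed
  have "(0 \<le> u \<longrightarrow> 0 < z \<longrightarrow> H' u * z \<le> H z + u * H' u) \<and> (0 \<le> u \<longrightarrow> u \<le> z \<longrightarrow> H' u \<le> H' z) \<and>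
      (0 \<le> u \<longrightarrow> 0 \<le> H' u) \<and> (0 < u \<longrightarrow> u \<le> z \<longrightarrow> H u \<le> H z) \<and> (0 < u \<longrightarrow> 0 < H u)" for u z
    using cases
  proof
    assume "\<exists>a>0. \<forall>s\<ge>0. H s = a * s"
    then obtain a where a: "a > 0" "\<forall>s\<ge>0. H s = a * s" by blast
    then show ?thesis using linear[OF a, of u] linear[OF a, of z] by (auto intro: mult_left_mono)
  next
    assume N: "hyp_H_nonlinear H H'"
    note F = nonlinear_H_facts[OF H_deriv N]
    have zero: "H' 0 = 0" using N unfolding hyp_H_nonlinear_def by blast
    have mono: "H' u \<le> H' z" if "0 \<le> u" "u \<le> z" for u z using F(1)[of u z] that by (cases "u = z") auto
    have "H' u * z \<le> H z + u * H' u" if "0 \<le> u" "0 < z"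
      using F(2)[OF that] H_nonneg[OF that(1)] by (simp add: algebra_simps)
    then show ?thesis using mono[of u z] mono[of 0 u] zero F(3)[of u z] F(4)[of u] by auto
  qed
  then have H_facts: "0 \<le> u \<Longrightarrow> 0 < z \<Longrightarrow> H' u * z \<le> H z + u * H' u" "0 \<le> u \<Longrightarrow> u \<le> z \<Longrightarrow> H' u \<le> H' z"
    "0 \<le> u \<Longrightarrow> 0 \<le> H' u" "0 < u \<Longrightarrow> u \<le> z \<Longrightarrow> H u \<le> H z" "0 < u \<Longrightarrow> 0 < H u" for u z
    by blast+
  \<comment> \<open>On \<open>[0,1]\<close> both \<open>\<xi>\<close> and \<open>g\<close> are at
    least their values at 1, and \<open>H\<close> is nondecreasing on the positive reals. This is
    the lower bound for \<open>m\<close> that controls \<open>\<eta>\<close>.\<close>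
  have \<delta>: "\<xi> 1 * H (g 1) \<le> m r" if "r \<in> {0..1}" for r
  proof -
    have "H (g 1) \<le> H (g r)" using that by (intro H_facts(4) g(1,2)) auto
    then have "\<xi> 1 * H (g 1) \<le> \<xi> r * H (g r)"
      using that \<xi>(1)[of r] \<xi>(2)[of r 1] g(1)[of 1] H_nonneg[of "g 1"] by (intro mult_mono) auto
    then show ?thesis using m(3)[of r] that by simp
  qed
  have \<delta>_pos: "0 < \<xi> 1 * H (g 1)" using \<xi>(1)[of 1] g(1)[of 1] H_facts(5) by simp
  interpret timoshenko_problem L \<rho>1 \<rho>2 b \<kappa> "\<xi> 1 * H (g 1)" g \<xi> H H' m \<phi>0 \<psi>0 \<phi> \<psi> \<phi>1 \<psi>1
    by (intro timoshenko_problem.intro interval.intro timoshenko_problem_axioms.intro) (fact assms g \<xi> H_facts H_nonneg H'_cont m \<delta> \<delta>_pos)+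
  from cases show ?thesis
  proof
    assume "\<exists>a>0. \<forall>s\<ge>0. H s = a * s"
    then obtain a where a: "a > 0" "\<forall>s\<ge>0. H s = a * s" by blast
    show ?thesis by (rule decay_linear[OF a(1) linear[OF a]])
  next
    assume N: "hyp_H_nonlinear H H'"
    then have "H' 0 = 0" unfolding hyp_H_nonlinear_def by blast
    then show ?thesis by (intro decay_nonlinear nonlinear_H_facts(1)[OF H_deriv N])
  qed
qed

end
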